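(* Let $k$ be a field of characteristic zero, and let $q\colon X\to Y$, $p\colon Y\to S$ and $\pi=p\circ q\colon X\to S$ be smooth morphisms of smooth schemes over $k$, with $q$ faithfully flat. Let $\mathcal F/S$ be the relative foliation on $X/S$ whose tangent complex is $T_{X/Y}$ (the foliation induced by the smooth leaf-space map $q$). Then leaf-space-basic transversal unfoldings of $\mathcal F/S$ are equivalent to flat splittings $$p^*T_{S/k}\longrightarrow T_{Y/k}$$ of the tangent sequence $0\to T_{Y/S}\to T_{Y/k}\to p^*T_{S/k}\to0$ of $p\colon Y\to S$. Equivalently, they are integrable Ehresmann connections on the leaf-space fibration $Y\to S$, pulled back to $X$.
   Context: Transversal unfolding: locally, for a relative Lie algebroid $\rho\colon\mathfrak g\to T_{A/B}$ (here $\mathfrak g=T_{X/Y}$ with its inclusion in $T_{X/S}$), a strict transversal unfolding is a Lie algebroid $\widetilde\rho\colon\widetilde{\mathfrak g}\to T_{A/k}$ over $A$ containing $\mathfrak g$ as a Lie ideal, with $\widetilde\rho|_{\mathfrak g}=\rho$, $\widetilde{\mathfrak g}/\mathfrak g\simeq A\otimes_BT_{B/k}$, and induced anchor on the quotient equal to the identity. It amounts to a transverse splitting, i.e. a lift of the base directions $\pi^*T_{S/k}$ to transverse infinitesimal symmetries of the foliation modulo $T_{X/Y}$, compatible with brackets (flat). The normal sheaf of the foliation is $T_X/T_{X/Y}\simeq q^*T_{Y/k}$, with normal morphism $q^*T_{Y/k}\to q^*p^*T_{S/k}=\pi^*T_{S/k}$ induced by $dp$. An $\mathcal O_X$-linear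 splitting of this normal morphism is leaf-space-basic if its transverse classes descend from $Y$, i.e. it is the pullback along $q$ of a splitting of $dp\colon T_{Y/k}\to p^*T_{S/k}$ (equivalently, it carries descent data along $q$). A transversal unfolding is leaf-space-basic if its transverse splitting is. A splitting $p^*T_{S/k}\to T_{Y/k}$ is flat (integrable) if its bracket curvature vanishes, i.e. horizontal lifts of vector fields on $S$ are compatible with the Lie bracket.
   Formalization: "Lie ideal" in a transversal unfolding is required only for brackets of the foliation with lifts of base directions (sections projecting locally to vector fields on S); required for all sections, it fails already for A^2 -> A^1 = S, where no unfolding would exist. *)

theory Defs
  imports
    "HOL-Library.Multiset"
    "HOL-Analysis.Abstract_Topology"
    "HOL-Algebra.RingHom"
    "HOL-Algebra.Module"
begin

section \<open>Sheaves and stalks\<close>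

text \<open>
  A presheaf on a topological space is given by its sets of sections on opens and by its
  restriction maps; \<open>r U V\<close> restricts from \<open>U\<close> to \<open>V \<subseteq> U\<close>. Values on non-open sets are irrelevant.
  The cover in the last clause may be empty, which makes the sections over the empty set a singleton.
\<close>

definition sheaf_on ::
  "'a topology \<Rightarrow> ('a set \<Rightarrow> 's set) \<Rightarrow> ('a set \<Rightarrow> 'a set \<Rightarrow> 's \<Rightarrow> 's) \<Rightarrow> bool" where
  "sheaf_on T F r \<longleftrightarrow>
    (\<forall>U V. openin T U \<and> openin T V \<and> V \<subseteq> U \<longrightarrow> r U V \<in> F U \<rightarrow> F V) \<and>
    (\<forall>U s. openin T U \<and> s \<in> F U \<longrightarrow> r U U s = s) \<and>
    (\<forall>U V W s. openin T U \<and> openin T V \<and> openin T W \<and> W \<subseteq> V \<and> V \<subseteq> U \<and> s \<in> F U \<longrightarrow>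
        r V W (r U V s) = r U W s) \<and>
    (\<forall>\<U> s. (\<forall>U\<in>\<U>. openin T U \<and> s U \<in> F U) \<and>
        (\<forall>U\<in>\<U>. \<forall>V\<in>\<U>. r U (U \<inter> V) (s U) = r V (U \<inter> V) (s V)) \<longrightarrow>
        (\<exists>!t. t \<in> F (\<Union>\<U>) \<and> (\<forall>U\<in>\<U>. r (\<Union>\<U>) U t = s U)))"

type_synonym ('a, 's) germ = "('a set \<times> 's) set"

definition germ ::
  "'a topology \<Rightarrow> ('a set \<Rightarrow> 's set) \<Rightarrow> ('a set \<Rightarrow> 'a set \<Rightarrow> 's \<Rightarrow> 's) \<Rightarrow> 'a \<Rightarrow> 'a set \<Rightarrow> 's
    \<Rightarrow> ('a, 's) germ" where
  "germ T F r x U s = {(V, t). openin T V \<and> x \<in> V \<and> t \<in> F V \<and>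
     (\<exists>W. openin T W \<and> x \<in> W \<and> W \<subseteq> U \<inter> V \<and> r U W s = r V W t)}"

definition stalk ::
  "'a topology \<Rightarrow> ('a set \<Rightarrow> 's set) \<Rightarrow> ('a set \<Rightarrow> 'a set \<Rightarrow> 's \<Rightarrow> 's) \<Rightarrow> 'a \<Rightarrow> ('a, 's) germ set" where
  "stalk T F r x = {germ T F r x U s | U s. openin T U \<and> x \<in> U \<and> s \<in> F U}"


section \<open>Locally ringed spaces\<close>

record ('a, 'b) ringed_space =
  space_top :: "'a topology"
  sect :: "'a set \<Rightarrow> 'b ring"
  rst :: "'a set \<Rightarrow> 'a set \<Rightarrow> 'b \<Rightarrow> 'b"

abbreviation opn :: "('a, 'b) ringed_space \<Rightarrow> 'a set \<Rightarrow> bool" where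
  "opn X U \<equiv> openin (space_top X) U"

abbreviation pts :: "('a, 'b) ringed_space \<Rightarrow> 'a set" where
  "pts X \<equiv> topspace (space_top X)"

definition is_ringed_space :: "('a, 'b) ringed_space \<Rightarrow> bool" where
  "is_ringed_space X \<longleftrightarrow>
    (\<forall>U. opn X U \<longrightarrow> cring (sect X U)) \<and>
    (\<forall>U V. opn X U \<and> opn X V \<and> V \<subseteq> U \<longrightarrow> rst X U V \<in> ring_hom (sect X U) (sect X V)) \<and>
    sheaf_on (space_top X) (\<lambda>U. carrier (sect X U)) (rst X)"

definition rgerm :: "('a, 'b) ringed_space \<Rightarrow> 'a \<Rightarrow> 'a set \<Rightarrow> 'b \<Rightarrow> ('a, 'b) germ" where
  "rgerm X x U s = germ (space_top X) (\<lambda>U. carrier (sect X U)) (rst X) x U s"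

text \<open>
  Operations on germs are written as unions over all representatives; on a well-defined
  operation every member of the union is the same equivalence class.
\<close>

definition stalk_ring :: "('a, 'b) ringed_space \<Rightarrow> 'a \<Rightarrow> ('a, 'b) germ ring" where
  "stalk_ring X x =
    \<lparr>carrier = stalk (space_top X) (\<lambda>U. carrier (sect X U)) (rst X) x,
     mult = (\<lambda>A B. \<Union>(U, s)\<in>A. \<Union>(V, t)\<in>B.
        rgerm X x (U \<inter> V) (rst X U (U \<inter> V) s \<otimes>\<^bsub>sect X (U \<inter> V)\<^esub> rst X V (U \<inter> V) t)),
     one = rgerm X x (pts X) \<one>\<^bsub>sect X (pts X)\<^esub>,
     zero = rgerm X x (pts X) \<zero>\<^bsub>sect X (pts X)\<^esub>,
     add = (\<lambda>A B. \<Union>(U, s)\<in>A. \<Union>(V, t)\<in>B.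
        rgerm X x (U \<inter> V) (rst X U (U \<inter> V) s \<oplus>\<^bsub>sect X (U \<inter> V)\<^esub> rst X V (U \<inter> V) t))\<rparr>"

definition is_local_ring :: "'r ring \<Rightarrow> bool" where
  "is_local_ring R \<longleftrightarrow> cring R \<and> (\<exists>!I. maximalideal I R)"

definition locally_ringed :: "('a, 'b) ringed_space \<Rightarrow> bool" where
  "locally_ringed X \<longleftrightarrow> is_ringed_space X \<and> (\<forall>x\<in>pts X. is_local_ring (stalk_ring X x))"

text \<open>\<open>sh f V\<close> is the comorphism from functions on \<open>V\<close> to functions on its preimage.\<close>

record ('a, 'b, 'c, 'd) rs_morphism =
  source :: "('a, 'b) ringed_space"
  target :: "('c, 'd) ringed_space"
  pt :: "'a \<Rightarrow> 'c"
  sh :: "'c set \<Rightarrow> 'd \<Rightarrow> 'b"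

definition preimg :: "('a, 'b, 'c, 'd) rs_morphism \<Rightarrow> 'c set \<Rightarrow> 'a set" where
  "preimg f V = {x \<in> pts (source f). pt f x \<in> V}"

text \<open>The pullback of a function on \<open>V\<close>, restricted to an open \<open>W\<close> of the preimage of \<open>V\<close>.\<close>

definition pull :: "('a, 'b, 'c, 'd) rs_morphism \<Rightarrow> 'c set \<Rightarrow> 'a set \<Rightarrow> 'd \<Rightarrow> 'b" where
  "pull f V W b = rst (source f) (preimg f V) W (sh f V b)"

definition stalk_map ::
  "('a, 'b, 'c, 'd) rs_morphism \<Rightarrow> 'a \<Rightarrow> ('c, 'd) germ \<Rightarrow> ('a, 'b) germ" where
  "stalk_map f x B = (\<Union>(V, b)\<in>B. rgerm (source f) x (preimg f V) (sh f V b))"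

definition is_morphism :: "('a, 'b, 'c, 'd) rs_morphism \<Rightarrow> bool" where
  "is_morphism f \<longleftrightarrow>
    locally_ringed (source f) \<and> locally_ringed (target f) \<and>
    continuous_map (space_top (source f)) (space_top (target f)) (pt f) \<and>
    (\<forall>V. opn (target f) V \<longrightarrow>
        sh f V \<in> ring_hom (sect (target f) V) (sect (source f) (preimg f V))) \<and>
    (\<forall>V V' b. opn (target f) V \<and> opn (target f) V' \<and> V' \<subseteq> V \<and> b \<in> carrier (sect (target f) V) \<longrightarrow>
        sh f V' (rst (target f) V V' b) = pull f V (preimg f V') b) \<and>
    (\<forall>x\<in>pts (source f). \<forall>B\<in>carrier (stalk_ring (target f) (pt f x)).
        stalk_map f x B \<in> Units (stalk_ring (source f) x) \<longrightarrow>
        B \<in> Units (stalk_ring (target f) (pt f x)))"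

definition is_iso :: "('a, 'b, 'c, 'd) rs_morphism \<Rightarrow> bool" where
  "is_iso f \<longleftrightarrow> is_morphism f \<and>
    homeomorphic_map (space_top (source f)) (space_top (target f)) (pt f) \<and>
    (\<forall>V. opn (target f) V \<longrightarrow>
        bij_betw (sh f V) (carrier (sect (target f) V)) (carrier (sect (source f) (preimg f V))))"

text \<open>\<open>mor_comp g f\<close> is the composite \<open>g \<circ> f\<close>.\<close>

definition mor_comp ::
  "('c, 'd, 'e, 'f) rs_morphism \<Rightarrow> ('a, 'b, 'c, 'd) rs_morphism \<Rightarrow> ('a, 'b, 'e, 'f) rs_morphism" where
  "mor_comp g f =
    \<lparr>source = source f, target = target g, pt = pt g \<circ> pt f,
     sh = (\<lambda>V b. sh f (preimg g V) (sh g V b))\<rparr>"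

text \<open>Equality of morphisms, disregarding values outside the spaces and rings involved.\<close>

definition mor_eq ::
  "('a, 'b, 'c, 'd) rs_morphism \<Rightarrow> ('a, 'b, 'c, 'd) rs_morphism \<Rightarrow> bool" where
  "mor_eq f g \<longleftrightarrow> source f = source g \<and> target f = target g \<and>
    (\<forall>x\<in>pts (source f). pt f x = pt g x) \<and>
    (\<forall>V. opn (target f) V \<longrightarrow> (\<forall>b\<in>carrier (sect (target f) V). sh f V b = sh g V b))"


section \<open>Schemes\<close>

definition frac :: "'r ring \<Rightarrow> 'r set \<Rightarrow> 'r \<Rightarrow> 'r \<Rightarrow> ('r \<times> 'r) set" where
  "frac R S a s = {(a', s'). a' \<in> carrier R \<and> s' \<in> S \<and>
     (\<exists>u\<in>S. u \<otimes>\<^bsub>R\<^esub> (s' \<otimes>\<^bsub>R\<^esub> a) = u \<otimes>\<^bsub>R\<^esub> (s \<otimes>\<^bsub>R\<^esub> a'))}"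

definition localization :: "'r ring \<Rightarrow> 'r set \<Rightarrow> ('r \<times> 'r) set ring" where
  "localization R S =
    \<lparr>carrier = {frac R S a s | a s. a \<in> carrier R \<and> s \<in> S},
     mult = (\<lambda>A B. \<Union>(a, s)\<in>A. \<Union>(b, t)\<in>B. frac R S (a \<otimes>\<^bsub>R\<^esub> b) (s \<otimes>\<^bsub>R\<^esub> t)),
     one = frac R S \<one>\<^bsub>R\<^esub> \<one>\<^bsub>R\<^esub>,
     zero = frac R S \<zero>\<^bsub>R\<^esub> \<one>\<^bsub>R\<^esub>,
     add = (\<lambda>A B. \<Union>(a, s)\<in>A. \<Union>(b, t)\<in>B.
        frac R S ((a \<otimes>\<^bsub>R\<^esub> t) \<oplus>\<^bsub>R\<^esub> (b \<otimes>\<^bsub>R\<^esub> s)) (s \<otimes>\<^bsub>R\<^esub> t))\<rparr>"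

abbreviation local_at :: "'r ring \<Rightarrow> 'r set \<Rightarrow> ('r \<times> 'r) set ring" where
  "local_at R P \<equiv> localization R (carrier R - P)"

definition Spec_sections :: "'r ring \<Rightarrow> 'r set set \<Rightarrow> ('r set \<Rightarrow> ('r \<times> 'r) set) set" where
  "Spec_sections R U = {\<sigma> \<in> (\<Pi>\<^sub>E P\<in>U. carrier (local_at R P)).
     \<forall>P\<in>U. \<exists>a\<in>carrier R. \<exists>b\<in>carrier R - P.
       \<forall>Q\<in>U. b \<notin> Q \<longrightarrow> \<sigma> Q = frac R (carrier R - Q) a b}"

definition Spec :: "'r ring \<Rightarrow> ('r set, 'r set \<Rightarrow> ('r \<times> 'r) set) ringed_space" where
  "Spec R =
    \<lparr>space_top = topology_generated_by {{P. primeideal P R \<and> a \<notin> P} | a. a \<in> carrier R},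
     sect = (\<lambda>U.
       \<lparr>carrier = Spec_sections R U,
        mult = (\<lambda>\<sigma> \<tau>. \<lambda>P\<in>U. \<sigma> P \<otimes>\<^bsub>local_at R P\<^esub> \<tau> P),
        one = (\<lambda>P\<in>U. \<one>\<^bsub>local_at R P\<^esub>),
        zero = (\<lambda>P\<in>U. \<zero>\<^bsub>local_at R P\<^esub>),
        add = (\<lambda>\<sigma> \<tau>. \<lambda>P\<in>U. \<sigma> P \<oplus>\<^bsub>local_at R P\<^esub> \<tau> P)\<rparr>),
     rst = (\<lambda>U V \<sigma>. restrict \<sigma> V)\<rparr>"

definition rs_restrict :: "('a, 'b) ringed_space \<Rightarrow> 'a set \<Rightarrow> ('a, 'b) ringed_space" where
  "rs_restrict X U = X\<lparr>space_top := subtopology (space_top X) U\<rparr>"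

text \<open>
  An affine open is isomorphic to the spectrum of its ring of functions, so rings
  on the type of sections suffice in the existential quantifier.
\<close>

definition affine_open :: "('a, 'b) ringed_space \<Rightarrow> 'a set \<Rightarrow> bool" where
  "affine_open X U \<longleftrightarrow> opn X U \<and>
    (\<exists>(R :: 'b ring) f. cring R \<and> is_iso f \<and> source f = rs_restrict X U \<and> target f = Spec R)"

definition is_scheme :: "('a, 'b) ringed_space \<Rightarrow> bool" where
  "is_scheme X \<longleftrightarrow> locally_ringed X \<and> (\<forall>x\<in>pts X. \<exists>U. x \<in> U \<and> affine_open X U)"


section \<open>Smooth morphisms\<close>

text \<open>
  Polynomials over \<open>R\<close> in the variables with indices below \<open>n\<close>; a monomial is a multiset of indices,
  as in \<^verbatim>\<open>HOL-Algebra.Indexed_Polynomials\<close>.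
\<close>

definition mpoly_ring :: "'r ring \<Rightarrow> nat \<Rightarrow> (nat multiset \<Rightarrow> 'r) ring" where
  "mpoly_ring R n =
    \<lparr>carrier = {f. (\<forall>m. f m \<in> carrier R) \<and> finite {m. f m \<noteq> \<zero>\<^bsub>R\<^esub>} \<and>
        (\<forall>m. f m \<noteq> \<zero>\<^bsub>R\<^esub> \<longrightarrow> set_mset m \<subseteq> {..<n})},
     mult = (\<lambda>f g m. \<Oplus>\<^bsub>R\<^esub>m'\<in>{m'. m' \<subseteq># m}. f m' \<otimes>\<^bsub>R\<^esub> g (m - m')),
     one = (\<lambda>m. if m = {#} then \<one>\<^bsub>R\<^esub> else \<zero>\<^bsub>R\<^esub>),
     zero = (\<lambda>m. \<zero>\<^bsub>R\<^esub>),
     add = (\<lambda>f g m. f m \<oplus>\<^bsub>R\<^esub> g m)\<rparr>"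

definition mpoly_eval ::
  "'r ring \<Rightarrow> 's ring \<Rightarrow> ('r \<Rightarrow> 's) \<Rightarrow> nat \<Rightarrow> (nat \<Rightarrow> 's) \<Rightarrow> (nat multiset \<Rightarrow> 'r) \<Rightarrow> 's" where
  "mpoly_eval R A \<phi> n a f =
    (\<Oplus>\<^bsub>A\<^esub>m\<in>{m. f m \<noteq> \<zero>\<^bsub>R\<^esub>}. \<phi> (f m) \<otimes>\<^bsub>A\<^esub> (\<Otimes>\<^bsub>A\<^esub>i\<in>{..<n}. a i [^]\<^bsub>A\<^esub> count m i))"

definition mpoly_deriv :: "'r ring \<Rightarrow> nat \<Rightarrow> (nat multiset \<Rightarrow> 'r) \<Rightarrow> (nat multiset \<Rightarrow> 'r)" where
  "mpoly_deriv R i f = (\<lambda>m. [(count m i + 1)] \<cdot>\<^bsub>R\<^esub> f (m + {#i#}))"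

text \<open>
  \<open>A \<cong> R[x\<^sub>0,\<dots>,x\<^sub>n\<^sub>-\<^sub>1] / (F\<^sub>0,\<dots>,F\<^sub>c\<^sub>-\<^sub>1)\<close> as an \<open>R\<close>-algebra, and the Jacobian matrix of the \<open>F\<^sub>i\<close>
  with respect to the first \<open>c\<close> variables is invertible over \<open>A\<close> (with inverse \<open>N\<close>).
\<close>

definition standard_smooth :: "'r ring \<Rightarrow> 's ring \<Rightarrow> ('r \<Rightarrow> 's) \<Rightarrow> bool" where
  "standard_smooth R A \<phi> \<longleftrightarrow> \<phi> \<in> ring_hom R A \<and>
    (\<exists>n c F a. c \<le> n \<and> (\<forall>i<c. F i \<in> carrier (mpoly_ring R n)) \<and> (\<forall>j<n. a j \<in> carrier A) \<and>
      mpoly_eval R A \<phi> n a ` carrier (mpoly_ring R n) = carrier A \<and>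
      {g \<in> carrier (mpoly_ring R n). mpoly_eval R A \<phi> n a g = \<zero>\<^bsub>A\<^esub>} =
        genideal (mpoly_ring R n) (F ` {..<c}) \<and>
      (\<exists>N. (\<forall>i<c. \<forall>j<c. N i j \<in> carrier A) \<and>
        (\<forall>i<c. \<forall>l<c.
          (\<Oplus>\<^bsub>A\<^esub>j\<in>{..<c}. mpoly_eval R A \<phi> n a (mpoly_deriv R j (F i)) \<otimes>\<^bsub>A\<^esub> N j l) =
            (if i = l then \<one>\<^bsub>A\<^esub> else \<zero>\<^bsub>A\<^esub>))))"

definition smooth_morphism :: "('a, 'b, 'c, 'd) rs_morphism \<Rightarrow> bool" where
  "smooth_morphism f \<longleftrightarrow> is_scheme (source f) \<and> is_scheme (target f) \<and> is_morphism f \<and>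
    (\<forall>x\<in>pts (source f). \<exists>U V. x \<in> U \<and> affine_open (source f) U \<and> affine_open (target f) V \<and>
        U \<subseteq> preimg f V \<and> standard_smooth (sect (target f) V) (sect (source f) U) (pull f V U))"


section \<open>Tensor products and flatness\<close>

text \<open>
  \<open>A \<otimes>\<^sub>R M\<close> for an \<open>R\<close>-algebra \<open>\<phi> : R \<rightarrow> A\<close>. The multiset \<open>{#(a\<^sub>1, m\<^sub>1), \<dots>#}\<close> stands for the
  formal sum of the \<open>a\<^sub>i \<otimes> m\<^sub>i\<close>; formal sums are identified by the bilinearity relations.
  The negative of \<open>a \<otimes> m\<close> is \<open>(-a) \<otimes> m\<close>, thanks to the last rule.
\<close>

inductive tensor_eq ::
  "'r ring \<Rightarrow> 's ring \<Rightarrow> ('r \<Rightarrow> 's) \<Rightarrow> ('r, 'm) module \<Rightarrow>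
    ('s \<times> 'm) multiset \<Rightarrow> ('s \<times> 'm) multiset \<Rightarrow> bool"
  for R A \<phi> M where
  refl: "set_mset xs \<subseteq> carrier A \<times> carrier M \<Longrightarrow> tensor_eq R A \<phi> M xs xs"
| sym: "tensor_eq R A \<phi> M xs ys \<Longrightarrow> tensor_eq R A \<phi> M ys xs"
| trans: "tensor_eq R A \<phi> M xs ys \<Longrightarrow> tensor_eq R A \<phi> M ys zs \<Longrightarrow> tensor_eq R A \<phi> M xs zs"
| cong: "tensor_eq R A \<phi> M xs ys \<Longrightarrow> set_mset zs \<subseteq> carrier A \<times> carrier M \<Longrightarrow>
    tensor_eq R A \<phi> M (xs + zs) (ys + zs)"
| add_left: "a \<in> carrier A \<Longrightarrow> b \<in> carrier A \<Longrightarrow> m \<in> carrier M \<Longrightarrow>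
    tensor_eq R A \<phi> M {#(a \<oplus>\<^bsub>A\<^esub> b, m)#} {#(a, m), (b, m)#}"
| add_right: "a \<in> carrier A \<Longrightarrow> m \<in> carrier M \<Longrightarrow> n \<in> carrier M \<Longrightarrow>
    tensor_eq R A \<phi> M {#(a, m \<oplus>\<^bsub>M\<^esub> n)#} {#(a, m), (a, n)#}"
| balanced: "a \<in> carrier A \<Longrightarrow> r \<in> carrier R \<Longrightarrow> m \<in> carrier M \<Longrightarrow>
    tensor_eq R A \<phi> M {#(a \<otimes>\<^bsub>A\<^esub> \<phi> r, m)#} {#(a, r \<odot>\<^bsub>M\<^esub> m)#}"
| null: "m \<in> carrier M \<Longrightarrow> tensor_eq R A \<phi> M {#(\<zero>\<^bsub>A\<^esub>, m)#} {#}"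

definition tensor_class ::
  "'r ring \<Rightarrow> 's ring \<Rightarrow> ('r \<Rightarrow> 's) \<Rightarrow> ('r, 'm) module \<Rightarrow> ('s \<times> 'm) multiset \<Rightarrow>
    ('s \<times> 'm) multiset set" where
  "tensor_class R A \<phi> M xs = {ys. tensor_eq R A \<phi> M xs ys}"

text \<open>The \<open>mult\<close> and \<open>one\<close> fields of a record used as a module carry no information.\<close>

definition tensor_module ::
  "'r ring \<Rightarrow> 's ring \<Rightarrow> ('r \<Rightarrow> 's) \<Rightarrow> ('r, 'm) module \<Rightarrow> ('s, ('s \<times> 'm) multiset set) module" where
  "tensor_module R A \<phi> M =
    \<lparr>carrier = {tensor_class R A \<phi> M xs | xs. set_mset xs \<subseteq> carrier A \<times> carrier M},
     mult = undefined, one = undefined,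
     zero = tensor_class R A \<phi> M {#},
     add = (\<lambda>C D. \<Union>xs\<in>C. \<Union>ys\<in>D. tensor_class R A \<phi> M (xs + ys)),
     smult = (\<lambda>a C. \<Union>xs\<in>C. tensor_class R A \<phi> M (image_mset (\<lambda>(b, m). (a \<otimes>\<^bsub>A\<^esub> b, m)) xs))\<rparr>"

text \<open>\<open>id \<otimes> h\<close>, with values in \<open>A \<otimes>\<^sub>R N\<close>.\<close>

definition tensor_map ::
  "'r ring \<Rightarrow> 's ring \<Rightarrow> ('r \<Rightarrow> 's) \<Rightarrow> ('r, 'n) module \<Rightarrow> ('m \<Rightarrow> 'n) \<Rightarrow>
    ('s \<times> 'm) multiset set \<Rightarrow> ('s \<times> 'n) multiset set" where
  "tensor_map R A \<phi> N h C = (\<Union>xs\<in>C. tensor_class R A \<phi> N (image_mset (map_prod id h) xs))"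

definition linear_map :: "'r ring \<Rightarrow> ('r, 'm) module \<Rightarrow> ('r, 'n) module \<Rightarrow> ('m \<Rightarrow> 'n) \<Rightarrow> bool" where
  "linear_map R M N h \<longleftrightarrow> h \<in> carrier M \<rightarrow> carrier N \<and>
    (\<forall>m\<in>carrier M. \<forall>m'\<in>carrier M. h (m \<oplus>\<^bsub>M\<^esub> m') = h m \<oplus>\<^bsub>N\<^esub> h m') \<and>
    (\<forall>r\<in>carrier R. \<forall>m\<in>carrier M. h (r \<odot>\<^bsub>M\<^esub> m) = r \<odot>\<^bsub>N\<^esub> h m)"

text \<open>
  Tensoring preserves injections. The modules range over the carrier type of \<open>R\<close>, which
  contains all ideals of \<open>R\<close>; injectivity for inclusions of ideals already implies flatness.
\<close>

definition flat_ring_map :: "'r ring \<Rightarrow> 's ring \<Rightarrow> ('r \<Rightarrow> 's) \<Rightarrow> bool" where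
  "flat_ring_map R A \<phi> \<longleftrightarrow>
    (\<forall>(M :: ('r, 'r) module) (N :: ('r, 'r) module) h.
       module R M \<and> module R N \<and> linear_map R M N h \<and> inj_on h (carrier M) \<longrightarrow>
       inj_on (tensor_map R A \<phi> N h) (carrier (tensor_module R A \<phi> M)))"

definition faithfully_flat :: "('a, 'b, 'c, 'd) rs_morphism \<Rightarrow> bool" where
  "faithfully_flat f \<longleftrightarrow> pt f ` pts (source f) = pts (target f) \<and>
    (\<forall>x\<in>pts (source f).
       flat_ring_map (stalk_ring (target f) (pt f x)) (stalk_ring (source f) x) (stalk_map f x))"


section \<open>Sheaves of modules\<close>

record ('a, 'b, 'm) mod_sheaf =
  msec :: "'a set \<Rightarrow> ('b, 'm) module"
  mrst :: "'a set \<Rightarrow> 'a set \<Rightarrow> 'm \<Rightarrow> 'm"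

abbreviation msects :: "('a, 'b, 'm, 'z) mod_sheaf_scheme \<Rightarrow> 'a set \<Rightarrow> 'm set" where
  "msects M U \<equiv> carrier (msec M U)"

definition is_mod_sheaf :: "('a, 'b) ringed_space \<Rightarrow> ('a, 'b, 'm, 'z) mod_sheaf_scheme \<Rightarrow> bool" where
  "is_mod_sheaf X M \<longleftrightarrow>
    (\<forall>U. opn X U \<longrightarrow> module (sect X U) (msec M U)) \<and>
    sheaf_on (space_top X) (msects M) (mrst M) \<and>
    (\<forall>U V. opn X U \<and> opn X V \<and> V \<subseteq> U \<longrightarrow>
       (\<forall>m\<in>msects M U. \<forall>m'\<in>msects M U.
          mrst M U V (m \<oplus>\<^bsub>msec M U\<^esub> m') = mrst M U V m \<oplus>\<^bsub>msec M V\<^esub> mrst M U V m') \<and>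
       (\<forall>a\<in>carrier (sect X U). \<forall>m\<in>msects M U.
          mrst M U V (a \<odot>\<^bsub>msec M U\<^esub> m) = rst X U V a \<odot>\<^bsub>msec M V\<^esub> mrst M U V m))"

text \<open>\<open>\<O>\<^sub>X\<close>-linear maps, normalised to be undefined outside opens and sections.\<close>

definition sheaf_hom ::
  "('a, 'b) ringed_space \<Rightarrow> ('a, 'b, 'm, 'y) mod_sheaf_scheme \<Rightarrow> ('a, 'b, 'n, 'z) mod_sheaf_scheme \<Rightarrow>
    ('a set \<Rightarrow> 'm \<Rightarrow> 'n) set" where
  "sheaf_hom X M N = {h \<in> (\<Pi>\<^sub>E U\<in>{U. opn X U}. msects M U \<rightarrow>\<^sub>E msects N U).
     (\<forall>U. opn X U \<longrightarrow> linear_map (sect X U) (msec M U) (msec N U) (h U)) \<and>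
     (\<forall>U V m. opn X U \<and> opn X V \<and> V \<subseteq> U \<and> m \<in> msects M U \<longrightarrow>
        h V (mrst M U V m) = mrst N U V (h U m))}"

definition mgerm ::
  "('a, 'b) ringed_space \<Rightarrow> ('a, 'b, 'm, 'z) mod_sheaf_scheme \<Rightarrow> 'a \<Rightarrow> 'a set \<Rightarrow> 'm \<Rightarrow> ('a, 'm) germ" where
  "mgerm X M x U m = germ (space_top X) (msects M) (mrst M) x U m"

definition stalk_module ::
  "('a, 'b) ringed_space \<Rightarrow> ('a, 'b, 'm, 'z) mod_sheaf_scheme \<Rightarrow> 'a \<Rightarrow>
    (('a, 'b) germ, ('a, 'm) germ) module" where
  "stalk_module X M x =
    \<lparr>carrier = stalk (space_top X) (msects M) (mrst M) x,
     mult = undefined, one = undefined,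
     zero = mgerm X M x (pts X) \<zero>\<^bsub>msec M (pts X)\<^esub>,
     add = (\<lambda>A B. \<Union>(U, m)\<in>A. \<Union>(V, m')\<in>B.
        mgerm X M x (U \<inter> V) (mrst M U (U \<inter> V) m \<oplus>\<^bsub>msec M (U \<inter> V)\<^esub> mrst M V (U \<inter> V) m')),
     smult = (\<lambda>A B. \<Union>(U, a)\<in>A. \<Union>(V, m)\<in>B.
        mgerm X M x (U \<inter> V) (rst X U (U \<inter> V) a \<odot>\<^bsub>msec M (U \<inter> V)\<^esub> mrst M V (U \<inter> V) m))\<rparr>"


section \<open>Pullback of sheaves of modules\<close>

text \<open>
  \<open>f\<^sup>*M\<close> is the sheafification of \<open>\<O>\<^sub>X \<otimes> f\<^sup>-\<^sup>1M\<close> over \<open>f\<^sup>-\<^sup>1\<O>\<^sub>Y\<close>: a section over \<open>U\<close> assigns to each \<open>x\<close> in \<open>U\<close>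
  an element of the stalk \<open>\<O>\<^sub>X\<^sub>,\<^sub>x \<otimes> M\<^sub>f\<^sub>x\<close> over \<open>\<O>\<^sub>Y\<^sub>,\<^sub>f\<^sub>x\<close>, locally given by a single finite
  sum of \<open>a\<^sub>i \<otimes> m\<^sub>i\<close> with \<open>a\<^sub>i\<close> and \<open>m\<^sub>i\<close> sections of \<open>\<O>\<^sub>X\<close> and \<open>M\<close>.
\<close>

type_synonym ('a, 'b, 'c, 'm) tens = "(('a, 'b) germ \<times> ('c, 'm) germ) multiset set"

definition pb_stalk ::
  "('a, 'b, 'c, 'd) rs_morphism \<Rightarrow> ('c, 'd, 'm) mod_sheaf \<Rightarrow> 'a \<Rightarrow>
    (('a, 'b) germ, ('a, 'b, 'c, 'm) tens) module" where
  "pb_stalk f M x = tensor_module (stalk_ring (target f) (pt f x)) (stalk_ring (source f) x)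
     (stalk_map f x) (stalk_module (target f) M (pt f x))"

text \<open>The value at \<open>x\<close> of the sum of \<open>a \<otimes> m\<close> over the list \<open>xs\<close>, with \<open>a \<in> \<O>\<^sub>X(W)\<close> and \<open>m \<in> M(V)\<close>.\<close>

definition pb_elem ::
  "('a, 'b, 'c, 'd) rs_morphism \<Rightarrow> ('c, 'd, 'm) mod_sheaf \<Rightarrow> 'a set \<Rightarrow> 'c set \<Rightarrow> ('b \<times> 'm) list \<Rightarrow>
    'a \<Rightarrow> ('a, 'b, 'c, 'm) tens" where
  "pb_elem f M W V xs x =
    tensor_class (stalk_ring (target f) (pt f x)) (stalk_ring (source f) x)
      (stalk_map f x) (stalk_module (target f) M (pt f x))
      (mset (map (\<lambda>(a, m). (rgerm (source f) x W a, mgerm (target f) M (pt f x) V m)) xs))"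

definition pb_represents ::
  "('a, 'b, 'c, 'd) rs_morphism \<Rightarrow> ('c, 'd, 'm) mod_sheaf \<Rightarrow> 'a set \<Rightarrow> 'c set \<Rightarrow> ('b \<times> 'm) list \<Rightarrow>
    ('a \<Rightarrow> ('a, 'b, 'c, 'm) tens) \<Rightarrow> bool" where
  "pb_represents f M W V xs \<theta> \<longleftrightarrow>
    opn (source f) W \<and> opn (target f) V \<and> W \<subseteq> preimg f V \<and>
    set xs \<subseteq> carrier (sect (source f) W) \<times> msects M V \<and>
    (\<forall>x\<in>W. \<theta> x = pb_elem f M W V xs x)"

definition pullback ::
  "('a, 'b, 'c, 'd) rs_morphism \<Rightarrow> ('c, 'd, 'm) mod_sheaf \<Rightarrow>
    ('a, 'b, 'a \<Rightarrow> ('a, 'b, 'c, 'm) tens) mod_sheaf" where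
  "pullback f M =
    \<lparr>msec = (\<lambda>U.
       \<lparr>carrier = {\<theta> \<in> (\<Pi>\<^sub>E x\<in>U. carrier (pb_stalk f M x)).
           \<forall>x\<in>U. \<exists>W V xs. x \<in> W \<and> W \<subseteq> U \<and> pb_represents f M W V xs \<theta>},
        mult = undefined, one = undefined,
        zero = (\<lambda>x\<in>U. \<zero>\<^bsub>pb_stalk f M x\<^esub>),
        add = (\<lambda>\<theta> \<eta>. \<lambda>x\<in>U. \<theta> x \<oplus>\<^bsub>pb_stalk f M x\<^esub> \<eta> x),
        smult = (\<lambda>a \<theta>. \<lambda>x\<in>U. rgerm (source f) x U a \<odot>\<^bsub>pb_stalk f M x\<^esub> \<theta> x)\<rparr>),
     mrst = (\<lambda>U V \<theta>. restrict \<theta> V)\<rparr>"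

text \<open>The unit \<open>M \<rightarrow> f\<^sub>*f\<^sup>*M\<close>, sending \<open>m\<close> to \<open>1 \<otimes> m\<close>.\<close>

definition pb_unit ::
  "('a, 'b, 'c, 'd) rs_morphism \<Rightarrow> ('c, 'd, 'm) mod_sheaf \<Rightarrow> 'c set \<Rightarrow> 'm \<Rightarrow>
    'a \<Rightarrow> ('a, 'b, 'c, 'm) tens" where
  "pb_unit f M V m =
    (\<lambda>x\<in>preimg f V. pb_elem f M (preimg f V) V [(\<one>\<^bsub>sect (source f) (preimg f V)\<^esub>, m)] x)"

text \<open>The pullback \<open>f\<^sup>*h : f\<^sup>*M \<rightarrow> f\<^sup>*N\<close> of a morphism \<open>h : M \<rightarrow> N\<close>, computed on stalks.\<close>

definition pb_map ::
  "('a, 'b, 'c, 'd) rs_morphism \<Rightarrow> ('c, 'd, 'm) mod_sheaf \<Rightarrow> ('c, 'd, 'n) mod_sheaf \<Rightarrow>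
    ('c set \<Rightarrow> 'm \<Rightarrow> 'n) \<Rightarrow>
    'a set \<Rightarrow> ('a \<Rightarrow> ('a, 'b, 'c, 'm) tens) \<Rightarrow> ('a \<Rightarrow> ('a, 'b, 'c, 'n) tens)" where
  "pb_map f M N h = (\<lambda>U\<in>{U. opn (source f) U}. \<lambda>\<theta>\<in>msects (pullback f M) U. \<lambda>x\<in>U.
     tensor_map (stalk_ring (target f) (pt f x)) (stalk_ring (source f) x) (stalk_map f x)
       (stalk_module (target f) N (pt f x))
       (\<lambda>\<mu>. \<Union>(V, m)\<in>\<mu>. mgerm (target f) N (pt f x) V (h V m)) (\<theta> x))"

text \<open>
  The canonical isomorphism \<open>(g \<circ> f)\<^sup>*M \<rightarrow> f\<^sup>*g\<^sup>*M\<close>, sending \<open>a \<otimes> m\<close> to \<open>a \<otimes> (1 \<otimes> m)\<close>.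
\<close>

definition pb_comp ::
  "('c, 'd, 'e, 'f) rs_morphism \<Rightarrow> ('a, 'b, 'c, 'd) rs_morphism \<Rightarrow> ('e, 'f, 'm) mod_sheaf \<Rightarrow>
    'a set \<Rightarrow> ('a \<Rightarrow> ('a, 'b, 'e, 'm) tens) \<Rightarrow>
    ('a \<Rightarrow> ('a, 'b, 'c, 'c \<Rightarrow> ('c, 'd, 'e, 'm) tens) tens)" where
  "pb_comp g f M = (\<lambda>U\<in>{U. opn (source f) U}. \<lambda>\<theta>\<in>msects (pullback (mor_comp g f) M) U. \<lambda>x\<in>U.
     tensor_map (stalk_ring (target f) (pt f x)) (stalk_ring (source f) x) (stalk_map f x)
       (stalk_module (target f) (pullback g M) (pt f x))
       (\<lambda>\<mu>. \<Union>(V, m)\<in>\<mu>. mgerm (target f) (pullback g M) (pt f x) (preimg g V) (pb_unit g M V m))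
       (\<theta> x))"


section \<open>Tangent sheaves and differentials\<close>

text \<open>
  For \<open>f : X \<rightarrow> Y\<close>, sections of \<open>T\<^bsub>X/Y\<^esub>\<close> over \<open>U\<close> are the \<open>f\<^sup>-\<^sup>1\<O>\<^sub>Y\<close>-linear derivations of the sheaf
  \<open>\<O>\<^sub>X|U\<close> into itself, as families indexed by the opens of \<open>U\<close>. Thus \<open>T\<^bsub>X/Y\<^esub>\<close> is literally a
  subsheaf of \<open>T\<^bsub>X/Z\<^esub>\<close> for a composite \<open>X \<rightarrow> Y \<rightarrow> Z\<close>.
\<close>

type_synonym ('a, 'b) vfield = "'a set \<Rightarrow> 'b \<Rightarrow> 'b"

definition derivations :: "('a, 'b, 'c, 'd) rs_morphism \<Rightarrow> 'a set \<Rightarrow> ('a, 'b) vfield set" where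
  "derivations f U = (let X = source f; Y = target f in
    {D \<in> (\<Pi>\<^sub>E W\<in>{W. opn X W \<and> W \<subseteq> U}. carrier (sect X W) \<rightarrow>\<^sub>E carrier (sect X W)).
      (\<forall>W s t. opn X W \<and> W \<subseteq> U \<and> s \<in> carrier (sect X W) \<and> t \<in> carrier (sect X W) \<longrightarrow>
         D W (s \<oplus>\<^bsub>sect X W\<^esub> t) = D W s \<oplus>\<^bsub>sect X W\<^esub> D W t \<and>
         D W (s \<otimes>\<^bsub>sect X W\<^esub> t) = (s \<otimes>\<^bsub>sect X W\<^esub> D W t) \<oplus>\<^bsub>sect X W\<^esub> (t \<otimes>\<^bsub>sect X W\<^esub> D W s)) \<and>
      (\<forall>W W' s. opn X W \<and> opn X W' \<and> W' \<subseteq> W \<and> W \<subseteq> U \<and> s \<in> carrier (sect X W) \<longrightarrow>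
         D W' (rst X W W' s) = rst X W W' (D W s)) \<and>
      (\<forall>W V b. opn X W \<and> W \<subseteq> U \<and> opn Y V \<and> W \<subseteq> preimg f V \<and> b \<in> carrier (sect Y V) \<longrightarrow>
         D W (pull f V W b) = \<zero>\<^bsub>sect X W\<^esub>)})"

definition tangent :: "('a, 'b, 'c, 'd) rs_morphism \<Rightarrow> ('a, 'b, ('a, 'b) vfield) mod_sheaf" where
  "tangent f = (let X = source f in
    \<lparr>msec = (\<lambda>U.
       \<lparr>carrier = derivations f U,
        mult = undefined, one = undefined,
        zero = (\<lambda>W\<in>{W. opn X W \<and> W \<subseteq> U}. \<lambda>s\<in>carrier (sect X W). \<zero>\<^bsub>sect X W\<^esub>),
        add = (\<lambda>D E. \<lambda>W\<in>{W. opn X W \<and> W \<subseteq> U}. \<lambda>s\<in>carrier (sect X W). D W s \<oplus>\<^bsub>sect X W\<^esub> E W s),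
        smult = (\<lambda>a D. \<lambda>W\<in>{W. opn X W \<and> W \<subseteq> U}. \<lambda>s\<in>carrier (sect X W).
           rst X U W a \<otimes>\<^bsub>sect X W\<^esub> D W s)\<rparr>),
     mrst = (\<lambda>U V D. restrict D {W. opn X W \<and> W \<subseteq> V})\<rparr>)"

definition commutator ::
  "('a, 'b) ringed_space \<Rightarrow> 'a set \<Rightarrow> ('a, 'b) vfield \<Rightarrow> ('a, 'b) vfield \<Rightarrow> ('a, 'b) vfield" where
  "commutator X U D E = (\<lambda>W\<in>{W. opn X W \<and> W \<subseteq> U}. \<lambda>s\<in>carrier (sect X W).
     D W (E W s) \<ominus>\<^bsub>sect X W\<^esub> E W (D W s))"

text \<open>
  The differential \<open>df : T\<^bsub>X/k\<^esub> \<rightarrow> f\<^sup>*T\<^bsub>Y/k\<^esub>\<close>, where \<open>tX\<close>, \<open>tY\<close> are the structure morphisms to \<open>Spec k\<close>.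
  It sends \<open>D\<close> to the section \<open>\<theta>\<close> which acts on functions of \<open>Y\<close> like \<open>D\<close>: wherever \<open>\<theta>\<close> is the sum
  of \<open>a\<^sub>i \<otimes> \<xi>\<^sub>i\<close>, one has that \<open>D (f\<^sup># b)\<close> is the sum of \<open>a\<^sub>i \<cdot> f\<^sup>#(\<xi>\<^sub>i b)\<close>. For \<open>Y\<close> smooth over \<open>k\<close>
  there is exactly one such \<open>\<theta>\<close>, because \<open>f\<^sup>*T\<^bsub>Y/k\<^esub>\<close> is then the sheaf of \<open>k\<close>-derivations
  \<open>f\<^sup>-\<^sup>1\<O>\<^sub>Y \<rightarrow> \<O>\<^sub>X\<close>.
\<close>

definition differential ::
  "('a, 'b, 'c, 'd) rs_morphism \<Rightarrow> ('a, 'b, 'p, 'q) rs_morphism \<Rightarrow> ('c, 'd, 'p, 'q) rs_morphism \<Rightarrow>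
    'a set \<Rightarrow> ('a, 'b) vfield \<Rightarrow> ('a \<Rightarrow> ('a, 'b, 'c, ('c, 'd) vfield) tens)" where
  "differential f tX tY = (\<lambda>U\<in>{U. opn (source f) U}. \<lambda>D\<in>msects (tangent tX) U.
    (THE \<theta>. \<theta> \<in> msects (pullback f (tangent tY)) U \<and>
      (\<forall>W V xs. W \<subseteq> U \<and> pb_represents f (tangent tY) W V xs \<theta> \<longrightarrow>
        (\<forall>W' V' b. opn (source f) W' \<and> opn (target f) V' \<and> W' \<subseteq> W \<and> V' \<subseteq> V \<and> W' \<subseteq> preimg f V' \<and>
            b \<in> carrier (sect (target f) V') \<longrightarrow>
          D W' (pull f V' W' b) =
            foldr (\<lambda>(a, \<xi>) c. (rst (source f) W W' a \<otimes>\<^bsub>sect (source f) W'\<^esub> pull f V' W' (\<xi> V' b))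
                \<oplus>\<^bsub>sect (source f) W'\<^esub> c) xs \<zero>\<^bsub>sect (source f) W'\<^esub>))))"


section \<open>Lie algebroids and transversal unfoldings\<close>

record ('a, 'b, 'g) algebroid = "('a, 'b, 'g) mod_sheaf" +
  bracket :: "'a set \<Rightarrow> 'g \<Rightarrow> 'g \<Rightarrow> 'g"
  anchor :: "'a set \<Rightarrow> 'g \<Rightarrow> ('a, 'b) vfield"

text \<open>
  Lie algebroids on \<open>X\<close> relative to \<open>r : X \<rightarrow> B\<close>. Linearity of the bracket over functions of \<open>B\<close> follows
  from additivity and the Leibniz rule, since the anchor takes values in \<open>T\<^bsub>X/B\<^esub>\<close>.
\<close>

definition is_lie_algebroid ::
  "('a, 'b, 'c, 'd) rs_morphism \<Rightarrow> ('a, 'b, 'g, 'z) algebroid_scheme \<Rightarrow> bool" where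
  "is_lie_algebroid r L \<longleftrightarrow> (let X = source r in
    is_mod_sheaf X L \<and> anchor L \<in> sheaf_hom X L (tangent r) \<and>
    (\<forall>U. opn X U \<longrightarrow>
      (\<forall>u\<in>msects L U. \<forall>v\<in>msects L U.
         bracket L U u v \<in> msects L U \<and>
         bracket L U u u = \<zero>\<^bsub>msec L U\<^esub> \<and>
         anchor L U (bracket L U u v) = commutator X U (anchor L U u) (anchor L U v) \<and>
         (\<forall>a\<in>carrier (sect X U). bracket L U u (a \<odot>\<^bsub>msec L U\<^esub> v) =
            (a \<odot>\<^bsub>msec L U\<^esub> bracket L U u v) \<oplus>\<^bsub>msec L U\<^esub> (anchor L U u U a \<odot>\<^bsub>msec L U\<^esub> v)) \<and>
         (\<forall>V. opn X V \<and> V \<subseteq> U \<longrightarrow>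
            mrst L U V (bracket L U u v) = bracket L V (mrst L U V u) (mrst L U V v)) \<and>
         (\<forall>w\<in>msects L U.
            bracket L U (u \<oplus>\<^bsub>msec L U\<^esub> v) w = bracket L U u w \<oplus>\<^bsub>msec L U\<^esub> bracket L U v w \<and>
            bracket L U w (u \<oplus>\<^bsub>msec L U\<^esub> v) = bracket L U w u \<oplus>\<^bsub>msec L U\<^esub> bracket L U w v \<and>
            bracket L U u (bracket L U v w) \<oplus>\<^bsub>msec L U\<^esub> bracket L U v (bracket L U w u)
              \<oplus>\<^bsub>msec L U\<^esub> bracket L U w (bracket L U u v) = \<zero>\<^bsub>msec L U\<^esub>))))"

text \<open>
  The foliation induced by \<open>q : X \<rightarrow> Y\<close> on \<open>X/S\<close>: its Lie algebroid is \<open>T\<^bsub>X/Y\<^esub>\<close> with the commutator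
  bracket, anchored by the inclusion into \<open>T\<^bsub>X/S\<^esub>\<close>.
\<close>

definition leaf_foliation ::
  "('a, 'b, 'c, 'd) rs_morphism \<Rightarrow> ('a, 'b, ('a, 'b) vfield) algebroid" where
  "leaf_foliation q =
    \<lparr>msec = msec (tangent q), mrst = mrst (tangent q),
     bracket = commutator (source q),
     anchor = (\<lambda>U\<in>{U. opn (source q) U}. \<lambda>D\<in>msects (tangent q) U. D)\<rparr>"

text \<open>
  The data of an unfolding of \<open>G\<close> along \<open>r : X \<rightarrow> S\<close>: a Lie algebroid, the inclusion of \<open>G\<close>, and the
  projection to the quotient \<open>r\<^sup>*T\<^bsub>S/k\<^esub>\<close> by \<open>G\<close>.
\<close>

record ('a, 'b, 'e, 'f, 'h, 'g) unfolding_data = "('a, 'b, 'g) algebroid" +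
  incl :: "'a set \<Rightarrow> 'h \<Rightarrow> 'g"
  proj :: "'a set \<Rightarrow> 'g \<Rightarrow> ('a \<Rightarrow> ('a, 'b, 'e, ('e, 'f) vfield) tens)"

text \<open>The sections of \<open>r\<^sup>*T\<^bsub>S/k\<^esub>\<close> that are locally pulled back from vector fields on the base \<open>S\<close>.\<close>

definition base_direction ::
  "('a, 'b, 'e, 'f) rs_morphism \<Rightarrow> ('e, 'f, 'p, 'q) rs_morphism \<Rightarrow> 'a set \<Rightarrow>
    ('a \<Rightarrow> ('a, 'b, 'e, ('e, 'f) vfield) tens) \<Rightarrow> bool" where
  "base_direction r tS U \<theta> \<longleftrightarrow>
    (\<forall>x\<in>U. \<exists>W V \<xi>. x \<in> W \<and> W \<subseteq> U \<and>
       pb_represents r (tangent tS) W V [(\<one>\<^bsub>sect (source r) W\<^esub>, \<xi>)] \<theta>)"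

text \<open>
  Strict transversal unfoldings of a Lie algebroid \<open>G\<close> relative to \<open>r : X \<rightarrow> S\<close>. The structure morphisms
  to \<open>Spec k\<close> are \<open>tX\<close> and \<open>tS\<close>. The quotient by \<open>G\<close> is identified with \<open>r\<^sup>*T\<^bsub>S/k\<^esub>\<close> by
  the exactness of \<open>0 \<rightarrow> G \<rightarrow> E \<rightarrow> r\<^sup>*T\<^bsub>S/k\<^esub> \<rightarrow> 0\<close>, and the induced anchor on it,
  with values in \<open>T\<^bsub>X/k\<^esub>/T\<^bsub>X/S\<^esub> = r\<^sup>*T\<^bsub>S/k\<^esub>\<close>, is the identity.

  In the last clause, that \<open>G\<close> is a Lie ideal is required with respect to the lifts of base directions:
  these are infinitesimal symmetries of \<open>G\<close>. Bracketing \<open>G\<close> with \<^emph>\<open>all\<close> sections \<open>u\<close> of \<open>E\<close> cannot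
  be meant: as \<open>[w, a u] = a [w, u] + \<rho>(w)(a) u\<close> for \<open>w\<close> in \<open>G\<close> and \<open>a\<close> in \<open>\<O>\<^sub>X\<close>, this would
  force \<open>\<rho>(w)(a) u \<in> G\<close> for all \<open>u\<close>, excluding every case with positive-dimensional leaves and base.
\<close>

definition strict_unfolding ::
  "('a, 'b, 'e, 'f) rs_morphism \<Rightarrow> ('a, 'b, 'p, 'q) rs_morphism \<Rightarrow> ('e, 'f, 'p, 'q) rs_morphism \<Rightarrow>
    ('a, 'b, 'h) algebroid \<Rightarrow> ('a, 'b, 'e, 'f, 'h, 'g) unfolding_data \<Rightarrow> bool" where
  "strict_unfolding r tX tS G E \<longleftrightarrow> (let X = source r; TS = pullback r (tangent tS) in
    is_lie_algebroid r G \<and> is_lie_algebroid tX E \<and>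
    incl E \<in> sheaf_hom X G E \<and>
    (\<forall>U. opn X U \<longrightarrow> inj_on (incl E U) (msects G U) \<and>
       (\<forall>g\<in>msects G U. anchor E U (incl E U g) = anchor G U g) \<and>
       (\<forall>g\<in>msects G U. \<forall>h\<in>msects G U.
          incl E U (bracket G U g h) = bracket E U (incl E U g) (incl E U h))) \<and>
    proj E \<in> sheaf_hom X E TS \<and>
    (\<forall>U. opn X U \<longrightarrow>
       {u \<in> msects E U. proj E U u = \<zero>\<^bsub>msec TS U\<^esub>} = incl E U ` msects G U \<and>
       (\<forall>\<theta>\<in>msects TS U. \<forall>x\<in>U. \<exists>W. opn X W \<and> x \<in> W \<and> W \<subseteq> U \<and>
          (\<exists>u\<in>msects E W. proj E W u = mrst TS U W \<theta>)) \<and>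
       (\<forall>u\<in>msects E U. differential r tX tS U (anchor E U u) = proj E U u)) \<and>
    (\<forall>U. opn X U \<longrightarrow>
       (\<forall>u\<in>msects E U. base_direction r tS U (proj E U u) \<longrightarrow>
          (\<forall>g\<in>msects G U. bracket E U u (incl E U g) \<in> incl E U ` msects G U))))"

definition unfolding_isos ::
  "('a, 'b) ringed_space \<Rightarrow> ('a, 'b, 'h) algebroid \<Rightarrow>
    ('a, 'b, 'e, 'f, 'h, 'g) unfolding_data \<Rightarrow> ('a, 'b, 'e, 'f, 'h, 'g1) unfolding_data \<Rightarrow>
    ('a set \<Rightarrow> 'g \<Rightarrow> 'g1) set" where
  "unfolding_isos X G E E' = {\<phi> \<in> sheaf_hom X E E'.
     \<forall>U. opn X U \<longrightarrow> bij_betw (\<phi> U) (msects E U) (msects E' U) \<and>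
       (\<forall>g\<in>msects G U. \<phi> U (incl E U g) = incl E' U g) \<and>
       (\<forall>u\<in>msects E U. anchor E' U (\<phi> U u) = anchor E U u \<and> proj E' U (\<phi> U u) = proj E U u \<and>
          (\<forall>v\<in>msects E U. \<phi> U (bracket E U u v) = bracket E' U (\<phi> U u) (\<phi> U v)))}"


section \<open>Splittings\<close>

text \<open>Throughout, \<open>X \<rightarrow> Y \<rightarrow> S\<close> are \<open>q\<close> and \<open>p\<close>, and \<open>tX\<close>, \<open>tY\<close>, \<open>tS\<close> are the structure morphisms to \<open>Spec k\<close>.\<close>

definition tangent_splitting ::
  "('c, 'd, 'e, 'f) rs_morphism \<Rightarrow> ('c, 'd, 'p, 'q) rs_morphism \<Rightarrow> ('e, 'f, 'p, 'q) rs_morphism \<Rightarrow>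
    ('c set \<Rightarrow> ('c \<Rightarrow> ('c, 'd, 'e, ('e, 'f) vfield) tens) \<Rightarrow> ('c, 'd) vfield) \<Rightarrow> bool" where
  "tangent_splitting p tY tS \<tau> \<longleftrightarrow>
    \<tau> \<in> sheaf_hom (source p) (pullback p (tangent tS)) (tangent tY) \<and>
    (\<forall>U. opn (source p) U \<longrightarrow>
       (\<forall>\<theta>\<in>msects (pullback p (tangent tS)) U. differential p tY tS U (\<tau> U \<theta>) = \<theta>))"

text \<open>The curvature vanishes: horizontal lifting of vector fields on \<open>S\<close> preserves brackets.\<close>

definition flat_splitting ::
  "('c, 'd, 'e, 'f) rs_morphism \<Rightarrow> ('c, 'd, 'p, 'q) rs_morphism \<Rightarrow> ('e, 'f, 'p, 'q) rs_morphism \<Rightarrow>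
    ('c set \<Rightarrow> ('c \<Rightarrow> ('c, 'd, 'e, ('e, 'f) vfield) tens) \<Rightarrow> ('c, 'd) vfield) \<Rightarrow> bool" where
  "flat_splitting p tY tS \<tau> \<longleftrightarrow> tangent_splitting p tY tS \<tau> \<and>
    (\<forall>V \<xi> \<eta>. opn (target p) V \<and> \<xi> \<in> msects (tangent tS) V \<and> \<eta> \<in> msects (tangent tS) V \<longrightarrow>
      (let lift = (\<lambda>\<zeta>. \<tau> (preimg p V) (pb_unit p (tangent tS) V \<zeta>)) in
        lift (commutator (target p) V \<xi> \<eta>) = commutator (source p) (preimg p V) (lift \<xi>) (lift \<eta>)))"

text \<open>
  Splittings \<open>s\<close> of the normal morphism \<open>q\<^sup>*T\<^bsub>Y/k\<^esub> \<rightarrow> q\<^sup>*p\<^sup>*T\<^bsub>S/k\<^esub> = \<pi>\<^sup>*T\<^bsub>S/k\<^esub>\<close> induced by \<open>dp\<close>; the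
  identification on the right is \<open>pb_comp\<close>.
\<close>

definition normal_splitting ::
  "('a, 'b, 'c, 'd) rs_morphism \<Rightarrow> ('c, 'd, 'e, 'f) rs_morphism \<Rightarrow>
    ('c, 'd, 'p, 'q) rs_morphism \<Rightarrow> ('e, 'f, 'p, 'q) rs_morphism \<Rightarrow>
    ('a set \<Rightarrow> ('a \<Rightarrow> ('a, 'b, 'e, ('e, 'f) vfield) tens) \<Rightarrow>
       ('a \<Rightarrow> ('a, 'b, 'c, ('c, 'd) vfield) tens)) \<Rightarrow> bool" where
  "normal_splitting q p tY tS s \<longleftrightarrow>
    (let X = source q; \<pi>TS = pullback (mor_comp p q) (tangent tS) in
      s \<in> sheaf_hom X \<pi>TS (pullback q (tangent tY)) \<and>
      (\<forall>U. opn X U \<longrightarrow> (\<forall>\<theta>\<in>msects \<pi>TS U.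
         pb_map q (tangent tY) (pullback p (tangent tS)) (differential p tY tS) U (s U \<theta>) =
           pb_comp p q (tangent tS) U \<theta>)))"

text \<open>The pullback \<open>q\<^sup>*\<tau> : \<pi>\<^sup>*T\<^bsub>S/k\<^esub> = q\<^sup>*p\<^sup>*T\<^bsub>S/k\<^esub> \<rightarrow> q\<^sup>*T\<^bsub>Y/k\<^esub>\<close>.\<close>

definition pullback_splitting ::
  "('a, 'b, 'c, 'd) rs_morphism \<Rightarrow> ('c, 'd, 'e, 'f) rs_morphism \<Rightarrow>
    ('c, 'd, 'p, 'q) rs_morphism \<Rightarrow> ('e, 'f, 'p, 'q) rs_morphism \<Rightarrow>
    ('c set \<Rightarrow> ('c \<Rightarrow> ('c, 'd, 'e, ('e, 'f) vfield) tens) \<Rightarrow> ('c, 'd) vfield) \<Rightarrow>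
    ('a set \<Rightarrow> ('a \<Rightarrow> ('a, 'b, 'e, ('e, 'f) vfield) tens) \<Rightarrow>
       ('a \<Rightarrow> ('a, 'b, 'c, ('c, 'd) vfield) tens))" where
  "pullback_splitting q p tY tS \<tau> =
    (\<lambda>U\<in>{U. opn (source q) U}. \<lambda>\<theta>\<in>msects (pullback (mor_comp p q) (tangent tS)) U.
       pb_map q (pullback p (tangent tS)) (tangent tY) \<tau> U (pb_comp p q (tangent tS) U \<theta>))"

definition leaf_basic_splitting ::
  "('a, 'b, 'c, 'd) rs_morphism \<Rightarrow> ('c, 'd, 'e, 'f) rs_morphism \<Rightarrow>
    ('c, 'd, 'p, 'q) rs_morphism \<Rightarrow> ('e, 'f, 'p, 'q) rs_morphism \<Rightarrow>
    ('a set \<Rightarrow> ('a \<Rightarrow> ('a, 'b, 'e, ('e, 'f) vfield) tens) \<Rightarrow>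
       ('a \<Rightarrow> ('a, 'b, 'c, ('c, 'd) vfield) tens)) \<Rightarrow> bool" where
  "leaf_basic_splitting q p tY tS s \<longleftrightarrow> normal_splitting q p tY tS s \<and>
    (\<exists>\<tau>. tangent_splitting p tY tS \<tau> \<and> s = pullback_splitting q p tY tS \<tau>)"

text \<open>
  The transverse splitting \<open>s\<close> of an unfolding \<open>E\<close> sends a base direction, lifted to \<open>u\<close> in \<open>E\<close>, to the class
  of the vector field \<open>\<rho>(u)\<close> in the normal sheaf \<open>T\<^bsub>X/k\<^esub>/T\<^bsub>X/Y\<^esub>\<close>, which \<open>dq\<close> identifies with \<open>q\<^sup>*T\<^bsub>Y/k\<^esub>\<close>.
\<close>

definition is_transverse_splitting ::
  "('a, 'b, 'c, 'd) rs_morphism \<Rightarrow> ('c, 'd, 'e, 'f) rs_morphism \<Rightarrow>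
    ('a, 'b, 'p, 'q) rs_morphism \<Rightarrow> ('c, 'd, 'p, 'q) rs_morphism \<Rightarrow> ('e, 'f, 'p, 'q) rs_morphism \<Rightarrow>
    ('a, 'b, 'e, 'f, 'h, 'g) unfolding_data \<Rightarrow>
    ('a set \<Rightarrow> ('a \<Rightarrow> ('a, 'b, 'e, ('e, 'f) vfield) tens) \<Rightarrow>
       ('a \<Rightarrow> ('a, 'b, 'c, ('c, 'd) vfield) tens)) \<Rightarrow> bool" where
  "is_transverse_splitting q p tX tY tS E s \<longleftrightarrow>
    s \<in> sheaf_hom (source q) (pullback (mor_comp p q) (tangent tS)) (pullback q (tangent tY)) \<and>
    (\<forall>U. opn (source q) U \<longrightarrow> (\<forall>u\<in>msects E U.
       s U (proj E U u) = differential q tX tY U (anchor E U u)))"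

definition leaf_space_basic_unfolding ::
  "('a, 'b, 'c, 'd) rs_morphism \<Rightarrow> ('c, 'd, 'e, 'f) rs_morphism \<Rightarrow>
    ('a, 'b, 'p, 'q) rs_morphism \<Rightarrow> ('c, 'd, 'p, 'q) rs_morphism \<Rightarrow> ('e, 'f, 'p, 'q) rs_morphism \<Rightarrow>
    ('a, 'b, 'e, 'f, ('a, 'b) vfield, 'g) unfolding_data \<Rightarrow> bool" where
  "leaf_space_basic_unfolding q p tX tY tS E \<longleftrightarrow>
    strict_unfolding (mor_comp p q) tX tS (leaf_foliation q) E \<and>
    (\<exists>s. is_transverse_splitting q p tX tY tS E s \<and> leaf_basic_splitting q p tY tS s)"


section \<open>Ehresmann connections\<close>

text \<open>
  A connection is given by its horizontal distribution: an \<open>\<O>\<^sub>Y\<close>-submodule \<open>H\<close> of \<open>T\<^bsub>Y/k\<^esub>\<close> complementary to the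
  vertical part \<open>T\<^bsub>Y/S\<^esub>\<close>. By convention \<open>H\<close> is empty on non-open sets.
\<close>

definition ehresmann_connection ::
  "('c, 'd, 'e, 'f) rs_morphism \<Rightarrow> ('c, 'd, 'p, 'q) rs_morphism \<Rightarrow>
    ('c set \<Rightarrow> ('c, 'd) vfield set) \<Rightarrow> bool" where
  "ehresmann_connection p tY H \<longleftrightarrow> (let Y = source p; T = tangent tY in
    (\<forall>U. \<not> opn Y U \<longrightarrow> H U = {}) \<and>
    (\<forall>U. opn Y U \<longrightarrow> submodule (H U) (sect Y U) (msec T U)) \<and>
    sheaf_on (space_top Y) H (mrst T) \<and>
    (\<forall>U. opn Y U \<longrightarrow> (\<forall>D\<in>msects T U.
       \<exists>!(v, h). v \<in> msects (tangent p) U \<and> h \<in> H U \<and> D = v \<oplus>\<^bsub>msec T U\<^esub> h)))"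

definition integrable_connection ::
  "('c, 'd, 'e, 'f) rs_morphism \<Rightarrow> ('c, 'd, 'p, 'q) rs_morphism \<Rightarrow>
    ('c set \<Rightarrow> ('c, 'd) vfield set) \<Rightarrow> bool" where
  "integrable_connection p tY H \<longleftrightarrow> ehresmann_connection p tY H \<and>
    (\<forall>U. opn (source p) U \<longrightarrow> (\<forall>D\<in>H U. \<forall>E\<in>H U. commutator (source p) U D E \<in> H U))"

definition horizontal_distribution ::
  "('c, 'd, 'e, 'f) rs_morphism \<Rightarrow> ('e, 'f, 'p, 'q) rs_morphism \<Rightarrow>
    ('c set \<Rightarrow> ('c \<Rightarrow> ('c, 'd, 'e, ('e, 'f) vfield) tens) \<Rightarrow> ('c, 'd) vfield) \<Rightarrow>
    'c set \<Rightarrow> ('c, 'd) vfield set" where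
  "horizontal_distribution p tS \<tau> U =
    (if opn (source p) U then \<tau> U ` msects (pullback p (tangent tS)) U else {})"

text \<open>
  The pullback of a connection to \<open>X\<close>: the vector fields \<open>D\<close> on \<open>X\<close> such that \<open>dq(D)\<close>
  lies in \<open>q\<^sup>*H \<subseteq> q\<^sup>*T\<^bsub>Y/k\<^esub>\<close>.
\<close>

definition pullback_connection ::
  "('a, 'b, 'c, 'd) rs_morphism \<Rightarrow> ('a, 'b, 'p, 'q) rs_morphism \<Rightarrow> ('c, 'd, 'p, 'q) rs_morphism \<Rightarrow>
    ('c set \<Rightarrow> ('c, 'd) vfield set) \<Rightarrow> 'a set \<Rightarrow> ('a, 'b) vfield set" where
  "pullback_connection q tX tY H U = {D \<in> msects (tangent tX) U.
     \<forall>x\<in>U. \<exists>W V xs. x \<in> W \<and> W \<subseteq> U \<and>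
       pb_represents q (tangent tY) W V xs (differential q tX tY U D) \<and> snd ` set xs \<subseteq> H V}"

end

(*
  Given a splitting tau, call a vector field D on X horizontal if dq(D) is the image under q^*tau
  of d(pi)(D). If E is an unfolding with transverse splitting q^*tau, then the anchor of E is
  injective and its image consists of all horizontal fields; so E is unique up to unique isomorphism,
  and it exists if and only if the horizontal fields are closed under brackets.

  Around a point of S there are coordinates a_l and a dual frame of commuting derivations e_l. A
  derivation along a morphism to S is the sum of its values on the a_l times the e_l, so D is
  horizontal if and only if it is the sum of the D(a_l) times the horizontal lifts of the e_l. If tau
  is flat, these lifts commute, and then the bracket of two such sums is again of this form.

  Conversely, vector fields on S lift locally to horizontal fields on X because q is smooth, and a
  horizontal lift to X is q-related to the horizontal lift to Y. If horizontal fields are closed under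
  brackets, this proves that tau is flat, as equality of derivations on Y can be tested on X: q is
  surjective and the flat local homomorphisms on its stalks are injective.

  A connection H is the image of the splitting that maps a section to its unique preimage under dp in
  H; it exists locally because p is smooth.
*)

theory Submission
  imports Defs "HOL-Algebra.Ring_Divisibility"
begin

text \<open>The pullbacks in the statement are families of tensor classes on stalks, and
  \<open>differential\<close> is a definite description; neither can be computed with directly. The
  way out is to let tensors act on germs of functions: \<open>sact\<close> turns a section of the
  pullback of a tangent sheaf along f into derivations of stalks along f. This action is faithful
  (\<open>act_inj\<close>), and derivations along f that vanish on the base and map sections to
  sections all arise from it (\<open>section_exists\<close>). Identities about differentials,
  splittings and lifts thereby become identities between derivations of local rings.

  Such derivations are controlled by standard smooth presentations with n generators and c
  relations. The Jacobian condition solves for the values at the first c generators, so the other n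
  - c are coordinates: values there can be prescribed freely and determine the derivation.
  Evaluation in dual numbers turns existence into a statement about ring homomorphisms. The passage
  from an affine open to its stalks is a localisation, which is what the study of spectra
  serves.\<close>

abbreviation (input) ring_times ("(_ *[_]/ _)" [70, 0, 71] 70) where "x *[R] y \<equiv> x \<otimes>\<^bsub>R\<^esub> y"
abbreviation (input) ring_plus ("(_ +[_]/ _)" [65, 0, 66] 65) where "x +[R] y \<equiv> x \<oplus>\<^bsub>R\<^esub> y"
abbreviation (input) ring_minus ("(_ -[_]/ _)" [65, 0, 66] 65) where "x -[R] y \<equiv> x \<ominus>\<^bsub>R\<^esub> y"
abbreviation (input) ring_uminus ("(-[_] _)" [0, 81] 80) where "-[R] x \<equiv> \<ominus>\<^bsub>R\<^esub> x"
abbreviation (input) ring_zero ("0[_]") where "0[R] \<equiv> \<zero>\<^bsub>R\<^esub>"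
abbreviation (input) ring_one ("1[_]") where "1[R] \<equiv> \<one>\<^bsub>R\<^esub>"
abbreviation (input) scalar_times ("(_ .[_]/ _)" [70, 0, 71] 70) where "a .[M] x \<equiv> a \<odot>\<^bsub>M\<^esub> x"
abbreviation (input) in_carrier ("(_/ :[_])" [51, 0] 50) where "x :[R] \<equiv> x \<in> carrier R"
syntax "_rsum" :: "'a ring \<Rightarrow> pttrn \<Rightarrow> 'i set \<Rightarrow> 'a \<Rightarrow> 'a" ("(3SM[_]_:_./ _)" [0, 0, 51, 10] 10)
translations "SM[R]i:A. b" \<rightharpoonup> "CONST finsum R (%i. b) A"

type_synonym ('a, 'b, 'e, 'f, 'u) unf = "('a, 'b, 'e, 'f, ('a, 'b) vfield, 'u) unfolding_data"

lemma ring_hom_cringI: "cring R ==> cring S ==> h \<in> ring_hom R S ==> ring_hom_cring R S h"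
 by (intro ring_hom_cring.intro ring_hom_cring_axioms.intro)

abbreviation (input) "ixs c n \<equiv> mset_set {c..<n::nat}"
abbreviation (input) "frc R P \<equiv> frac R (carrier R - P)"
abbreviation (input) "Der \<equiv> derivations"
abbreviation (input) "smap \<equiv> stalk_map"
abbreviation (input) "comm \<equiv> commutator"
abbreviation (input) "rg \<equiv> rgerm"
abbreviation (input) "mg \<equiv> mgerm"
abbreviation (input) "pre \<equiv> preimg"
abbreviation (input) "MPol \<equiv> mpoly_ring"
abbreviation (input) "mev \<equiv> mpoly_eval"
abbreviation (input) "mder \<equiv> mpoly_deriv"
abbreviation (input) "HD \<equiv> horizontal_distribution"
abbreviation (input) "psplit \<equiv> pullback_splitting"
abbreviation (input) "trsplit \<equiv> is_transverse_splitting"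
abbreviation (input) "pconn \<equiv> pullback_connection"
abbreviation (input) "prep \<equiv> pb_represents"
abbreviation (input) "tcl \<equiv> tensor_class"
abbreviation (input) "tmod \<equiv> tensor_module"
abbreviation (input) "folia \<equiv> leaf_foliation"
abbreviation (input) "car \<equiv> carrier"
abbreviation (input) "teq \<equiv> tensor_eq"
abbreviation (input) "diff \<equiv> differential"
abbreviation (input) "img \<equiv> image_mset"
abbreviation (input) "stk \<equiv> stalk_ring"
abbreviation (input) "Sec M U \<equiv> msects M U"

section \<open>Commutative algebra\<close>

text \<open>Formal tensors are multisets with repetitions, so their values are folds and not sums
  over index sets. The guards make the folded function commute for all arguments, as
  \<open>comp_fun_commute\<close> demands; a summand outside the carrier is skipped.\<close>

definition msum :: "('g, 'z) ring_scheme => ('x => 'g) => 'x multiset => 'g" where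
 "msum G g M =
  fold_mset (%x c. if c :[G] & g x :[G] then g x +[G] c else c) 0[G] M"

context abelian_monoid
begin

lemma msum_comm: "comp_fun_commute (%x c. if c :[G] & g x :[G] then g x +[G] c else c)" by standard (auto simp: a_lcomm)

lemma msum_empty [simp]: "msum G g {#} = 0[G]" by (simp add: msum_def)

lemma msum_closed [simp]: "msum G g M :[G]"
proof (induction M)
 case (add x M)
 thus ?case unfolding msum_def comp_fun_commute.fold_mset_add_mset[OF msum_comm] by auto
qed simp

lemma msum_add_mset [simp]: "g x :[G] ==> msum G g (add_mset x M) = g x +[G] msum G g M" using msum_closed[of g M]
 unfolding msum_def comp_fun_commute.fold_mset_add_mset[OF msum_comm] by auto

lemma msum_union:
 "(!!x. x :# M + N ==> g x :[G]) ==> msum G g (M + N) = msum G g M +[G] msum G g N" by (induction M) (auto simp: a_assoc)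

lemma msum_cong: assumes "!!x. x :# M ==> g x = h x" shows "msum G g M = msum G h M" using assms unfolding msum_def
 by (induction M) (simp_all add: comp_fun_commute.fold_mset_add_mset[OF msum_comm])

lemma msum_image: "(!!x. x :# M ==> g (k x) :[G]) ==> msum G g (img k M) = msum G (%x. g (k x)) M" by (induction M) auto

lemma msum_zero: "(!!x. x :# M ==> g x = 0[G]) ==> msum G g M = 0[G]" by (induction M) auto

lemma msum_add:
 "(!!x. x :# M ==> g x :[G] & h x :[G]) ==>
  msum G (%x. g x +[G] h x) M = msum G g M +[G] msum G h M" by (induction M) (auto simp: a_ac)

end

lemma msum_hom: assumes "abelian_monoid G" "abelian_monoid H" "h : car G \<rightarrow> car H" "h 0[G] = 0[H]"
  and "!!a b. a :[G] ==> b :[G] ==> h (a +[G] b) = h a +[H] h b" and "!!x. x :# M ==> g x :[G]"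
 shows "h (msum G g M) = msum H (%x. h (g x)) M"
proof -
 interpret G: abelian_monoid G by fact
 interpret H: abelian_monoid H by fact
 show ?thesis using assms(3-) by (induction M) (auto simp: Pi_iff)
qed

lemma (in semiring) msum_ldistr:
 "a :[R] ==> (!!x. x :# M ==> g x :[R]) ==>
  a *[R] msum R g M = msum R (%x. a *[R] g x) M" by (induction M) (auto simp: r_distr)

subsection \<open>Tensor products\<close>

text \<open>The universal property of the tensor product: a balanced biadditive \<open>g\<close> has
  the same total on equivalent formal sums. The membership conjuncts belong to the induction, since
  in the congruence rule a total is split over a union only when all values lie in the
  carrier.\<close>

lemma tensor_eq_msum: assumes "abelian_monoid G" "teq R A ph M xs ys" and cl: "!!a m. a :[A] ==> m :[M] ==> g (a, m) :[G]"
  and "!!a b. a :[A] ==> b :[A] ==> a +[A] b :[A]" and "!!m n. m :[M] ==> n :[M] ==> m +[M] n :[M]"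
  and "!!a r. a :[A] ==> r :[R] ==> a *[A] ph r :[A]" and "!!r m. r :[R] ==> m :[M] ==> r .[M] m :[M]" and "0[A] :[A]"
  and "!!a b m. a :[A] ==> b :[A] ==> m :[M] ==>
   g (a +[A] b, m) = g (a, m) +[G] g (b, m)" and "!!a m n. a :[A] ==> m :[M] ==> n :[M] ==>
   g (a, m +[M] n) = g (a, m) +[G] g (a, n)" and "!!a r m. a :[A] ==> r :[R] ==> m :[M] ==>
   g (a *[A] ph r, m) = g (a, r .[M] m)" and "!!m. m :[M] ==> g (0[A], m) = 0[G]"
 shows "set_mset xs <= car A \<times> car M & set_mset ys <= car A \<times> car M &
  msum G g xs = msum G g ys"
proof -
 interpret abelian_monoid G by fact
 show ?thesis using assms(2)
 proof (induction rule: tensor_eq.induct)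
  case (cong xs ys zs)
  hence "!!x. x :# xs + zs ==> g x :[G]" "!!x. x :# ys + zs ==> g x :[G]" using cl by auto
  hence "msum G g (xs + zs) = msum G g xs +[G] msum G g zs" "msum G g (ys + zs) = msum G g ys +[G] msum G g zs"
   by (intro msum_union; blast)+
  thus ?case using cong by simp
 qed (use assms in auto)
qed

text \<open>The conditions on \<open>M\<close> are those that stalks provide before any module law
  has been proved for them.\<close>

locale base_change =
 fixes R :: "'r ring" and A :: "'s ring" and ph :: "'r => 's" and M :: "('r, 'm) module"
 assumes A: "cring A" and phi: "ph : car R \<rightarrow> car A" and M_add: "!!m n. m :[M] ==> n :[M] ==> m +[M] n :[M]"
  and M_smult: "!!r m. r :[R] ==> m :[M] ==> r .[M] m :[M]"
begin

interpretation A: cring A by (rule A)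

lemma phi_closed [simp]: "r :[R] ==> ph r :[A]" using phi by auto

lemma tensor_eq_carrier: assumes "teq R A ph M xs ys" shows "set_mset xs <= car A \<times> car M" "set_mset ys <= car A \<times> car M"
 using assms by induction (auto simp: M_add M_smult)

lemma tensor_eq_union: assumes "teq R A ph M xs ys" "teq R A ph M xs' ys'" shows "teq R A ph M (xs + xs') (ys + ys')"
 using tensor_eq.cong[OF assms(1) tensor_eq_carrier(1)[OF assms(2)]]
  tensor_eq.cong[OF assms(2) tensor_eq_carrier(2)[OF assms(1)]] by (metis add.commute tensor_eq.trans)

lemma tensor_class_eqI: "teq R A ph M xs ys ==> tcl R A ph M xs = tcl R A ph M ys" unfolding tensor_class_def
 by (rule Collect_cong) (rule, erule tensor_eq.trans[OF tensor_eq.sym], assumption, erule tensor_eq.trans, assumption)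

lemma tensor_class_self:
 "set_mset xs <= car A \<times> car M ==> xs : tcl R A ph M xs" unfolding tensor_class_def by (auto intro: tensor_eq.refl)

lemma tensor_class_mem: "ys : tcl R A ph M xs ==> teq R A ph M xs ys" by (simp add: tensor_class_def)

text \<open>Operations on classes are unions over all representatives. Once the members of the union
  do not depend on the representative, it collapses, because \<open>xs\<close> itself inhabits the
  class.\<close>

lemma UN_tensor_class: assumes "set_mset xs <= car A \<times> car M" and "!!ys. teq R A ph M xs ys ==> F ys = c"
 shows "(UN ys:tcl R A ph M xs. F ys) = c"
proof -
 have "F ys = c" if "ys : tcl R A ph M xs" for ys by (rule assms(2)[OF tensor_class_mem[OF that]])
 thus ?thesis using tensor_class_self[OF assms(1)] by auto
qed

lemma tensor_module_carrier:
 "C :[tmod R A ph M] \<longleftrightarrow>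
  (EX xs. set_mset xs <= car A \<times> car M & C = tcl R A ph M xs)" by (auto simp: tensor_module_def)

lemma tensor_module_add: assumes "set_mset xs <= car A \<times> car M" "set_mset ys <= car A \<times> car M"
 shows "tcl R A ph M xs +[tmod R A ph M] tcl R A ph M ys =
  tcl R A ph M (xs + ys)"
proof -
 have "(UN ys':tcl R A ph M ys. tcl R A ph M (xs' + ys')) = tcl R A ph M (xs + ys)"
  if eq: "teq R A ph M xs xs'" for xs'
 proof -
  have "tcl R A ph M (xs' + ys') = tcl R A ph M (xs + ys)"
   if "teq R A ph M ys ys'" for ys' by (rule tensor_class_eqI, rule, rule tensor_eq_union[OF eq that])
  thus ?thesis by (rule UN_tensor_class[OF assms(2)])
 qed
 thus ?thesis unfolding tensor_module_def by (simp add: UN_tensor_class[OF assms(1)])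
qed

text \<open>Functoriality in all arguments at once. Scalar multiplication is the case
  \<open>u = mult A a\<close>; the map \<open>ro\<close> of base rings occurs when a pullback along
  a composite is rewritten as an iterated pullback.\<close>

lemma tensor_eq_map_prod: assumes "teq R A ph M xs ys" and "0[A'] :[A']" and u: "!!a. a :[A] ==> u a :[A']" "u 0[A] = 0[A']"
   "!!a b. a :[A] ==> b :[A] ==> u (a +[A] b) = u a +[A'] u b"
   "!!a r. a :[A] ==> r :[R] ==> u (a *[A] ph r) = u a *[A'] ph' (ro r)" and r: "!!r. r :[R] ==> ro r :[R']"
  and h: "!!m. m :[M] ==> h m :[N]"
   "!!m n. m :[M] ==> n :[M] ==> h (m +[M] n) = h m +[N] h n"
   "!!r m. r :[R] ==> m :[M] ==> h (r .[M] m) = ro r .[N] h m" shows "teq R' A' ph' N (img (map_prod u h) xs) (img (map_prod u h) ys)"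
 using assms(1)
proof (induction rule: tensor_eq.induct)
 case (cong xs ys zs)
 hence "set_mset (img (map_prod u h) zs) <= car A' \<times> car N" using u(1) h(1) by auto
 with cong.IH show ?case unfolding image_mset_union by rule
next
 case (add_left a b m)
 thus ?case using tensor_eq.add_left[of "u a" A' "u b" "h m" N R' ph'] u h by simp
next
 case (add_right a m n)
 thus ?case using tensor_eq.add_right[of "u a" A' "h m" N "h n" R' ph'] u h by simp
next
 case (balanced a r m)
 thus ?case using tensor_eq.balanced[of "u a" A' "ro r" R' "h m" N ph'] u h r by simp
next
 case (null m)
 thus ?case using tensor_eq.null[of "h m" N R' A' ph'] u h by simp
next
 case (refl xs)
 thus ?case using u(1) h(1) by (intro tensor_eq.refl) auto
next
 case (sym xs ys)
 show ?case by rule (rule sym.IH)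
next
 case (trans xs ys zs)
 show ?case by (rule tensor_eq.trans[OF trans.IH])
qed

lemma tensor_module_smult: assumes "a :[A]" "set_mset xs <= car A \<times> car M" shows "a .[tmod R A ph M] tcl R A ph M xs =
  tcl R A ph M (img (map_prod (mult A a) id) xs)"
proof -
 have "teq R A ph M (img (map_prod (mult A a) id) xs)
   (img (map_prod (mult A a) id) ys)" if "teq R A ph M xs ys" for ys
  by (rule tensor_eq_map_prod[OF that, where ro = id]) (use assms in "auto simp: A.r_distr A.m_assoc")
 hence "(UN ys:tcl R A ph M xs. tcl R A ph M (img (map_prod (mult A a) id) ys)) =
   tcl R A ph M (img (map_prod (mult A a) id) xs)" by (intro UN_tensor_class[OF assms(2)] tensor_class_eqI) rule
 thus ?thesis by (simp add: tensor_module_def map_prod_def)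
qed

lemma tensor_map_class: assumes "set_mset xs <= car A \<times> car M" and "!!r. r :[R] ==> ph r = ph' (ro r) & ro r :[R']"
  and h: "!!m. m :[M] ==> h m :[N]"
   "!!m n. m :[M] ==> n :[M] ==> h (m +[M] n) = h m +[N] h n"
   "!!r m. r :[R] ==> m :[M] ==> h (r .[M] m) = ro r .[N] h m" shows "tensor_map R' A ph' N h (tcl R A ph M xs) =
  tcl R' A ph' N (img (map_prod id h) xs)"
proof -
 have eq: "tcl R' A ph' N ys = tcl R' A ph' N zs" if "teq R' A ph' N zs ys" for ys zs unfolding tensor_class_def
  by (rule Collect_cong) (rule, (rule tensor_eq.trans[OF that], assumption), rule tensor_eq.trans[OF tensor_eq.sym[OF that]])
 have "teq R' A ph' N (img (map_prod id h) xs) (img (map_prod id h) ys)"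
  if "teq R A ph M xs ys" for ys by (rule tensor_eq_map_prod[OF that, where ro = ro]) (use assms in auto)
 thus ?thesis unfolding tensor_map_def by (intro UN_tensor_class[OF assms(1)] eq)
qed

text \<open>The map \<open>A \<otimes>\<^sub>R M \<rightarrow> A\<close> induced by a \<open>ph\<close>-semilinear \<open>h : M \<rightarrow> A\<close>.\<close>

definition contract :: "('m => 's) => ('s \<times> 'm) multiset set => 's" where
 "contract h C = msum A (%(a, m). a *[A] h m) (SOME xs. xs : C)"

lemma contract_class: assumes "set_mset xs <= car A \<times> car M" and h: "!!m. m :[M] ==> h m :[A]"
   "!!m n. m :[M] ==> n :[M] ==> h (m +[M] n) = h m +[A] h n"
   "!!r m. r :[R] ==> m :[M] ==> h (r .[M] m) = ph r *[A] h m" shows "contract h (tcl R A ph M xs) = msum A (%(a, m). a *[A] h m) xs"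
proof -
 define ys where "ys = (SOME ys. ys : tcl R A ph M xs)"
 have "ys : tcl R A ph M xs" unfolding ys_def by (rule someI) (rule tensor_class_self[OF assms(1)])
 hence "teq R A ph M xs ys" by (rule tensor_class_mem)
 hence "msum A (%(a, m). a *[A] h m) xs = msum A (%(a, m). a *[A] h m) ys"
  by (rule tensor_eq_msum[OF A.abelian_monoid_axioms, THEN conjunct2, THEN conjunct2])
   (use h in "auto simp: M_add M_smult A.l_distr A.r_distr A.m_assoc")
 thus ?thesis unfolding contract_def ys_def by simp
qed

end

subsection \<open>Dual numbers and derivations\<close>

definition dual :: "'b ring => ('b \<times> 'b) ring" where
 "dual B =
  \<lparr>carrier = car B \<times> car B,
  mult = (%(a, b) (c, d). (a *[B] c, (a *[B] d) +[B] (c *[B] b))),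
  one = (1[B], 0[B]), zero = (0[B], 0[B]),
  add = (%(a, b) (c, d). (a +[B] c, b +[B] d))\<rparr>"

lemma dual_simps [simp]:
 "car (dual B) = car B \<times> car B"
 "(a, b) *[dual B] (c, d) = (a *[B] c, (a *[B] d) +[B] (c *[B] b))"
 "1[dual B] = (1[B], 0[B])" "0[dual B] = (0[B], 0[B])"
 "(a, b) +[dual B] (c, d) = (a +[B] c, b +[B] d)" by (simp_all add: dual_def)

lemma dual_cring:
 fixes B (structure) assumes "cring B" shows "cring (dual B)"
proof -
 interpret cring B by fact
 have "EX y:car B \<times> car B. y +[dual B] x = 0[dual B]"
  if "x : car B \<times> car B" for x using that by auto
 thus ?thesis by (intro cringI abelian_groupI comm_monoidI)
   (auto simp: a_ac m_ac r_distr)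
qed

definition der :: "'a ring => 'b ring => ('a => 'b) => ('a => 'b) => bool" where
 "der A B ps d \<longleftrightarrow> d : car A \<rightarrow> car B &
  (ALL a:car A. ALL b:car A. d (a +[A] b) = d a +[B] d b &
   d (a *[A] b) = (ps a *[B] d b) +[B] (ps b *[B] d a))"

lemma derD: assumes "der A B ps d" "a :[A]" "b :[A]" shows "d a :[B]" "d (a +[A] b) = d a +[B] d b"
  "d (a *[A] b) = (ps a *[B] d b) +[B] (ps b *[B] d a)" using assms by (auto simp: der_def)

lemma der_zero: assumes "der A B ps d" "cring A" "cring B" shows "d 0[A] = 0[B]"
proof -
 interpret A: cring A by fact
 interpret B: cring B by fact
 have "d 0[A] +[B] d 0[A] = d 0[A]" "d 0[A] :[B]" using derD[OF assms(1), of "0[A]" "0[A]"] by auto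
 thus ?thesis using B.add.r_cancel_one' by metis
qed

lemma der_one: assumes "der A B ps d" "cring A" "cring B" "ps : ring_hom A B" shows "d 1[A] = 0[B]"
proof -
 interpret A: cring A by fact
 interpret B: cring B by fact
 have "d 1[A] = d 1[A] +[B] d 1[A]" "d 1[A] :[B]" using derD[OF assms(1), of "1[A]" "1[A]"] assms(4) by (auto simp: ring_hom_one)
 thus ?thesis using B.add.r_cancel_one' by metis
qed

text \<open>A derivation is the second component of a ring homomorphism to the dual numbers that
  lifts \<open>ps\<close>. Extension and uniqueness of derivations thereby reduce to those of
  homomorphisms, both for localisations and for polynomial rings.\<close>

lemma der_iff_ring_hom: assumes "cring A" "cring B" "ps : ring_hom A B"
 shows "der A B ps d \<longleftrightarrow> (%a. (ps a, d a)) : ring_hom A (dual B)"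
proof
 assume d: "der A B ps d"
 thus "(%a. (ps a, d a)) : ring_hom A (dual B)" using assms(3) der_one[OF d assms] ring_hom_closed[OF assms(3)]
  by (intro ring_hom_memI) (auto simp: der_def ring_hom_mult ring_hom_add ring_hom_one)
next
 assume h: "(%a. (ps a, d a)) : ring_hom A (dual B)"
 show "der A B ps d" unfolding der_def using ring_hom_closed[OF h] ring_hom_add[OF h] ring_hom_mult[OF h] by auto
qed

text \<open>The inverse of \<open>u + v eps\<close> is \<open>1/u - (v/u^2) eps\<close>. Hence
  denominators stay invertible when a homomorphism is replaced by its lift to the dual
  numbers.\<close>

lemma dual_Units:
 fixes B (structure) assumes "cring B" "u : Units B" "v :[B]" shows "(u, v) : Units (dual B)"
proof -
 interpret cring B by fact
 interpret D: cring "dual B" by (rule dual_cring) fact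
 let ?i = "inv u"
 have u: "u :[B]" "?i :[B]" "u *[B] ?i = 1[B]" using assms(2) by auto
 let ?w = "-[B] (?i *[B] (?i *[B] v))"
 have w: "?w :[B]" using u assms(3) by blast
 have "u *[B] (?i *[B] (?i *[B] v)) = ?i *[B] v" using u assms(3) by (metis l_one m_assoc m_closed)
 hence "u *[B] ?w +[B] ?i *[B] v = 0[B]" using u(1,2) assms(3) by (metis l_neg m_closed r_minus)
 hence eq: "(u, v) *[dual B] (?i, ?w) = 1[dual B]" unfolding dual_simps u(3) by simp
 show ?thesis by (rule D.unit_factor[of _ "(?i, ?w)"]) (use eq u(1,2) assms(3) D.Units_one_closed in simp_all)
qed

subsection \<open>Localisation\<close>

text \<open>\<open>L\<close> is the localisation of \<open>A\<close> at all elements that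
  \<open>g\<close> makes invertible: every element is a fraction, and what becomes zero is
  annihilated by such a denominator. No multiplicative set has to be named, so the notion applies to
  the stalks of a ringed space as they stand.\<close>

definition localizing :: "'a ring => 'l ring => ('a => 'l) => bool" where
 "localizing A L g \<longleftrightarrow> g : ring_hom A L &
  (ALL bb:car L. EX a:car A. EX b:car A. g b : Units L & g b *[L] bb = g a) &
  (ALL a:car A. g a = 0[L] --> (EX u:car A. g u : Units L & u *[A] a = 0[A]))"

lemma ring_hom_Units: assumes "cring A" "cring B" "h : ring_hom A B" "u : Units A" shows "h u : Units B"
proof -
 interpret A: cring A by fact
 interpret B: cring B by fact
 have car: "u :[A]" "inv\<^bsub>A\<^esub> u :[A]" using assms(4) by auto
 have "h u *[B] h (inv\<^bsub>A\<^esub> u) = 1[B]"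
  unfolding ring_hom_mult[OF assms(3) car, symmetric] A.Units_r_inv[OF assms(4)] ring_hom_one[OF assms(3)] ..
 hence "h u *[B] h (inv\<^bsub>A\<^esub> u) : Units B" by simp
 thus ?thesis using car by (rule B.unit_factor[OF _ ring_hom_closed[OF assms(3)] ring_hom_closed[OF assms(3)]])
qed

lemma ring_hom_zero': assumes "cring A" "cring B" "h : ring_hom A B" shows "h 0[A] = 0[B]"
 using ring_hom_zero[OF assms(3)] assms(1,2) by (simp add: cring.axioms(1))

lemma (in cring) Units_cancel:
 "u : Units R ==> x :[R] ==> y :[R] ==> u *[R] x = u *[R] y ==> x = y" by simp

lemma localizing_hom_ext: assumes "cring L" "cring B" "localizing A L g" "h : ring_hom L B" "h' : ring_hom L B"
  and "!!a. a :[A] ==> h (g a) = h' (g a)" "bb :[L]" shows "h bb = h' bb"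
proof -
 interpret B: cring B by fact
 have g: "g : ring_hom A L" using assms(3) by (simp add: localizing_def)
 obtain a b where ab: "a :[A]" "b :[A]" "g b : Units L" "g b *[L] bb = g a" using assms(3,7) unfolding localizing_def by blast
 hence "h (g b) *[B] h bb = h (g b) *[B] h' bb"
  using ring_hom_mult[OF assms(4), of "g b" bb] ring_hom_mult[OF assms(5), of "g b" bb] assms(6,7)
   ring_hom_closed[OF g] by simp
 moreover have "h (g b) : Units B" by (rule ring_hom_Units[OF assms(1,2,4) ab(3)])
 ultimately show ?thesis using assms(7) ring_hom_closed[OF assms(4)] ring_hom_closed[OF assms(5)] by simp
qed

lemma (in cring) fraction_add: assumes "b :[R]" "b' :[R]" "x :[R]" "y :[R]"
  "b *[R] x = a" "b' *[R] y = a'"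
 shows "(b *[R] b') *[R] (x +[R] y) = (b' *[R] a) +[R] (b *[R] a')" "(b *[R] b') *[R] (x *[R] y) = a *[R] a'"
 using assms(1-4) unfolding assms(5,6)[symmetric] by (simp_all add: r_distr m_ac)

text \<open>The universal property of localisation. The image of a fraction is the solution
  \<open>gg\<close> of \<open>h b *[B] gg = h a\<close>, which exists since \<open>h b\<close> is a
  unit; different fractions for the same element give the same solution.\<close>

lemma localizing_hom_ex: assumes "cring A" "cring L" "cring B" "localizing A L g" "h : ring_hom A B"
  and units: "!!a. a :[A] ==> g a : Units L ==> h a : Units B" obtains h' where "h' : ring_hom L B" "!!a. a :[A] ==> h' (g a) = h a"
proof -
 interpret A: cring A by fact
 interpret L: cring L by fact
 interpret B: cring B by fact
 have g: "g : ring_hom A L" using assms(4) by (simp add: localizing_def)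
 note gc [simp] = ring_hom_closed[OF g] and hc [simp] = ring_hom_closed[OF assms(5)]
 define rep where "rep bb a b \<longleftrightarrow> a :[A] & b :[A] & g b : Units L & g b *[L] bb = g a" for bb a b
 have ex: "EX a b. rep bb a b" if "bb :[L]" for bb using that assms(4) unfolding localizing_def rep_def by blast
 \<comment> \<open>The cross difference \<open>?c\<close> is sent to zero by \<open>g\<close>, hence
   annihilated by some \<open>u\<close> with \<open>g u\<close> invertible. Then \<open>h u\<close>
   is a unit and cancels.\<close>
 have uniq: "h b *[B] h a' = h b' *[B] h a" if "bb :[L]" "rep bb a b" "rep bb a' b'" for bb a b a' b'
 proof -
  let ?c = "(b *[A] a') -[A] (b' *[A] a)"
  have car: "a :[A]" "b :[A]" "a' :[A]" "b' :[A]" and eq: "g b *[L] bb = g a" "g b' *[L] bb = g a'" using that(2,3) by (auto simp: rep_def)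
  have "g (b *[A] a') = g (b' *[A] a)" using car that(1) unfolding ring_hom_mult[OF g car(2,3)] ring_hom_mult[OF g car(4,1)] eq[symmetric]
   by (simp add: L.m_lcomm)
  moreover have "?c +[A] (b' *[A] a) = b *[A] a'" using car by (simp add: A.minus_eq A.a_assoc A.l_neg)
  hence "g ?c +[L] g (b' *[A] a) = g (b *[A] a')" using car ring_hom_add[OF g, of ?c "b' *[A] a"] by simp
  ultimately have "g ?c +[L] g (b' *[A] a) = g (b' *[A] a)" by simp
  hence "g ?c = 0[L]" by (rule iffD1[OF L.add.r_cancel_one, rotated 2]) (use car in auto)
  moreover have "?c :[A]" using car by simp
  ultimately obtain u where u: "u :[A]" "g u : Units L" "u *[A] ?c = 0[A]" using assms(4) unfolding localizing_def by blast
  have "(u *[A] (b *[A] a')) -[A] (u *[A] (b' *[A] a)) = 0[A]" using u car by (simp add: A.minus_eq A.r_distr A.r_minus)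
  hence "h u *[B] (h b *[B] h a') = h u *[B] (h b' *[B] h a)" using u(1) car by (simp add: ring_hom_mult[OF assms(5), symmetric])
  thus ?thesis using units[OF u(1,2)] car by simp
 qed
 define h' where "h' bb = (THE gg. gg :[B] & (ALL a b. rep bb a b --> h b *[B] gg = h a))" for bb
 have h'I: "h' bb = gg" if "bb :[L]" "rep bb a b" "gg :[B]" "h b *[B] gg = h a" for bb a b gg unfolding h'_def
 proof (rule the_equality)
  have u: "h b : Units B" "h b :[B]" "h a :[B]" using that(2) units by (auto simp: rep_def)
  show "gg :[B] & (ALL a b. rep bb a b --> h b *[B] gg = h a)"
  proof (intro conjI allI impI that(3))
   fix a' b' assume r: "rep bb a' b'"
   hence car: "h a' :[B]" "h b' :[B]" by (auto simp: rep_def)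
   have "h b *[B] (h b' *[B] gg) = h b *[B] h a'" using uniq[OF that(1,2) r] that(3,4) u car by (metis B.m_lcomm)
   thus "h b' *[B] gg = h a'" using u(1) car that(3) by simp
  qed
  show "gg' = gg" if "gg' :[B] & (ALL a b. rep bb a b --> h b *[B] gg' = h a)" for gg'
   using that \<open>rep bb a b\<close> \<open>h b *[B] gg = h a\<close> u(1) \<open>gg \<in> carrier B\<close> by (metis B.Units_cancel)
 qed
 have h'E: "h' bb :[B] & h b *[B] h' bb = h a" if "bb :[L]" "rep bb a b" for bb a b
 proof -
  have u: "h b : Units B" "h b :[B]" "h a :[B]" using that(2) units by (auto simp: rep_def)
  hence eq: "h b *[B] (inv\<^bsub>B\<^esub> (h b) *[B] h a) = h a" by (simp add: B.m_assoc[symmetric])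
  hence "h' bb = inv\<^bsub>B\<^esub> (h b) *[B] h a" using u by (intro h'I[OF that]) auto
  thus ?thesis using u eq by simp
 qed
 have g1: "g 1[A] = 1[L]" "h 1[A] = 1[B]" using g assms(5) by (auto simp: ring_hom_one)
 have h'g: "h' (g a) = h a" if "a :[A]" for a by (rule h'I[of _ a "1[A]"]) (use that g1 in "auto simp: rep_def")
 have "h' : ring_hom L B"
 proof (rule ring_hom_memI)
  show "h' 1[L] = 1[B]" using h'g[of "1[A]"] g1 by simp
 next
  fix x assume "x :[L]" thus "h' x :[B]" using ex h'E by blast
 next
  fix x y assume xy: "x :[L]" "y :[L]"
  obtain a b a' b' where r: "rep x a b" "rep y a' b'" using ex xy by meson
  hence car: "a :[A]" "b :[A]" "a' :[A]" "b' :[A]" by (auto simp: rep_def)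
  have bb: "g (b *[A] b') : Units L" using r ring_hom_mult[OF g car(2,4)] unfolding rep_def by simp
  note fx = L.fraction_add[of "g b" "g b'" x y "g a" "g a'"] and fh = B.fraction_add[of "h b" "h b'" "h' x" "h' y" "h a" "h a'"]
  have fx': "(g b *[L] g b') *[L] (x +[L] y) = (g b' *[L] g a) +[L] (g b *[L] g a')"
   "(g b *[L] g b') *[L] (x *[L] y) = g a *[L] g a'" using fx r xy by (auto simp: rep_def)
  have "rep (x +[L] y) ((b' *[A] a) +[A] (b *[A] a')) (b *[A] b')"
   unfolding rep_def using bb car fx' by (simp add: ring_hom_mult[OF g] ring_hom_add[OF g])
  thus "h' (x +[L] y) = h' x +[B] h' y" by (rule h'I[rotated]) (use fh h'E[OF xy(1) r(1)] h'E[OF xy(2) r(2)] xy car in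
    "auto simp: ring_hom_mult[OF assms(5)] ring_hom_add[OF assms(5)]")
  have "rep (x *[L] y) (a *[A] a') (b *[A] b')" unfolding rep_def using bb car fx' by (simp add: ring_hom_mult[OF g])
  thus "h' (x *[L] y) = h' x *[B] h' y" by (rule h'I[rotated]) (use fh h'E[OF xy(1) r(1)] h'E[OF xy(2) r(2)] xy car in
    "auto simp: ring_hom_mult[OF assms(5)]")
 qed
 thus ?thesis using h'g that by blast
qed

lemma der_localizing_ext: assumes "cring L" "cring B" "localizing A L g" "ps : ring_hom L B" and "der L B ps d" "der L B ps d'"
  and "!!a. a :[A] ==> d (g a) = d' (g a)" "bb :[L]" shows "d bb = d' bb"
proof -
 have "(ps bb, d bb) = (ps bb, d' bb)" by (rule localizing_hom_ext[OF assms(1) dual_cring[OF assms(2)] assms(3),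
     of "%a. (ps a, d a)" "%a. (ps a, d' a)"])
   (use assms der_iff_ring_hom[OF assms(1,2,4)] in auto)
 thus ?thesis by simp
qed

text \<open>The homomorphism to the dual numbers extends by the universal property. The first
  component of the extension is again \<open>ps\<close>, as both agree on \<open>A\<close>, so the
  second component is a derivation along \<open>ps\<close>.\<close>

lemma der_localizing_ex: assumes "cring A" "cring L" "cring B" "localizing A L g" "ps : ring_hom L B" and d: "der A B (%a. ps (g a)) d"
 obtains d' where "der L B ps d'" "!!a. a :[A] ==> d' (g a) = d a"
proof -
 have g: "g : ring_hom A L" using assms(4) by (simp add: localizing_def)
 hence "(%a. ps (g a)) : ring_hom A B" using ring_hom_trans[OF g assms(5)] by (simp add: comp_def)
 hence h: "(%a. (ps (g a), d a)) : ring_hom A (dual B)" using d der_iff_ring_hom[OF assms(1,3)] by blast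
 obtain h' where h': "h' : ring_hom L (dual B)" "!!a. a :[A] ==> h' (g a) = (ps (g a), d a)"
 proof (rule localizing_hom_ex[OF assms(1,2) dual_cring[OF assms(3)] assms(4) h])
  fix a assume "a :[A]" "g a : Units L"
  thus "(ps (g a), d a) : Units (dual B)" using d by (intro dual_Units[OF assms(3)] ring_hom_Units[OF assms(2,3,5)])
    (auto simp: der_def)
 qed blast
 have "fst : ring_hom (dual B) B" by (rule ring_hom_memI) auto
 hence "fst \<circ> h' : ring_hom L B" using h'(1) ring_hom_trans by blast
 hence fst: "fst (h' bb) = ps bb" if "bb :[L]" for bb
  using localizing_hom_ext[OF assms(2,3,4) _ assms(5), of "fst \<circ> h'" bb] that h'(2) by auto
 have "der L B ps (snd \<circ> h')" unfolding der_def
 proof (intro conjI ballI)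
  show "snd \<circ> h' : car L \<rightarrow> car B" using ring_hom_closed[OF h'(1)] by (auto simp: mem_Times_iff)
  fix a b assume ab: "a :[L]" "b :[L]"
  have h'_eq: "h' c = (ps c, snd (h' c))" if "c :[L]" for c using fst[OF that] by (metis prod.collapse)
  show "(snd \<circ> h') (a +[L] b) = (snd \<circ> h') a +[B] (snd \<circ> h') b"
   using ring_hom_add[OF h'(1) ab] h'_eq[OF ab(1)] h'_eq[OF ab(2)] by (metis comp_apply dual_simps(5) snd_conv)
  show "(snd \<circ> h') (a *[L] b) = (ps a *[B] (snd \<circ> h') b) +[B] (ps b *[B] (snd \<circ> h') a)"
   using ring_hom_mult[OF h'(1) ab] h'_eq[OF ab(1)] h'_eq[OF ab(2)] by (metis comp_apply dual_simps(2) snd_conv)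
 qed
 thus ?thesis by rule (simp add: h'(2))
qed

subsection \<open>Prime ideals and local rings\<close>

text \<open>Zorn's lemma for the ideals that avoid \<open>S\<close>. With 1 as the only element of
  \<open>S\<close> it yields maximal ideals, with a multiplicative set prime ideals.\<close>

lemma (in cring) maximal_ideal_disjoint: assumes "ideal I R" "I Int S = {}" obtains P where "ideal P R" "I <= P" "P Int S = {}"
  "!!J. ideal J R ==> P <= J ==> J Int S = {} ==> J = P"
proof -
 let ?A = "{J. ideal J R & I <= J & J Int S = {}}"
 have "\<Union>C : ?A" if C: "C ~= {}" "subset.chain ?A C" for C
 proof -
  have "subset.chain {J. ideal J R} C" using C(2) by (auto simp: subset.chain_def)
  hence "ideal (\<Union>C) R" using chain_Union_is_ideal[of C] C(1) by simp
  moreover have "I <= \<Union>C" using C unfolding subset.chain_def by blast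
  moreover have "\<Union>C Int S = {}" using C(2) by (auto simp: subset.chain_def)
  ultimately show ?thesis by blast
 qed
 moreover have "?A ~= {}" using assms by auto
 ultimately obtain P where "P : ?A" "ALL X:?A. P <= X --> X = P" using subset_Zorn_nonempty[of ?A] by auto
 thus ?thesis by (intro that[of P]) auto
qed

lemma (in cring) exists_maximalideal: assumes "ideal I R" "1[R] ~: I" obtains P where "maximalideal P R" "I <= P"
proof -
 obtain P where P: "ideal P R" "I <= P" "P Int {1[R]} = {}"
  "!!J. ideal J R ==> P <= J ==> J Int {1[R]} = {} ==> J = P" using maximal_ideal_disjoint[OF assms(1), of "{1[R]}"] assms(2) by auto
 have "maximalideal P R"
 proof (rule maximalidealI[OF P(1)])
  show "car R ~= P" using P(3) by auto
  fix J assume "ideal J R" "P <= J" "J <= car R"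
  thus "J = P | J = car R" using P(4) ideal.one_imp_carrier[of J R] by auto
 qed
 thus ?thesis using P(2) that by blast
qed

lemma (in cring) exists_primeideal_disjoint: assumes "ideal I R" "I Int S = {}" "1[R] : S" "S <= car R"
  "!!s t. s : S ==> t : S ==> s *[R] t : S" obtains P where "primeideal P R" "I <= P" "P Int S = {}"
proof -
 obtain P where P: "ideal P R" "I <= P" "P Int S = {}" and max: "!!J. ideal J R ==> P <= J ==> J Int S = {} ==> J = P"
  using maximal_ideal_disjoint[OF assms(1,2)] by metis
 interpret P: ideal P R by fact
 have "primeideal P R"
 proof (rule primeidealI[OF P(1) cring_axioms])
  show "car R ~= P" using P(3) assms(3,4) by auto
  \<comment> \<open>By maximality, adding \<open>a\<close> to \<open>P\<close> produces an ideal
    that meets \<open>S\<close>. For two elements outside \<open>P\<close> whose product lies in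
    \<open>P\<close>, the product of the two witnesses lies both in \<open>P\<close> and in
    \<open>S\<close>.\<close>
  have meets: "EX x:car R. EX y:P. (a *[R] x) +[R] y : S" if a: "a :[R]" "a ~: P" for a
  proof -
   have J: "ideal (PIdl a <+>\<^bsub>R\<^esub> P) R" using a(1) by (auto intro!: add_ideals P cgenideal_ideal)
   have sub: "P <= PIdl a <+>\<^bsub>R\<^esub> P"
   proof
    fix y assume "y : P"
    moreover have "0[R] : PIdl a" using cgenideal_ideal[OF a(1)] by (simp add: additive_subgroup.zero_closed ideal.axioms(1))
    ultimately have "0[R] +[R] y : PIdl a <+>\<^bsub>R\<^esub> P" unfolding set_add_def' by blast
    thus "y : PIdl a <+>\<^bsub>R\<^esub> P" using \<open>y \<in> P\<close> by auto
   qed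
   have "a +[R] 0[R] : PIdl a <+>\<^bsub>R\<^esub> P" using cgenideal_self[OF a(1)] P.zero_closed unfolding set_add_def' by blast
   hence "PIdl a <+>\<^bsub>R\<^esub> P ~= P" using a by auto
   then obtain s where s: "s : PIdl a <+>\<^bsub>R\<^esub> P" "s : S" using max[OF J sub] by auto
   then obtain u y where "u : PIdl a" "y : P" "s = u +[R] y" unfolding set_add_def' by auto
   thus ?thesis using s(2) a(1) unfolding cgenideal_def by (auto simp: m_comm)
  qed
  fix a b assume ab: "a :[R]" "b :[R]" "a *[R] b : P"
  show "a : P | b : P"
  proof (rule ccontr)
   assume "~ ?thesis"
   then obtain x y x' y' where *: "x :[R]" "y : P" "(a *[R] x) +[R] y : S"
    "x' :[R]" "y' : P" "(b *[R] x') +[R] y' : S" using meets[OF ab(1)] meets[OF ab(2)] by blast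
   have car: "y :[R]" "y' :[R]" using * by auto
   have "((a *[R] x) +[R] y) *[R] ((b *[R] x') +[R] y') =
     ((a *[R] b) *[R] (x *[R] x')) +[R] ((y' *[R] (a *[R] x)) +[R] (y *[R] ((b *[R] x') +[R] y')))"
    using ab * by (simp add: r_distr m_ac a_ac)
   also have "... : P" using P.I_r_closed[OF ab(3), of "x *[R] x'"] P.I_r_closed[OF *(5), of "a *[R] x"]
     P.I_r_closed[OF *(2), of "(b *[R] x') +[R] y'"] ab * by simp
   finally show False using assms(5)[OF *(3,6)] P(3) by auto
  qed
 qed
 thus ?thesis using P that by blast
qed

text \<open>Two non-units generate ideals inside the unique maximal ideal, which then contains their
  sum.\<close>

lemma local_ring_Units_add: assumes "is_local_ring R" "a :[R]" "b :[R]" "a +[R] b : Units R" shows "a : Units R | b : Units R"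
proof (rule ccontr)
 assume neg: "~ ?thesis"
 interpret cring R using assms(1) by (simp add: is_local_ring_def)
 have one: "1[R] ~: PIdl\<^bsub>R\<^esub> x" if "x :[R]" "x ~: Units R" for x
  using that m_comm unfolding cgenideal_def by (auto simp: Units_def)
 obtain P where P: "maximalideal P R" "PIdl\<^bsub>R\<^esub> a <= P"
  using exists_maximalideal[OF cgenideal_ideal[OF assms(2)] one] neg assms(2) by metis
 obtain Q where Q: "maximalideal Q R" "PIdl\<^bsub>R\<^esub> b <= Q"
  using exists_maximalideal[OF cgenideal_ideal[OF assms(3)] one] neg assms(3) by metis
 have "P = Q" using P(1) Q(1) assms(1) by (auto simp: is_local_ring_def)
 interpret P: maximalideal P R by fact
 have "a : P" "b : P" using P Q \<open>P = Q\<close> cgenideal_self assms(2,3) by auto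
 hence "a +[R] b : P" by simp
 hence "inv\<^bsub>R\<^esub> (a +[R] b) *[R] (a +[R] b) : P" by (rule P.I_l_closed) (simp add: assms(4))
 hence "P = car R" using P.one_imp_carrier assms(4) by simp
 thus False using P.I_notcarr by simp
qed

lemma local_ring_one_neq_zero: assumes "is_local_ring R" shows "1[R] ~= 0[R]" "0[R] ~: Units R"
proof -
 interpret cring R using assms(1) by (simp add: is_local_ring_def)
 obtain P where "maximalideal P R" using assms by (auto simp: is_local_ring_def)
 then interpret P: maximalideal P R .
 show one: "1[R] ~= 0[R]" using P.I_notcarr P.one_imp_carrier by auto
 show "0[R] ~: Units R" using one by (metis Units_r_inv Units_inv_closed l_null)
qed

lemma local_ring_Units_finsum: assumes "is_local_ring R" "finite C" "f : C \<rightarrow> car R" "finsum R f C : Units R"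
 obtains j where "j : C" "f j : Units R"
proof -
 interpret cring R using assms(1) by (simp add: is_local_ring_def)
 have "EX j:C. f j : Units R" using assms(2,3,4)
 proof (induction C)
  case (insert j C)
  thus ?case using local_ring_Units_add[OF assms(1), of "f j" "finsum R f C"] by auto
 qed (use local_ring_one_neq_zero[OF assms(1)] in auto)
 thus ?thesis using that by blast
qed

text \<open>Elimination with the pivot \<open>K j0\<close>, whose inverse is \<open>c\<close>.
  Subtracting a multiple of row \<open>K\<close> does not change the value of row \<open>L\<close>
  at \<open>v\<close>, since \<open>v\<close> solves row \<open>K\<close>, and the new row has no
  entry at \<open>j0\<close>.\<close>

lemma (in cring) gauss_step: assumes "finite C" "j0 : C" "v : C \<rightarrow> car R" "K : C \<rightarrow> car R" "L : C \<rightarrow> car R"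
  and "c :[R]" "K j0 *[R] c = 1[R]" "(SM[R]j:C. K j *[R] v j) = 0[R]"
 shows "(SM[R]j:C - {j0}. (L j -[R] L j0 *[R] c *[R] K j) *[R] v j) = (SM[R]j:C. L j *[R] v j)"
proof -
 let ?C = "C - {j0}"
 have C: "C = insert j0 ?C" "finite ?C" "j0 ~: ?C" using assms(1,2) by auto
 have car: "K j0 :[R]" "L j0 :[R]" "v j0 :[R]" using assms by auto
 have "K j0 *[R] v j0 +[R] (SM[R]j:?C. K j *[R] v j) = 0[R]" using assms by (subst (asm) C(1), subst (asm) finsum_insert) auto
 moreover have "(SM[R]j:?C. K j *[R] v j) :[R]" using assms by (intro finsum_closed) auto
 ultimately have K: "(SM[R]j:?C. K j *[R] v j) = -[R] (K j0 *[R] v j0)"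
  using car by (intro minus_equality[symmetric]) (simp_all add: a_comm)
 have "(SM[R]j:?C. (L j -[R] L j0 *[R] c *[R] K j) *[R] v j) =
   (SM[R]j:?C. L j *[R] v j +[R] (-[R] (L j0 *[R] c)) *[R] (K j *[R] v j))"
  using assms by (intro finsum_cong') (auto simp: Pi_iff minus_eq l_distr l_minus m_assoc)
 also have "... = (SM[R]j:?C. L j *[R] v j) +[R] (SM[R]j:?C. (-[R] (L j0 *[R] c)) *[R] (K j *[R] v j))"
  using assms by (intro finsum_addf) (auto simp: Pi_iff)
 also have "(SM[R]j:?C. (-[R] (L j0 *[R] c)) *[R] (K j *[R] v j)) = (-[R] (L j0 *[R] c)) *[R] (-[R] (K j0 *[R] v j0))"
  unfolding K[symmetric] using assms by (intro finsum_rdistr[symmetric]) (auto simp: Pi_iff)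
 also have "... = L j0 *[R] ((K j0 *[R] c) *[R] v j0)" using assms(6) car by (simp add: r_minus m_ac)
 also have "... = L j0 *[R] v j0" using assms(7) car by simp
 also have "(SM[R]j:?C. L j *[R] v j) +[R] L j0 *[R] v j0 = (SM[R]j:C. L j *[R] v j)"
  using assms by (subst C(1), subst finsum_insert) (auto simp: Pi_iff a_comm)
 finally show ?thesis .
qed

text \<open>The presentation of a smooth algebra supplies a right inverse of the Jacobian, that is
  surjectivity, whereas uniqueness of derivations needs a trivial kernel. Over a local ring Gaussian
  elimination bridges the gap: a surjective matrix has a unit in each row, and removing the row and
  column of a pivot preserves the hypotheses.\<close>

lemma local_ring_square_surj_imp_inj: assumes local: "is_local_ring R" shows "finite I ==> finite C ==> card I = card C ==>
  (!!i j. i : I ==> j : C ==> J i j :[R]) ==>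
  (!!w. w : I \<rightarrow> car R ==> EX v:C \<rightarrow> car R. ALL i:I. (SM[R]j:C. J i j *[R] v j) = w i) ==>
  v : C \<rightarrow> car R ==> (!!i. i : I ==> (SM[R]j:C. J i j *[R] v j) = 0[R]) ==>
  ALL j:C. v j = 0[R]"
proof (induction I arbitrary: C J v rule: finite_induct)
 case (insert i0 I)
 interpret cring R using local by (simp add: is_local_ring_def)
 note J = insert.prems(3)
 \<comment> \<open>Row \<open>i0\<close> takes the value 1, and in a local ring a sum that is a unit
   has a unit among its terms. This provides the pivot.\<close>
 obtain u where u: "u : C \<rightarrow> car R" "(SM[R]j:C. J i0 j *[R] u j) = 1[R]" using insert.prems(4)[of "%_. 1[R]"] by auto
 obtain j0 where j0: "j0 : C" "J i0 j0 *[R] u j0 : Units R"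
  using local_ring_Units_finsum[OF local insert.prems(1), of "%j. J i0 j *[R] u j"] u J by (auto simp: Pi_iff)
 have "J i0 j0 : Units R" by (rule unit_factor[OF j0(2)]) (use J j0 u(1) in auto)
 then obtain c where c: "c :[R]" "J i0 j0 *[R] c = 1[R]" using Units_r_inv by blast
 define J' where "J' i j = J i j -[R] J i j0 *[R] c *[R] J i0 j" for i j
 let ?C = "C - {j0}"
 have step: "(SM[R]j:?C. J' i j *[R] v j) = (SM[R]j:C. J i j *[R] v j)"
  if "i : I" "v : C \<rightarrow> car R" "(SM[R]j:C. J i0 j *[R] v j) = 0[R]" for i v
  unfolding J'_def using insert.prems(1) j0(1) that J c by (intro gauss_step) auto
 have zero: "ALL j:?C. v j = 0[R]"
 proof (rule insert.IH[of ?C J' v])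
  show "finite ?C" "card I = card ?C" using insert.prems(1,2) insert.hyps j0(1) by auto
  show "J' i j :[R]" if "i : I" "j : ?C" for i j using that J j0 c by (auto simp: J'_def)
  show "v : ?C \<rightarrow> car R" using insert.prems(5) by auto
  show "(SM[R]j:?C. J' i j *[R] v j) = 0[R]" if "i : I" for i using step[OF that insert.prems(5)] insert.prems(6) that by auto
  show "EX v:?C \<rightarrow> car R. ALL i:I. (SM[R]j:?C. J' i j *[R] v j) = w i" if w: "w : I \<rightarrow> car R" for w
  proof -
   \<comment> \<open>The target vector is extended by 0 in the pivot row, so that every preimage
     satisfies the hypothesis of \<open>step\<close>.\<close>
   have "w(i0 := 0[R]) : insert i0 I \<rightarrow> car R" using w by auto
   then obtain x where x: "x : C \<rightarrow> car R"
    "ALL i:insert i0 I. (SM[R]j:C. J i j *[R] x j) = (w(i0 := 0[R])) i" using insert.prems(4) by blast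
   hence "ALL i:I. (SM[R]j:?C. J' i j *[R] x j) = w i" using step[of _ x] insert.hyps by auto
   thus ?thesis using x(1) by auto
  qed
 qed
 have "0[R] = (SM[R]j:insert j0 ?C. J i0 j *[R] v j)" using insert.prems(6)[of i0] j0(1) by (simp add: insert_absorb)
 also have "... = J i0 j0 *[R] v j0 +[R] (SM[R]j:?C. J i0 j *[R] v j)" using insert.prems(1,5) J j0 by (intro finsum_insert) auto
 also have "(SM[R]j:?C. J i0 j *[R] v j) = (SM[R]j:?C. 0[R])" using zero J by (intro finsum_cong') auto
 finally have *: "0[R] = J i0 j0 *[R] v j0 +[R] (SM[R]j:?C. 0[R])" .
 have "J i0 j0 :[R]" "v j0 :[R]" using J j0 insert.prems(5) by auto
 moreover from this have "0[R] = J i0 j0 *[R] v j0" using * by simp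
 ultimately have "J i0 j0 *[R] v j0 = J i0 j0 *[R] 0[R]" by (metis r_null)
 hence "v j0 = 0[R]" using \<open>J i0 j0 \<in> Units R\<close> insert.prems(5) j0(1) by (metis Pi_mem Units_cancel zero_closed)
 thus ?case using zero by auto
qed auto

subsection \<open>Polynomial rings\<close>

lemma finite_submultisets [simp]: "finite {m'. m' <=# m}"
proof (induction m)
 case (add a m)
 have "{m'. m' <=# add_mset a m} <= {m'. m' <=# m} Un add_mset a ` {m'. m' <=# m}"
 proof
  fix x assume x: "x : {m'. m' <=# add_mset a m}"
  show "x : {m'. m' <=# m} Un add_mset a ` {m'. m' <=# m}"
  proof (cases "a :# x")
   case True
   then obtain y where "x = add_mset a y" by (metis insert_DiffM)
   thus ?thesis using x by auto
  next
   case False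
   thus ?thesis using x by (auto simp: subseteq_mset_def not_in_iff split: if_splits) (metis le_zero_eq linorder_le_cases)
  qed
 qed
 thus ?case using add finite_subset by blast
qed simp

lemma mset_double_diff: "v <=# u ==> u - (u - v) = v" by (simp add: multiset_eq_iff subseteq_mset_def)

lemma (in abelian_monoid) finsum_Sigma: assumes "finite A" "!!a. a : A ==> finite (B a)" "!!a b. a : A ==> b : B a ==> f a b :[G]"
 shows "(SM[G]a:A. SM[G]b:B a. f a b) = finsum G (%(a, b). f a b) (Sigma A B)" using assms
proof (induction A)
 case (insert x A)
 have Sig: "Sigma (insert x A) B = Pair x ` B x Un Sigma A B" "Pair x ` B x Int Sigma A B = {}" using insert.hyps by auto
 have "finsum G (%(a, b). f a b) (Sigma (insert x A) B) =
   finsum G (%(a, b). f a b) (Pair x ` B x) +[G] finsum G (%(a, b). f a b) (Sigma A B)"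
  unfolding Sig(1) using insert by (intro finsum_Un_disjoint) auto
 also have "finsum G (%(a, b). f a b) (Pair x ` B x) = (SM[G]b:B x. f x b)" using insert by (subst finsum_reindex) (auto simp: inj_on_def)
 finally show ?case using insert by auto
qed simp

locale coeff_ring = cring R for R :: "'r ring" (structure)
begin

abbreviation conv :: "(nat multiset => 'r) => (nat multiset => 'r) => nat multiset => 'r" where
 "conv f g == (%m. SM[R]m':{m'. m' <=# m}. f m' *[R] g (m - m'))"

lemma conv_closed [simp]: "[|!!m. f m :[R]; !!m. g m :[R]|] ==> conv f g m :[R]" by auto

lemma conv_comm: assumes "!!m. f m :[R]" "!!m. g m :[R]" shows "conv f g m = conv g f m"
proof -
 let ?S = "{m'. m' <=# m}"
 have inj: "inj_on (%m'. m - m') ?S" by (intro inj_onI) (metis mset_double_diff mem_Collect_eq)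
 have img: "(%m'. m - m') ` ?S = ?S"
 proof (intro equalityI subsetI)
  fix x assume "x : ?S" thus "x : (%m'. m - m') ` ?S" by (intro image_eqI[of _ _ "m - x"]) (auto simp: mset_double_diff)
 qed auto
 have "conv f g m = (SM[R]m':(%m'. m - m') ` ?S. f m' *[R] g (m - m'))" by (simp only: img)
 also have "... = (SM[R]m':?S. f (m - m') *[R] g (m - (m - m')))" by (rule finsum_reindex[OF _ inj]) (use assms in auto)
 also have "... = conv g f m" by (rule finsum_cong') (use assms in "auto simp: mset_double_diff m_comm")
 finally show ?thesis .
qed

text \<open>Both sides run over the factorisations of the monomial \<open>m\<close> into three
  factors. \<open>?t\<close> passes from the first two factors to the pair of their product and the
  first one.\<close>

lemma conv_assoc: assumes "!!m. f m :[R]" "!!m. g m :[R]" "!!m. h m :[R]" shows "conv (conv f g) h m = conv f (conv g h) m"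
proof -
 let ?S = "%m. {m'. m' <=# m}"
 let ?t = "%(v, w). (v + w, v :: nat multiset)"
 have inj: "inj_on ?t (Sigma (?S m) (%v. ?S (m - v)))" by (auto intro!: inj_onI)
 have img: "?t ` Sigma (?S m) (%v. ?S (m - v)) = Sigma (?S m) ?S"
 proof (intro equalityI subsetI)
  fix x assume "x : Sigma (?S m) ?S"
  then obtain u v where x: "x = (u, v)" "u <=# m" "v <=# u" by auto
  thus "x : ?t ` Sigma (?S m) (%v. ?S (m - v))" by (intro image_eqI[of _ _ "(v, u - v)"])
    (auto simp: subseteq_mset_def intro: order_trans diff_le_mono)
 next
  fix x assume "x : ?t ` Sigma (?S m) (%v. ?S (m - v))"
  then obtain v w where x: "x = (v + w, v)" "v <=# m" "w <=# m - v" by auto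
  hence "v + w <=# m" by (metis subset_mset.add_diff_inverse subset_mset.add_le_cancel_left)
  thus "x : Sigma (?S m) ?S" using x by simp
 qed
 have "conv (conv f g) h m = (SM[R]u:?S m. SM[R]v:?S u. f v *[R] g (u - v) *[R] h (m - u))"
  using assms by (intro finsum_cong') (auto simp: finsum_ldistr)
 also have "... = finsum R (%(u, v). f v *[R] g (u - v) *[R] h (m - u)) (Sigma (?S m) ?S)" using assms by (intro finsum_Sigma) auto
 also have "... = finsum R (%(v, w). f v *[R] g w *[R] h (m - (v + w))) (Sigma (?S m) (%v. ?S (m - v)))"
  unfolding img[symmetric] using assms by (subst finsum_reindex[OF _ inj]) (auto simp: case_prod_unfold)
 also have "... = (SM[R]v:?S m. SM[R]w:?S (m - v). f v *[R] g w *[R] h (m - (v + w)))" using assms by (intro finsum_Sigma[symmetric]) auto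
 also have "... = conv f (conv g h) m" using assms by (intro finsum_cong') (auto simp: finsum_rdistr m_assoc)
 finally show ?thesis .
qed

lemma conv_one: assumes "!!m. f m :[R]" shows "conv (%m. if m = {#} then 1[R] else 0[R]) f m = f m"
proof -
 have "conv (%m. if m = {#} then 1[R] else 0[R]) f m = (SM[R]m':{m'. m' <=# m}. if {#} = m' then f (m - m') else 0[R])"
  using assms by (intro finsum_cong') auto
 also have "... = f m" using finsum_singleton[of "{#}" "{m'. m' <=# m}" "%m'. f (m - m')"] assms by simp
 finally show ?thesis .
qed

lemma conv_add: assumes "!!m. f m :[R]" "!!m. g m :[R]" "!!m. h m :[R]" shows "conv (%m. f m +[R] g m) h m = conv f h m +[R] conv g h m"
proof -
 have "conv (%m. f m +[R] g m) h m = (SM[R]m':{m'. m' <=# m}. f m' *[R] h (m - m') +[R] g m' *[R] h (m - m'))"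
  using assms by (intro finsum_cong') (auto simp: l_distr)
 also have "... = conv f h m +[R] conv g h m" using assms by auto
 finally show ?thesis .
qed

lemma conv_nonzero: assumes "!!m. f m :[R]" "!!m. g m :[R]" "conv f g m ~= 0[R]"
 obtains m' where "m' <=# m" "f m' ~= 0[R]" "g (m - m') ~= 0[R]"
proof -
 have "EX m':{m'. m' <=# m}. f m' *[R] g (m - m') ~= 0[R]"
  using assms(3) add.finprod_one_eqI[of "{m'. m' <=# m}" "%m'. f m' *[R] g (m - m')"] by blast
 thus ?thesis using that assms(1,2) by force
qed

lemma mpoly_ring_simps:
 "car (MPol R n) = {f. (ALL m. f m :[R]) & finite {m. f m ~= 0[R]} &
  (ALL m. f m ~= 0[R] --> set_mset m <= {..<n})}"
 "mult (MPol R n) = conv" "1[MPol R n] = (%m. if m = {#} then 1[R] else 0[R])"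
 "0[MPol R n] = (%m. 0[R])" "f +[MPol R n] g = (%m. f m +[R] g m)" by (simp_all add: mpoly_ring_def)

lemma mpoly_memD: assumes "f :[MPol R n]" shows "f m :[R]" "finite {m. f m ~= 0[R]}" "f m ~= 0[R] ==> set_mset m <= {..<n}"
 using assms by (auto simp: mpoly_ring_simps)

lemma mpoly_add_closed: assumes "f :[MPol R n]" "g :[MPol R n]" shows "f +[MPol R n] g :[MPol R n]"
proof -
 have sub: "{m. f m +[R] g m ~= 0[R]} <= {m. f m ~= 0[R]} Un {m. g m ~= 0[R]}" by auto
 moreover have "finite ..." using assms by (auto simp: mpoly_ring_simps)
 ultimately have "finite {m. f m +[R] g m ~= 0[R]}" by (rule finite_subset)
 thus ?thesis using assms sub unfolding mpoly_ring_simps by blast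
qed

lemma mpoly_mult_closed: assumes f: "f :[MPol R n]" and g: "g :[MPol R n]" shows "f *[MPol R n] g :[MPol R n]"
proof -
 have sub: "{m. conv f g m ~= 0[R]} <= (%(a, b). a + b) ` ({m. f m ~= 0[R]} \<times> {m. g m ~= 0[R]})"
 proof
  fix m assume "m : {m. conv f g m ~= 0[R]}"
  then obtain m' where "m' <=# m" "f m' ~= 0[R]" "g (m - m') ~= 0[R]" using conv_nonzero mpoly_memD(1)[OF f] mpoly_memD(1)[OF g] by blast
  thus "m : (%(a, b). a + b) ` ({m. f m ~= 0[R]} \<times> {m. g m ~= 0[R]})" by (intro image_eqI[of _ _ "(m', m - m')"]) auto
 qed
 have "finite ({m. f m ~= 0[R]} \<times> {m. g m ~= 0[R]})" using mpoly_memD(2)[OF f] mpoly_memD(2)[OF g] by simp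
 hence fin: "finite {m. conv f g m ~= 0[R]}" using finite_subset[OF sub] by blast
 have "set_mset m <= {..<n}" if "conv f g m ~= 0[R]" for m
 proof -
  have "m : (%(a, b). a + b) ` ({m. f m ~= 0[R]} \<times> {m. g m ~= 0[R]})" using sub that by blast
  then obtain a b where "m = a + b" "f a ~= 0[R]" "g b ~= 0[R]" by auto
  thus ?thesis using mpoly_memD(3)[OF f] mpoly_memD(3)[OF g] by auto
 qed
 thus ?thesis using fin mpoly_memD(1)[OF f] mpoly_memD(1)[OF g] by (simp add: mpoly_ring_simps)
qed

lemma mpoly_cring: "cring (MPol R n)"
proof (intro cringI abelian_groupI comm_monoidI)
 fix f assume f: "f :[MPol R n]"
 have "{m. -[R] f m ~= 0[R]} <= {m. f m ~= 0[R]}" by auto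
 hence "finite {m. -[R] f m ~= 0[R]}" using mpoly_memD(2)[OF f] by (rule finite_subset)
 moreover have "set_mset m <= {..<n}" if "-[R] f m ~= 0[R]" for m using that mpoly_memD(3)[OF f, of m] by (cases "f m = 0[R]") auto
 ultimately have "(%m. -[R] f m) :[MPol R n]" "(%m. -[R] f m) +[MPol R n] f = 0[MPol R n]"
  using mpoly_memD(1)[OF f] by (auto simp: mpoly_ring_simps l_neg)
 thus "EX y:car (MPol R n). y +[MPol R n] f = 0[MPol R n]" by blast
 show "1[MPol R n] *[MPol R n] f = f" using mpoly_memD(1)[OF f] conv_one[of f] by (simp add: mpoly_ring_simps)
next
 fix f g assume fg: "f :[MPol R n]" "g :[MPol R n]"
 show "f *[MPol R n] g = g *[MPol R n] f"
  using mpoly_memD(1)[OF fg(1)] mpoly_memD(1)[OF fg(2)] conv_comm[of f g] by (simp add: mpoly_ring_simps)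
 fix h assume h: "h :[MPol R n]"
 note car = mpoly_memD(1)[OF fg(1)] mpoly_memD(1)[OF fg(2)] mpoly_memD(1)[OF h]
 show "f *[MPol R n] g *[MPol R n] h = f *[MPol R n] (g *[MPol R n] h)" using car conv_assoc[of f g h] by (simp add: mpoly_ring_simps)
 show "(f +[MPol R n] g) *[MPol R n] h =
   f *[MPol R n] h +[MPol R n] g *[MPol R n] h" using car conv_add[of f g h] by (simp add: mpoly_ring_simps)
qed (auto simp: mpoly_add_closed mpoly_mult_closed,
  auto simp: mpoly_ring_simps a_ac)

end

subsection \<open>Evaluation of polynomials\<close>

locale mpoly_hom = R: coeff_ring R + B: cring B for R :: "'r ring" and B :: "'b ring" +
 fixes ph :: "'r => 'b" and n :: nat and a :: "nat => 'b" assumes phi: "ph : ring_hom R B" and a: "j < n ==> a j :[B]"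
begin

definition mon :: "nat multiset => 'b" where
 "mon m = (\<Otimes>\<^bsub>B\<^esub>i\<in>{..<n}. a i [^]\<^bsub>B\<^esub> count m i)"

lemma a_pow [simp]: "(%i. a i [^]\<^bsub>B\<^esub> count m i) : {..<n} \<rightarrow> car B" using a by auto

lemma mon_closed [simp]: "mon m :[B]" unfolding mon_def by auto

lemma phi_closed [simp]: "r :[R] ==> ph r :[B]" using phi by (rule ring_hom_closed)

lemma phi_zero [simp]: "ph 0[R] = 0[B]" using ring_hom_zero'[OF R.cring_axioms B.cring_axioms phi] .

lemma mon_empty [simp]: "mon {#} = 1[B]" unfolding mon_def by auto

lemma mon_union: "mon (m + m') = mon m *[B] mon m'"
proof -
 have "mon (m + m') = (\<Otimes>\<^bsub>B\<^esub>i\<in>{..<n}. (a i [^]\<^bsub>B\<^esub> count m i) *[B] (a i [^]\<^bsub>B\<^esub> count m' i))"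
  unfolding mon_def using a by (intro B.finprod_cong') (auto simp: B.nat_pow_mult)
 also have "... = mon m *[B] mon m'" unfolding mon_def by auto
 finally show ?thesis .
qed

lemma mon_single: "j < n ==> mon {#j#} = a j"
proof -
 assume j: "j < n"
 have "mon {#j#} = (\<Otimes>\<^bsub>B\<^esub>i\<in>{..<n}. if j = i then a i else 1[B])"
  unfolding mon_def using a by (intro B.finprod_cong') auto
 also have "... = a j" using j a by (intro B.finprod_singleton) auto
 finally show ?thesis .
qed

lemma mon_add_mset: "j < n ==> mon (add_mset j m) = a j *[B] mon m" using mon_union[of "{#j#}" m] mon_single by simp

text \<open>Cancellation makes the supports of sums and products hard to control, so evaluations are
  compared on a common finite set that contains the supports.\<close>

lemma eval_superset: assumes "finite T" "{m. f m ~= 0[R]} <= T" "!!m. f m :[R]" shows "mev R B ph n a f = (SM[B]m:T. ph (f m) *[B] mon m)"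
 unfolding mpoly_eval_def mon_def[symmetric] using assms by (intro B.add.finprod_mono_neutral_cong_left) auto

lemma eval_closed [simp]:
 "[|!!m. f m :[R]|] ==> mev R B ph n a f :[B]" unfolding mpoly_eval_def by auto

lemma eval_monom: assumes "r :[R]" shows "mev R B ph n a (%m. if m = m0 then r else 0[R]) = ph r *[B] mon m0"
 by (subst eval_superset[of "{m0}"]) (use assms in auto)

lemma eval_add: assumes "f :[MPol R n]" "g :[MPol R n]" shows "mev R B ph n a (f +[MPol R n] g) =
  mev R B ph n a f +[B] mev R B ph n a g"
proof -
 let ?T = "{m. f m ~= 0[R]} Un {m. g m ~= 0[R]}"
 have fin: "finite ?T" and car: "!!m. f m :[R]" "!!m. g m :[R]" using assms by (auto simp: R.mpoly_ring_simps)
 have "mev R B ph n a (f +[MPol R n] g) =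
   (SM[B]m:?T. ph (f m +[R] g m) *[B] mon m)" unfolding R.mpoly_ring_simps using fin car by (intro eval_superset) auto
 also have "... = (SM[B]m:?T. (ph (f m) *[B] mon m) +[B] (ph (g m) *[B] mon m))"
  using car by (intro B.finsum_cong') (auto simp: ring_hom_add[OF phi] B.l_distr)
 also have "... = mev R B ph n a f +[B] mev R B ph n a g" using fin car by (subst (1 2) eval_superset[of ?T]) auto
 finally show ?thesis .
qed

lemma phi_finsum: assumes "finite S" "!!s. s : S ==> f s :[R]" shows "ph (finsum R f S) = (SM[B]s:S. ph (f s))" using assms
proof (induction S)
 case (insert s S)
 with insert show ?case by (simp add: ring_hom_add[OF phi])
qed simp

text \<open>\<open>?T\<close> consists of the products of monomials from the two supports and
  contains the support of the product. Over it one has a double sum indexed by a monomial and a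
  divisor; pairs that do not come from the two supports contribute zero, and the rest is the product
  of the evaluations.\<close>

lemma eval_mult: assumes f: "f :[MPol R n]" and g: "g :[MPol R n]" shows "mev R B ph n a (f *[MPol R n] g) =
  mev R B ph n a f *[B] mev R B ph n a g"
proof -
 let ?F = "{m. f m ~= 0[R]}" and ?G = "{m. g m ~= 0[R]}" and ?S = "%m. {m'. m' <=# m}"
 let ?T = "(%(u, w). u + w) ` (?F \<times> ?G)"
 let ?t = "%(u, w). (u + w, u :: nat multiset)"
 have fin: "finite ?F" "finite ?G" and finT: "finite ?T" and car [simp]: "!!m. f m :[R]" "!!m. g m :[R]"
  using f g by (auto simp: R.mpoly_ring_simps)
 have supp: "{m. R.conv f g m ~= 0[R]} <= ?T"
 proof
  fix m assume "m : {m. R.conv f g m ~= 0[R]}"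
  then obtain m' where "m' <=# m" "f m' ~= 0[R]" "g (m - m') ~= 0[R]" using R.conv_nonzero[of f g m] by auto
  thus "m : ?T" by (intro image_eqI[of _ _ "(m', m - m')"]) auto
 qed
 have inj: "inj_on ?t (?F \<times> ?G)" by (auto intro!: inj_onI)
 have "mev R B ph n a (f *[MPol R n] g) = (SM[B]m:?T. ph (R.conv f g m) *[B] mon m)"
  unfolding R.mpoly_ring_simps using finT supp by (intro eval_superset) auto
 also have "... = (SM[B]m:?T. SM[B]u:?S m. (ph (f u) *[B] mon u) *[B] (ph (g (m - u)) *[B] mon (m - u)))"
 proof (rule B.finsum_cong')
  fix m
  have "ph (R.conv f g m) *[B] mon m = (SM[B]u:?S m. ph (f u *[R] g (m - u))) *[B] mon m" by (subst phi_finsum) auto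
  also have "... = (SM[B]u:?S m. ph (f u *[R] g (m - u)) *[B] mon m)" by (rule B.finsum_ldistr) auto
  also have "... = (SM[B]u:?S m. (ph (f u) *[B] mon u) *[B] (ph (g (m - u)) *[B] mon (m - u)))"
  proof (rule B.finsum_cong')
   fix u assume "u : ?S m"
   hence "mon m = mon u *[B] mon (m - u)" using mon_union[of u "m - u"] by auto
   thus "ph (f u *[R] g (m - u)) *[B] mon m =
     (ph (f u) *[B] mon u) *[B] (ph (g (m - u)) *[B] mon (m - u))" by (simp add: ring_hom_mult[OF phi] B.m_ac)
  qed auto
  finally show "ph (R.conv f g m) *[B] mon m = (SM[B]u:?S m. (ph (f u) *[B] mon u) *[B] (ph (g (m - u)) *[B] mon (m - u)))" .
 qed auto
 also have "... = finsum B (%(m, u). (ph (f u) *[B] mon u) *[B] (ph (g (m - u)) *[B] mon (m - u))) (Sigma ?T ?S)"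
  using finT by (intro B.finsum_Sigma) auto
 also have "... = finsum B (%(m, u). (ph (f u) *[B] mon u) *[B] (ph (g (m - u)) *[B] mon (m - u))) (?t ` (?F \<times> ?G))"
 proof (rule B.add.finprod_mono_neutral_cong_right)
  show "finite (Sigma ?T ?S)" using finT by auto
  show "?t ` (?F \<times> ?G) <= Sigma ?T ?S" by auto
  fix i assume i: "i : Sigma ?T ?S - ?t ` (?F \<times> ?G)"
  then obtain m u where mu: "i = (m, u)" "u <=# m" by auto
  have "f u = 0[R] | g (m - u) = 0[R]"
  proof (rule ccontr)
   assume "~ ?thesis"
   hence "(m, u) : ?t ` (?F \<times> ?G)" using mu by (intro image_eqI[of _ _ "(u, m - u)"]) auto
   thus False using i mu by auto
  qed
  thus "(case i of (m, u) => (ph (f u) *[B] mon u) *[B] (ph (g (m - u)) *[B] mon (m - u))) = 0[B]" using mu by auto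
 qed auto
 also have "... = finsum B (%(u, w). (ph (f u) *[B] mon u) *[B] (ph (g w) *[B] mon w)) (?F \<times> ?G)"
  by (subst B.finsum_reindex[OF _ inj]) (auto simp: case_prod_unfold)
 also have "... = (SM[B]u:?F. SM[B]w:?G. (ph (f u) *[B] mon u) *[B] (ph (g w) *[B] mon w))"
  using fin by (intro B.finsum_Sigma[symmetric]) auto
 also have "... = (SM[B]u:?F. (ph (f u) *[B] mon u) *[B] mev R B ph n a g)"
  unfolding mpoly_eval_def mon_def[symmetric] using fin by (intro B.finsum_cong' B.finsum_rdistr[symmetric]) auto
 also have "... = mev R B ph n a f *[B] mev R B ph n a g"
  unfolding mpoly_eval_def mon_def[symmetric] using fin by (intro B.finsum_ldistr[symmetric]) auto
 finally show ?thesis .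
qed

lemma eval_ring_hom: "mev R B ph n a : ring_hom (MPol R n) B"
proof (rule ring_hom_memI)
 show "mev R B ph n a 1[MPol R n] = 1[B]" unfolding R.mpoly_ring_simps using ring_hom_one[OF phi] by (simp add: eval_monom)
qed (auto simp: eval_add eval_mult R.mpoly_memD)

lemma hom_eval: assumes "cring C" "h : ring_hom B C" "!!m. f m :[R]" "finite {m. f m ~= 0[R]}"
 shows "h (mev R B ph n a f) = mev R C (%r. h (ph r)) n (%i. h (a i)) f"
proof -
 interpret C: cring C by fact
 interpret h: ring_hom_cring B C h by (rule ring_hom_cring.intro[OF B.cring_axioms assms(1) ring_hom_cring_axioms.intro[OF assms(2)]])
 have "h (mev R B ph n a f) = (SM[C]m:{m. f m ~= 0[R]}. h (ph (f m) *[B] mon m))"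
  unfolding mpoly_eval_def mon_def[symmetric] using assms(3) by (subst h.hom_finsum) (auto simp: comp_def)
 also have "... = (SM[C]m:{m. f m ~= 0[R]}. h (ph (f m)) *[C] (\<Otimes>\<^bsub>C\<^esub>i\<in>{..<n}. h (a i) [^]\<^bsub>C\<^esub> count m i))"
 proof (rule C.finsum_cong')
  fix m
  have "h (mon m) = (\<Otimes>\<^bsub>C\<^esub>i\<in>{..<n}. h (a i [^]\<^bsub>B\<^esub> count m i))"
   unfolding mon_def by (subst h.hom_finprod) (auto simp: comp_def)
  also have "... = (\<Otimes>\<^bsub>C\<^esub>i\<in>{..<n}. h (a i) [^]\<^bsub>C\<^esub> count m i)" using a by (intro C.finprod_cong') auto
  finally show "h (ph (f m) *[B] mon m) = h (ph (f m)) *[C] (\<Otimes>\<^bsub>C\<^esub>i\<in>{..<n}. h (a i) [^]\<^bsub>C\<^esub> count m i)"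
   using assms(3) by simp
 qed (use assms(3) a in auto)
 finally show ?thesis by (simp add: mpoly_eval_def)
qed

end

lemma (in abelian_monoid) finsum_swap: assumes "finite A" "finite B" "!!a b. a : A ==> b : B ==> f a b :[G]"
 shows "(SM[G]a:A. SM[G]b:B. f a b) = (SM[G]b:B. SM[G]a:A. f a b)" using assms
proof (induction A)
 case empty
 thus ?case by simp
next
 case (insert x A)
 have "(SM[G]b:B. SM[G]a:insert x A. f a b) = (SM[G]b:B. f x b +[G] (SM[G]a:A. f a b))" using insert by (intro finsum_cong') auto
 also have "... = (SM[G]b:B. f x b) +[G] (SM[G]b:B. SM[G]a:A. f a b)" using insert by auto
 finally show ?case using insert by simp
qed

lemma finsum_dual: assumes "cring B" "finite S" "!!s. s : S ==> f s :[B] & g s :[B]"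
 shows "finsum (dual B) (%s. (f s, g s)) S = (finsum B f S, finsum B g S)"
proof -
 interpret B: cring B by fact
 interpret D: cring "dual B" by (rule dual_cring) fact
 show ?thesis using assms(2,3)
 proof (induction S)
  case (insert s S)
  with insert show ?case by auto
 qed simp
qed

context coeff_ring begin

lemma mpoly_deriv_supp: "{m. mder R j f m ~= 0[R]} <= {m. f (add_mset j m) ~= 0[R]}" by (auto simp: mpoly_deriv_def)

lemma mpoly_deriv_closed [simp]: "(!!m. f m :[R]) ==> mder R j f m :[R]" by (simp add: mpoly_deriv_def)

lemma finite_supp_add_mset: assumes "finite {m. f m ~= 0[R]}" shows "finite {m. f (add_mset j m) ~= 0[R]}"
proof -
 have "add_mset j ` {m. f (add_mset j m) ~= 0[R]} <= {m. f m ~= 0[R]}" by auto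
 hence "finite (add_mset j ` {m. f (add_mset j m) ~= 0[R]})" using assms finite_subset by blast
 thus ?thesis by (rule finite_imageD) (auto simp: inj_on_def)
qed

end

text \<open>Polynomials are evaluated in the dual numbers at \<open>a j + e j eps\<close>, with
  coefficients mapped to \<open>ph r + d r eps\<close>. The second component is the value that a
  derivation extending \<open>d\<close> must take if it has the values \<open>e j\<close> at the
  generators.\<close>

locale mpoly_der = mpoly_hom +
 fixes d and e assumes d: "der R B ph d" and e: "j < n ==> e j :[B]"
begin

sublocale D: mpoly_hom R "dual B" "%r. (ph r, d r)" n "%j. (a j, e j)"
proof (intro mpoly_hom.intro mpoly_hom_axioms.intro R.coeff_ring_axioms)
 show "cring (dual B)" by (rule dual_cring[OF B.cring_axioms])
 show "(%r. (ph r, d r)) : ring_hom R (dual B)" using der_iff_ring_hom[OF R.cring_axioms B.cring_axioms phi] d by blast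
qed (auto simp: a e)

lemma d_closed [simp]: "r :[R] ==> d r :[B]" using d by (auto simp: der_def)

text \<open>The partial derivative of a monomial in direction \<open>i\<close>, times
  \<open>e i\<close>. If \<open>i\<close> does not occur, the difference of multisets leaves
  \<open>m\<close> unchanged, but then the factor \<open>count m i\<close> is zero.\<close>

definition dmon_term :: "nat multiset => nat => _" where
 "dmon_term m i = [count m i] \<cdot>\<^bsub>B\<^esub> (mon (m - {#i#}) *[B] e i)"

lemma dmon_term_closed [simp]: "i < n ==> dmon_term m i :[B]" using e by (auto simp: dmon_term_def)

lemma dmon_term_add_mset: assumes "j < n" "i < n" shows "dmon_term (add_mset j m) i =
  (a j *[B] dmon_term m i) +[B] (if j = i then mon m *[B] e i else 0[B])"
proof -
 have car: "a j :[B]" "e i :[B]" using assms a e by auto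
 have "a j *[B] dmon_term m i = [count m i] \<cdot>\<^bsub>B\<^esub> (a j *[B] mon (m - {#i#}) *[B] e i)"
  using car by (simp add: dmon_term_def B.add_pow_rdistr B.m_assoc)
 also have "... = [count m i] \<cdot>\<^bsub>B\<^esub> (mon (add_mset j (m - {#i#})) *[B] e i)" using mon_add_mset[OF assms(1)] by simp
 finally have eq: "a j *[B] dmon_term m i = [count m i] \<cdot>\<^bsub>B\<^esub> (mon (add_mset j (m - {#i#})) *[B] e i)" .
 show ?thesis
 proof (cases "i :# m")
  case True
  show ?thesis
  proof (cases "j = i")
   case j: True
   have "add_mset i (m - {#i#}) = m" using True by simp
   thus ?thesis unfolding eq using car by (simp add: dmon_term_def)
  next
   case False
   thus ?thesis unfolding eq using car by (simp add: dmon_term_def)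
  qed
 next
  case False
  hence "count m i = 0" by (simp add: not_in_iff)
  thus ?thesis using car by (auto simp: dmon_term_def)
 qed
qed

lemma D_mon: "set_mset m <= {..<n} ==> D.mon m = (mon m, SM[B]i:{..<n}. dmon_term m i)"
proof (induction m)
 case empty
 have "(SM[B]i:{..<n}. dmon_term {#} i) = (SM[B]i:{..<n}. 0[B])" by (intro B.finsum_cong') (auto simp: dmon_term_def)
 thus ?case by simp
next
 case (add j m)
 hence j: "j < n" by auto
 have car: "a j :[B]" "e j :[B]" using j a e by auto
 have "(SM[B]i:{..<n}. dmon_term (add_mset j m) i) =
   (SM[B]i:{..<n}. (a j *[B] dmon_term m i) +[B] (if j = i then mon m *[B] e i else 0[B]))"
  using j car by (intro B.finsum_cong') (auto simp: dmon_term_add_mset)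
 also have "... = (SM[B]i:{..<n}. a j *[B] dmon_term m i) +[B]
   (SM[B]i:{..<n}. if j = i then mon m *[B] e i else 0[B])" using car by (intro B.finsum_addf) auto
 also have "(SM[B]i:{..<n}. a j *[B] dmon_term m i) = a j *[B] (SM[B]i:{..<n}. dmon_term m i)"
  using car by (intro B.finsum_rdistr[symmetric]) auto
 also have "(SM[B]i:{..<n}. if j = i then mon m *[B] e i else 0[B]) = mon m *[B] e j" using j e by (intro B.finsum_singleton) auto
 finally show ?case using add by (simp add: D.mon_add_mset mon_add_mset)
qed

definition dconst :: "(nat multiset => _) => _" where
 "dconst f = (SM[B]m:{m. f m ~= 0[R]}. mon m *[B] d (f m))"

text \<open>Monomials without the variable \<open>i\<close> contribute nothing. Removing one
  occurrence of \<open>i\<close> from the others is the index shift of \<open>mpoly_deriv\<close>,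
  and the exponent is its factor.\<close>

lemma eval_deriv_term: assumes f: "f :[MPol R n]" and i: "i < n" shows "(SM[B]m:{m. f m ~= 0[R]}. ph (f m) *[B] dmon_term m i) =
  mev R B ph n a (mder R i f) *[B] e i"
proof -
 let ?T = "{m. f (add_mset i m) ~= 0[R]}"
 have car [simp]: "!!m. f m :[R]" and fin: "finite {m. f m ~= 0[R]}" using R.mpoly_memD[OF f] by auto
 have finT: "finite ?T" by (rule R.finite_supp_add_mset[OF fin])
 have ei [simp]: "e i :[B]" by (rule e[OF i])
 have pow: "ph ([k] \<cdot>\<^bsub>R\<^esub> r) = [k] \<cdot>\<^bsub>B\<^esub> ph r" if "r :[R]" for k :: nat and r
  using that by (induction k) (auto simp: ring_hom_add[OF phi])
 have "(SM[B]m:{m. f m ~= 0[R]}. ph (f m) *[B] dmon_term m i) =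
   (SM[B]m:add_mset i ` ?T. ph (f m) *[B] dmon_term m i)"
 proof (rule B.add.finprod_mono_neutral_cong_right[OF fin])
  fix m assume m: "m : {m. f m ~= 0[R]} - add_mset i ` ?T"
  have "i ~:# m"
  proof
   assume "i :# m" then obtain m' where "m = add_mset i m'" by (metis insert_DiffM)
   thus False using m by auto
  qed
  hence "count m i = 0" by (simp add: not_in_iff)
  thus "ph (f m) *[B] dmon_term m i = 0[B]" by (simp add: dmon_term_def)
 qed (use i in auto)
 also have "... = (SM[B]m:?T. ph (f (add_mset i m)) *[B] dmon_term (add_mset i m) i)"
  using i by (subst B.finsum_reindex) (auto simp: inj_on_def)
 also have "... = (SM[B]m:?T. (ph (mder R i f m) *[B] mon m) *[B] e i)"
 proof (intro B.finsum_cong' refl)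
  fix m
  define r k where "r = f (add_mset i m)" and "k = Suc (count m i)"
  have "r :[R]" by (simp add: r_def)
  hence "ph r *[B] ([k] \<cdot>\<^bsub>B\<^esub> (mon m *[B] e i)) = (ph ([k] \<cdot>\<^bsub>R\<^esub> r) *[B] mon m) *[B] e i"
   by (simp add: pow B.add_pow_ldistr B.add_pow_rdistr B.m_assoc)
  thus "ph (f (add_mset i m)) *[B] dmon_term (add_mset i m) i =
    (ph (mder R i f m) *[B] mon m) *[B] e i" unfolding dmon_term_def mpoly_deriv_def r_def k_def by simp
 qed auto
 also have "... = (SM[B]m:?T. ph (mder R i f m) *[B] mon m) *[B] e i" using finT by (intro B.finsum_ldistr[symmetric]) auto
 also have "(SM[B]m:?T. ph (mder R i f m) *[B] mon m) = mev R B ph n a (mder R i f)"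
  by (rule eval_superset[OF _ R.mpoly_deriv_supp, symmetric]) (use finT in simp_all)
 finally show ?thesis .
qed

text \<open>The chain rule: the second component consists of the partial derivatives paired with
  \<open>e\<close>, and of \<open>dconst f\<close>, which comes from differentiating the
  coefficients.\<close>

lemma D_eval: assumes f: "f :[MPol R n]" shows "mev R (dual B) (%r. (ph r, d r)) n (%j. (a j, e j)) f =
  (mev R B ph n a f,
  (SM[B]j:{..<n}. mev R B ph n a (mder R j f) *[B] e j) +[B] dconst f)"
proof -
 let ?S = "{m. f m ~= 0[R]}"
 have car [simp]: "!!m. f m :[R]" and fin: "finite ?S" and supp: "!!m. f m ~= 0[R] ==> set_mset m <= {..<n}"
  using R.mpoly_memD[OF f] by auto
 have "mev R (dual B) (%r. (ph r, d r)) n (%j. (a j, e j)) f =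
  (\<Oplus>\<^bsub>dual B\<^esub>m\<in>?S. (ph (f m), d (f m)) *[dual B] D.mon m)" unfolding mpoly_eval_def D.mon_def ..
 also have "... = (\<Oplus>\<^bsub>dual B\<^esub>m\<in>?S. (ph (f m) *[B] mon m,
   (ph (f m) *[B] (SM[B]i:{..<n}. dmon_term m i)) +[B] (mon m *[B] d (f m))))" by (intro D.B.finsum_cong') (auto simp: D_mon supp)
 also have "... = (SM[B]m:?S. ph (f m) *[B] mon m, SM[B]m:?S.
   (ph (f m) *[B] (SM[B]i:{..<n}. dmon_term m i)) +[B] (mon m *[B] d (f m)))" by (rule finsum_dual[OF B.cring_axioms fin]) auto
 also have "(SM[B]m:?S. (ph (f m) *[B] (SM[B]i:{..<n}. dmon_term m i)) +[B] (mon m *[B] d (f m))) =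
   (SM[B]m:?S. ph (f m) *[B] (SM[B]i:{..<n}. dmon_term m i)) +[B] dconst f" unfolding dconst_def by auto
 also have "(SM[B]m:?S. ph (f m) *[B] (SM[B]i:{..<n}. dmon_term m i)) =
   (SM[B]m:?S. SM[B]i:{..<n}. ph (f m) *[B] dmon_term m i)" by (intro B.finsum_cong' B.finsum_rdistr) auto
 also have "... = (SM[B]i:{..<n}. SM[B]m:?S. ph (f m) *[B] dmon_term m i)" using fin by (intro B.finsum_swap) auto
 also have "... = (SM[B]j:{..<n}. mev R B ph n a (mder R j f) *[B] e j)" using e by (intro B.finsum_cong' eval_deriv_term[OF f]) auto
 finally show ?thesis by (simp add: mpoly_eval_def mon_def)
qed

end

subsection \<open>Derivations on standard smooth algebras\<close>

text \<open>The witnesses of \<open>standard_smooth\<close> become parameters. The Jacobian solves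
  for the first \<open>c\<close> generators; the generators \<open>a l\<close> with
  \<open>c <= l < n\<close> will serve as coordinates.\<close>

definition spres ::
 "'r ring => 's ring => ('r => 's) => nat => nat => (nat => nat multiset => 'r) => (nat => 's) =>
  (nat => nat => 's) => bool" where
 "spres R A ph n c F a N \<longleftrightarrow> ph : ring_hom R A & c <= n &
  (ALL i<c. F i :[MPol R n]) & (ALL j<n. a j :[A]) &
  mev R A ph n a ` car (MPol R n) = car A &
  {g : car (MPol R n). mev R A ph n a g = 0[A]} =
   genideal (MPol R n) (F ` {..<c}) &
  (ALL i<c. ALL j<c. N i j :[A]) &
  (ALL i<c. ALL l<c.
   (SM[A]j:{..<c}. mev R A ph n a (mder R j (F i)) *[A] N j l) =
    (if i = l then 1[A] else 0[A]))"

lemma standard_smooth_iff: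
 "standard_smooth R A ph \<longleftrightarrow> (EX n c F a N. spres R A ph n c F a N)" unfolding standard_smooth_def spres_def by simp

locale smooth_algebra = R: coeff_ring R + A: cring A + B: cring B
 for R :: "'r ring" and A :: "'s ring" and B :: "'b ring" +
 fixes ph n c F a N ps assumes pres: "spres R A ph n c F a N" and psi: "ps : ring_hom A B"
begin

lemma phi: "ph : ring_hom R A" using pres unfolding spres_def by auto

lemma cn: "c <= n" using pres unfolding spres_def by auto

lemma F: "i < c ==> F i :[MPol R n]" using pres unfolding spres_def by auto

lemma a [simp]: "j < n ==> a j :[A]" using pres unfolding spres_def by auto

lemma surj: "mev R A ph n a ` car (MPol R n) = car A" using pres unfolding spres_def by auto

lemma ker: "{g : car (MPol R n). mev R A ph n a g = 0[A]} =
  genideal (MPol R n) (F ` {..<c})" using pres unfolding spres_def by auto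

lemma N [simp]: "i < c ==> j < c ==> N i j :[A]" using pres unfolding spres_def by auto

lemma JN: "i < c ==> l < c ==>
  (SM[A]j:{..<c}. mev R A ph n a (mder R j (F i)) *[A] N j l) =
   (if i = l then 1[A] else 0[A])" using pres unfolding spres_def by auto

lemma psi_closed [simp]: "x :[A] ==> ps x :[B]" using psi by (rule ring_hom_closed)

sublocale EA: mpoly_hom R A ph n a by (intro mpoly_hom.intro mpoly_hom_axioms.intro R.coeff_ring_axioms A.cring_axioms phi a)

lemma psi_phi: "(%r. ps (ph r)) : ring_hom R B" using ring_hom_trans[OF phi psi] by (simp add: comp_def)

sublocale EB: mpoly_hom R B "%r. ps (ph r)" n "%j. ps (a j)"
 by (intro mpoly_hom.intro mpoly_hom_axioms.intro R.coeff_ring_axioms B.cring_axioms psi_phi) simp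

sublocale psi: ring_hom_cring A B ps by (rule ring_hom_cring.intro[OF A.cring_axioms B.cring_axioms ring_hom_cring_axioms.intro[OF psi]])

abbreviation J :: "nat => nat => 'b" where
 "J i j == mev R B (%r. ps (ph r)) n (%j. ps (a j)) (mder R j (F i))"

lemma F_coeff [simp]: "i < c ==> F i m :[R]" using R.mpoly_memD(1)[OF F] .

lemma J_eq: "i < c ==> ps (mev R A ph n a (mder R j (F i))) = J i j"
 using finite_subset[OF R.mpoly_deriv_supp R.finite_supp_add_mset[OF R.mpoly_memD(2)[OF F]]]
 by (intro EA.hom_eval[OF B.cring_axioms psi]) auto

lemma eval_F: "i < c ==> mev R A ph n a (F i) = 0[A]"
proof -
 assume i: "i < c"
 interpret P: cring "MPol R n" by (rule R.mpoly_cring)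
 have "F i : genideal (MPol R n) (F ` {..<c})" using P.genideal_self[of "F ` {..<c}"] i F by auto
 thus ?thesis using ker by blast
qed

text \<open>The solution is the given right inverse applied to \<open>w\<close>. The entries of this
  inverse are carried to \<open>B\<close> by \<open>ps\<close>, so the system is solvable over every
  target of derivations.\<close>

lemma jacobian_solve: assumes w: "!!i. i < c ==> w i :[B]"
 obtains v where "!!j. j < c ==> v j :[B]" "!!i. i < c ==> (SM[B]j:{..<c}. J i j *[B] v j) = w i"
proof
 let ?v = "%j. SM[B]l:{..<c}. ps (N j l) *[B] w l"
 show "?v j :[B]" if "j < c" for j using that w by auto
 fix i assume i: "i < c"
 have "(SM[B]j:{..<c}. J i j *[B] ?v j) = (SM[B]j:{..<c}. SM[B]l:{..<c}. (J i j *[B] ps (N j l)) *[B] w l)"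
 proof (rule B.finsum_cong')
  fix j assume "j : {..<c}"
  hence "J i j *[B] ?v j = (SM[B]l:{..<c}. J i j *[B] (ps (N j l) *[B] w l))" using i w by (intro B.finsum_rdistr) auto
  also have "... = (SM[B]l:{..<c}. (J i j *[B] ps (N j l)) *[B] w l)"
   using i w \<open>j \<in> {..<c}\<close> by (intro B.finsum_cong') (auto simp: B.m_assoc)
  finally show "J i j *[B] ?v j = (SM[B]l:{..<c}. (J i j *[B] ps (N j l)) *[B] w l)" .
 qed (use i w in auto)
 also have "... = (SM[B]l:{..<c}. SM[B]j:{..<c}. (J i j *[B] ps (N j l)) *[B] w l)" using i w by (intro B.finsum_swap) auto
 also have "... = (SM[B]l:{..<c}. if i = l then w l else 0[B])"
 proof (rule B.finsum_cong')
  fix l assume l: "l : {..<c}"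
  have "(SM[B]j:{..<c}. (J i j *[B] ps (N j l)) *[B] w l) = (SM[B]j:{..<c}. J i j *[B] ps (N j l)) *[B] w l"
   using i w l by (intro B.finsum_ldistr[symmetric]) auto
  also have "(SM[B]j:{..<c}. J i j *[B] ps (N j l)) =
    (SM[B]j:{..<c}. ps (mev R A ph n a (mder R j (F i)) *[A] N j l))" using i l by (intro B.finsum_cong') (auto simp: J_eq)
  also have "... = ps (SM[A]j:{..<c}. mev R A ph n a (mder R j (F i)) *[A] N j l)" using i l by (subst psi.hom_finsum) (auto simp: comp_def)
  also have "... = (if i = l then 1[B] else 0[B])" using JN[of i l] i l by simp
  finally show "(SM[B]j:{..<c}. (J i j *[B] ps (N j l)) *[B] w l) = (if i = l then w l else 0[B])" using w l by auto
 qed (use w in auto)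
 also have "... = w i" using i w by (intro B.finsum_singleton) auto
 finally show "(SM[B]j:{..<c}. J i j *[B] ?v j) = w i" .
qed

text \<open>Applying \<open>de\<close> to the relations gives a homogeneous linear system for the
  values at the first \<open>c\<close> generators, with the Jacobian as its matrix. Over a local
  ring the only solution is zero.\<close>

lemma derivation_zero: assumes local: "is_local_ring B" and d: "der A B ps de"
  and zero: "!!r. r :[R] ==> de (ph r) = 0[B]" "!!l. c <= l ==> l < n ==> de (a l) = 0[B]" and x: "x :[A]" shows "de x = 0[B]"
proof -
 have h: "(%x. (ps x, de x)) : ring_hom A (dual B)" using der_iff_ring_hom[OF A.cring_axioms B.cring_axioms psi] d by blast
 have dc [simp]: "y :[A] ==> de y :[B]" for y using d by (auto simp: der_def)
 have dph: "der R B (%r. ps (ph r)) (%r. de (ph r))" using d by (auto simp: der_def ring_hom_add[OF phi] ring_hom_mult[OF phi])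
 interpret E: mpoly_der R B "%r. ps (ph r)" n "%j. ps (a j)" "%r. de (ph r)" "%j. de (a j)" by unfold_locales (use dph in auto)
 have const: "E.dconst f = 0[B]" if "f :[MPol R n]" for f unfolding E.dconst_def using R.mpoly_memD(1)[OF that] zero(1) by auto
 have hev: "(ps (mev R A ph n a f), de (mev R A ph n a f)) =
   (mev R B (%r. ps (ph r)) n (%j. ps (a j)) f,
   (SM[B]j:{..<n}. mev R B (%r. ps (ph r)) n (%j. ps (a j)) (mder R j f) *[B] de (a j)) +[B] E.dconst f)"
  if "f :[MPol R n]" for f using EA.hom_eval[OF dual_cring[OF B.cring_axioms] h, of f] R.mpoly_memD[OF that] E.D_eval[OF that] by simp
 have "ALL j:{..<c}. de (a j) = 0[B]"
 proof (rule local_ring_square_surj_imp_inj[OF local, where I = "{..<c}" and J = J])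
  fix i assume "i : {..<c}"
  hence i: "i < c" by simp
  have "(SM[B]j:{..<c}. J i j *[B] de (a j)) = (SM[B]j:{..<n}. J i j *[B] de (a j))"
   using cn i zero(2) by (intro B.add.finprod_mono_neutral_cong_left) auto
  also have "... = de (mev R A ph n a (F i))" using hev[OF F[OF i]] const[OF F[OF i]] i by auto
  also have "... = 0[B]" using eval_F[OF i] der_zero[OF d A.cring_axioms B.cring_axioms] by simp
  finally show "(SM[B]j:{..<c}. J i j *[B] de (a j)) = 0[B]" .
 next
  fix w assume w: "w : {..<c} \<rightarrow> car B"
  obtain v where "!!j. j < c ==> v j :[B]" "!!i. i < c ==> (SM[B]j:{..<c}. J i j *[B] v j) = w i" using jacobian_solve[of w] w by blast
  thus "EX v:{..<c} \<rightarrow> car B. ALL i:{..<c}. (SM[B]j:{..<c}. J i j *[B] v j) = w i" by auto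
 qed (use cn in auto)
 hence zero': "de (a j) = 0[B]" if "j < n" for j using zero(2) that by (cases "j < c") auto
 obtain f where f: "f :[MPol R n]" "x = mev R A ph n a f" using surj x by blast
 have "(SM[B]j:{..<n}. mev R B (%r. ps (ph r)) n (%j. ps (a j)) (mder R j f) *[B] de (a j)) = 0[B]"
  using zero' R.mpoly_memD(1)[OF f(1)] by (intro B.add.finprod_one_eqI) auto
 thus ?thesis using hev[OF f(1)] f(2) const[OF f(1)] by simp
qed

text \<open>The values at the first \<open>c\<close> generators are chosen so that evaluation in the
  dual numbers kills the relations. It then factors through the quotient \<open>A\<close> of the
  polynomial ring.\<close>

lemma derivation_extend: assumes d: "der R B (%r. ps (ph r)) d" and e0: "!!l. c <= l ==> l < n ==> e0 l :[B]"
 obtains de where "der A B ps de" "!!r. r :[R] ==> de (ph r) = d r"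
  "!!l. c <= l ==> l < n ==> de (a l) = e0 l"
proof -
 have dc [simp]: "r :[R] ==> d r :[B]" for r using d by (auto simp: der_def)
 let ?cst = "%f. SM[B]m:{m. f m ~= 0[R]}. EB.mon m *[B] d (f m)"
 \<comment> \<open>The right hand side is forced: the derivative of \<open>F i\<close> has a part
   from the coordinates and a part from the coefficients, and the part from the first
   \<open>c\<close> generators must cancel both.\<close>
 let ?w = "%i. -[B] ((SM[B]j:{c..<n}. J i j *[B] e0 j) +[B] ?cst (F i))"
 have wc: "(SM[B]j:{c..<n}. J i j *[B] e0 j) :[B]" "?cst (F i) :[B]" if "i < c" for i using that e0 by auto
 obtain v where v: "!!j. j < c ==> v j :[B]" "!!i. i < c ==> (SM[B]j:{..<c}. J i j *[B] v j) = ?w i" using jacobian_solve[of ?w] wc by auto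
 define e where "e j = (if j < c then v j else e0 j)" for j
 have e: "e j :[B]" if "j < n" for j using that v(1) e0 by (auto simp: e_def)
 interpret E: mpoly_der R B "%r. ps (ph r)" n "%j. ps (a j)" d e by unfold_locales (use d e in auto)
 let ?K = "mev R (dual B) (%r. (ps (ph r), d r)) n (%j. (ps (a j), e j))"
 let ?P = "MPol R n"
 interpret P: cring ?P by (rule R.mpoly_cring)
 interpret K: ring_hom_cring ?P "dual B" ?K
  by (rule ring_hom_cring.intro[OF P.cring_axioms E.D.B.cring_axioms ring_hom_cring_axioms.intro[OF E.D.eval_ring_hom]])
 interpret V: ring_hom_cring ?P A "mev R A ph n a"
  by (rule ring_hom_cring.intro[OF P.cring_axioms A.cring_axioms ring_hom_cring_axioms.intro[OF EA.eval_ring_hom]])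
 have fstK: "fst (?K f) = ps (mev R A ph n a f)" if "f :[?P]" for f
  using E.D_eval[OF that] EA.hom_eval[OF B.cring_axioms psi] R.mpoly_memD[OF that] by simp
 have KF: "?K (F i) = 0[dual B]" if i: "i < c" for i
 proof -
  have sum: "(SM[B]j:{..<n}. J i j *[B] e j) = ?w i +[B] (SM[B]j:{c..<n}. J i j *[B] e0 j)"
  proof -
   have "(SM[B]j:{..<n}. J i j *[B] e j) = (SM[B]j:{..<c} Un {c..<n}. J i j *[B] e j)" using cn by (simp add: ivl_disj_un)
   also have "... = (SM[B]j:{..<c}. J i j *[B] e j) +[B] (SM[B]j:{c..<n}. J i j *[B] e j)" using i cn e by (intro B.finsum_Un_disjoint) auto
   also have "(SM[B]j:{..<c}. J i j *[B] e j) = (SM[B]j:{..<c}. J i j *[B] v j)" using i v by (intro B.finsum_cong') (auto simp: e_def)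
   also have "(SM[B]j:{c..<n}. J i j *[B] e j) = (SM[B]j:{c..<n}. J i j *[B] e0 j)" using i e0 by (intro B.finsum_cong') (auto simp: e_def)
   finally show ?thesis using v(2)[OF i] by simp
  qed
  have "snd (?K (F i)) = ?w i +[B] (SM[B]j:{c..<n}. J i j *[B] e0 j) +[B] ?cst (F i)"
   unfolding E.D_eval[OF F[OF i]] E.dconst_def sum by simp
  also have "... = 0[B]" using wc[OF i] by (simp add: B.a_assoc B.l_neg)
  finally show ?thesis using fstK[OF F[OF i]] eval_F[OF i] by (simp add: prod_eq_iff)
 qed
 have "genideal ?P (F ` {..<c}) <= a_kernel ?P (dual B) ?K"
 proof (intro P.genideal_minimal K.ring.kernel_is_ideal subsetI)
  fix x assume "x : F ` {..<c}"
  thus "x : a_kernel ?P (dual B) ?K" using F KF unfolding a_kernel_def' by blast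
 qed
 hence Kker: "?K g = 0[dual B]" if "g :[?P]" "mev R A ph n a g = 0[A]" for g using that ker unfolding a_kernel_def' by blast
 have Keq: "?K f = ?K g" if fg: "f :[?P]" "g :[?P]" "mev R A ph n a f = mev R A ph n a g" for f g
 proof -
  have "mev R A ph n a (f -[?P] g) = 0[A]" using fg by auto
  hence "?K (f -[?P] g) = 0[dual B]" using fg by (intro Kker) auto
  thus ?thesis using fg(1,2) by (simp del: dual_simps)
 qed
 \<comment> \<open>\<open>g\<close> picks a polynomial that represents \<open>x\<close>. By
   \<open>Keq\<close> the evaluation does not depend on the choice, so it is additive and
   multiplicative in \<open>x\<close>.\<close>
 define g where "g x = (SOME f. f :[?P] & mev R A ph n a f = x)" for x
 have g: "g x :[?P] & mev R A ph n a (g x) = x" if "x :[A]" for x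
 proof -
  have "EX f. f :[?P] & mev R A ph n a f = x" using that surj by (metis imageE)
  thus ?thesis unfolding g_def by rule
 qed
 have Kg: "?K (g x) = (ps x, snd (?K (g x)))" if "x :[A]" for x using fstK[of "g x"] g[OF that] by (metis prod.collapse)
 have val: "snd (?K (g (mev R A ph n a f))) = snd (?K f)" if "f :[?P]" for f using Keq[of "g (mev R A ph n a f)" f] g that by auto
 show ?thesis
 proof
  show "der A B ps (%x. snd (?K (g x)))" unfolding der_def
  proof (intro conjI ballI Pi_I)
   fix x assume x: "x :[A]"
   show "snd (?K (g x)) :[B]" using K.hom_closed[of "g x"] g[OF x] by auto
   fix y assume y: "y :[A]"
   have "?K (g (x +[A] y)) = ?K (g x +[?P] g y)" using g[OF x] g[OF y] g[of "x +[A] y"] x y by (intro Keq) auto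
   also have "... = (ps x, snd (?K (g x))) +[dual B] (ps y, snd (?K (g y)))" using g[OF x] g[OF y] Kg[OF x] Kg[OF y] by auto
   finally show "snd (?K (g (x +[A] y))) = snd (?K (g x)) +[B] snd (?K (g y))" by simp
   have "?K (g (x *[A] y)) = ?K (g x *[?P] g y)" using g[OF x] g[OF y] g[of "x *[A] y"] x y by (intro Keq) auto
   also have "... = (ps x, snd (?K (g x))) *[dual B] (ps y, snd (?K (g y)))" using g[OF x] g[OF y] Kg[OF x] Kg[OF y] by auto
   finally show "snd (?K (g (x *[A] y))) = (ps x *[B] snd (?K (g y))) +[B] (ps y *[B] snd (?K (g x)))" by simp
  qed
 next
  fix r assume r: "r :[R]"
  let ?f = "%m::nat multiset. if m = {#} then r else 0[R]"
  have "?f :[?P]" using r by (auto simp: R.mpoly_ring_simps)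
  hence "snd (?K (g (ph r))) = snd (?K ?f)" using val[of ?f] EA.eval_monom[OF r, of "{#}"] r by simp
  also have "... = d r" using E.D.eval_monom[OF r, of "{#}"] r by simp
  finally show "snd (?K (g (ph r))) = d r" .
 next
  fix l assume l: "c <= l" "l < n"
  let ?f = "%m. if m = {#l#} then 1[R] else 0[R]"
  have "?f :[?P]" using l by (auto simp: R.mpoly_ring_simps)
  hence "snd (?K (g (a l))) = snd (?K ?f)"
   using val[of ?f] EA.eval_monom[of "1[R]" "{#l#}"] l ring_hom_one[OF phi] by (simp add: EA.mon_single)
  also have "... = e0 l" using E.D.eval_monom[of "1[R]" "{#l#}"] l ring_hom_one[OF E.D.phi] e[OF l(2)]
   by (simp add: E.D.mon_single) (simp add: e_def)
  finally show "snd (?K (g (a l))) = e0 l" .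
 qed
qed

end

section \<open>Germs and stalks\<close>

lemma UN_const_eq: "a : A ==> (!!x. x : A ==> f x = c) ==> (UN x:A. f x) = c" by auto

locale presheaf_on =
 fixes T :: "'a topology" and F :: "'a set => 's set" and r :: "'a set => 'a set => 's => 's"
 assumes restr_closed: "[|openin T U; openin T V; V <= U; s : F U|] ==> r U V s : F V"
  and restr_id: "[|openin T U; s : F U|] ==> r U U s = s"
  and restr_comp: "[|openin T U; openin T V; openin T W; W <= V; V <= U; s : F U|] ==>
    r V W (r U V s) = r U W s"

lemmas presheaf_onD = presheaf_on.restr_closed presheaf_on.restr_id presheaf_on.restr_comp

lemma sheaf_on_presheaf: assumes "sheaf_on T F r" shows "presheaf_on T F r"
proof
 have 1: "ALL U V. openin T U & openin T V & V <= U --> r U V : F U \<rightarrow> F V" using assms unfolding sheaf_on_def by auto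
 show "r U V s : F V" if "openin T U" "openin T V" "V <= U" "s : F U" for U V s using 1 that by auto
 have 2: "ALL U s. openin T U & s : F U --> r U U s = s" using assms unfolding sheaf_on_def by auto
 show "r U U s = s" if "openin T U" "s : F U" for U s using 2 that by simp
 have 3: "ALL U V W s. openin T U & openin T V & openin T W & W <= V & V <= U & s : F U -->
   r V W (r U V s) = r U W s" using assms unfolding sheaf_on_def by auto
 show "r V W (r U V s) = r U W s"
  if "openin T U" "openin T V" "openin T W" "W <= V" "V <= U" "s : F U" for U V W s using 3 that by simp
qed

lemma sheaf_on_ex1: assumes "sheaf_on T F r" "!!U. U : \<U> ==> openin T U" "!!U. U : \<U> ==> s U : F U"
  "!!U V. U : \<U> ==> V : \<U> ==> r U (U Int V) (s U) = r V (U Int V) (s V)"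
 shows "EX! t. t : F (\<Union>\<U>) & (ALL U:\<U>. r (\<Union>\<U>) U t = s U)"
proof -
 have "ALL \<U> s. (ALL U:\<U>. openin T U & s U : F U) &
    (ALL U:\<U>. ALL V:\<U>. r U (U Int V) (s U) = r V (U Int V) (s V)) -->
    (EX! t. t : F (\<Union>\<U>) & (ALL U:\<U>. r (\<Union>\<U>) U t = s U))" using assms(1) unfolding sheaf_on_def by (elim conjE)
 note imp = this[rule_format, of \<U> s]
 show ?thesis by (rule imp) (intro conjI ballI; rule assms(2-); assumption)
qed

lemma germ_mem:
 "(V, t) : germ T F r x U s \<longleftrightarrow> openin T V & x : V & t : F V &
  (EX W. openin T W & x : W & W <= U & W <= V & r U W s = r V W t)" by (auto simp: germ_def)

context
 fixes T :: "'a topology" and F :: "'a set => 's set" and r assumes F: "presheaf_on T F r"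
begin

lemma germ_self: "openin T U ==> x : U ==> s : F U ==> (U, s) : germ T F r x U s" by (auto simp: germ_mem)

lemma germ_eqI: assumes "openin T U" "openin T V" "s : F U" "t : F V" "openin T W" "x : W" "W <= U" "W <= V"
  "r U W s = r V W t" shows "germ T F r x U s = germ T F r x V t"
proof -
 have "germ T F r x U s <= germ T F r x V t"
  if "openin T U" "openin T V" "s : F U" "t : F V" "W <= U" "W <= V" "r U W s = r V W t" for U V s t
 proof (rule subrelI)
  fix V' t' assume "(V', t') : germ T F r x U s"
  then obtain W' where V': "openin T V'" "x : V'" "t' : F V'"
   and W': "openin T W'" "x : W'" "W' <= U" "W' <= V'" "r U W' s = r V' W' t'" by (auto simp: germ_mem)
  let ?N = "W Int W'"
  have N: "openin T ?N" "x : ?N" "?N <= W" "?N <= W'" "?N <= V" "?N <= V'" using assms(5,6) W' that by auto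
  have "r V ?N t = r V' ?N t'" using presheaf_onD(3)[OF F that(1) assms(5) N(1,3) that(5,3)]
    presheaf_onD(3)[OF F that(2) assms(5) N(1,3) that(6,4)] presheaf_onD(3)[OF F that(1) W'(1) N(1,4) W'(3) that(3)]
    presheaf_onD(3)[OF F V'(1) W'(1) N(1,4) W'(4) V'(3)] that(7) W'(5) by metis
  thus "(V', t') : germ T F r x V t" unfolding germ_mem using V' N by blast
 qed
 from this[OF assms(1-4,7-9)] this[OF assms(2,1,4,3,8,7) assms(9)[symmetric]] show ?thesis by blast
qed

lemma germ_eqD: assumes "openin T V" "x : V" "t : F V" "germ T F r x U s = germ T F r x V t"
 obtains W where "openin T W" "x : W" "W <= U" "W <= V" "r U W s = r V W t"
 using germ_self[OF assms(1-3)] unfolding assms(4)[symmetric] germ_mem by blast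

lemma germ_memD: assumes "openin T U" "s : F U" "(V, t) : germ T F r x U s"
 shows "openin T V" "x : V" "t : F V" "germ T F r x V t = germ T F r x U s" using assms germ_eqI[of V U t s _ x] by (auto simp: germ_mem)

lemma germ_restrict: assumes "openin T U" "openin T V" "V <= U" "x : V" "s : F U" shows "germ T F r x V (r U V s) = germ T F r x U s"
 by (rule germ_eqI[of _ _ _ _ V]) (use assms presheaf_onD[OF F] in auto)

lemma stalk_mem:
 "bb : stalk T F r x \<longleftrightarrow> (EX U s. openin T U & x : U & s : F U & bb = germ T F r x U s)" by (auto simp: stalk_def)

lemma stalk_shrink: assumes "bb : stalk T F r x" "openin T U" "x : U"
 obtains W s where "openin T W" "x : W" "W <= U" "s : F W" "bb = germ T F r x W s"
proof -
 obtain V t where V: "openin T V" "x : V" "t : F V" "bb = germ T F r x V t" using assms(1) by (auto simp: stalk_mem)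
 show ?thesis by (rule that[of "U Int V" "r V (U Int V) t"])
   (use V assms germ_restrict[of V "U Int V" x t] presheaf_onD(1)[OF F V(1) openin_Int[OF assms(2) V(1)] _ V(3)] in auto)
qed

end

text \<open>Maps of germs are written as unions over all representatives, and this evaluates such a
  union at one of them. The map \<open>p\<close> on neighbourhoods covers preimages, intersections
  with a fixed open set and the identity.\<close>

lemma germ_op1: assumes F: "presheaf_on T F rF" and H: "presheaf_on T' H rH"
  and p: "!!V. openin T V ==> openin T' (p V)" "!!V. openin T V ==> y : V ==> x : p V"
   "!!V W. openin T V ==> openin T W ==> W <= V ==> p W <= p V" and op: "!!V s. openin T V ==> s : F V ==> op V s : H (p V)"
   "!!V W s. openin T V ==> openin T W ==> W <= V ==> s : F V ==>
    op W (rF V W s) = rH (p V) (p W) (op V s)" and s: "openin T V" "y : V" "s : F V"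
 shows "(UN (V, s):germ T F rF y V s. germ T' H rH x (p V) (op V s)) = germ T' H rH x (p V) (op V s)"
proof -
 have "germ T' H rH x (p V') (op V' s') = germ T' H rH x (p V) (op V s)"
  if m: "(V', s') : germ T F rF y V s" for V' s'
 proof -
  obtain W where V': "openin T V'" "y : V'" "s' : F V'" and W: "openin T W" "y : W" "W <= V" "W <= V'" "rF V W s = rF V' W s'"
   using m unfolding germ_mem by blast
  show ?thesis by (rule germ_eqI[OF H, of _ _ _ _ "p W"])
    (use V' W s p op(1) op(2)[of V W s] op(2)[of V' W s'] in auto)
 qed
 thus ?thesis by (intro UN_const_eq[OF germ_self[OF F s]]) auto
qed

text \<open>Binary operations on germs can be computed on any common neighbourhood \<open>W\<close>.
  Two choices are compared on the intersection of all neighbourhoods involved.\<close>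

lemma germ_op2: assumes F: "presheaf_on T F rF" and G: "presheaf_on T G rG" and H: "presheaf_on T H rH"
  and op: "!!U s t. openin T U ==> s : F U ==> t : G U ==> op U s t : H U"
   "!!U V s t. openin T U ==> openin T V ==> V <= U ==> s : F U ==> t : G U ==>
    rH U V (op U s t) = op V (rF U V s) (rG U V t)" and s: "openin T U" "s : F U" and t: "openin T V" "t : G V"
  and W: "openin T W" "x : W" "W <= U" "W <= V" shows "(UN (U, s):germ T F rF x U s. UN (V, t):germ T G rG x V t.
   germ T H rH x (U Int V) (op (U Int V) (rF U (U Int V) s) (rG V (U Int V) t))) =
  germ T H rH x W (op W (rF U W s) (rG V W t))"
proof -
 have eq: "germ T H rH x (U' Int V') (op (U' Int V') (rF U' (U' Int V') s') (rG V' (U' Int V') t')) =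
   germ T H rH x W (op W (rF U W s) (rG V W t))"
  if m: "(U', s') : germ T F rF x U s" "(V', t') : germ T G rG x V t" for U' s' V' t'
 proof -
  obtain A where U': "openin T U'" "x : U'" "s' : F U'" and A: "openin T A" "x : A" "A <= U" "A <= U'" "rF U A s = rF U' A s'"
   using m(1) unfolding germ_mem by blast
  obtain B where V': "openin T V'" "x : V'" "t' : G V'" and B: "openin T B" "x : B" "B <= V" "B <= V'" "rG V B t = rG V' B t'"
   using m(2) unfolding germ_mem by blast
  let ?N = "A Int B Int W"
  have N: "openin T ?N" "x : ?N" "openin T (U' Int V')" "?N <= A" "?N <= B" using A B W U' V' by auto
  have F_eq: "rF U ?N s = rF U' ?N s'"
   using presheaf_onD(3)[OF F s(1) A(1) N(1,4) A(3) s(2)] presheaf_onD(3)[OF F U'(1) A(1) N(1,4) A(4) U'(3)] A(5) by metis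
  have G_eq: "rG V ?N t = rG V' ?N t'"
   using presheaf_onD(3)[OF G t(1) B(1) N(1,5) B(3) t(2)] presheaf_onD(3)[OF G V'(1) B(1) N(1,5) B(4) V'(3)] B(5) by metis
  have cl: "rF U W s : F W" "rG V W t : G W" "rF U' (U' Int V') s' : F (U' Int V')" "rG V' (U' Int V') t' : G (U' Int V')"
   using presheaf_onD(1)[OF F] presheaf_onD(1)[OF G] s t W U' V' N by auto
  have "rH (U' Int V') ?N (op (U' Int V') (rF U' (U' Int V') s') (rG V' (U' Int V') t')) = op ?N (rF U' ?N s') (rG V' ?N t')"
   using op(2)[OF N(3,1) _ cl(3,4)] presheaf_onD(3)[OF F U'(1) N(3,1) _ _ U'(3)]
    presheaf_onD(3)[OF G V'(1) N(3,1) _ _ V'(3)] A B by auto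
  moreover have "rH W ?N (op W (rF U W s) (rG V W t)) = op ?N (rF U ?N s) (rG V ?N t)"
   using op(2)[OF W(1) N(1) _ cl(1,2)] presheaf_onD(3)[OF F s(1) W(1) N(1) _ W(3) s(2)]
    presheaf_onD(3)[OF G t(1) W(1) N(1) _ W(4) t(2)] by auto
  ultimately show ?thesis by (intro germ_eqI[OF H N(3) W(1) op(1)[OF N(3) cl(3,4)] op(1)[OF W(1) cl(1,2)] N(1,2)])
    (use A B F_eq G_eq in auto)
 qed
 have "x : U" "x : V" using W by auto
 hence "(U, s) : germ T F rF x U s" "(V, t) : germ T G rG x V t" using germ_self[OF F s(1) _ s(2)] germ_self[OF G t(1) _ t(2)] by auto
 have "(UN (V, t):germ T G rG x V t.
   germ T H rH x (U' Int V) (op (U' Int V) (rF U' (U' Int V) s') (rG V (U' Int V) t))) =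
  germ T H rH x W (op W (rF U W s) (rG V W t))" if "(U', s') : germ T F rF x U s" for U' s'
  using \<open>(V, t) \<in> germ T G rG x V t\<close> by (rule UN_const_eq) (use eq[OF that] in auto)
 thus ?thesis by (intro UN_const_eq[OF \<open>(U, s) \<in> germ T F rF x U s\<close>]) auto
qed

lemma sheaf_on_eqI: assumes F: "sheaf_on T F r" and U: "openin T U" "s : F U" "t : F U"
  and eq: "!!x. x : U ==> germ T F r x U s = germ T F r x U t" shows "s = t"
proof -
 note P = sheaf_on_presheaf[OF F]
 define \<U> where "\<U> = {W. openin T W & W <= U & r U W s = r U W t}"
 have cover: "\<Union>\<U> = U"
 proof (intro equalityI subsetI)
  fix x assume x: "x : U"
  obtain W where "openin T W" "x : W" "W <= U" "r U W s = r U W t" by (rule germ_eqD[OF P U(1) x U(3) eq[OF x]])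
  thus "x : \<Union>\<U>" by (auto simp: \<U>_def)
 qed (auto simp: \<U>_def)
 have "EX! u. u : F (\<Union>\<U>) & (ALL W:\<U>. r (\<Union>\<U>) W u = r U W s)"
 proof (rule sheaf_on_ex1[OF F])
  fix V W assume "V : \<U>" "W : \<U>"
  hence VW: "openin T V" "openin T W" "V <= U" "W <= U" "openin T (V Int W)" by (auto simp: \<U>_def)
  show "r V (V Int W) (r U V s) = r W (V Int W) (r U W s)"
   using presheaf_onD(3)[OF P U(1) VW(1,5) _ VW(3) U(2)] presheaf_onD(3)[OF P U(1) VW(2,5) _ VW(4) U(2)] by auto
 qed (use presheaf_onD(1)[OF P U(1)] U in "auto simp: \<U>_def")
 thus ?thesis using U(2,3) unfolding cover by (auto simp: \<U>_def)
qed

text \<open>Prescribing germs instead of sections makes agreement on overlaps automatic, because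
  sections with the same germs coincide by \<open>sheaf_on_eqI\<close>.\<close>

lemma sheaf_on_glue: assumes F: "sheaf_on T F r" and U: "openin T U"
  and loc: "!!x. x : U ==> EX W s. openin T W & x : W & W <= U & s : F W & (ALL z:W. germ T F r z W s = g z)"
 obtains s where "s : F U" "!!z. z : U ==> germ T F r z U s = g z"
proof -
 note P = sheaf_on_presheaf[OF F]
 define ok where "ok W s \<longleftrightarrow> openin T W & W <= U & s : F W & (ALL z:W. germ T F r z W s = g z)" for W s
 define \<U> where "\<U> = {W. EX s. ok W s}"
 define s where "s W = (SOME s. ok W s)" for W
 have ok: "ok W (s W)" if "W : \<U>" for W using that someI_ex[of "ok W"] unfolding \<U>_def s_def by blast
 have cover: "\<Union>\<U> = U"
 proof (intro equalityI subsetI)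
  fix x assume "x : U"
  from loc[OF this] obtain W s where "x : W" "ok W s" unfolding ok_def by auto
  thus "x : \<Union>\<U>" unfolding \<U>_def by blast
 qed (auto simp: \<U>_def ok_def)
 have "EX! t. t : F (\<Union>\<U>) & (ALL W:\<U>. r (\<Union>\<U>) W t = s W)"
 proof (rule sheaf_on_ex1[OF F])
  fix V W assume "V : \<U>" "W : \<U>"
  hence VW: "ok V (s V)" "ok W (s W)" using ok by auto
  hence o: "openin T V" "openin T W" "openin T (V Int W)" "s V : F V" "s W : F W" by (auto simp: ok_def)
  show "r V (V Int W) (s V) = r W (V Int W) (s W)"
  proof (rule sheaf_on_eqI[OF F o(3)])
   fix x assume "x : V Int W"
   thus "germ T F r x (V Int W) (r V (V Int W) (s V)) = germ T F r x (V Int W) (r W (V Int W) (s W))"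
    using VW germ_restrict[OF P o(1,3) _ _ o(4), of x] germ_restrict[OF P o(2,3) _ _ o(5), of x] by (auto simp: ok_def)
  qed (use presheaf_onD(1)[OF P] o in auto)
 qed (use ok ok_def in auto)
 then obtain t where t: "t : F U" "!!W. W : \<U> ==> r U W t = s W" unfolding cover by blast
 have "germ T F r z U t = g z" if z: "z : U" for z
 proof -
  obtain W where W: "W : \<U>" "z : W" using z cover by blast
  have o: "ok W (s W)" by (rule ok[OF W(1)])
  hence "germ T F r z U t = germ T F r z W (s W)" using germ_restrict[OF P U _ _ W(2) t(1)] t(2)[OF W(1)] by (auto simp: ok_def)
  thus ?thesis using o W(2) by (simp add: ok_def)
 qed
 thus ?thesis using t(1) that by blast
qed

subsection \<open>Stalks of ringed spaces\<close>

locale ringed = fixes X :: "('a, 'b) ringed_space" assumes ringed: "is_ringed_space X"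
begin

abbreviation "\<O> == %U. car (sect X U)"

lemma sect_cring: "opn X U ==> cring (sect X U)" using ringed by (auto simp: is_ringed_space_def)

lemma rst_hom: "opn X U ==> opn X V ==> V <= U ==> rst X U V : ring_hom (sect X U) (sect X V)"
 using ringed by (auto simp: is_ringed_space_def)

lemma sheaf: "sheaf_on (space_top X) \<O> (rst X)" using ringed by (auto simp: is_ringed_space_def)

lemmas presheaf = sheaf_on_presheaf[OF sheaf]

lemma rst_closed [simp]: "opn X U ==> opn X V ==> V <= U ==> s : \<O> U ==> rst X U V s : \<O> V" using presheaf_onD(1)[OF presheaf] .

lemma rst_id [simp]: "opn X U ==> s : \<O> U ==> rst X U U s = s" using presheaf_onD(2)[OF presheaf] .

lemma rst_rst [simp]:
 "opn X U ==> opn X V ==> opn X W ==> W <= V ==> V <= U ==> s : \<O> U ==> rst X V W (rst X U V s) = rst X U W s"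
 using presheaf_onD(3)[OF presheaf] .

lemma rst_ops: assumes "opn X U" "opn X V" "V <= U"
 shows "s : \<O> U ==> t : \<O> U ==> rst X U V (s +[sect X U] t) = rst X U V s +[sect X V] rst X U V t"
  and "s : \<O> U ==> t : \<O> U ==> rst X U V (s *[sect X U] t) = rst X U V s *[sect X V] rst X U V t"
  and "rst X U V 1[sect X U] = 1[sect X V]" and "rst X U V 0[sect X U] = 0[sect X V]"
 using rst_hom[OF assms] ring_hom_zero'[OF sect_cring[OF assms(1)] sect_cring[OF assms(2)] rst_hom[OF assms]]
 by (auto simp: ring_hom_add ring_hom_mult ring_hom_one)

lemma sect_closed: assumes "opn X U" shows "s : \<O> U ==> t : \<O> U ==> s +[sect X U] t : \<O> U"
  and "s : \<O> U ==> t : \<O> U ==> s *[sect X U] t : \<O> U" and "1[sect X U] : \<O> U" "0[sect X U] : \<O> U"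
proof -
 interpret cring "sect X U" by (rule sect_cring[OF assms])
 show "s : \<O> U ==> t : \<O> U ==> s +[sect X U] t : \<O> U"
  "s : \<O> U ==> t : \<O> U ==> s *[sect X U] t : \<O> U"
  "1[sect X U] : \<O> U" "0[sect X U] : \<O> U" by auto
qed

lemma opn_subset: "opn X U ==> U <= pts X" by (rule openin_subset)

lemma stalk_ring_carrier:
 "bb :[stk X x] \<longleftrightarrow> (EX U s. opn X U & x : U & s : \<O> U & bb = rg X x U s)"
 by (simp add: stalk_ring_def stalk_mem[OF presheaf] rgerm_def)

lemma rgerm_closed [simp]: "opn X U ==> x : U ==> s : \<O> U ==> rg X x U s :[stk X x]" by (auto simp: stalk_ring_carrier)

lemma rgerm_rst [simp]:
 "opn X U ==> opn X V ==> V <= U ==> x : V ==> s : \<O> U ==> rg X x V (rst X U V s) = rg X x U s"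
 unfolding rgerm_def by (rule germ_restrict[OF presheaf])

lemma rgerm_eqD: assumes "opn X V" "x : V" "t : \<O> V" "rg X x U s = rg X x V t"
 obtains W where "opn X W" "x : W" "W <= U" "W <= V" "rst X U W s = rst X V W t"
 using germ_eqD[OF presheaf assms(1-3)] assms(4) unfolding rgerm_def by blast

lemma sect_eqI: assumes "opn X U" "s : \<O> U" "t : \<O> U" "!!x. x : U ==> rg X x U s = rg X x U t" shows "s = t"
 using sheaf_on_eqI[OF sheaf assms(1-3)] assms(4) unfolding rgerm_def by blast

lemma sect_glue: assumes "opn X U" and "!!x. x : U ==> EX W s. opn X W & x : W & W <= U & s : \<O> W & (ALL z:W. rg X z W s = g z)"
 obtains s where "s : \<O> U" "!!z. z : U ==> rg X z U s = g z"
 using sheaf_on_glue[OF sheaf assms(1), of g] assms(2) unfolding rgerm_def by blast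

lemma stalk_shrink_ring: assumes "bb :[stk X x]" "opn X U" "x : U"
 obtains W s where "opn X W" "x : W" "W <= U" "s : \<O> W" "bb = rg X x W s"
 using stalk_shrink[OF presheaf, of bb x U] assms unfolding rgerm_def stalk_ring_def by auto

lemma rgerm_mult_gen: assumes "opn X U" "s : \<O> U" "opn X V" "t : \<O> V" "opn X W" "x : W" "W <= U" "W <= V"
 shows "rg X x U s *[stk X x] rg X x V t =
  rg X x W (rst X U W s *[sect X W] rst X V W t)" using germ_op2[OF presheaf presheaf presheaf, of "%U. mult (sect X U)", OF _ _ assms]
 by (simp add: stalk_ring_def rgerm_def sect_closed rst_ops)

lemma rgerm_add_gen: assumes "opn X U" "s : \<O> U" "opn X V" "t : \<O> V" "opn X W" "x : W" "W <= U" "W <= V"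
 shows "rg X x U s +[stk X x] rg X x V t =
  rg X x W (rst X U W s +[sect X W] rst X V W t)" using germ_op2[OF presheaf presheaf presheaf, of "%U. add (sect X U)", OF _ _ assms]
 by (simp add: stalk_ring_def rgerm_def sect_closed rst_ops)

lemma rgerm_hom: assumes "opn X U" "x : U" shows "rg X x U : ring_hom (sect X U) (stk X x)"
proof (rule ring_hom_memI)
 have "rg X x U (rst X (pts X) U 1[sect X (pts X)]) = 1[stk X x]" using assms opn_subset[OF assms(1)]
  by (simp add: stalk_ring_def sect_closed)
 thus "rg X x U 1[sect X U] = 1[stk X x]" using assms opn_subset[OF assms(1)] by (simp add: rst_ops)
qed (use assms rgerm_mult_gen[of U _ U _ U x] rgerm_add_gen[of U _ U _ U x] in "auto")

lemma rgerm_ops: assumes "opn X U" "x : U"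
 shows "s : \<O> U ==> t : \<O> U ==> rg X x U (s +[sect X U] t) = rg X x U s +[stk X x] rg X x U t"
  and "s : \<O> U ==> t : \<O> U ==> rg X x U (s *[sect X U] t) = rg X x U s *[stk X x] rg X x U t" and "rg X x U 1[sect X U] = 1[stk X x]"
 using rgerm_hom[OF assms] by (auto simp: ring_hom_add ring_hom_mult ring_hom_one)

lemma rgerm_zero: assumes "opn X U" "x : U" shows "rg X x U 0[sect X U] = 0[stk X x]"
proof -
 have "rg X x U (rst X (pts X) U 0[sect X (pts X)]) = 0[stk X x]" using assms opn_subset[OF assms(1)]
  by (simp add: stalk_ring_def sect_closed)
 thus ?thesis using assms opn_subset[OF assms(1)] by (simp add: rst_ops)
qed

lemma rgerm_unit: assumes "opn X U" "x : U" "s : \<O> U" "rg X x U s : Units (stk X x)"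
 obtains W c where "opn X W" "x : W" "W <= U" "c : \<O> W" "rst X U W s *[sect X W] c = 1[sect X W]"
proof -
 obtain gg where gg: "gg :[stk X x]" "rg X x U s *[stk X x] gg = 1[stk X x]" using assms(4) by (auto simp: Units_def)
 obtain V t where V: "opn X V" "x : V" "V <= U" "t : \<O> V" "gg = rg X x V t" using stalk_shrink_ring[OF gg(1) assms(1,2)] by blast
 have "rg X x V (rst X U V s *[sect X V] t) = rg X x U s *[stk X x] gg"
  unfolding V(5) using V assms(1,3) by (subst rgerm_mult_gen[of U s V t V x]) auto
 hence "rg X x V (rst X U V s *[sect X V] t) = rg X x V 1[sect X V]" using gg(2) rgerm_ops(3)[OF V(1,2)] by simp
 then obtain W where W: "opn X W" "x : W" "W <= V"
  "rst X V W (rst X U V s *[sect X V] t) = rst X V W 1[sect X V]" using rgerm_eqD[of V x "1[sect X V]" V] V sect_closed by auto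
 show ?thesis by rule (use W V assms in "auto simp: rst_ops")
qed

end

subsection \<open>Affine opens\<close>

locale localized = cring R for R :: "'r ring" (structure) +
 fixes S assumes S: "S <= car R" "1[R] : S" "!!s t. s : S ==> t : S ==> s *[R] t : S"
begin

lemma S_closed: "s : S ==> s :[R]" using S(1) by blast

lemma frac_mem: "(a', s') : frac R S a s \<longleftrightarrow> a' :[R] & s' : S &
  (EX u:S. u *[R] (s' *[R] a) = u *[R] (s *[R] a'))" by (simp add: frac_def)

lemma frac_self: "a :[R] ==> s : S ==> (a, s) : frac R S a s" using S(2) by (auto simp: frac_mem)

lemma frac_subset: assumes "a :[R]" "s : S" "b :[R]" "t : S" "u : S" "u *[R] (t *[R] a) = u *[R] (s *[R] b)"
 shows "frac R S a s <= frac R S b t"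
proof (rule subrelI)
 fix c v assume "(c, v) : frac R S a s"
 then obtain w where c: "c :[R]" "v : S" "w : S" "w *[R] (v *[R] a) = w *[R] (s *[R] c)" by (auto simp: frac_mem)
 note S_closed [simp]
 have "(u *[R] w *[R] s) *[R] (v *[R] b) = (w *[R] v) *[R] (u *[R] (s *[R] b))" using assms(1-5) c(1-3) by (simp add: m_ac)
 also have "... = (u *[R] t) *[R] (w *[R] (v *[R] a))" unfolding assms(6)[symmetric] using assms(1-5) c(1-3) by (simp add: m_ac)
 also have "... = (u *[R] w *[R] s) *[R] (t *[R] c)" unfolding c(4) using assms(1-5) c(1-3) by (simp add: m_ac)
 finally show "(c, v) : frac R S b t" using c assms S(3) by (auto simp: frac_mem)
qed

lemma frac_eqI: assumes "a :[R]" "s : S" "b :[R]" "t : S" "u : S" "u *[R] (t *[R] a) = u *[R] (s *[R] b)"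
 shows "frac R S a s = frac R S b t" using frac_subset[OF assms] frac_subset[OF assms(3,4,1,2,5) assms(6)[symmetric]] by blast

lemma frac_eqD: assumes "b :[R]" "t : S" "frac R S a s = frac R S b t" obtains u where "u : S" "u *[R] (t *[R] a) = u *[R] (s *[R] b)"
 using frac_self[OF assms(1,2)] unfolding assms(3)[symmetric] frac_mem by blast

lemma frac_mult: assumes "a :[R]" "s : S" "b :[R]" "t : S"
 shows "frac R S a s *[localization R S] frac R S b t = frac R S (a *[R] b) (s *[R] t)"
proof -
 note S_closed [simp]
 have eq: "frac R S (a' *[R] b') (s' *[R] t') = frac R S (a *[R] b) (s *[R] t)"
  if m: "(a', s') : frac R S a s" "(b', t') : frac R S b t" for a' s' b' t'
 proof -
  obtain u where a': "a' :[R]" "s' : S" "u : S" "u *[R] (s' *[R] a) = u *[R] (s *[R] a')" using m(1) by (auto simp: frac_mem)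
  obtain v where b': "b' :[R]" "t' : S" "v : S" "v *[R] (t' *[R] b) = v *[R] (t *[R] b')" using m(2) by (auto simp: frac_mem)
  have "(u *[R] v) *[R] ((s *[R] t) *[R] (a' *[R] b')) = (u *[R] (s *[R] a')) *[R] (v *[R] (t *[R] b'))"
   using assms a'(1-3) b'(1-3) by (simp add: m_ac)
  also have "... = (u *[R] v) *[R] ((s' *[R] t') *[R] (a *[R] b))"
   unfolding a'(4)[symmetric] b'(4)[symmetric] using assms a'(1-3) b'(1-3) by (simp add: m_ac)
  finally show ?thesis using assms a' b' S(3) by (intro frac_eqI[where u = "u *[R] v"]) auto
 qed
 have self: "(a, s) : frac R S a s" "(b, t) : frac R S b t" using frac_self assms by auto
 have "(UN (b, t):frac R S b t. frac R S (a' *[R] b) (s' *[R] t)) = frac R S (a *[R] b) (s *[R] t)"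
  if "(a', s') : frac R S a s" for a' s' using self(2) by (rule UN_const_eq) (use eq[OF that] in auto)
 hence "(UN (a, s):frac R S a s. UN (b, t):frac R S b t. frac R S (a *[R] b) (s *[R] t)) = frac R S (a *[R] b) (s *[R] t)"
  by (intro UN_const_eq[OF self(1)]) auto
 thus ?thesis by (simp add: localization_def)
qed

end

locale spec = cring R for R :: "'r ring" (structure) + assumes ringed_Spec: "is_ringed_space (Spec R)"
begin

sublocale Spec: ringed "Spec R" by standard (rule ringed_Spec)

abbreviation D :: "'r => 'r set set" where "D a == {P. primeideal P R & a ~: P}"

lemma localized_prime: "primeideal P R ==> localized R (car R - P)"
proof -
 assume P: "primeideal P R"
 interpret P: primeideal P R by fact
 show ?thesis
 proof
  show "1[R] : car R - P" using P.I_notcarr P.one_imp_carrier by auto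
  show "s *[R] t : car R - P" if "s : car R - P" "t : car R - P" for s t using that P.I_prime by auto
 qed auto
qed

lemma D_one: "D 1[R] = {P. primeideal P R}" using localized_prime localized.S(2) by blast

lemma D_mult: "a :[R] ==> b :[R] ==> D (a *[R] b) = D a Int D b"
proof -
 assume ab: "a :[R]" "b :[R]"
 have "a *[R] b ~: P \<longleftrightarrow> a ~: P & b ~: P" if P: "primeideal P R" for P
 proof -
  interpret P: primeideal P R by (rule P)
  show ?thesis using P.I_prime[OF ab] P.I_l_closed[OF _ ab(1)] P.I_r_closed[OF _ ab(2)] by auto
 qed
 thus ?thesis by auto
qed

lemma opn_D: "a :[R] ==> opn (Spec R) (D a)" unfolding Spec_def by (auto intro: topology_generated_by_Basis)

lemma pts_Spec: "pts (Spec R) = {P. primeideal P R}"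
proof -
 have "pts (Spec R) = \<Union>{D a |a. a :[R]}" unfolding Spec_def by (simp add: topology_generated_by_topspace)
 thus ?thesis using D_one by auto
qed

lemma D_base: assumes "opn (Spec R) U" "P : U" obtains b where "b :[R]" "P : D b" "D b <= U"
proof -
 have "generate_topology_on {D a |a. a :[R]} U" using assms(1) unfolding Spec_def by (simp add: openin_topology_generated_by)
 hence "ALL P:U. EX b:car R. P : D b & D b <= U"
 proof induction
  case (Int A B)
  show ?case
  proof
   fix P assume P: "P : A Int B"
   obtain a where "a :[R]" "P : D a" "D a <= A" using bspec[OF Int.IH(1) IntD1[OF P]] by blast
   moreover obtain b where "b :[R]" "P : D b" "D b <= B" using bspec[OF Int.IH(2) IntD2[OF P]] by blast
   ultimately show "EX c:car R. P : D c & D c <= A Int B" by (intro bexI[of _ "a *[R] b"]) (unfold D_mult, auto)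
  qed
 next
  case (UN K)
  thus ?case by (meson Union_iff Union_upper order_trans)
 qed auto
 thus ?thesis using assms(2) that by blast
qed

lemma Spec_simps:
 "car (sect (Spec R) U) = Spec_sections R U"
 "si *[sect (Spec R) U] ta = (\<lambda>P\<in>U. si P *[local_at R P] ta P)"
 "1[sect (Spec R) U] = (\<lambda>P\<in>U. frc R P 1[R] 1[R])"
 "0[sect (Spec R) U] = (\<lambda>P\<in>U. frc R P 0[R] 1[R])"
 "rst (Spec R) U V si = restrict si V" by (simp_all add: Spec_def localization_def)

text \<open>The image of \<open>r\<close> under the structure map from the ring to the global
  functions on its spectrum.\<close>

definition const :: "'r => 'r set => ('r \<times> 'r) set" where
 "const r = (\<lambda>P\<in>{P. primeideal P R}. frc R P r 1[R])"

lemma fraction_section: assumes "U <= D b" "a :[R]" "b :[R]" shows "(\<lambda>P\<in>U. frc R P a b) : Spec_sections R U"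
proof -
 have "frc R P a b :[local_at R P]" if "P : U" for P using that assms by (auto simp: localization_def)
 thus ?thesis using assms unfolding Spec_sections_def by auto
qed

lemma const_closed: "r :[R] ==> const r : Spec_sections R {P. primeideal P R}"
 unfolding const_def by (rule fraction_section) (use D_one in auto)

text \<open>Near a point a section is a fraction \<open>a/b\<close>. The section \<open>gg\<close>
  is the inverse of \<open>b\<close> there, so that the equation which makes \<open>b\<close> times
  \<open>si\<close> equal to \<open>a\<close> has an invertible coefficient, as required by
  \<open>localizing\<close>.\<close>

lemma local_fraction: assumes U: "opn (Spec R) U" and s: "si : Spec_sections R U" and P: "P : U"
 obtains V a b gg where "opn (Spec R) V" "P : V" "V <= U" "a :[R]" "b :[R]" "V <= D b"
  "!!Q. Q : V ==> si Q = frc R Q a b"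
  "gg : Spec_sections R V"
  "restrict (const b) V *[sect (Spec R) V] gg = 1[sect (Spec R) V]"
  "restrict (const b) V *[sect (Spec R) V] restrict si V = restrict (const a) V"
proof -
 have prime: "primeideal Q R" if "Q : U" for Q using that Spec.opn_subset[OF U] pts_Spec by auto
 obtain a b where ab: "a :[R]" "b :[R]" "b ~: P" and si: "!!Q. Q : U ==> b ~: Q ==> si Q = frc R Q a b"
  using s P unfolding Spec_sections_def by auto
 let ?V = "U Int D b"
 let ?gg = "\<lambda>Q\<in>?V. frc R Q 1[R] b"
 have loc: "localized R (car R - Q)" "b : car R - Q" if "Q : ?V" for Q using that localized_prime ab by auto
 note mult = localized.frac_mult[OF loc(1)] and eqI = localized.frac_eqI[OF loc(1)] and one = localized.S(2)[OF loc(1)]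
 show ?thesis
 proof (rule that[of ?V a b ?gg])
  show "opn (Spec R) ?V" using U opn_D[OF ab(2)] by (rule openin_Int)
  show "?gg : Spec_sections R ?V" using ab by (intro fraction_section) auto
  show "restrict (const b) ?V *[sect (Spec R) ?V] ?gg = 1[sect (Spec R) ?V]" unfolding Spec_simps
  proof (rule restrict_ext)
   fix Q assume Q: "Q : ?V"
   have "frc R Q b 1[R] *[local_at R Q] frc R Q 1[R] b = frc R Q (b *[R] 1[R]) (1[R] *[R] b)"
    using ab loc(2)[OF Q] one[OF Q] by (intro mult[OF Q]) auto
   also have "... = frc R Q 1[R] 1[R]" using ab loc(2)[OF Q] one[OF Q] by (intro eqI[OF Q, where u = \<one>]) auto
   finally show "restrict (const b) ?V Q *[local_at R Q] ?gg Q = frc R Q 1[R] 1[R]" using Q by (simp add: const_def)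
  qed
  show "restrict (const b) ?V *[sect (Spec R) ?V] restrict si ?V = restrict (const a) ?V" unfolding Spec_simps
  proof (rule restrict_ext)
   fix Q assume Q: "Q : ?V"
   have "frc R Q b 1[R] *[local_at R Q] frc R Q a b = frc R Q (b *[R] a) (1[R] *[R] b)"
    using ab loc(2)[OF Q] one[OF Q] by (intro mult[OF Q]) auto
   also have "... = frc R Q a 1[R]" using ab loc(2)[OF Q] one[OF Q] by (intro eqI[OF Q, where u = \<one>]) auto
   finally show "restrict (const b) ?V Q *[local_at R Q] restrict si ?V Q = const a Q" using Q si by (simp add: const_def)
  qed
 qed (use ab P si prime in auto)
qed

text \<open>If no power of \<open>t\<close> annihilated \<open>r\<close>, then the annihilator of
  \<open>r\<close> would lie in a prime that avoids these powers. But at this prime the fraction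
  \<open>r/1\<close> vanishes, so an element outside the prime annihilates \<open>r\<close>.\<close>

lemma vanishing_power: assumes "r :[R]" "t :[R]" and zero: "!!Q. Q : D t ==> frc R Q r 1[R] = frc R Q 0[R] 1[R]"
 obtains N :: nat where "t [^] N *[R] r = 0[R]"
proof (rule ccontr)
 assume neg: "~ thesis"
 let ?I = "{x : car R. x *[R] r = 0[R]}" and ?S = "range (%N::nat. t [^] N)"
 have "ideal ?I R"
 proof (rule idealI[OF ring_axioms])
  show "subgroup ?I (add_monoid R)" by (rule add.subgroupI) (use assms(1) in "auto simp: l_distr l_minus intro: exI[of _ \<zero>]")
  fix x y assume xy: "x : ?I" "y :[R]"
  hence "(y *[R] x) *[R] r = 0[R]" "x :[R]" "y :[R]" using assms(1) by (auto simp: m_assoc)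
  thus "y *[R] x : ?I" "x *[R] y : ?I" using m_comm[of x y] by auto
 qed
 moreover have "?I Int ?S = {}" using neg that by auto
 moreover have "1[R] : ?S" by (rule range_eqI[of _ _ 0]) simp
 moreover have "?S <= car R" using assms(2) by auto
 moreover have "x *[R] y : ?S" if "x : ?S" "y : ?S" for x y using that assms(2) by (auto simp: nat_pow_mult)
 ultimately obtain Q where Q: "primeideal Q R" "?I <= Q" "Q Int ?S = {}" using exists_primeideal_disjoint[of ?I ?S] by metis
 have "t ~: Q" using Q(3) assms(2) rangeI[of "%N::nat. t [^] N" 1] by auto
 hence "frc R Q r 1[R] = frc R Q 0[R] 1[R]" using zero Q(1) by simp
 then obtain u where "u : car R - Q" "u *[R] (1[R] *[R] r) = u *[R] (1[R] *[R] 0[R])"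
  using localized.frac_eqD[OF localized_prime[OF Q(1)] zero_closed localized.S(2)[OF localized_prime[OF Q(1)]]] by metis
 thus False using Q(2) assms(1) by auto
qed

text \<open>
 A section \<open>si\<close> vanishing on \<open>D b\<close> is killed by a power of \<open>b\<close>: the \<open>r\<close> such that some power of \<open>b\<close> kills \<open>si\<close> on
 \<open>D r\<close> form an ideal contained in no maximal ideal. This replaces quasi-compactness of the spectrum.
\<close>

lemma section_killed_by_power: assumes s: "si : Spec_sections R {P. primeideal P R}" and b: "b :[R]"
  and zero: "!!Q. Q : D b ==> si Q = frc R Q 0[R] 1[R]"
 obtains N :: nat where "const (b [^] N) *[sect (Spec R) {P. primeideal P R}] si = 0[sect (Spec R) {P. primeideal P R}]"
proof -
 let ?X = "{P. primeideal P R}"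
 define kills where "kills N r \<longleftrightarrow>
  (ALL Q:D r. frc R Q (b [^] (N::nat)) 1[R] *[local_at R Q] si Q = frc R Q 0[R] 1[R])" for N r
 have one: "1[R] : car R - Q" if "Q : ?X" for Q using localized.S(2)[OF localized_prime] that by blast
 have si: "EX a s. a :[R] & s : car R - Q & si Q = frc R Q a s" if "Q : ?X" for Q
  using s that unfolding Spec_sections_def by (auto simp: PiE_iff localization_def) blast
 have zero_mult: "frc R Q c 1[R] *[local_at R Q] frc R Q 0[R] 1[R] = frc R Q 0[R] 1[R]"
  if "c :[R]" "Q : ?X" for c Q using that one[OF that(2)] localized.frac_mult[OF localized_prime, of Q c \<one> \<zero> \<one>] by auto
 \<comment> \<open>Two elements of the ideal come with different exponents; the larger one serves
   both.\<close>
 have kills_mono: "kills M r" if "kills N r" "N <= M" for M N r unfolding kills_def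
 proof
  fix Q assume Q: "Q : D r"
  then interpret L: localized R "car R - Q" by (intro localized_prime) simp
  obtain a s where as: "a :[R]" "s : car R - Q" "si Q = frc R Q a s" using si Q by blast
  have o: "1[R] : car R - Q" using one Q by blast
  have "frc R Q (b [^] N *[R] a) (1[R] *[R] s) = frc R Q 0[R] 1[R]"
   using that(1) Q as b o L.frac_mult[of "b [^] N" \<one> a s] unfolding kills_def by auto
  then obtain u where u: "u : car R - Q" "u *[R] (1[R] *[R] (b [^] N *[R] a)) = u *[R] ((1[R] *[R] s) *[R] 0[R])"
   using L.frac_eqD[OF zero_closed o] by metis
  hence u0: "u *[R] (b [^] N *[R] a) = 0[R]" using as b by auto
  have "b [^] M *[R] a = b [^] (M - N) *[R] (b [^] N *[R] a)" using that(2) as b by (simp add: m_assoc[symmetric] nat_pow_mult)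
  hence "u *[R] (b [^] M *[R] a) = b [^] (M - N) *[R] (u *[R] (b [^] N *[R] a))" using u(1) as b by (simp add: m_lcomm)
  hence "u *[R] (b [^] M *[R] a) = 0[R]" using u0 b by simp
  hence "frc R Q (b [^] M *[R] a) (1[R] *[R] s) = frc R Q 0[R] 1[R]" using u(1) as b o by (intro L.frac_eqI[where u = u]) auto
  thus "frc R Q (b [^] M) 1[R] *[local_at R Q] si Q = frc R Q 0[R] 1[R]" using as b o by (simp add: L.frac_mult)
 qed
 let ?J = "{r : car R. EX N. kills N r}"
 have J: "ideal ?J R"
 proof (rule idealI[OF ring_axioms])
  have sub: "kills N r" if "kills N r'" "D r <= D r'" for N r r' using that unfolding kills_def by blast
  have mult: "D (x *[R] r) <= D r" if "x :[R]" "r :[R]" for x r using D_mult[OF that] by blast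
  show "subgroup ?J (add_monoid R)"
  proof (rule add.subgroupI)
   fix x y assume "x : ?J" "y : ?J"
   then obtain N M where x: "x :[R]" "kills N x" and y: "y :[R]" "kills M y" by auto
   have k: "kills (max N M) x" "kills (max N M) y" using kills_mono[OF x(2), of "max N M"] kills_mono[OF y(2), of "max N M"] by auto
   have "x : P ==> y : P ==> x +[R] y : P" if "primeideal P R" for P
   proof -
    interpret primeideal P R by fact
    show "x : P ==> y : P ==> x +[R] y : P" by simp
   qed
   hence "D (x +[R] y) <= D x Un D y" by blast
   hence "kills (max N M) (x +[R] y)" using k unfolding kills_def by blast
   thus "x +[R] y : ?J" using x y by auto
  next
   have "D 0[R] = {}" using primeideal.axioms(1) additive_subgroup.zero_closed ideal.axioms(1) by blast
   hence "kills 0 0[R]" unfolding kills_def by blast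
   thus "?J ~= {}" by blast
  next
   fix x assume "x : ?J"
   then obtain N where x: "x :[R]" "kills N x" by auto
   have "D (-[R] x) = D ((-[R] 1[R]) *[R] x)" using x by (simp add: l_minus)
   also have "... <= D x" using x by (intro mult) auto
   finally show "-[R] x : ?J" using sub[OF x(2)] x(1) by auto
  qed auto
  fix a x assume "a : ?J" "x :[R]"
  then obtain N where a: "a :[R]" "kills N a" "x :[R]" by auto
  have "kills N (x *[R] a)" by (rule sub[OF a(2) mult[OF a(3,1)]])
  thus "x *[R] a : ?J" "a *[R] x : ?J" using a m_comm[of a x] by auto
 qed
 have "1[R] : ?J"
 proof (rule ccontr)
  assume "1[R] ~: ?J"
  then obtain P where P: "maximalideal P R" "?J <= P" using exists_maximalideal[OF J] by metis
  hence prime: "primeideal P R" by (intro maximalideal_prime)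
  have X: "opn (Spec R) ?X" using opn_D[OF one_closed] D_one by simp
  obtain r t where rt: "r :[R]" "t :[R]" "t ~: P" and sirt: "!!Q. Q : D t ==> si Q = frc R Q r t"
   using s prime unfolding Spec_sections_def by auto
  have "frc R Q r 1[R] = frc R Q 0[R] 1[R]" if Q: "Q : D (t *[R] b)" for Q
  proof -
   have Q: "Q : D t" "Q : D b" "Q : ?X" using Q D_mult[OF rt(2) b] by auto
   interpret L: localized R "car R - Q" using Q by (intro localized_prime) simp
   have "frc R Q r t = frc R Q 0[R] 1[R]" using sirt[OF Q(1)] zero[OF Q(2)] by simp
   then obtain u where u: "u : car R - Q" "u *[R] (1[R] *[R] r) = u *[R] (t *[R] 0[R])"
    using L.frac_eqD[OF zero_closed one[OF Q(3)]] by metis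
   thus ?thesis using rt one[OF Q(3)] by (intro L.frac_eqI[where u = u]) auto
  qed
  then obtain N :: nat where N: "(t *[R] b) [^] N *[R] r = 0[R]" using vanishing_power[of r "t *[R] b"] rt b by blast
  have "kills N t" unfolding kills_def
  proof
   fix Q assume Q: "Q : D t"
   then interpret L: localized R "car R - Q" by (intro localized_prime) simp
   have t: "t : car R - Q" using Q rt by auto
   have pow: "t [^] N : car R - Q"
   proof (induction N)
    case (Suc N) thus ?case using L.S(3)[OF _ t] by simp
   qed (use L.S(2) in simp)
   have o: "1[R] : car R - Q" using one Q by blast
   have "t [^] N *[R] (b [^] N *[R] r) = 0[R]" using N rt b by (simp add: nat_pow_distrib m_assoc)
   hence "frc R Q (b [^] N *[R] r) (1[R] *[R] t) = frc R Q 0[R] 1[R]" using rt b t o pow by (intro L.frac_eqI[where u = "t [^] N"]) auto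
   thus "frc R Q (b [^] N) 1[R] *[local_at R Q] si Q = frc R Q 0[R] 1[R]" using sirt[OF Q] rt b t o by (simp add: L.frac_mult)
  qed
  thus False using P(2) rt by blast
 qed
 then obtain N where "kills N 1[R]" by auto
 hence "const (b [^] N) *[sect (Spec R) ?X] si = 0[sect (Spec R) ?X]"
  unfolding Spec_simps kills_def D_one by (intro restrict_ext) (simp add: const_def)
 thus ?thesis by (rule that)
qed

end

locale local_ringed = ringed + assumes local_stalk: "x : pts X ==> is_local_ring (stk X x)"
begin

lemma stalk_cring: "x : pts X ==> cring (stk X x)" using local_stalk by (simp add: is_local_ring_def)

end

lemma local_ringed_iff: "locally_ringed X \<longleftrightarrow> local_ringed X"
 unfolding locally_ringed_def local_ringed_def local_ringed_axioms_def ringed_def by blast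

locale affine_iso = local_ringed X for X :: "('a, 'b) ringed_space" +
 fixes U and R :: "'b ring" and f :: "('a, 'b, 'b set, 'b set => ('b \<times> 'b) set) rs_morphism"
 assumes U: "opn X U" and R: "cring R" and iso: "is_iso f" and src: "source f = rs_restrict X U" and tgt: "target f = Spec R"
begin

lemma morphism: "is_morphism f" using iso by (simp add: is_iso_def)

sublocale spec R using morphism R unfolding is_morphism_def tgt locally_ringed_def by (simp add: spec.intro spec_axioms.intro)

lemma opn_restrict: "opn (rs_restrict X U) W \<longleftrightarrow> opn X W & W <= U"
 unfolding rs_restrict_def by (simp add: openin_open_subtopology U)

lemma pts_restrict: "pts (rs_restrict X U) = U" unfolding rs_restrict_def using opn_subset[OF U] by auto

lemma sect_restrict [simp]: "sect (rs_restrict X U) = sect X" "rst (rs_restrict X U) = rst X" by (simp_all add: rs_restrict_def)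

abbreviation "\<X> == {P. primeideal P R}"

lemma homeo: "homeomorphic_map (space_top (rs_restrict X U)) (space_top (Spec R)) (pt f)" using iso unfolding is_iso_def src tgt by simp

lemma preimg_f: "pre f V = {x : U. pt f x : V}" unfolding preimg_def src pts_restrict ..

lemma opn_preimg: "opn (Spec R) V ==> opn X (pre f V) & pre f V <= U"
 using continuous_map[of "space_top (rs_restrict X U)" "space_top (Spec R)" "pt f"]
  homeomorphic_imp_continuous_map[OF homeo] opn_restrict[of "pre f V"] unfolding preimg_def src pts_restrict by auto

lemma pt_f: "x : U ==> primeideal (pt f x) R" using homeomorphic_imp_surjective_map[OF homeo] pts_restrict pts_Spec by blast

lemma opn_image: assumes "opn X W" "W <= U" shows "opn (Spec R) (pt f ` W)" "pre f (pt f ` W) = W"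
proof -
 have "open_map (space_top (rs_restrict X U)) (space_top (Spec R)) (pt f)" using homeomorphic_imp_open_map[OF homeo] .
 thus "opn (Spec R) (pt f ` W)" using assms opn_restrict by (auto simp: open_map_def)
 have "inj_on (pt f) U" using homeomorphic_imp_injective_map[OF homeo] pts_restrict by simp
 thus "pre f (pt f ` W) = W" unfolding preimg_f using assms(2) by (auto simp: inj_on_def)
qed

lemma sh_hom: "opn (Spec R) V ==> sh f V : ring_hom (sect (Spec R) V) (sect X (pre f V))"
 using morphism unfolding is_morphism_def src tgt by simp

lemma sh_bij: "opn (Spec R) V ==> bij_betw (sh f V) (car (sect (Spec R) V)) (car (sect X (pre f V)))"
 using iso unfolding is_iso_def src tgt by simp

lemma sh_rst: assumes "opn (Spec R) V" "opn (Spec R) V'" "V' <= V" "si : Spec_sections R V"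
 shows "sh f V' (restrict si V') = rst X (pre f V) (pre f V') (sh f V si)"
proof -
 have "ALL V V' b. opn (target f) V & opn (target f) V' & V' <= V & b : car (sect (target f) V) -->
   sh f V' (rst (target f) V V' b) = pull f V (pre f V') b" using morphism unfolding is_morphism_def by (elim conjE)
 hence "sh f V' (rst (Spec R) V V' si) = pull f V (pre f V') si" using assms unfolding tgt Spec_simps by blast
 thus ?thesis unfolding pull_def src Spec_simps by simp
qed

lemma opn_X: "opn (Spec R) \<X>" "pre f \<X> = U" using opn_D[OF one_closed] D_one pt_f by (auto simp: preimg_f)

text \<open>This is the property through which affine opens are used later. Fractions come from
  \<open>local_fraction\<close>. A function with zero germ vanishes on a basic open
  \<open>D b\<close> around the point and is killed by a power of \<open>b\<close>, which is
  invertible at the point. Both facts are transported along the isomorphism with the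
  spectrum.\<close>

lemma localizing_stalk: assumes x: "x : U" shows "localizing (sect X U) (stk X x) (rg X x U)" unfolding localizing_def
proof (intro conjI ballI impI)
 show "rg X x U : ring_hom (sect X U) (stk X x)" by (rule rgerm_hom[OF U x])
next
 fix bb assume bb: "bb :[stk X x]"
 obtain W s where W: "opn X W" "x : W" "W <= U" "s : \<O> W" "bb = rg X x W s" using stalk_shrink_ring[OF bb U x] by blast
 let ?V = "pt f ` W"
 note V = opn_image[OF W(1,3)]
 have "s : sh f ?V ` car (sect (Spec R) ?V)" using bij_betw_imp_surj_on[OF sh_bij[OF V(1)]] W(4) by (simp add: V(2))
 then obtain si where si: "si : Spec_sections R ?V" "sh f ?V si = s" unfolding Spec_simps by (elim imageE) simp
 obtain V' a b gg where V': "opn (Spec R) V'" "pt f x : V'" "V' <= ?V" "a :[R]" "b :[R]" and gg: "gg : Spec_sections R V'"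
  and eq: "restrict (const b) V' *[sect (Spec R) V'] gg = 1[sect (Spec R) V']"
   "restrict (const b) V' *[sect (Spec R) V'] restrict si V' = restrict (const a) V'"
  by (rule local_fraction[OF V(1) si(1) imageI[OF W(2)]]) (rule that; assumption)
 let ?W' = "pre f V'"
 have W': "opn X ?W'" "?W' <= W" "x : ?W'" "?W' <= U" using opn_preimg[OF V'(1)] V'(2,3) x V(2) unfolding preimg_f by auto
 have VX: "V' <= \<X>" using Spec.opn_subset[OF V'(1)] pts_Spec by simp
 let ?a = "sh f \<X> (const a)" and ?b = "sh f \<X> (const b)"
 have car: "?a : \<O> U" "?b : \<O> U" "sh f V' gg : \<O> ?W'"
  using ring_hom_closed[OF sh_hom[OF opn_X(1)]] ring_hom_closed[OF sh_hom[OF V'(1)]] const_closed V'(4,5) gg opn_X(2)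
  by (auto simp: Spec_simps)
 have rb: "restrict (const b) V' : Spec_sections R V'" "restrict si V' : Spec_sections R V'"
  using Spec.rst_closed[OF opn_X(1) V'(1) VX] Spec.rst_closed[OF V(1) V'(1,3)] const_closed[OF V'(5)] si(1) by (auto simp: Spec_simps)
 have sb: "sh f V' (restrict (const b) V') = rst X U ?W' ?b" "sh f V' (restrict (const a) V') = rst X U ?W' ?a"
  using sh_rst[OF opn_X(1) V'(1) VX] const_closed V'(4,5) opn_X(2) by auto
 have ssi: "sh f V' (restrict si V') = rst X W ?W' s" using sh_rst[OF V(1) V'(1,3) si(1)] si(2) V(2) by simp
 have 1: "rst X U ?W' ?b *[sect X ?W'] sh f V' gg = 1[sect X ?W']"
  using ring_hom_mult[OF sh_hom[OF V'(1)], of "restrict (const b) V'" gg] ring_hom_one[OF sh_hom[OF V'(1)]] rb gg sb eq(1)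
  unfolding Spec_simps(1) by simp
 have 2: "rst X U ?W' ?b *[sect X ?W'] rst X W ?W' s = rst X U ?W' ?a"
  using ring_hom_mult[OF sh_hom[OF V'(1)], of "restrict (const b) V'" "restrict si V'"] rb sb ssi eq(2) unfolding Spec_simps(1) by simp
 interpret W': cring "sect X ?W'" by (rule sect_cring[OF W'(1)])
 have "rst X U ?W' ?b : Units (sect X ?W')" by (rule W'.unit_factor[of _ "sh f V' gg"]) (use 1 car W' U W'.Units_one_closed in simp_all)
 moreover have "cring (stk X x)" by (rule stalk_cring) (use opn_subset[OF U] x in blast)
 ultimately have "rg X x ?W' (rst X U ?W' ?b) : Units (stk X x)" by (intro ring_hom_Units[OF W'.cring_axioms _ rgerm_hom[OF W'(1,3)]])
 moreover have "rg X x U ?b *[stk X x] bb = rg X x U ?a"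
  unfolding W(5) using rgerm_mult_gen[OF U car(2) W(1,4) W'(1,3,4,2)] 2 W' U car by simp
 ultimately show "EX a:\<O> U. EX b:\<O> U. rg X x U b : Units (stk X x) &
   rg X x U b *[stk X x] bb = rg X x U a" using car W' U by auto
next
 fix a assume a: "a : \<O> U" "rg X x U a = 0[stk X x]"
 have "rg X x U a = rg X x U 0[sect X U]" using a(2) rgerm_zero[OF U x] by simp
 then obtain W where W: "opn X W" "x : W" "W <= U" "rst X U W a = rst X U W 0[sect X U]"
  using rgerm_eqD[OF U x sect_closed(4)[OF U]] by metis
 have "a : sh f \<X> ` car (sect (Spec R) \<X>)" using bij_betw_imp_surj_on[OF sh_bij[OF opn_X(1)]] a(1) by (simp add: opn_X(2))
 then obtain si where si: "si : Spec_sections R \<X>" "sh f \<X> si = a" unfolding Spec_simps by (elim imageE) simp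
 note V = opn_image[OF W(1,3)]
 obtain b where b: "b :[R]" "pt f x : D b" "D b <= pt f ` W" by (rule D_base[OF V(1) imageI[OF W(2)]]) (rule that; assumption)
 let ?W' = "pre f (D b)"
 have W': "opn X ?W'" "?W' <= W" "x : ?W'" "?W' <= U" using opn_preimg[OF opn_D[OF b(1)]] b(2,3) x V(2) unfolding preimg_f by auto
 have DX: "D b <= \<X>" by auto
 have "sh f (D b) (restrict si (D b)) = rst X U ?W' a" using sh_rst[OF opn_X(1) opn_D[OF b(1)] DX si(1)] si(2) opn_X(2) by simp
 also have "... = rst X W ?W' (rst X U W 0[sect X U])" unfolding W(4)[symmetric] using W(1,3) W' U a(1) by simp
 also have "... = 0[sect X ?W']" using W W' U by (simp add: rst_ops)
 also have "... = sh f (D b) 0[sect (Spec R) (D b)]"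
  using ring_hom_zero'[OF Spec.sect_cring[OF opn_D[OF b(1)]] sect_cring[OF W'(1)] sh_hom[OF opn_D[OF b(1)]]] by simp
 finally have "restrict si (D b) = 0[sect (Spec R) (D b)]"
 proof (rule inj_onD[OF bij_betw_imp_inj_on[OF sh_bij[OF opn_D[OF b(1)]]]])
  show "restrict si (D b) :[sect (Spec R) (D b)]" using Spec.rst_closed[OF opn_X(1) opn_D[OF b(1)] DX] si(1) by (simp add: Spec_simps)
 qed (rule Spec.sect_closed[OF opn_D[OF b(1)]])
 hence eq: "restrict si (D b) Q = (\<lambda>P\<in>D b. frc R P 0[R] 1[R]) Q" for Q by (simp add: Spec_simps)
 have zero: "si Q = frc R Q 0[R] 1[R]" if "Q : D b" for Q using that eq[of Q] by simp
 obtain N :: nat where N: "const (b [^]\<^bsub>R\<^esub> N) *[sect (Spec R) \<X>] si = 0[sect (Spec R) \<X>]"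
  by (rule section_killed_by_power[OF si(1) b(1) zero]) (assumption, rule that)
 let ?c = "b [^]\<^bsub>R\<^esub> N" let ?u = "sh f \<X> (const ?c)"
 have c: "?c :[R]" "const ?c : Spec_sections R \<X>" using b(1) const_closed by auto
 have u: "?u : \<O> U" using ring_hom_closed[OF sh_hom[OF opn_X(1)]] c opn_X(2) by (auto simp: Spec_simps)
 have "?u *[sect X U] a = 0[sect X U]" using ring_hom_mult[OF sh_hom[OF opn_X(1)], of "const ?c" si] N c si opn_X(2)
   ring_hom_zero'[OF Spec.sect_cring[OF opn_X(1)] sect_cring[OF U], of "sh f \<X>"] sh_hom[OF opn_X(1)] unfolding Spec_simps(1) by simp
 moreover have "rg X x U ?u : Units (stk X x)"
 proof -
  have prime: "primeideal (pt f x) R" by (rule pt_f[OF x])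
  have xp: "x : pts X" using opn_subset[OF U] x by blast
  interpret L: localized R "car R - pt f x" by (rule localized_prime[OF prime])
  have cb: "?c : car R - pt f x"
  proof (induction N)
   case (Suc N) thus ?case using L.S(3) b by simp
  qed (use L.S(2) in simp)
  let ?V = "D ?c"
  have oV: "opn (Spec R) ?V" by (rule opn_D[OF c(1)])
  let ?gg = "\<lambda>Q\<in>?V. frc R Q 1[R] ?c"
  have gg: "?gg : Spec_sections R ?V" using c by (intro fraction_section) auto
  have VX: "?V <= \<X>" by auto
  have "restrict (const ?c) ?V *[sect (Spec R) ?V] ?gg = 1[sect (Spec R) ?V]" unfolding Spec_simps
  proof (rule restrict_ext)
   fix Q assume Q: "Q : ?V"
   then interpret Q: localized R "car R - Q" by (intro localized_prime) simp
   have cQ: "?c : car R - Q" using Q c by auto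
   have "frc R Q ?c 1[R] *[local_at R Q] frc R Q 1[R] ?c =
     frc R Q (?c *[R] 1[R]) (1[R] *[R] ?c)" using cQ Q.S(2) by (intro Q.frac_mult) auto
   also have "... = frc R Q 1[R] 1[R]" using cQ Q.S(2) by (intro Q.frac_eqI[where u = "1[R]"]) auto
   finally show "restrict (const ?c) ?V Q *[local_at R Q] ?gg Q = frc R Q 1[R] 1[R]" using Q by (simp add: const_def)
  qed
  hence 1: "rst X U (pre f ?V) ?u *[sect X (pre f ?V)] sh f ?V ?gg = 1[sect X (pre f ?V)]"
   using ring_hom_mult[OF sh_hom[OF oV], of "restrict (const ?c) ?V" ?gg] ring_hom_one[OF sh_hom[OF oV]] gg
    sh_rst[OF opn_X(1) oV VX c(2)] Spec.rst_closed[OF opn_X(1) oV VX] c(2) opn_X(2) unfolding Spec_simps(1,5) by simp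
  have W'': "opn X (pre f ?V)" "pre f ?V <= U" "x : pre f ?V" using opn_preimg[OF oV] cb prime x unfolding preimg_f by auto
  interpret W'': cring "sect X (pre f ?V)" by (rule sect_cring[OF W''(1)])
  have "rst X U (pre f ?V) ?u : Units (sect X (pre f ?V))" by (rule W''.unit_factor[of _ "sh f ?V ?gg"])
    (use 1 u W'' U W''.Units_one_closed ring_hom_closed[OF sh_hom[OF oV]] gg in "simp_all add: Spec_simps(1)")
  hence "rg X x (pre f ?V) (rst X U (pre f ?V) ?u) : Units (stk X x)"
   by (intro ring_hom_Units[OF W''.cring_axioms stalk_cring[OF xp] rgerm_hom[OF W''(1,3)]])
  thus ?thesis using u W'' U by simp
 qed
 ultimately show "EX u:\<O> U. rg X x U u : Units (stk X x) & u *[sect X U] a = 0[sect X U]" using u by blast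
qed

end

section \<open>Vector fields\<close>

subsection \<open>Operations on derivations\<close>

lemma der_closed: "der A B ps d ==> a :[A] ==> d a :[B]" by (auto simp: der_def)

lemma der_cong:
 "der A B ps d ==> cring A ==> (!!a. a :[A] ==> ps a = ps' a & d a = d' a) ==> der A B ps' d'"
 unfolding der_def by (auto simp: cring.cring_simprules Pi_iff)

lemma der_zero_map: "cring B ==> ps : ring_hom A B ==> der A B ps (%_. 0[B])"
 unfolding der_def by (auto simp: cring.cring_simprules ring_hom_closed)

context
 fixes A :: "'r ring" and B :: "'s ring" and ps assumes A: "cring A" and B: "cring B" and ps: "ps : ring_hom A B"
begin

interpretation B: cring B by (rule B)

lemma der_add: assumes "der A B ps d" "der A B ps d'" shows "der A B ps (%a. d a +[B] d' a)"
 using der_closed[OF assms(1)] der_closed[OF assms(2)] ring_hom_closed[OF ps] assms by (auto simp: der_def B.a_ac B.r_distr)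

lemma der_smult: assumes "der A B ps d" "c :[B]" shows "der A B ps (%a. c *[B] d a)"
 using der_closed[OF assms(1)] ring_hom_closed[OF ps] assms by (auto simp: der_def B.m_lcomm B.r_distr)

lemma der_minus: assumes "der A B ps d" "der A B ps d'" shows "der A B ps (%a. d a -[B] d' a)"
proof -
 have "der A B ps (%a. d a +[B] ((-[B] 1[B]) *[B] d' a))" using assms by (intro der_add der_smult) auto
 thus ?thesis by (rule der_cong[OF _ A]) (use der_closed[OF assms(2)] in "auto simp: B.minus_eq B.l_minus")
qed

lemma der_msum: assumes "!!i. i :# I ==> der A B ps (d i)" shows "der A B ps (%a. msum B (%i. d i a) I)"
proof -
 have "der A B ps (%a. msum B (%i. d i a) I) & (\<forall>i\<in>#I. der A B ps (d i))" using assms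
 proof (induction I)
  case empty thus ?case using der_zero_map[OF B ps] by simp
 next
  case (add i I)
  hence i: "der A B ps (d i)" and I: "der A B ps (%a. msum B (%i. d i a) I)" by auto
  have "der A B ps (%a. msum B (%i. d i a) (add_mset i I))" using der_add[OF i I] by (rule der_cong[OF _ A]) (use der_closed[OF i] in auto)
  thus ?case using add by auto
 qed
 thus ?thesis ..
qed

lemma der_comp_hom: "der B C \<chi> d ==> der A C (%a. \<chi> (ps a)) (%a. d (ps a))"
 using ring_hom_closed[OF ps] by (auto simp: der_def ring_hom_add[OF ps] ring_hom_mult[OF ps])

lemma der_hom_comp: "der A A (%a. a) d ==> der A B ps (%a. ps (d a))"
 using ring_hom_closed[OF ps] A by (auto simp: der_def ring_hom_add[OF ps] ring_hom_mult[OF ps] cring.cring_simprules Pi_iff)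

end

lemma der_commutator: assumes "cring B" "der B B (%a. a) d" "der B B (%a. a) d'" shows "der B B (%a. a) (%a. d (d' a) -[B] d' (d a))"
proof -
 interpret cring B by fact
 note c [simp] = der_closed[OF assms(2)] der_closed[OF assms(3)]
 note a = derD(2)[OF assms(2)] derD(2)[OF assms(3)]
 note m = derD(3)[OF assms(2)] derD(3)[OF assms(3)]
 show ?thesis unfolding der_def
 proof (intro conjI ballI)
  fix x y assume xy [simp]: "x :[B]" "y :[B]"
  show "d (d' (x +[B] y)) -[B] d' (d (x +[B] y)) =
    d (d' x) -[B] d' (d x) +[B] (d (d' y) -[B] d' (d y))" by (simp add: a minus_eq minus_add a_ac)
  have e1: "d (d' (x *[B] y)) = (x *[B] d (d' y) +[B] y *[B] d (d' x)) +[B] (d x *[B] d' y +[B] d y *[B] d' x)" by (simp add: a m a_ac m_ac)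
  have e2: "d' (d (x *[B] y)) = (x *[B] d' (d y) +[B] y *[B] d' (d x)) +[B] (d x *[B] d' y +[B] d y *[B] d' x)" by (simp add: a m a_ac)
  have cancel: "(p +[B] r) -[B] (q +[B] r) = p -[B] q" if "p :[B]" "q :[B]" "r :[B]" for p q r
  proof -
   have "r +[B] (-[B] q +[B] -[B] r) = -[B] q" using that a_lcomm[of r "-[B] q" "-[B] r"] by (simp add: r_neg)
   thus ?thesis using that by (simp add: minus_eq minus_add a_assoc)
  qed
  show "d (d' (x *[B] y)) -[B] d' (d (x *[B] y)) =
    x *[B] (d (d' y) -[B] d' (d y)) +[B] y *[B] (d (d' x) -[B] d' (d x))"
   unfolding e1 e2 by (subst cancel) (simp_all add: minus_eq minus_add a_ac r_distr r_minus)
 qed auto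
qed

subsection \<open>Morphisms on stalks\<close>

locale morph =
 fixes f :: "('a, 'b, 'c, 'd) rs_morphism" assumes morphism: "is_morphism f"
begin

sublocale X: local_ringed "source f" using morphism by (simp add: is_morphism_def local_ringed_iff)

sublocale Y: local_ringed "target f" using morphism by (simp add: is_morphism_def local_ringed_iff)

abbreviation "X == source f"
abbreviation "Y == target f"
abbreviation "SX == stk (source f)"
abbreviation "SY x == stk (target f) (pt f x)"

lemma cont: "continuous_map (space_top X) (space_top Y) (pt f)" using morphism by (simp add: is_morphism_def)

lemma pt_closed [simp]: "x : pts X ==> pt f x : pts Y" using cont by (auto simp: continuous_map_def)

lemma opn_preimg [simp]: "opn Y V ==> opn X (pre f V)" using cont by (simp add: continuous_map_def preimg_def)

lemma preimg_mono: "V <= W ==> pre f V <= pre f W" by (auto simp: preimg_def)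

lemma preimg_mem: "x : pre f V \<longleftrightarrow> x : pts X & pt f x : V" by (simp add: preimg_def)

lemma sh_hom: "opn Y V ==> sh f V : ring_hom (sect Y V) (sect X (pre f V))" using morphism by (simp add: is_morphism_def)

lemma sh_closed [simp]: "opn Y V ==> b : Y.\<O> V ==> sh f V b : X.\<O> (pre f V)" using sh_hom by (rule ring_hom_closed)

lemma sh_rst: assumes "opn Y V" "opn Y V'" "V' <= V" "b : Y.\<O> V" shows "sh f V' (rst Y V V' b) = rst X (pre f V) (pre f V') (sh f V b)"
proof -
 have "ALL V V' b. opn (target f) V & opn (target f) V' & V' <= V & b : car (sect (target f) V) -->
   sh f V' (rst (target f) V V' b) = pull f V (pre f V') b" using morphism unfolding is_morphism_def by simp
 thus ?thesis using assms unfolding pull_def by blast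
qed

lemma stalk_map_germ: assumes "opn Y V" "pt f x : V" "b : Y.\<O> V" "x : pts X"
 shows "smap f x (rg Y (pt f x) V b) = rg X x (pre f V) (sh f V b)" unfolding stalk_map_def rgerm_def
 by (rule germ_op1[OF Y.presheaf X.presheaf])
  (use assms sh_rst preimg_mem in "auto")

lemma stalk_map_hom: assumes x: "x : pts X" shows "smap f x : ring_hom (SY x) (SX x)"
proof (rule ring_hom_memI)
 have P: "opn Y (pts Y)" "pt f x : pts Y" using x by auto
 show "smap f x 1[SY x] = 1[SX x]" using stalk_map_germ[OF P Y.sect_closed(3)[OF P(1)] x] Y.rgerm_ops(3)[OF P]
   X.rgerm_ops(3)[OF opn_preimg[OF P(1)], of x] ring_hom_one[OF sh_hom[OF P(1)]] x preimg_mem by simp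
 fix bb assume "bb :[SY x]"
 then obtain V b where V: "opn Y V" "pt f x : V" "b : Y.\<O> V" "bb = rg Y (pt f x) V b" by (auto simp: Y.stalk_ring_carrier)
 show "smap f x bb :[SX x]" using V x stalk_map_germ[OF V(1-3) x] preimg_mem by simp
 fix gg assume gg: "gg :[SY x]"
 obtain W c where W: "opn Y W" "pt f x : W" "W <= V" "c : Y.\<O> W" "gg = rg Y (pt f x) W c"
  using Y.stalk_shrink_ring[OF gg V(1,2)] by metis
 let ?b = "rst Y V W b"
 have b: "?b : Y.\<O> W" "bb = rg Y (pt f x) W ?b" using V W by auto
 have xW: "x : pre f W" using x W preimg_mem by simp
 note g = stalk_map_germ[OF W(1,2) _ x]
 show "smap f x (bb *[SY x] gg) = smap f x bb *[SX x] smap f x gg" unfolding b(2) W(5) Y.rgerm_ops(2)[OF W(1,2) b(1) W(4), symmetric]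
  using g[OF b(1)] g[OF W(4)] g[OF Y.sect_closed(2)[OF W(1) b(1) W(4)]] W(1,4) b(1) xW
  by (simp add: ring_hom_mult[OF sh_hom] X.rgerm_ops(2))
 show "smap f x (bb +[SY x] gg) = smap f x bb +[SX x] smap f x gg" unfolding b(2) W(5) Y.rgerm_ops(1)[OF W(1,2) b(1) W(4), symmetric]
  using g[OF b(1)] g[OF W(4)] g[OF Y.sect_closed(1)[OF W(1) b(1) W(4)]] W(1,4) b(1) xW by (simp add: ring_hom_add[OF sh_hom] X.rgerm_ops(1))
qed

lemma stalk_map_closed [simp]: "x : pts X ==> bb :[SY x] ==> smap f x bb :[SX x]" using stalk_map_hom by (rule ring_hom_closed)

lemma stalk_map_local:
 "x : pts X ==> bb :[SY x] ==> smap f x bb : Units (SX x) ==> bb : Units (SY x)" using morphism unfolding is_morphism_def by blast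

lemma pull_closed [simp]:
 "opn Y V ==> opn X W ==> W <= pre f V ==> b : Y.\<O> V ==> pull f V W b : X.\<O> W" unfolding pull_def by simp

lemma pull_germ: assumes "opn Y V" "opn X W" "W <= pre f V" "b : Y.\<O> V" "x : W"
 shows "rg X x W (pull f V W b) = smap f x (rg Y (pt f x) V b)"
proof -
 have x: "x : pts X" "pt f x : V" using assms preimg_mem by auto
 show ?thesis unfolding pull_def stalk_map_germ[OF assms(1) x(2) assms(4) x(1)] using assms by simp
qed

lemma pull_hom: assumes "opn Y V" "opn X W" "W <= pre f V" shows "pull f V W : ring_hom (sect Y V) (sect X W)"
proof -
 have "rst X (pre f V) W \<circ> sh f V : ring_hom (sect Y V) (sect X W)" using ring_hom_trans[OF sh_hom X.rst_hom] assms by simp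
 thus ?thesis by (simp add: pull_def[abs_def] comp_def)
qed

end

lemma stalk_map_comp: assumes "morph f" "morph g" "target f = source g" "x : pts (source f)" "bb : car (stk (target g) (pt g (pt f x)))"
 shows "smap (mor_comp g f) x bb = smap f x (smap g (pt f x) bb)"
proof -
 interpret f: morph f by fact
 interpret g: morph g by fact
 have pre: "pre (mor_comp g f) V = pre f (pre g V)" for V using f.pt_closed assms(3) by (auto simp: preimg_def mor_comp_def)
 obtain V b where V: "opn (target g) V" "pt g (pt f x) : V" "b : g.Y.\<O> V" "bb = rg (target g) (pt g (pt f x)) V b"
  using assms(5) by (auto simp: g.Y.stalk_ring_carrier)
 have y: "pt f x : pts (source g)" using f.pt_closed[OF assms(4)] assms(3) by simp
 have "smap f x (smap g (pt f x) bb) = rg (source f) x (pre f (pre g V)) (sh f (pre g V) (sh g V b))"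
  unfolding V(4) g.stalk_map_germ[OF V(1-3) y] unfolding assms(3)[symmetric]
  by (rule f.stalk_map_germ) (use V y assms(3,4) g.preimg_mem in auto)
 also have "... = smap (mor_comp g f) x bb" unfolding stalk_map_def V(4) rgerm_def pre unfolding mor_comp_def rs_morphism.simps
  by (rule germ_op1[OF g.Y.presheaf f.X.presheaf, symmetric])
   (use V y assms(3,4) f.preimg_mem g.preimg_mem g.preimg_mono
     g.sh_rst f.sh_rst in "auto")
 finally show "smap (mor_comp g f) x bb = smap f x (smap g (pt f x) bb)" ..
qed

lemma stalk_map_eq: assumes "mor_eq f g" "morph f" "x : pts (source f)" "bb :[stk (target f) (pt f x)]" shows "smap f x bb = smap g x bb"
proof -
 interpret f: morph f by fact
 have st: "source f = source g" "target f = target g" using assms(1) by (auto simp: mor_eq_def)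
 have pre: "pre f V = pre g V" for V using assms(1) by (auto simp: mor_eq_def preimg_def)
 obtain U s where bb: "opn (target f) U" "pt f x : U" "s : f.Y.\<O> U" "bb = rg (target f) (pt f x) U s"
  using assms(4) by (auto simp: f.Y.stalk_ring_carrier)
 have "sh f V b = sh g V b" if "(V, b) : bb" for V b
  using germ_memD[OF f.Y.presheaf bb(1,3), of V b] that bb(4) assms(1) unfolding rgerm_def mor_eq_def by auto
 thus "smap f x bb = smap g x bb" unfolding stalk_map_def pre st by auto
qed

subsection \<open>The action of vector fields on germs\<close>

text \<open>The derivation of the stalk at \<open>x\<close> induced by a vector field on
  \<open>U\<close>. A representative of the germ is first restricted to \<open>U\<close>, where the
  field is defined.\<close>

definition vact :: "('a, 'b) ringed_space => 'a set => ('a, 'b) vfield => 'a => ('a, 'b) germ => ('a, 'b) germ" where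
 "vact X U D x bb = (UN (V, b):bb. rg X x (U Int V) (D (U Int V) (rst X V (U Int V) b)))"

lemma der_diff: assumes "der A B ps d" "cring A" "cring B" "a :[A]" "b :[A]" shows "d (a -[A] b) = d a -[B] d b"
proof -
 interpret A: cring A by fact
 interpret B: cring B by fact
 have c: "d a :[B]" "d b :[B]" "d (a -[A] b) :[B]" using der_closed[OF assms(1)] assms(4,5) by auto
 have "(a -[A] b) +[A] b = a" using assms(4,5) by (simp add: A.minus_eq A.a_assoc A.l_neg)
 hence eq: "d (a -[A] b) +[B] d b = d a" using derD(2)[OF assms(1), of "a -[A] b" b] assms(4,5) by simp
 show ?thesis unfolding eq[symmetric] B.minus_eq using c by (simp add: B.a_assoc B.r_neg)
qed

context morph
begin

abbreviation "T == tangent f"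

lemma derivationsD: assumes "D : Der f U" shows "D : (\<Pi>\<^sub>E W\<in>{W. opn X W & W <= U}. X.\<O> W \<rightarrow>\<^sub>E X.\<O> W)"
  and "opn X W ==> W <= U ==> s : X.\<O> W ==> D W s : X.\<O> W"
  and "opn X W ==> W <= U ==> s : X.\<O> W ==> t : X.\<O> W ==> D W (s +[sect X W] t) = D W s +[sect X W] D W t"
  and "opn X W ==> W <= U ==> s : X.\<O> W ==> t : X.\<O> W ==>
   D W (s *[sect X W] t) = (s *[sect X W] D W t) +[sect X W] (t *[sect X W] D W s)"
  and "opn X W ==> opn X W' ==> W' <= W ==> W <= U ==> s : X.\<O> W ==> D W' (rst X W W' s) = rst X W W' (D W s)"
  and "opn X W ==> W <= U ==> opn Y V ==> W <= pre f V ==> b : Y.\<O> V ==> D W (pull f V W b) = 0[sect X W]"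
proof -
 note D = assms[unfolded derivations_def Let_def mem_Collect_eq]
 show P: "D : (\<Pi>\<^sub>E W\<in>{W. opn X W & W <= U}. X.\<O> W \<rightarrow>\<^sub>E X.\<O> W)" using D by simp
 show "D W s : X.\<O> W" if "opn X W" "W <= U" "s : X.\<O> W"
 proof -
  have "D W : X.\<O> W \<rightarrow>\<^sub>E X.\<O> W" using PiE_mem[OF P] that by blast
  thus ?thesis using that(3) by auto
 qed
 show "opn X W ==> W <= U ==> s : X.\<O> W ==> t : X.\<O> W ==> D W (s +[sect X W] t) = D W s +[sect X W] D W t" using D by simp
 show "opn X W ==> W <= U ==> s : X.\<O> W ==> t : X.\<O> W ==>
   D W (s *[sect X W] t) = (s *[sect X W] D W t) +[sect X W] (t *[sect X W] D W s)" using D by simp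
 show "opn X W ==> opn X W' ==> W' <= W ==> W <= U ==> s : X.\<O> W ==> D W' (rst X W W' s) = rst X W W' (D W s)" using D by simp
 show "opn X W ==> W <= U ==> opn Y V ==> W <= pre f V ==> b : Y.\<O> V ==> D W (pull f V W b) = 0[sect X W]" using D by simp
qed

lemma vact_germ: assumes D: "D : Der f U" and U: "opn X U" and V: "opn X V" "b : X.\<O> V" and W: "opn X W" "x : W" "W <= U" "W <= V"
 shows "vact X U D x (rg X x V b) = rg X x W (D W (rst X V W b))"
proof -
 have "vact X U D x (rg X x V b) = rg X x (U Int V) (D (U Int V) (rst X V (U Int V) b))" unfolding vact_def rgerm_def
 proof (rule germ_op1[OF X.presheaf X.presheaf, where p = "%V. U Int V" and op = "%V b. D (U Int V) (rst X V (U Int V) b)"])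
  fix V W s assume *: "opn X V" "opn X W" "W <= V" "s : X.\<O> V"
  have o: "opn X (U Int V)" "opn X (U Int W)" "U Int W <= U Int V" using U * by auto
  thus "D (U Int W) (rst X W (U Int W) (rst X V W s)) = rst X (U Int V) (U Int W) (D (U Int V) (rst X V (U Int V) s))"
   using derivationsD(5)[OF D o(1,2,3), of "rst X V (U Int V) s"] * by simp
 qed (use U V W derivationsD(2)[OF D] in "auto simp: openin_Int")
 also have "... = rg X x W (rst X (U Int V) W (D (U Int V) (rst X V (U Int V) b)))"
  using U V W derivationsD(2)[OF D] by (intro X.rgerm_rst[symmetric]) (auto simp: openin_Int)
 also have "rst X (U Int V) W (D (U Int V) (rst X V (U Int V) b)) = D W (rst X V W b)"
  using derivationsD(5)[OF D, of "U Int V" W "rst X V (U Int V) b"] U V W by (simp add: openin_Int)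
 finally show ?thesis .
qed

lemma vact_germ_same: assumes "D : Der f U" "opn X U" "opn X W" "x : W" "W <= U" "s : X.\<O> W"
 shows "vact X U D x (rg X x W s) = rg X x W (D W s)" using vact_germ[OF assms(1-3,6,3-5)] assms by simp

lemma vact_der: assumes D: "D : Der f U" and U: "opn X U" "x : U" shows "der (SX x) (SX x) (%a. a) (vact X U D x)" unfolding der_def
proof (intro conjI ballI Pi_I)
 fix bb assume "bb :[SX x]"
 then obtain V s where V: "opn X V" "x : V" "V <= U" "s : X.\<O> V" "bb = rg X x V s" using X.stalk_shrink_ring[OF _ U] by metis
 show "vact X U D x bb :[SX x]" using V derivationsD(2)[OF D V(1,3,4)] by (simp add: vact_germ_same[OF D U(1)])
 fix gg assume "gg :[SX x]"
 then obtain W t where W: "opn X W" "x : W" "W <= V" "t : X.\<O> W" "gg = rg X x W t" using X.stalk_shrink_ring[OF _ V(1,2)] by metis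
 have WU: "W <= U" using W V by auto
 let ?s = "rst X V W s"
 have s: "?s : X.\<O> W" "bb = rg X x W ?s" using V W by auto
 note Dc = derivationsD(2)[OF D W(1) WU s(1)] derivationsD(2)[OF D W(1) WU W(4)]
 note vg = vact_germ_same[OF D U(1) W(1,2) WU]
 note op = X.rgerm_ops[OF W(1,2)]
 show "vact X U D x (bb +[SX x] gg) = vact X U D x bb +[SX x] vact X U D x gg"
  unfolding s(2) W(5) op(1)[OF s(1) W(4), symmetric] vg[OF s(1)] vg[OF W(4)]
   vg[OF X.sect_closed(1)[OF W(1) s(1) W(4)]] derivationsD(3)[OF D W(1) WU s(1) W(4)] op(1)[OF Dc] ..
 show "vact X U D x (bb *[SX x] gg) = bb *[SX x] vact X U D x gg +[SX x] gg *[SX x] vact X U D x bb"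
  unfolding s(2) W(5) op(2)[OF s(1) W(4), symmetric] vg[OF s(1)] vg[OF W(4)]
   vg[OF X.sect_closed(2)[OF W(1) s(1) W(4)]] derivationsD(4)[OF D W(1) WU s(1) W(4)] using Dc s(1) W(1,4) by (simp add: op X.sect_closed)
qed

lemma vact_closed [simp]:
 "D : Der f U ==> opn X U ==> x : U ==> bb :[SX x] ==> vact X U D x bb :[SX x]" using der_closed[OF vact_der] .

lemma vact_kills: assumes D: "D : Der f U" and U: "opn X U" "x : U" and gg: "gg :[SY x]" shows "vact X U D x (smap f x gg) = 0[SX x]"
proof -
 have x: "x : pts X" using X.opn_subset[OF U(1)] U(2) by blast
 obtain V b where V: "opn Y V" "pt f x : V" "b : Y.\<O> V" "gg = rg Y (pt f x) V b" using gg by (auto simp: Y.stalk_ring_carrier)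
 let ?W = "U Int pre f V"
 have W: "opn X ?W" "x : ?W" "?W <= U" "?W <= pre f V" using U V x by (auto simp: preimg_mem)
 have "smap f x gg = rg X x ?W (pull f V ?W b)" unfolding V(4) using pull_germ[OF V(1) W(1,4) V(3) W(2)] by simp
 thus ?thesis using vact_germ_same[OF D U(1) W(1,2,3) pull_closed[OF V(1) W(1,4) V(3)]] derivationsD(6)[OF D W(1,3) V(1) W(4) V(3)]
   X.rgerm_zero[OF W(1,2)] by simp
qed

lemma derivations_eqI: assumes D: "D : Der f U" and E: "E : Der f U" and U: "opn X U"
  and eq: "!!x bb. x : U ==> bb :[SX x] ==> vact X U D x bb = vact X U E x bb" shows "D = E"
proof (rule PiE_ext[OF derivationsD(1)[OF D] derivationsD(1)[OF E]])
 fix W assume "W : {W. opn X W & W <= U}"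
 hence W: "opn X W" "W <= U" by auto
 show "D W = E W"
 proof (rule PiE_ext)
  show "D W : X.\<O> W \<rightarrow>\<^sub>E X.\<O> W" "E W : X.\<O> W \<rightarrow>\<^sub>E X.\<O> W"
   using PiE_mem[OF derivationsD(1)[OF D]] PiE_mem[OF derivationsD(1)[OF E]] W by auto
  fix s assume s: "s : X.\<O> W"
  show "D W s = E W s"
  proof (rule X.sect_eqI[OF W(1) derivationsD(2)[OF D W s] derivationsD(2)[OF E W s]])
   fix x assume x: "x : W"
   thus "rg X x W (D W s) = rg X x W (E W s)"
    using eq[of x "rg X x W s"] vact_germ_same[OF D U W(1) x W(2) s] vact_germ_same[OF E U W(1) x W(2) s] W s by auto
  qed
 qed
qed

text \<open>A family of maps that induces derivations of the stalks is itself a vector field,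
  because functions are separated by their germs. In this way the algebra of vector fields is done
  on stalks.\<close>

lemma derivationsI: assumes U: "opn X U" and D: "D : (\<Pi>\<^sub>E W\<in>{W. opn X W & W <= U}. X.\<O> W \<rightarrow>\<^sub>E X.\<O> W)"
  and de: "!!x. x : U ==> der (SX x) (SX x) (%a. a) (de x)" and kills: "!!x gg. x : U ==> gg :[SY x] ==> de x (smap f x gg) = 0[SX x]"
  and eq: "!!W s x. opn X W ==> W <= U ==> s : X.\<O> W ==> x : W ==> rg X x W (D W s) = de x (rg X x W s)"
 shows "D : Der f U & (ALL x:U. ALL bb:car (SX x). vact X U D x bb = de x bb)"
proof
 have cl: "D W s : X.\<O> W" if "opn X W" "W <= U" "s : X.\<O> W" for W s using PiE_mem[OF D, of W] that by auto
 note oc = X.sect_closed and op = X.rgerm_ops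
 show Dd: "D : Der f U" unfolding derivations_def Let_def mem_Collect_eq
 proof (intro conjI allI impI; (elim conjE)?)
  fix W s t assume W: "opn X W" "W <= U" and st: "s : X.\<O> W" "t : X.\<O> W"
  show "D W (s +[sect X W] t) = D W s +[sect X W] D W t" by (rule X.sect_eqI[OF W(1)])
    (use W st in "auto simp: cl oc eq op derD(2)[OF de]")
  show "D W (s *[sect X W] t) = (s *[sect X W] D W t) +[sect X W] (t *[sect X W] D W s)" by (rule X.sect_eqI[OF W(1)])
    (use W st in "auto simp: cl oc eq op derD(3)[OF de]")
 next
  fix W W' s assume "opn X W" "opn X W'" "W' <= W" "W <= U" "s : X.\<O> W"
  thus "D W' (rst X W W' s) = rst X W W' (D W s)" by (intro X.sect_eqI[of W']) (auto simp: cl eq)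
 next
  fix W V b assume W: "opn X W" "W <= U" "opn Y V" "W <= pre f V" "b : Y.\<O> V"
  show "D W (pull f V W b) = 0[sect X W]"
  proof (rule X.sect_eqI[OF W(1) cl[OF W(1,2) pull_closed[OF W(3,1,4,5)]] X.sect_closed(4)[OF W(1)]])
   fix x assume x: "x : W"
   hence "pt f x : V" "x : U" using W by (auto simp: preimg_mem)
   thus "rg X x W (D W (pull f V W b)) = rg X x W 0[sect X W]"
    using eq[OF W(1,2) pull_closed[OF W(3,1,4,5)] x] pull_germ[OF W(3,1,4,5) x] kills W by (simp add: X.rgerm_zero[OF W(1) x])
  qed
 qed fact
 show "ALL x:U. ALL bb:car (SX x). vact X U D x bb = de x bb"
 proof (intro ballI)
  fix x bb assume x: "x : U" "bb :[SX x]"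
  obtain V s where "opn X V" "x : V" "V <= U" "s : X.\<O> V" "bb = rg X x V s" using X.stalk_shrink_ring[OF x(2) U x(1)] by metis
  thus "vact X U D x bb = de x bb" using vact_germ_same[OF Dd U] eq by simp
 qed
qed

text \<open>Derivations of stalks form a vector field if they map the germs of a section locally to
  the germs of another section. The values on sections are then glued by the sheaf property of
  functions.\<close>

lemma vfield_exists: assumes U: "opn X U" and de: "!!x. x : U ==> der (SX x) (SX x) (%a. a) (de x)"
  and kills: "!!x gg. x : U ==> gg :[SY x] ==> de x (smap f x gg) = 0[SX x]"
  and loc: "!!W s x. opn X W ==> W <= U ==> s : X.\<O> W ==> x : W ==>
   EX W' t. opn X W' & x : W' & W' <= W & t : X.\<O> W' & (ALL z:W'. rg X z W' t = de z (rg X z W s))"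
 obtains D where "D : Der f U" "!!x bb. x : U ==> bb :[SX x] ==> vact X U D x bb = de x bb"
proof -
 define P where "P W s t \<longleftrightarrow> t : X.\<O> W & (ALL z:W. rg X z W t = de z (rg X z W s))" for W s t
 have ex: "EX t. P W s t" if "opn X W" "W <= U" "s : X.\<O> W" for W s
  using X.sect_glue[OF that(1), of "%z. de z (rg X z W s)"] loc[OF that] unfolding P_def by metis
 define D where "D = (\<lambda>W\<in>{W. opn X W & W <= U}. \<lambda>s\<in>X.\<O> W. SOME t. P W s t)"
 have D: "P W s (D W s)" if "opn X W" "W <= U" "s : X.\<O> W" for W s using someI_ex[OF ex[OF that]] that by (simp add: D_def)
 have "D : (\<Pi>\<^sub>E W\<in>{W. opn X W & W <= U}. X.\<O> W \<rightarrow>\<^sub>E X.\<O> W)"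
 proof -
  have "t : X.\<O> W" if "P W s t" for W s t using that by (simp add: P_def)
  thus ?thesis unfolding D_def by (intro restrict_PiE_iff[THEN iffD2]) (auto intro: someI_ex[OF ex])
 qed
 hence "D : Der f U & (ALL x:U. ALL bb:car (SX x). vact X U D x bb = de x bb)"
  by (rule derivationsI[OF U _ de kills]) (use D in "auto simp: P_def")
 thus ?thesis using that by blast
qed

subsection \<open>The tangent sheaf\<close>

lemma tan_simps:
 "Sec T U = Der f U"
 "0[msec T U] = (\<lambda>W\<in>{W. opn X W & W <= U}. \<lambda>s\<in>X.\<O> W. 0[sect X W])"
 "D +[msec T U] E = (\<lambda>W\<in>{W. opn X W & W <= U}. \<lambda>s\<in>X.\<O> W. D W s +[sect X W] E W s)"
 "a .[msec T U] D = (\<lambda>W\<in>{W. opn X W & W <= U}. \<lambda>s\<in>X.\<O> W. rst X U W a *[sect X W] D W s)"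
 "mrst T U V D = restrict D {W. opn X W & W <= V}" by (simp_all add: tangent_def Let_def)

lemma vfield_add: assumes D: "D : Der f U" and E: "E : Der f U" and U: "opn X U" shows "D +[msec T U] E : Der f U"
  and "x : U ==> bb :[SX x] ==> vact X U (D +[msec T U] E) x bb = vact X U D x bb +[SX x] vact X U E x bb"
proof -
 have S: "cring (SX x)" if "x : U" for x using X.stalk_cring X.opn_subset[OF U] that by blast
 have "D +[msec T U] E : Der f U &
   (ALL x:U. ALL bb:car (SX x). vact X U (D +[msec T U] E) x bb = vact X U D x bb +[SX x] vact X U E x bb)"
 proof (rule derivationsI[OF U])
  show "D +[msec T U] E : (\<Pi>\<^sub>E W\<in>{W. opn X W & W <= U}. X.\<O> W \<rightarrow>\<^sub>E X.\<O> W)" unfolding tan_simps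
   by (intro restrict_PiE_iff[THEN iffD2]) (auto simp: X.sect_closed derivationsD(2)[OF D] derivationsD(2)[OF E])
  show "der (SX x) (SX x) (%a. a) (%bb. vact X U D x bb +[SX x] vact X U E x bb)" if "x : U" for x
   using that D E U S by (intro der_add vact_der) (auto intro: id_ring_hom[unfolded id_def])
  show "vact X U D x (smap f x gg) +[SX x] vact X U E x (smap f x gg) = 0[SX x]"
   if "x : U" "gg :[SY x]" for x gg
   using that vact_kills[OF D U] vact_kills[OF E U] cring.cring_simprules(8)[OF S] cring.cring_simprules(2)[OF S] by simp
 qed (auto simp: tan_simps vact_germ_same[OF D U] vact_germ_same[OF E U] X.rgerm_ops derivationsD(2)[OF D] derivationsD(2)[OF E])
 thus "D +[msec T U] E : Der f U"
  "x : U ==> bb :[SX x] ==> vact X U (D +[msec T U] E) x bb = vact X U D x bb +[SX x] vact X U E x bb" by auto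
qed

lemma vfield_smult: assumes D: "D : Der f U" and a: "a : X.\<O> U" and U: "opn X U" shows "a .[msec T U] D : Der f U"
  and "x : U ==> bb :[SX x] ==> vact X U (a .[msec T U] D) x bb = rg X x U a *[SX x] vact X U D x bb"
proof -
 have S: "cring (SX x)" if "x : U" for x using X.stalk_cring X.opn_subset[OF U] that by blast
 have "a .[msec T U] D : Der f U &
   (ALL x:U. ALL bb:car (SX x). vact X U (a .[msec T U] D) x bb = rg X x U a *[SX x] vact X U D x bb)"
 proof (rule derivationsI[OF U])
  show "a .[msec T U] D : (\<Pi>\<^sub>E W\<in>{W. opn X W & W <= U}. X.\<O> W \<rightarrow>\<^sub>E X.\<O> W)" unfolding tan_simps
   by (intro restrict_PiE_iff[THEN iffD2]) (use U a in "auto simp: X.sect_closed derivationsD(2)[OF D]")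
  show "der (SX x) (SX x) (%a. a) (%bb. rg X x U a *[SX x] vact X U D x bb)" if "x : U" for x
   using that D U S a by (intro der_smult vact_der) (auto intro: id_ring_hom[unfolded id_def])
  show "rg X x U a *[SX x] vact X U D x (smap f x gg) = 0[SX x]"
   if "x : U" "gg :[SY x]" for x gg
  proof -
   interpret cring "SX x" using S[OF that(1)] .
   show ?thesis using that vact_kills[OF D U that] U a by simp
  qed
 qed (use U a in "auto simp: tan_simps vact_germ_same[OF D U] X.rgerm_ops derivationsD(2)[OF D]")
 thus "a .[msec T U] D : Der f U"
  "x : U ==> bb :[SX x] ==> vact X U (a .[msec T U] D) x bb = rg X x U a *[SX x] vact X U D x bb" by auto
qed

lemma vfield_zero: assumes U: "opn X U" shows "0[msec T U] : Der f U" and "x : U ==> bb :[SX x] ==> vact X U 0[msec T U] x bb = 0[SX x]"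
proof -
 have S: "cring (SX x)" if "x : U" for x using X.stalk_cring X.opn_subset[OF U] that by blast
 have "0[msec T U] : Der f U & (ALL x:U. ALL bb:car (SX x). vact X U 0[msec T U] x bb = 0[SX x])"
 proof (rule derivationsI[OF U])
  show "0[msec T U] : (\<Pi>\<^sub>E W\<in>{W. opn X W & W <= U}. X.\<O> W \<rightarrow>\<^sub>E X.\<O> W)"
   unfolding tan_simps by (intro restrict_PiE_iff[THEN iffD2]) (auto simp: X.sect_closed)
  show "der (SX x) (SX x) (%a. a) (%bb. 0[SX x])" if "x : U" for x using S[OF that] by (intro der_zero_map id_ring_hom[unfolded id_def])
 qed (auto simp: tan_simps X.rgerm_zero)
 thus "0[msec T U] : Der f U"
  "x : U ==> bb :[SX x] ==> vact X U 0[msec T U] x bb = 0[SX x]" by auto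
qed

lemma vfield_restrict: assumes D: "D : Der f U" and U: "opn X U" and V: "opn X V" "V <= U" shows "mrst T U V D : Der f V"
  and "x : V ==> bb :[SX x] ==> vact X V (mrst T U V D) x bb = vact X U D x bb"
proof -
 have "mrst T U V D : Der f V & (ALL x:V. ALL bb:car (SX x). vact X V (mrst T U V D) x bb = vact X U D x bb)"
 proof (rule derivationsI[OF V(1)])
  show "mrst T U V D : (\<Pi>\<^sub>E W\<in>{W. opn X W & W <= V}. X.\<O> W \<rightarrow>\<^sub>E X.\<O> W)" unfolding tan_simps
   by (intro restrict_PiE_iff[THEN iffD2] ballI PiE_mem[OF derivationsD(1)[OF D]]) (use V in auto)
 qed (use V vact_der[OF D U] vact_kills[OF D U] vact_germ_same[OF D U] in "auto simp: tan_simps")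
 thus "mrst T U V D : Der f V"
  "x : V ==> bb :[SX x] ==> vact X V (mrst T U V D) x bb = vact X U D x bb" by auto
qed

lemma vfield_commutator: assumes D: "D : Der f U" and E: "E : Der f U" and U: "opn X U" shows "comm X U D E : Der f U"
  and "x : U ==> bb :[SX x] ==> vact X U (comm X U D E) x bb =
   vact X U D x (vact X U E x bb) -[SX x] vact X U E x (vact X U D x bb)"
proof -
 have S: "cring (SX x)" if "x : U" for x using X.stalk_cring X.opn_subset[OF U] that by blast
 have "comm X U D E : Der f U & (ALL x:U. ALL bb:car (SX x). vact X U (comm X U D E) x bb =
   vact X U D x (vact X U E x bb) -[SX x] vact X U E x (vact X U D x bb))"
 proof (rule derivationsI[OF U])
  have m: "s -[sect X W] t : X.\<O> W" if "opn X W" "s : X.\<O> W" "t : X.\<O> W" for W s t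
   using that X.sect_cring by (simp add: cring.cring_simprules(4))
  show "comm X U D E : (\<Pi>\<^sub>E W\<in>{W. opn X W & W <= U}. X.\<O> W \<rightarrow>\<^sub>E X.\<O> W)" unfolding commutator_def
   by (intro restrict_PiE_iff[THEN iffD2]) (auto simp: m derivationsD(2)[OF D] derivationsD(2)[OF E])
  show "der (SX x) (SX x) (%a. a) (%bb. vact X U D x (vact X U E x bb) -[SX x] vact X U E x (vact X U D x bb))" if "x : U" for x
   using that D E U S by (intro der_commutator vact_der)
  show "vact X U D x (vact X U E x (smap f x gg)) -[SX x] vact X U E x (vact X U D x (smap f x gg)) = 0[SX x]"
   if "x : U" "gg :[SY x]" for x gg
  proof -
   interpret cring "SX x" using S[OF that(1)] .
   show ?thesis using vact_kills[OF D U that] vact_kills[OF E U that] der_zero[OF vact_der[OF D U that(1)]]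
     der_zero[OF vact_der[OF E U that(1)]] cring_axioms by auto
  qed
  fix W s x assume W: "opn X W" "W <= U" "s : X.\<O> W" "x : W"
  interpret W: cring "sect X W" by (rule X.sect_cring[OF W(1)])
  note c = derivationsD(2)[OF D W(1,2)] derivationsD(2)[OF E W(1,2)]
  note g = vact_germ_same[OF D U W(1,4,2)] vact_germ_same[OF E U W(1,4,2)]
  interpret h: ring_hom_cring "sect X W" "SX x" "rg X x W" using W X.rgerm_hom S by (intro ring_hom_cringI W.cring_axioms) auto
  show "rg X x W (comm X U D E W s) =
    vact X U D x (vact X U E x (rg X x W s)) -[SX x] vact X U E x (vact X U D x (rg X x W s))" using W c by (simp add: commutator_def g)
 qed
 thus "comm X U D E : Der f U"
  "x : U ==> bb :[SX x] ==> vact X U (comm X U D E) x bb =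
   vact X U D x (vact X U E x bb) -[SX x] vact X U E x (vact X U D x bb)" by auto
qed


lemma tangent_module:  assumes U: "opn X U" shows "module (sect X U) (msec T U)"
proof -
 interpret O: cring "sect X U" by (rule X.sect_cring[OF U])
 have S: "cring (SX x)" if "x : U" for x using X.stalk_cring X.opn_subset[OF U] that by blast
 note cl = vfield_add(1)[OF _ _ U] vfield_smult(1)[OF _ _ U] vfield_zero(1)[OF U]
  and va = vfield_add(2)[OF _ _ U] vfield_smult(2)[OF _ _ U] vfield_zero(2)[OF U]
 note rs = cring.cring_simprules[OF S]
 show ?thesis
 proof (intro moduleI abelian_groupI; (unfold tan_simps(1))?)
  fix D assume D: "D : Der f U"
  show "EX E:Der f U. E +[msec T U] D = 0[msec T U]"
  proof (intro bexI derivations_eqI[OF _ _ U])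
   fix x bb assume x: "x : U" "bb :[SX x]"
   interpret S: cring "SX x" by (rule S[OF x(1)])
   interpret h: ring_hom_cring "sect X U" "SX x" "rg X x U" using U x X.rgerm_hom by (intro ring_hom_cringI O.cring_axioms S.cring_axioms)
   show "vact X U (((-[sect X U] 1[sect X U]) .[msec T U] D) +[msec T U] D) x bb = vact X U 0[msec T U] x bb"
    using D x U by (simp add: va cl S.l_minus S.l_neg)
  qed (use D in "auto intro!: cl")
 qed (auto intro!: derivations_eqI[OF _ _ U] simp: va cl U X.rgerm_ops rs O.cring_axioms)
qed

lemma tangent_presheaf: "presheaf_on (space_top X) (Sec T) (mrst T)"
proof
 fix U s assume "opn X U" "s : Sec T U"
 thus "mrst T U U s = s" using derivationsD(1)[of s U] by (auto simp: tan_simps)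
next
 fix U V W :: "'a set" and s assume "W <= V" "V <= U"
 thus "mrst T V W (mrst T U V s) = mrst T U W s" by (auto simp: tan_simps fun_eq_iff)
qed (use vfield_restrict(1) in "simp add: tan_simps(1)")

lemma tangent_sheaf: "sheaf_on (space_top X) (Sec T) (mrst T)" unfolding sheaf_on_def
proof (intro conjI allI impI; (elim conjE)?)
 fix \<U> s assume sU: "ALL U:\<U>. opn X U & s U : Sec T U"
  and comp: "ALL U:\<U>. ALL V:\<U>. mrst T U (U Int V) (s U) = mrst T V (U Int V) (s V)"
 have s: "opn X U" "s U : Der f U" if "U : \<U>" for U using sU that by (auto simp: tan_simps)
 have U: "opn X (\<Union>\<U>)" using s(1) by blast
 \<comment> \<open>Any member of the cover containing \<open>x\<close> gives the same derivation of
   the stalk, since the fields agree on overlaps.\<close>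
 define de where "de x = (let U = SOME U. U : \<U> & x : U in vact X U (s U) x)" for x
 have de: "de x bb = vact X V (s V) x bb" if V: "V : \<U>" "x : V" and bb: "bb :[SX x]" for x V bb
 proof -
  let ?U = "SOME U. U : \<U> & x : U"
  have U: "?U : \<U> & x : ?U" by (rule someI[of _ V]) (use V in simp)
  have W: "opn X (?U Int V)" "x : ?U Int V" using U V s(1) by auto
  have "mrst T ?U (?U Int V) (s ?U) = mrst T V (?U Int V) (s V)" using comp U V by blast
  thus ?thesis using vfield_restrict(2)[OF s(2,1)[OF conjunct1[OF U]] W(1) Int_lower1 W(2) bb]
    vfield_restrict(2)[OF s(2,1)[OF V(1)] W(1) Int_lower2 W(2) bb] by (simp add: de_def Let_def)
 qed
 obtain D where D: "D : Der f (\<Union>\<U>)"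
  "!!x bb. x : \<Union>\<U> ==> bb :[SX x] ==> vact X (\<Union>\<U>) D x bb = de x bb"
 proof (rule vfield_exists[OF U, of de])
  fix x assume "x : \<Union>\<U>"
  then obtain V where V: "V : \<U>" "x : V" by auto
  have "x : pts X" using X.opn_subset[OF s(1)[OF V(1)]] V(2) by auto
  thus "der (SX x) (SX x) (%a. a) (de x)" by (intro der_cong[OF vact_der[OF s(2,1)[OF V(1)] V(2)]] X.stalk_cring) (simp_all add: de[OF V])
  fix gg assume "gg :[SY x]"
  thus "de x (smap f x gg) = 0[SX x]" using de[OF V] vact_kills[OF s(2,1)[OF V(1)] V(2)] \<open>x \<in> pts X\<close> by simp
 next
  fix W t x assume W: "opn X W" "W <= \<Union>\<U>" "t : X.\<O> W" "x : W"
  then obtain V where V: "V : \<U>" "x : V" by auto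
  let ?W = "W Int V"
  have W': "opn X ?W" "?W <= V" "?W <= W" using W s(1)[OF V(1)] by auto
  have "rg X z ?W (s V ?W (rst X W ?W t)) = de z (rg X z W t)" if "z : ?W" for z
   using de[OF V(1), of z "rg X z W t"] vact_germ[OF s(2,1)[OF V(1)] W(1,3) W'(1) that W'(2,3)] that W by simp
  thus "EX W' t'. opn X W' & x : W' & W' <= W & t' : X.\<O> W' & (ALL z:W'. rg X z W' t' = de z (rg X z W t))"
   using derivationsD(2)[OF s(2)[OF V(1)] W'(1,2), of "rst X W ?W t"] W W' V by auto
 qed blast
 show "EX! D. D : Sec T (\<Union>\<U>) & (ALL U:\<U>. mrst T (\<Union>\<U>) U D = s U)"
 proof (rule ex1I[of _ D])
  show "D : Sec T (\<Union>\<U>) & (ALL U:\<U>. mrst T (\<Union>\<U>) U D = s U)"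
  proof (intro conjI ballI)
   fix V assume V: "V : \<U>"
   have VU: "V <= \<Union>\<U>" using V by auto
   note R = vfield_restrict[OF D(1) U s(1)[OF V] VU]
   show "mrst T (\<Union>\<U>) V D = s V"
   proof (rule derivations_eqI[OF R(1) s(2,1)[OF V]])
    fix x bb assume x: "x : V" "bb :[SX x]"
    thus "vact X V (mrst T (\<Union>\<U>) V D) x bb = vact X V (s V) x bb"
     using R(2)[OF x] D(2)[OF subsetD[OF VU x(1)] x(2)] de[OF V x] by simp
   qed
  qed (use D in "simp add: tan_simps")
  fix E assume E: "E : Sec T (\<Union>\<U>) & (ALL U:\<U>. mrst T (\<Union>\<U>) U E = s U)"
  show "E = D"
  proof (rule derivations_eqI[OF _ D(1) U])
   show E': "E : Der f (\<Union>\<U>)" using E by (simp add: tan_simps)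
   fix x bb assume x: "x : \<Union>\<U>" "bb :[SX x]"
   then obtain V where V: "V : \<U>" "x : V" by auto
   have "V <= \<Union>\<U>" using V by auto
   thus "vact X (\<Union>\<U>) E x bb = vact X (\<Union>\<U>) D x bb"
    using vfield_restrict(2)[OF E' U s(1)[OF V(1)] _ V(2) x(2)] E V D(2)[OF x] de[OF V x(2)] by simp
  qed
 qed
qed (use presheaf_onD[OF tangent_presheaf] in auto)

lemma tangent_mod_sheaf: "is_mod_sheaf X T" unfolding is_mod_sheaf_def
proof (intro conjI allI impI ballI tangent_module tangent_sheaf; (elim conjE)?)
 fix U V D E assume UV: "opn X U" "opn X V" "V <= U" and D: "D : Sec T U"
 show "mrst T U V (D +[msec T U] E) = mrst T U V D +[msec T V] mrst T U V E" using UV by (auto simp: tan_simps fun_eq_iff)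
 show "mrst T U V (a .[msec T U] D) = rst X U V a .[msec T V] mrst T U V D" if "a : X.\<O> U" for a
  using UV that by (auto simp: tan_simps fun_eq_iff)
qed

end

subsection \<open>The Lie algebra of vector fields\<close>

text \<open>The six elements are the results of applying three fields in their six orders; each of
  them occurs once with either sign.\<close>

lemma (in abelian_group) jacobi_sum: assumes [simp]: "a :[G]" "b :[G]" "c :[G]" "d :[G]" "e :[G]" "f :[G]"
 shows "((a -[G] b) -[G] (c -[G] d)) +[G] ((c -[G] e) -[G] (f -[G] b)) +[G] ((f -[G] d) -[G] (a -[G] e)) = 0[G]"
proof -
 let ?S = "a +[G] b +[G] c +[G] d +[G] e +[G] f"
 have "((a -[G] b) -[G] (c -[G] d)) +[G] ((c -[G] e) -[G] (f -[G] b)) +[G] ((f -[G] d) -[G] (a -[G] e)) = ?S +[G] (-[G] ?S)"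
  by (simp add: minus_eq minus_add a_ac)
 thus ?thesis by (simp add: r_neg)
qed

context morph
begin

lemma commutator_lie: assumes U: "opn X U" and D: "D : Der f U" and E: "E : Der f U" shows "comm X U D D = 0[msec T U]"
  and "a : X.\<O> U ==> comm X U D (a .[msec T U] E) =
   (a .[msec T U] comm X U D E) +[msec T U] (D U a .[msec T U] E)" and "a : X.\<O> U ==> comm X U (a .[msec T U] D) E =
   (a .[msec T U] comm X U D E) +[msec T U] ((-[sect X U] E U a) .[msec T U] D)" and "F : Der f U ==>
   comm X U (D +[msec T U] E) F = comm X U D F +[msec T U] comm X U E F" and "F : Der f U ==>
   comm X U F (D +[msec T U] E) = comm X U F D +[msec T U] comm X U F E" and "F : Der f U ==> comm X U D (comm X U E F) +[msec T U]
   comm X U E (comm X U F D) +[msec T U] comm X U F (comm X U D E) = 0[msec T U]" and "opn X V ==> V <= U ==>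
   mrst T U V (comm X U D E) = comm X V (mrst T U V D) (mrst T U V E)"
proof -
 interpret O: cring "sect X U" by (rule X.sect_cring[OF U])
 note cl = vfield_add(1)[OF _ _ U] vfield_smult(1)[OF _ _ U] vfield_zero(1)[OF U] vfield_commutator(1)[OF _ _ U]
  and va = vfield_add(2)[OF _ _ U] vfield_smult(2)[OF _ _ U] vfield_zero(2)[OF U] vfield_commutator(2)[OF _ _ U]
 have S: "cring (SX x)" if "x : U" for x using X.stalk_cring X.opn_subset[OF U] that by blast
 have add: "vact X U D x (bb +[SX x] gg) = vact X U D x bb +[SX x] vact X U D x gg"
  and mult: "vact X U D x (bb *[SX x] gg) = bb *[SX x] vact X U D x gg +[SX x] gg *[SX x] vact X U D x bb"
  and diff: "vact X U D x (bb -[SX x] gg) = vact X U D x bb -[SX x] vact X U D x gg"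
  if "D : Der f U" "x : U" "bb :[SX x]" "gg :[SX x]" for D x bb gg using derD(2,3)[OF vact_der[OF that(1) U that(2)] that(3,4)]
   der_diff[OF vact_der[OF that(1) U that(2)] S S that(3,4)] that(2) by auto
 have germ: "rg X x U (D U a) = vact X U D x (rg X x U a)" if "D : Der f U" "x : U" "a : X.\<O> U" for D x a
  using vact_germ_same[OF that(1) U U that(2) subset_refl that(3)] by simp
 have Uc: "D U a : X.\<O> U" if "D : Der f U" "a : X.\<O> U" for D a using derivationsD(2)[OF that(1) U subset_refl that(2)] .
 note vc = vact_closed[OF _ U]
 note eqI = derivations_eqI[OF _ _ U]
 show "comm X U D D = 0[msec T U]"
 proof (rule eqI[OF cl(4)[OF D D] cl(3)])
  fix x bb assume x: "x : U" "bb :[SX x]"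
  interpret S: cring "SX x" by (rule S[OF x(1)])
  show "vact X U (comm X U D D) x bb = vact X U 0[msec T U] x bb" using x D by (simp add: va vc)
 qed
 show "comm X U D (a .[msec T U] E) =
   (a .[msec T U] comm X U D E) +[msec T U] (D U a .[msec T U] E)" if a: "a : X.\<O> U"
 proof (rule eqI)
  fix x bb assume x: "x : U" "bb :[SX x]"
  interpret S: cring "SX x" by (rule S[OF x(1)])
  have ac: "rg X x U a :[SX x]" using a x U by simp
  show "vact X U (comm X U D (a .[msec T U] E)) x bb =
    vact X U ((a .[msec T U] comm X U D E) +[msec T U] (D U a .[msec T U] E)) x bb"
   using x D E a ac by (simp add: va cl vc Uc mult germ S.minus_eq S.r_distr S.r_minus S.a_ac S.m_ac)
 qed ((rule D E a Uc[OF D a] cl(1) cl(2) cl(4))+)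
 show "comm X U (a .[msec T U] D) E =
   (a .[msec T U] comm X U D E) +[msec T U] ((-[sect X U] E U a) .[msec T U] D)" if a: "a : X.\<O> U"
 proof (rule eqI)
  fix x bb assume x: "x : U" "bb :[SX x]"
  interpret S: cring "SX x" by (rule S[OF x(1)])
  interpret h: ring_hom_cring "sect X U" "SX x" "rg X x U" using U x X.rgerm_hom by (intro ring_hom_cringI O.cring_axioms S.cring_axioms)
  have ac: "rg X x U a :[SX x]" using a by simp
  show "vact X U (comm X U (a .[msec T U] D) E) x bb =
    vact X U ((a .[msec T U] comm X U D E) +[msec T U] ((-[sect X U] E U a) .[msec T U] D)) x bb" using x D E a
   by (simp add: va cl vc Uc mult germ S.minus_eq S.r_distr S.r_minus S.minus_add S.a_ac S.m_ac)
 qed ((rule D E a Uc[OF E a] O.a_inv_closed cl(1) cl(2) cl(4))+)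
 show "comm X U (D +[msec T U] E) F = comm X U D F +[msec T U] comm X U E F"
  "comm X U F (D +[msec T U] E) = comm X U F D +[msec T U] comm X U F E"
  if F: "F : Der f U"
 proof -
  have *: "vact X U (comm X U (D +[msec T U] E) F) x bb = vact X U (comm X U D F +[msec T U] comm X U E F) x bb"
   "vact X U (comm X U F (D +[msec T U] E)) x bb = vact X U (comm X U F D +[msec T U] comm X U F E) x bb"
   if x: "x : U" "bb :[SX x]" for x bb
  proof -
   interpret S: cring "SX x" by (rule S[OF x(1)])
   show "vact X U (comm X U (D +[msec T U] E) F) x bb = vact X U (comm X U D F +[msec T U] comm X U E F) x bb"
    "vact X U (comm X U F (D +[msec T U] E)) x bb = vact X U (comm X U F D +[msec T U] comm X U F E) x bb"
    using x D E F by (simp_all add: va cl vc add S.minus_eq S.minus_add S.a_ac)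
  qed
  show "comm X U (D +[msec T U] E) F = comm X U D F +[msec T U] comm X U E F"
   "comm X U F (D +[msec T U] E) = comm X U F D +[msec T U] comm X U F E" by (rule eqI; (rule D E F cl(1) cl(4) | (rule *; assumption))+)+
 qed
 show "comm X U D (comm X U E F) +[msec T U]
   comm X U E (comm X U F D) +[msec T U] comm X U F (comm X U D E) = 0[msec T U]"
  if F: "F : Der f U"
 proof (rule eqI)
  fix x bb assume x: "x : U" "bb :[SX x]"
  interpret S: cring "SX x" by (rule S[OF x(1)])
  show "vact X U (comm X U D (comm X U E F) +[msec T U]
   comm X U E (comm X U F D) +[msec T U] comm X U F (comm X U D E)) x bb = vact X U 0[msec T U] x bb"
   using x D E F by (simp add: va cl vc diff S.jacobi_sum)
 qed ((rule cl(1) cl(3) cl(4) D E F)+)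
 show "mrst T U V (comm X U D E) = comm X V (mrst T U V D) (mrst T U V E)" if V: "opn X V" "V <= U"
  using V by (auto simp: tan_simps commutator_def fun_eq_iff)
qed

text \<open>The leaf foliation and the horizontal fields are both sheaves of vector fields with the
  commutator as bracket. The laws are inherited from all vector fields, so closure under the bracket
  is the essential condition.\<close>

lemma sub_lie_algebroid: assumes L: "is_mod_sheaf X L" "!!U. opn X U ==> Sec L U <= Der f U"
  and ops: "!!U. opn X U ==> 0[msec L U] = 0[msec T U] & add (msec L U) = add (msec T U) & smult (msec L U) = smult (msec T U)"
   "mrst L = mrst T" "bracket L = comm X" "anchor L = (\<lambda>U\<in>{U. opn X U}. \<lambda>D\<in>Sec L U. D)"
  and br: "!!U D E. opn X U ==> D : Sec L U ==> E : Sec L U ==> comm X U D E : Sec L U" shows "is_lie_algebroid f L"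
proof -
 have d: "D : Der f U" if "opn X U" "D : Sec L U" for U D using L(2) that by blast
 have P: "presheaf_on (space_top X) (Sec L) (mrst L)" using L(1) by (auto simp: is_mod_sheaf_def sheaf_on_presheaf)
 have M: "module (sect X U) (msec L U)" if "opn X U" for U using L(1) that by (auto simp: is_mod_sheaf_def)
 show ?thesis unfolding is_lie_algebroid_def Let_def
 proof (intro conjI allI impI ballI; (elim conjE)?)
  show "anchor L : sheaf_hom X L T" unfolding sheaf_hom_def mem_Collect_eq
  proof (intro conjI allI impI; (elim conjE)?)
   show "anchor L : (\<Pi>\<^sub>E U\<in>{U. opn X U}. Sec L U \<rightarrow>\<^sub>E Sec T U)"
    unfolding ops(4) using subsetD[OF L(2)] by (auto simp: tan_simps)
   show "linear_map (sect X U) (msec L U) (msec T U) (anchor L U)" if U: "opn X U" for U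
   proof -
    interpret M: module "sect X U" "msec L U" by (rule M[OF U])
    show ?thesis unfolding linear_map_def using U L(2)[OF U] ops(1)[OF U] M.M.a_closed M.smult_closed by (auto simp: ops(4) tan_simps(1))
   qed
   show "anchor L V (mrst L U V m) = mrst T U V (anchor L U m)"
    if "opn X U" "opn X V" "V <= U" "m : Sec L U" for U V m using that presheaf_onD(1)[OF P that] by (simp add: ops(2,4))
  qed
  fix U u v assume U: "opn X U" and u: "u : Sec L U" and v: "v : Sec L U"
  note du = d[OF U u] and dv = d[OF U v]
  note c = commutator_lie[OF U du dv]
  show "bracket L U u v : Sec L U" unfolding ops(3) by (rule br[OF U u v])
  show "bracket L U u u = 0[msec L U]" using c(1) ops(1)[OF U] by (simp add: ops(3))
  show "anchor L U (bracket L U u v) = comm X U (anchor L U u) (anchor L U v)" using U u v br[OF U u v] by (simp add: ops(3,4))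
  show "bracket L U u (a .[msec L U] v) = (a .[msec L U] bracket L U u v) +[msec L U] (anchor L U u U a .[msec L U] v)"
   if "a : X.\<O> U" for a using c(2)[OF that] U u ops(1)[OF U] by (simp add: ops(3,4))
  show "mrst L U V (bracket L U u v) = bracket L V (mrst L U V u) (mrst L U V v)" if "opn X V" "V <= U" for V
   using c(7)[OF that] by (simp add: ops(2,3))
  fix w assume w: "w : Sec L U"
  note dw = d[OF U w]
  show "bracket L U (u +[msec L U] v) w = bracket L U u w +[msec L U] bracket L U v w"
   "bracket L U w (u +[msec L U] v) = bracket L U w u +[msec L U] bracket L U w v"
   "bracket L U u (bracket L U v w) +[msec L U] bracket L U v (bracket L U w u)
       +[msec L U] bracket L U w (bracket L U u v) = 0[msec L U]" using c(4-6)[OF dw] ops(1)[OF U] by (simp_all add: ops(3))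
 qed fact
qed

end

lemma subsheaf_on: assumes F: "sheaf_on T F r" and sub: "!!U. openin T U ==> C U <= F U"
  and res: "!!U V s. openin T U ==> openin T V ==> V <= U ==> s : C U ==> r U V s : C V" and loc: "!!U s. openin T U ==> s : F U ==>
   (!!x. x : U ==> EX W. openin T W & x : W & W <= U & r U W s : C W) ==> s : C U" shows "sheaf_on T C r"
proof -
 note P = sheaf_on_presheaf[OF F]
 show ?thesis unfolding sheaf_on_def
 proof (intro conjI allI impI; (elim conjE)?)
  fix \<U> s assume s: "ALL U:\<U>. openin T U & s U : C U" and c: "ALL U:\<U>. ALL V:\<U>. r U (U Int V) (s U) = r V (U Int V) (s V)"
  have s': "ALL U:\<U>. openin T U & s U : F U" using s subsetD[OF sub] by simp
  have ex: "EX! t. t : F (\<Union>\<U>) & (ALL U:\<U>. r (\<Union>\<U>) U t = s U)"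
   by (rule sheaf_on_ex1[OF F]; (rule c[rule_format]; assumption)?; (use s' in blast)?)
  obtain t where t': "t : F (\<Union>\<U>) & (ALL U:\<U>. r (\<Union>\<U>) U t = s U)" by (rule exE[OF ex1_implies_ex[OF ex]])
  note t = conjunct1[OF t'] conjunct2[OF t']
  have uniq: "t' = t" if "t' : F (\<Union>\<U>)" "ALL U:\<U>. r (\<Union>\<U>) U t' = s U" for t'
   by (rule ex1E[OF ex], frule spec[of _ t], drule spec[of _ t']) (use t that in simp)
  have o: "openin T (\<Union>\<U>)" using s by blast
  have "t : C (\<Union>\<U>)"
  proof (rule loc[OF o t(1)])
   fix x assume "x : \<Union>\<U>"
   then obtain U where "U : \<U>" "x : U" by auto
   thus "EX W. openin T W & x : W & W <= \<Union>\<U> & r (\<Union>\<U>) W t : C W" using s t(2) by auto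
  qed
  thus "EX! t. t : C (\<Union>\<U>) & (ALL U:\<U>. r (\<Union>\<U>) U t = s U)" using t(2) uniq subsetD[OF sub[OF o]] by blast
 qed (use res subsetD[OF sub] presheaf_onD(2,3)[OF P] in auto)
qed

lemma submodule_sheaf: assumes M: "is_mod_sheaf X M" and C: "!!U. opn X U ==> submodule (C U) (sect X U) (msec M U)"
  and sh: "sheaf_on (space_top X) C (mrst M)" and L: "!!U. msec L U = (msec M U)\<lparr>carrier := C U\<rparr>" "mrst L = mrst M"
 shows "is_mod_sheaf X L"
proof -
 have sub: "C U <= Sec M U" if "opn X U" for U using submodule.axioms(1)[OF C[OF that]] subgroup.subset by fastforce
 show ?thesis unfolding is_mod_sheaf_def
 proof (intro conjI allI impI ballI; (elim conjE)?)
  show "module (sect X U) (msec L U)" if "opn X U" for U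
   unfolding L using submodule.submodule_is_module[OF C[OF that]] M that by (auto simp: is_mod_sheaf_def)
  show "sheaf_on (space_top X) (Sec L) (mrst L)" using sh by (simp add: L)
 qed (use M sub in "auto simp: is_mod_sheaf_def L subset_iff")
qed

subsection \<open>Extension of derivations from affine opens\<close>

text \<open>The quotient rule: \<open>x\<close> is the unknown derivative of a fraction with
  denominator \<open>b\<close>, and \<open>z\<close> is the term of the Leibniz rule in which
  \<open>b\<close> is differentiated.\<close>

lemma (in cring) solve_fraction: assumes "b :[R]" "c :[R]" "x :[R]" "z :[R]" "b *[R] c = 1[R]" shows "c *[R] ((b *[R] x +[R] z) -[R] z) = x"
proof -
 have "(b *[R] x +[R] z) -[R] z = b *[R] x" using assms by (simp add: minus_eq a_assoc r_neg)
 hence "c *[R] ((b *[R] x +[R] z) -[R] z) = (b *[R] c) *[R] x" using assms m_lcomm[of c b x] m_assoc[of b c x] by simp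
 thus ?thesis using assms by simp
qed

lemma (in local_ringed) affine_localizing: assumes "affine_open X U" "x : U" shows "localizing (sect X U) (stk X x) (rg X x U)"
proof -
 obtain R :: "'b ring" and f where "opn X U" "cring R" "is_iso f" "source f = rs_restrict X U" "target f = Spec R"
  using assms(1) by (auto simp: affine_open_def)
 then interpret affine_iso X U R f by (intro affine_iso.intro affine_iso_axioms.intro local_ringed_axioms)
 show ?thesis by (rule localizing_stalk[OF assms(2)])
qed

context morph
begin

text \<open>A derivation of the functions on an affine open extends to each stalk by localisation,
  and the quotient rule shows that the extensions map sections to sections. The condition
  \<open>kills\<close> speaks about any extension \<open>de\<close> to a stalk, because the actual
  one is constructed only in the proof.\<close>

lemma vfield_extend: assumes U: "affine_open X U" and W: "opn X W" "W <= U" and d: "der (sect X U) (sect X W) (rst X U W) d"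
  and kills: "!!z de gg. z : W ==> der (SX z) (SX z) (%a. a) de ==>
   (!!a. a : X.\<O> U ==> de (rg X z U a) = rg X z W (d a)) ==> gg :[SY z] ==>
   de (smap f z gg) = 0[SX z]" obtains D where "D : Der f W"
  "!!z a. z : W ==> a : X.\<O> U ==> vact X W D z (rg X z U a) = rg X z W (d a)"
proof -
 have oU: "opn X U" using U by (simp add: affine_open_def)
 note dc = der_closed[OF d]
 have S: "cring (SX z)" if "z : W" for z using X.stalk_cring X.opn_subset[OF W(1)] that by blast
 have "EX de. der (SX z) (SX z) (%a. a) de & (ALL a:X.\<O> U. de (rg X z U a) = rg X z W (d a))" if z: "z : W" for z
 proof -
  note g = X.rgerm_hom[OF W(1) z]
  have "der (sect X U) (SX z) (%a. rg X z U a) (%a. rg X z W (d a))" unfolding der_def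
   using dc derD(2,3)[OF d] oU W z X.sect_closed[OF W(1)] by (auto simp: X.rgerm_ops)
  thus ?thesis using der_localizing_ex[OF X.sect_cring[OF oU] S[OF z] S[OF z] X.affine_localizing[OF U subsetD[OF W(2) z]],
     of "%a. a" "%a. rg X z W (d a)"] id_ring_hom[unfolded id_def] by metis
 qed
 then obtain de where de: "!!z. z : W ==> der (SX z) (SX z) (%a. a) (de z)"
  "!!z a. z : W ==> a : X.\<O> U ==> de z (rg X z U a) = rg X z W (d a)" by metis
 obtain D where D: "D : Der f W" "!!z bb. z : W ==> bb :[SX z] ==> vact X W D z bb = de z bb"
 proof (rule vfield_exists[OF W(1) de(1)])
  fix V s x assume V: "opn X V" "V <= W" and s: "s : X.\<O> V" and x: "x : V"
  have xU: "x : U" "x : W" using x V W by auto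
  obtain a b where ab: "a : X.\<O> U" "b : X.\<O> U" "rg X x U b : Units (SX x)"
   "rg X x U b *[SX x] rg X x V s = rg X x U a"
   using X.affine_localizing[OF U xU(1)] X.rgerm_closed[OF V(1) x s] unfolding localizing_def by blast
  obtain V1 c where V1: "opn X V1" "x : V1" "V1 <= U" "c : X.\<O> V1" "rst X U V1 b *[sect X V1] c = 1[sect X V1]"
   using X.rgerm_unit[OF oU xU(1) ab(2,3)] by metis
  let ?V = "V Int V1"
  have V': "opn X ?V" "x : ?V" "?V <= V" "?V <= V1" "?V <= U" "?V <= W" using V V1 x by auto
  let ?b = "rst X U ?V b" and ?s = "rst X V ?V s"
  have car: "?b : X.\<O> ?V" "?s : X.\<O> ?V" "rst X U ?V a : X.\<O> ?V" using oU V V' s ab by auto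
  have "rg X x ?V (?b *[sect X ?V] ?s) = rg X x U a" using X.rgerm_mult_gen[OF oU ab(2) V(1) s V'(1,2,5,3)] ab(4) by simp
  then obtain N where N: "opn X N" "x : N" "N <= ?V" "rst X ?V N (?b *[sect X ?V] ?s) = rst X U N a"
   using X.rgerm_eqD[OF oU xU(1) ab(1)] by metis
  have NU: "N <= U" "N <= V" "N <= V1" "N <= W" using N(3) V' by auto
  interpret N: cring "sect X N" by (rule X.sect_cring[OF N(1)])
  \<comment> \<open>The quotient rule for the fraction \<open>a/b\<close> that represents
    \<open>s\<close> near \<open>x\<close>, where \<open>c\<close> is the inverse of
    \<open>b\<close> on \<open>V1\<close>.\<close>
  let ?t = "rst X V1 N c *[sect X N] (rst X W N (d a) -[sect X N] (rst X V N s *[sect X N] rst X W N (d b)))"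
  have Nc: "rst X V1 N c : X.\<O> N" "rst X W N (d a) : X.\<O> N" "rst X W N (d b) : X.\<O> N" "rst X V N s : X.\<O> N" "rst X U N b : X.\<O> N"
   using N V V1 W oU s ab dc by auto
  have Ns: "rst X U N b *[sect X N] rst X V N s = rst X U N a" using N(4) N(1,3) V' oU V s ab(2) by (simp add: X.rst_ops)
  have "rst X V1 N (rst X U V1 b *[sect X V1] c) = 1[sect X N]" unfolding V1(5) using V1(1) N(1) NU by (simp add: X.rst_ops)
  moreover have "rst X U V1 b : X.\<O> V1" using V1(1,3) oU ab(2) by simp
  ultimately have Nbc: "rst X U N b *[sect X N] rst X V1 N c = 1[sect X N]" using V1(1,3,4) N(1) NU oU ab(2) by (simp add: X.rst_ops)
  have "rg X z N ?t = de z (rg X z V s)" if z: "z : N" for z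
  proof -
   have zW: "z : W" "z : V" "z : U" "z : V1" using z NU by auto
   interpret S: cring "SX z" by (rule S[OF zW(1)])
   interpret h: ring_hom_cring "sect X N" "SX z" "rg X z N"
    using N(1) z X.rgerm_hom by (intro ring_hom_cringI N.cring_axioms S.cring_axioms)
   have g: "rg X z N (rst X V1 N c) = rg X z V1 c" "rg X z N (rst X W N (d a)) = de z (rg X z U a)"
    "rg X z N (rst X W N (d b)) = de z (rg X z U b)" "rg X z N (rst X V N s) = rg X z V s"
    "rg X z N (rst X U N b) = rg X z U b" "rg X z N (rst X U N a) = rg X z U a"
    using N(1) NU z V V1 W oU s ab dc de(2)[OF zW(1)] by simp_all
   have gc: "rg X z U b :[SX z]" "rg X z V s :[SX z]" "rg X z V1 c :[SX z]" using oU V V1 zW ab s by auto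
   note dz = der_closed[OF de(1)[OF zW(1)]]
   have "de z (rg X z U a) = de z (rg X z U b *[SX z] rg X z V s)" using Ns h.hom_mult[OF Nc(5,4)] g by simp
   also have "... = (rg X z U b *[SX z] de z (rg X z V s)) +[SX z] (rg X z V s *[SX z] de z (rg X z U b))"
    by (rule derD(3)[OF de(1)[OF zW(1)] gc(1,2)])
   finally have e: "de z (rg X z U a) = ..." .
   have "rg X z U b *[SX z] rg X z V1 c = 1[SX z]" using Nbc h.hom_mult[OF Nc(5,1)] g by simp
   thus ?thesis using Nc S.solve_fraction[OF gc(1,3) dz[OF gc(2)] S.m_closed[OF gc(2) dz[OF gc(1)]]] by (simp add: g e)
  qed
  thus "EX W' t. opn X W' & x : W' & W' <= V & t : X.\<O> W' & (ALL z:W'. rg X z W' t = de z (rg X z V s))"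
   using N Nc by (intro exI[of _ N] exI[of _ ?t]) simp
 next
  show "de z (smap f z gg) = 0[SX z]" if "z : W" "gg :[SY z]" for z gg
   by (rule kills[OF that(1) de(1)[OF that(1)] de(2)[OF that(1)] that(2)])
 qed ((assumption | (rule that; assumption))+)
 show ?thesis by (rule that[OF D(1)]) (use D(2) de(2) oU W in auto)
qed

end

subsection \<open>Charts of smooth morphisms\<close>

lemma (in abelian_monoid) msum_delta: assumes "finite S" "i : S" "!!j. j : S ==> j ~= i ==> g j = 0[G]" "g i :[G]"
 shows "msum G g (mset_set S) = g i"
proof -
 have "mset_set S = add_mset i (mset_set (S - {i}))" using assms(1,2) by (simp add: mset_set.remove)
 moreover have "msum G g (mset_set (S - {i})) = 0[G]" using assms(1,3) by (intro msum_zero) simp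
 ultimately show ?thesis using assms(4) by simp
qed

lemma (in abelian_monoid) msum_swap: assumes "!!i j. i :# I ==> j :# J ==> g i j :[G]"
 shows "msum G (%i. msum G (g i) J) I = msum G (%j. msum G (%i. g i j) I) J" using assms
proof (induction I)
 case empty
 thus ?case by (simp add: msum_zero)
next
 case (add i I)
 have "msum G (%j. msum G (%i. g i j) (add_mset i I)) J = msum G (%j. g i j +[G] msum G (%i. g i j) I) J"
  using add.prems by (intro msum_cong) simp
 also have "... = msum G (g i) J +[G] msum G (%j. msum G (%i. g i j) I) J" using add.prems by (intro msum_add) simp_all
 finally show ?case using add by simp
qed

locale smooth_morph = morph + assumes smooth: "smooth_morphism f"
begin

definition chart where
 "chart U V n c F a N \<longleftrightarrow> affine_open X U & affine_open Y V & U <= pre f V &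
  spres (sect Y V) (sect X U) (pull f V U) n c F a N"

lemma chart_exists: assumes "x : pts X" obtains U V n c F a N where "chart U V n c F a N" "x : U"
proof -
 have "EX U V. x : U & affine_open X U & affine_open Y V & U <= pre f V &
   standard_smooth (sect Y V) (sect X U) (pull f V U)" using smooth assms unfolding smooth_morphism_def by simp
 thus ?thesis unfolding standard_smooth_iff using that unfolding chart_def by auto
qed

context
 fixes U V n c F a N assumes chart: "chart U V n c F a N"
begin

lemma chartD: "affine_open X U" "affine_open Y V" "U <= pre f V"
  "spres (sect Y V) (sect X U) (pull f V U) n c F a N" "opn X U" "opn Y V" using chart by (simp_all add: chart_def affine_open_def)

lemma chart_coord: "l < n ==> a l : X.\<O> U" using chartD(4) unfolding spres_def by simp

lemma chart_algebra: "cring B ==> ps : ring_hom (sect X U) B ==>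
  smooth_algebra (sect Y V) (sect X U) B (pull f V U) n c F a N ps" using chartD X.sect_cring Y.sect_cring
 by (intro smooth_algebra.intro coeff_ring.intro smooth_algebra_axioms.intro)

text \<open>The difference of the two derivations vanishes on the functions of the chart by
  \<open>derivation_zero\<close>, hence on the stalk, which is a localisation of them. Allowing any
  local ring \<open>B\<close> over the stalk covers derivations along morphisms.\<close>

lemma chart_der_eqI: assumes z: "z : U" and B: "is_local_ring B" and ps: "ps : ring_hom (SX z) B"
  and d: "der (SX z) B ps d" "der (SX z) B ps d'" and base: "!!gg. gg :[SY z] ==> d (smap f z gg) = d' (smap f z gg)"
  and coord: "!!l. c <= l ==> l < n ==> d (rg X z U (a l)) = d' (rg X z U (a l))" and bb: "bb :[SX z]" shows "d bb = d' bb"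
proof -
 have Bc: "cring B" using B by (simp add: is_local_ring_def)
 interpret B: cring B by (rule Bc)
 have zX: "z : pts X" using X.opn_subset[OF chartD(5)] z by blast
 note S = X.stalk_cring[OF zX]
 note g = X.rgerm_hom[OF chartD(5) z]
 note dc = der_closed[OF d(1)] der_closed[OF d(2)]
 interpret sm: smooth_algebra "sect Y V" "sect X U" B "pull f V U" n c F a N "%s. ps (rg X z U s)"
  using ring_hom_trans[OF g ps] by (intro chart_algebra Bc) (simp add: comp_def)
 let ?e = "%bb. d bb -[B] d' bb"
 have e: "der (SX z) B ps ?e" by (rule der_minus[OF S Bc ps d])
 have zero: "x -[B] y = 0[B]" if "x = y" "y :[B]" for x y using that by simp
 have "?e (rg X z U s) = 0[B]" if s: "s : X.\<O> U" for s
 proof (rule sm.derivation_zero[OF B der_comp_hom[OF X.sect_cring[OF chartD(5)] S g e] _ _ s])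
  fix r assume r: "r : Y.\<O> V"
  have "rg X z U (pull f V U r) = smap f z (rg Y (pt f z) V r)" by (rule pull_germ[OF chartD(6,5,3) r z])
  moreover have "rg Y (pt f z) V r :[SY z]" using r z chartD(3,6) by (auto simp: preimg_mem)
  ultimately show "?e (rg X z U (pull f V U r)) = 0[B]" using zX by (simp add: base dc)
 next
  fix l assume "c <= l" "l < n"
  thus "?e (rg X z U (a l)) = 0[B]" using z chartD(5) by (simp add: coord dc)
 qed
 hence "?e bb = 0[B]" using der_localizing_ext[OF S Bc X.affine_localizing[OF chartD(1) z] ps e der_zero_map[OF Bc ps] _ bb] by simp
 thus ?thesis using bb dc by simp
qed

lemma rst_pull: assumes "opn X W" "W <= U" "b : Y.\<O> V" shows "rst X U W (pull f V U b) = pull f V W b"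
 using assms chartD by (simp add: pull_def)

lemma chart_extend: assumes W: "opn X W" "W <= U" and d: "der (sect Y V) (sect X W) (pull f V W) d"
  and e: "!!l. c <= l ==> l < n ==> e l : X.\<O> W" obtains D where "der (sect X U) (sect X W) (rst X U W) D"
  "!!r. r : Y.\<O> V ==> D (pull f V U r) = d r" "!!l. c <= l ==> l < n ==> D (a l) = e l"
proof -
 interpret sm: smooth_algebra "sect Y V" "sect X U" "sect X W" "pull f V U" n c F a N "rst X U W"
  using W chartD by (intro chart_algebra X.sect_cring X.rst_hom)
 have "der (sect Y V) (sect X W) (%r. rst X U W (pull f V U r)) d"
  using der_cong[OF d Y.sect_cring[OF chartD(6)], of "%r. rst X U W (pull f V U r)" d] rst_pull[OF W] by simp
 thus ?thesis by (rule sm.derivation_extend) (((erule (1) e) | (rule that; assumption))+)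
qed

text \<open>The relative vector fields dual to the coordinates, that is, the partial
  derivatives.\<close>

definition frame where
 "frame fr \<longleftrightarrow> (ALL l. c <= l --> l < n --> fr l : Der f U & (ALL m. c <= m --> m < n -->
  (ALL z:U. vact X U (fr l) z (rg X z U (a m)) = (if m = l then 1[SX z] else 0[SX z]))))"

text \<open>A derivation of the chart is obtained by prescribing zero on the base and Kronecker
  deltas at the coordinates, and \<open>vfield_extend\<close> turns it into a field. It kills all
  germs of base functions because these are fractions of functions on the affine open
  \<open>V\<close>.\<close>

lemma frame_exists: obtains fr where "frame fr"
proof -
 note o = chartD(5,6)
 define P where "P l D \<longleftrightarrow> D : Der f U & (ALL m. c <= m --> m < n --> (ALL z:U. vact X U D z (rg X z U (a m)) =
   (if m = l then 1[SX z] else 0[SX z])))" for l D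
 have ex: "EX D. P l D" for l
 proof -
  note zero = der_zero_map[OF X.sect_cring[OF o(1)] pull_hom[OF o(2,1) chartD(3)]]
  obtain D where D: "der (sect X U) (sect X U) (rst X U U) D"
   "!!r. r : Y.\<O> V ==> D (pull f V U r) = 0[sect X U]"
   "!!m. c <= m ==> m < n ==> D (a m) = (if m = l then 1[sect X U] else 0[sect X U])"
   by (rule chart_extend[OF o(1) subset_refl zero, of "%m. if m = l then 1[sect X U] else 0[sect X U]"])
    (((simp add: X.sect_closed[OF o(1)]; fail) | (rule that; assumption))+)
  obtain E where E: "E : Der f U" "!!z s. z : U ==> s : X.\<O> U ==> vact X U E z (rg X z U s) = rg X z U (D s)"
  proof (rule vfield_extend[OF chartD(1) o(1) subset_refl D(1)])
   fix z de gg assume z: "z : U" and de: "der (SX z) (SX z) (%a. a) de"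
    "!!s. s : X.\<O> U ==> de (rg X z U s) = rg X z U (D s)" and gg: "gg :[SY z]"
   have zX: "z : pts X" and zV: "pt f z : V" using z chartD(3) by (auto simp: preimg_mem)
   note S = X.stalk_cring[OF zX] Y.stalk_cring[OF pt_closed[OF zX]]
   show "de (smap f z gg) = 0[SX z]"
   proof (rule der_localizing_ext[OF S(2,1) Y.affine_localizing[OF chartD(2) zV] stalk_map_hom[OF zX]
      der_comp_hom[OF S(2,1) stalk_map_hom[OF zX] de(1)] der_zero_map[OF S(1) stalk_map_hom[OF zX]] _ gg])
    fix b assume b: "b : Y.\<O> V"
    have "rg X z U (pull f V U b) = smap f z (rg Y (pt f z) V b)" by (rule pull_germ[OF o(2,1) chartD(3) b z])
    thus "de (smap f z (rg Y (pt f z) V b)) = 0[SX z]"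
     using de(2)[OF pull_closed[OF o(2,1) chartD(3) b]] D(2)[OF b] X.rgerm_zero[OF o(1) z] by simp
   qed
  qed ((assumption | (rule that; assumption))+)
  show ?thesis unfolding P_def
  proof (intro exI[of _ E] conjI E(1) allI impI ballI)
   fix m z assume "c <= m" "m < n" "z : U"
   thus "vact X U E z (rg X z U (a m)) = (if m = l then 1[SX z] else 0[SX z])"
    using E(2)[OF _ chart_coord] D(3) X.rgerm_zero[OF o(1)] X.rgerm_ops(3)[OF o(1)] by simp
  qed
 qed
 have "P l (SOME D. P l D)" for l by (rule someI_ex[OF ex])
 hence "frame (%l. SOME D. P l D)" unfolding P_def frame_def by blast
 thus ?thesis by rule
qed

text \<open>Both sides are derivations along \<open>ps\<close> that vanish on the base and agree at
  the coordinates. With the identity for \<open>ps\<close> this expands vector fields, with a stalk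
  map it expands derivations along a morphism.\<close>

lemma frame_expand: assumes fr: "frame fr" and B: "is_local_ring B" and ps: "ps : ring_hom (SX z) B" and d: "der (SX z) B ps d"
  and z: "z : U" and kill: "!!gg. gg :[SY z] ==> d (smap f z gg) = 0[B]" and bb: "bb :[SX z]"
 shows "d bb = msum B (%l. d (rg X z U (a l)) *[B] ps (vact X U (fr l) z bb)) (ixs c n)"
proof -
 note o = chartD(5,6)
 have fr: "c <= l ==> l < n ==> fr l : Der f U"
  "c <= l ==> l < n ==> c <= m ==> m < n ==> vact X U (fr l) z (rg X z U (a m)) = (if m = l then 1[SX z] else 0[SX z])" for l m
  using fr z by (simp_all add: frame_def)
 have Bc: "cring B" using B by (simp add: is_local_ring_def)
 interpret B: cring B by (rule Bc)
 have zX: "z : pts X" using X.opn_subset[OF o(1)] z by blast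
 note S = X.stalk_cring[OF zX]
 have ps0: "ps 0[SX z] = 0[B]" "ps 1[SX z] = 1[B]" using ring_hom_zero'[OF S Bc ps] ring_hom_one[OF ps] .
 note dc = der_closed[OF d]
 show ?thesis
 proof (rule chart_der_eqI[OF z B ps d _ _ _ bb])
  show "der (SX z) B ps (%bb. msum B (%l. d (rg X z U (a l)) *[B] ps (vact X U (fr l) z bb)) (ixs c n))"
  proof (rule der_msum[OF S Bc ps])
   fix l assume "l :# ixs c n"
   thus "der (SX z) B ps (%bb. d (rg X z U (a l)) *[B] ps (vact X U (fr l) z bb))" using z o chart_coord dc
    by (intro der_smult[OF S Bc ps] der_hom_comp[OF S Bc ps] vact_der[OF fr(1)]) simp_all
  qed
 next
  fix gg assume "gg :[SY z]"
  thus "d (smap f z gg) = msum B (%l. d (rg X z U (a l)) *[B] ps (vact X U (fr l) z (smap f z gg))) (ixs c n)"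
   using kill vact_kills[OF fr(1) o(1) z] ps0 z o chart_coord dc by (subst B.msum_zero) simp_all
 next
  fix m assume m: "c <= m" "m < n"
  hence "msum B (%l. d (rg X z U (a l)) *[B] ps (vact X U (fr l) z (rg X z U (a m)))) (ixs c n) =
    d (rg X z U (a m)) *[B] ps (vact X U (fr m) z (rg X z U (a m)))" using fr(2) ps0 z o chart_coord dc by (intro B.msum_delta) simp_all
  thus "d (rg X z U (a m)) = msum B (%l. d (rg X z U (a l)) *[B] ps (vact X U (fr l) z (rg X z U (a m)))) (ixs c n)"
   using m fr(2) ps0 z o chart_coord dc by simp
 qed
qed

end

end

section \<open>Pullbacks\<close>

subsection \<open>Stalks of sheaves of modules\<close>

text \<open>Pullbacks satisfy these conditions by construction. For pullbacks of tangent sheaves the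
  module laws are derived later, from their action on functions.\<close>

locale premodule = ringed X for X :: "('a, 'b) ringed_space" +
 fixes M :: "('a, 'b, 'm) mod_sheaf" assumes mod_presheaf: "presheaf_on (space_top X) (Sec M) (mrst M)"
  and mod_zero [simp]: "opn X U ==> 0[msec M U] : Sec M U"
  and mod_add [simp]: "opn X U ==> m : Sec M U ==> m' : Sec M U ==> m +[msec M U] m' : Sec M U"
  and mod_smult [simp]: "opn X U ==> a :[sect X U] ==> m : Sec M U ==> a .[msec M U] m : Sec M U"
  and mrst_add: "opn X U ==> opn X V ==> V <= U ==> m : Sec M U ==> m' : Sec M U ==>
   mrst M U V (m +[msec M U] m') = mrst M U V m +[msec M V] mrst M U V m'"
  and mrst_smult: "opn X U ==> opn X V ==> V <= U ==> a :[sect X U] ==> m : Sec M U ==>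
   mrst M U V (a .[msec M U] m) = rst X U V a .[msec M V] mrst M U V m"
begin

abbreviation "SM == stalk_module X M"

lemmas mrst_closed [simp] = presheaf_onD(1)[OF mod_presheaf]
lemmas mrst_mrst [simp] = presheaf_onD(3)[OF mod_presheaf]

lemma mgerm_closed [simp]: "opn X U ==> x : U ==> m : Sec M U ==> mg X M x U m :[SM x]"
 by (simp add: stalk_module_def mgerm_def stalk_def) blast

lemma mgerm_mrst [simp]:
 "opn X U ==> opn X V ==> V <= U ==> x : V ==> m : Sec M U ==> mg X M x V (mrst M U V m) = mg X M x U m"
 unfolding mgerm_def by (rule germ_restrict[OF mod_presheaf])

lemma mgerm_cases: assumes "mu :[SM x]" "opn X U" "x : U" obtains W m where "opn X W" "x : W" "W <= U" "m : Sec M W" "mu = mg X M x W m"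
proof -
 have "mu : stalk (space_top X) (Sec M) (mrst M) x" using assms(1) by (simp add: stalk_module_def)
 thus ?thesis by (rule stalk_shrink[OF mod_presheaf _ assms(2,3)]) (rule, simp_all add: mgerm_def)
qed

lemma mgerm_add: assumes U: "opn X U" "x : U" and m: "m : Sec M U" "m' : Sec M U"
 shows "mg X M x U m +[SM x] mg X M x U m' = mg X M x U (m +[msec M U] m')"
proof -
 have "mg X M x U m +[SM x] mg X M x U m' = mg X M x U (mrst M U U m +[msec M U] mrst M U U m')"
  unfolding stalk_module_def mgerm_def ring.simps
  by (rule germ_op2[OF mod_presheaf mod_presheaf mod_presheaf, where op = "%U. add (msec M U)"])
   (simp_all add: U m mrst_add)
 thus ?thesis using U m presheaf_onD(2)[OF mod_presheaf] by simp
qed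

lemma mgerm_smult: assumes U: "opn X U" "x : U" and m: "a : \<O> U" "m : Sec M U"
 shows "rg X x U a .[SM x] mg X M x U m = mg X M x U (a .[msec M U] m)"
proof -
 have "rg X x U a .[SM x] mg X M x U m = mg X M x U (rst X U U a .[msec M U] mrst M U U m)"
  unfolding stalk_module_def mgerm_def rgerm_def module.simps
  by (rule germ_op2[OF presheaf mod_presheaf mod_presheaf, where op = "%U. smult (msec M U)"])
   (simp_all add: U m mrst_smult)
 thus ?thesis using U m presheaf_onD(2)[OF mod_presheaf] by simp
qed

lemma mgerm_cases2: assumes "mu :[SM x]" "nu :[SM x]" "x : pts X" obtains W m m' where "opn X W" "x : W" "m : Sec M W" "m' : Sec M W"
  "mu = mg X M x W m" "nu = mg X M x W m'" "mu +[SM x] nu = mg X M x W (m +[msec M W] m')"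
proof -
 obtain V m where V: "opn X V" "x : V" "V <= pts X" "m : Sec M V" "mu = mg X M x V m"
  by (rule mgerm_cases[OF assms(1) openin_topspace assms(3)])
 obtain W m' where W: "opn X W" "x : W" "W <= V" "m' : Sec M W" "nu = mg X M x W m'" by (rule mgerm_cases[OF assms(2) V(1,2)])
 show ?thesis using V W mgerm_add[of W x "mrst M V W m" m'] by (intro that[of W "mrst M V W m" m']) simp_all
qed

lemma mgerm_cases_smult: assumes "al :[stk X x]" "nu :[SM x]" "x : pts X" obtains W a m where "opn X W" "x : W" "a : \<O> W" "m : Sec M W"
  "al = rg X x W a" "nu = mg X M x W m" "al .[SM x] nu = mg X M x W (a .[msec M W] m)"
proof -
 obtain V a where V: "opn X V" "x : V" "V <= pts X" "a : \<O> V" "al = rg X x V a"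
  by (rule stalk_shrink_ring[OF assms(1) openin_topspace assms(3)])
 obtain W m where W: "opn X W" "x : W" "W <= V" "m : Sec M W" "nu = mg X M x W m" by (rule mgerm_cases[OF assms(2) V(1,2)])
 show ?thesis using V W mgerm_smult[of W x "rst X V W a" m] by (intro that[of W "rst X V W a" m]) simp_all
qed

lemma stalk_add_closed: "x : pts X ==> mu :[SM x] ==> nu :[SM x] ==> mu +[SM x] nu :[SM x]" by (rule mgerm_cases2[of mu x nu]) simp_all

lemma stalk_smult_closed:
 "x : pts X ==> al :[stk X x] ==> nu :[SM x] ==> al .[SM x] nu :[SM x]" by (rule mgerm_cases_smult[of al x nu]) simp_all

end

lemma mod_sheaf_premodule: assumes "is_ringed_space X" "is_mod_sheaf X M" shows "premodule X M"
proof -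
 have P: "presheaf_on (space_top X) (Sec M) (mrst M)" using assms(2) by (auto simp: is_mod_sheaf_def sheaf_on_presheaf)
 have M: "module (sect X U) (msec M U)" if "opn X U" for U using assms(2) that by (simp add: is_mod_sheaf_def)
 show ?thesis
 proof (intro premodule.intro ringed.intro premodule_axioms.intro P assms(1))
  fix U assume U: "opn X U"
  interpret module "sect X U" "msec M U" by (rule M[OF U])
  show "0[msec M U] : Sec M U" by simp
  show "m +[msec M U] m' : Sec M U" if "m : Sec M U" "m' : Sec M U" for m m' using that by simp
  show "a .[msec M U] m : Sec M U" if "a :[sect X U]" "m : Sec M U" for a m using that by simp
 qed (use assms(2) in "simp_all add: is_mod_sheaf_def")
qed

sublocale morph \<subseteq> tan: premodule "source f" "tangent f" by (rule mod_sheaf_premodule[OF X.ringed tangent_mod_sheaf])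

subsection \<open>Sections of pullbacks\<close>

locale pullback_mod = morph f + N: premodule "target f" M
 for f :: "('a, 'b, 'c, 'd) rs_morphism" and M :: "('c, 'd, 'm) mod_sheaf"
begin

abbreviation "MY x == stalk_module Y M (pt f x)"
abbreviation (input) "tens x xs \<equiv> set_mset xs \<subseteq> carrier (SX x) \<times> carrier (MY x)"
abbreviation "TC x == tcl (SY x) (SX x) (smap f x) (MY x)"
abbreviation "P == pullback f M"

lemma bc: "x : pts X ==> base_change (SY x) (SX x) (smap f x) (MY x)"
 by (intro base_change.intro X.stalk_cring N.stalk_add_closed N.stalk_smult_closed Pi_I stalk_map_closed pt_closed)

lemma pb_stalk_cases: assumes "t :[pb_stalk f M x]" obtains xs where "tens x xs" "t = TC x xs"
 using assms by (auto simp: pb_stalk_def tensor_module_def)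

lemma pb_stalk_closed [simp]: "tens x xs ==> TC x xs :[pb_stalk f M x]"
 by (auto simp: pb_stalk_def tensor_module_def)

lemma pb_stalk_ops: assumes "x : pts X" "tens x xs"
 shows "tens x ys ==> TC x xs +[pb_stalk f M x] TC x ys = TC x (xs + ys)"
  and "a :[SX x] ==> a .[pb_stalk f M x] TC x xs = TC x (img (%(b, m). (a *[SX x] b, m)) xs)" and "0[pb_stalk f M x] = TC x {#}"
 unfolding pb_stalk_def
 using base_change.tensor_module_add[OF bc[OF assms(1)] assms(2)] base_change.tensor_module_smult[OF bc[OF assms(1)] _ assms(2)]
 by (simp_all add: tensor_module_def map_prod_def)

abbreviation gmap where
 "gmap W V x == (%(a, m). (rg X x W a, mg Y M (pt f x) V m))"

lemma gmap_closed: assumes "opn X W" "opn Y V" "W <= pre f V" "set xs <= X.\<O> W \<times> Sec M V" "x : W"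
 shows "set_mset (mset (map (gmap W V x) xs)) <= car (SX x) \<times> car (MY x)" using assms by (auto simp: preimg_mem subset_iff)

lemma pb_elem_eq: "pb_elem f M W V xs x = TC x (mset (map (gmap W V x) xs))" by (simp add: pb_elem_def)

lemma pb_elem_closed:
 "opn X W ==> opn Y V ==> W <= pre f V ==> set xs <= X.\<O> W \<times> Sec M V ==> x : W ==>
  pb_elem f M W V xs x :[pb_stalk f M x]" unfolding pb_elem_eq using gmap_closed by simp

lemma pb_represents_restrict:
 assumes r: "prep f M W V xs th" and W': "opn X W'" "W' <= W" and V': "opn Y V'" "V' <= V" and sub: "W' <= pre f V'"
  and eq: "!!x. x : W' ==> th' x = th x" shows "prep f M W' V' (map (map_prod (rst X W W') (mrst M V V')) xs) th'"
proof -
 have *: "opn X W" "opn Y V" "set xs <= X.\<O> W \<times> Sec M V" "!!x. x : W ==> th x = pb_elem f M W V xs x"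
  using r by (simp_all add: pb_represents_def)
 have "map (gmap W' V' x) (map (map_prod (rst X W W') (mrst M V V')) xs) = map (gmap W V x) xs" if x: "x : W'" for x
 proof -
  have "pt f x : V'" using sub x by (auto simp: preimg_mem)
  thus ?thesis using * W' V' x by auto
 qed
 hence "th' x = pb_elem f M W' V' (map (map_prod (rst X W W') (mrst M V V')) xs) x" if x: "x : W'" for x
  using x eq *(4) W'(2) by (simp only: pb_elem_eq subsetD)
 moreover have "set (map (map_prod (rst X W W') (mrst M V V')) xs) <= X.\<O> W' \<times> Sec M V'" using *(1-3) W' V' by auto
 ultimately show ?thesis using W' V' sub by (simp add: pb_represents_def)
qed

lemma pullback_simps:
 "0[msec P U] = (\<lambda>x\<in>U. 0[pb_stalk f M x])"
 "th +[msec P U] et = (\<lambda>x\<in>U. th x +[pb_stalk f M x] et x)"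
 "a .[msec P U] th = (\<lambda>x\<in>U. rg X x U a .[pb_stalk f M x] th x)"
 "mrst P U V th = restrict th V" by (simp_all add: pullback_def)

lemma pullback_mem:
 "th : Sec P U \<longleftrightarrow> th : extensional U & (ALL x:U. EX W V xs. x : W & W <= U & prep f M W V xs th)"
proof -
 have "th x :[pb_stalk f M x]" if "x : W" "prep f M W V xs th" for x W V xs using that pb_elem_closed by (simp add: pb_represents_def)
 thus ?thesis by (simp add: pullback_def PiE_def) blast
qed

lemma pullback_value: "th : Sec P U ==> x : U ==> th x :[pb_stalk f M x]" by (auto simp: pullback_def)

lemma pullback_rep: assumes "th : Sec P U" "x : U" obtains W V xs where "x : W" "W <= U" "prep f M W V xs th"
proof -
 have "EX W V xs. x : W & W <= U & prep f M W V xs th" using assms unfolding pullback_mem by simp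
 thus ?thesis by (elim exE conjE) rule
qed

lemma pullback_eqI: "th : Sec P U ==> et : Sec P U ==> (!!x. x : U ==> th x = et x) ==> th = et"
 unfolding pullback_mem by (rule extensionalityI[of _ U]) simp_all

lemma pullback_restrict: assumes "th : Sec P U" "opn X V" "V <= U" shows "restrict th V : Sec P V" unfolding pullback_mem
proof (intro conjI ballI restrict_extensional)
 fix x assume x: "x : V"
 obtain W V' xs where r: "x : W" "W <= U" "prep f M W V' xs th" by (rule pullback_rep[OF assms(1) subsetD[OF assms(3) x]])
 hence W: "opn X W" "opn Y V'" "W <= pre f V'" by (simp_all add: pb_represents_def)
 have "prep f M (W Int V) V' (map (map_prod (rst X W (W Int V)) (mrst M V' V')) xs) (restrict th V)"
  using W assms(2) by (intro pb_represents_restrict[OF r(3)]) auto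
 thus "EX W V' xs. x : W & W <= V & prep f M W V' xs (restrict th V)" using r(1) x by blast
qed

lemma pullback_add: assumes th: "th : Sec P U" and et: "et : Sec P U" and U: "opn X U" shows "th +[msec P U] et : Sec P U"
 unfolding pullback_mem
proof (intro conjI ballI)
 show "th +[msec P U] et : extensional U" by (simp add: pullback_simps)
 fix x assume x: "x : U"
 obtain W V xs where r: "x : W" "W <= U" "prep f M W V xs th" by (rule pullback_rep[OF th x])
 obtain W' V' ys where r': "x : W'" "W' <= U" "prep f M W' V' ys et" by (rule pullback_rep[OF et x])
 have o: "opn X W" "opn X W'" "opn Y V" "opn Y V'" "W <= pre f V" "W' <= pre f V'" using r r' by (simp_all add: pb_represents_def)
 let ?W = "W Int W'" and ?V = "V Int V'"
 have sub: "?W <= pre f ?V" using o(5,6) by (simp add: subset_iff preimg_mem)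
 have "prep f M ?W ?V (map (map_prod (rst X W ?W) (mrst M V ?V)) xs) th"
  using o sub by (intro pb_represents_restrict[OF r(3)]) (simp_all add: openin_Int)
 moreover have "prep f M ?W ?V (map (map_prod (rst X W' ?W) (mrst M V' ?V)) ys) et"
  using o sub by (intro pb_represents_restrict[OF r'(3)]) (simp_all add: openin_Int)
 ultimately obtain xs' ys' where R: "prep f M ?W ?V xs' th" "prep f M ?W ?V ys' et" by blast
 hence R': "opn X ?W" "opn Y ?V" "?W <= pre f ?V" "set xs' <= X.\<O> ?W \<times> Sec M ?V" "set ys' <= X.\<O> ?W \<times> Sec M ?V"
  by (simp_all add: pb_represents_def)
 have "(th +[msec P U] et) z = pb_elem f M ?W ?V (xs' @ ys') z" if z: "z : ?W" for z
 proof -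
  have zX: "z : pts X" "z : U" using X.opn_subset[OF R'(1)] z r(2) by blast+
  have "th z = pb_elem f M ?W ?V xs' z" "et z = pb_elem f M ?W ?V ys' z" using R z by (simp_all add: pb_represents_def)
  thus ?thesis using pb_stalk_ops(1)[OF zX(1) gmap_closed[OF R'(1-4) z] gmap_closed[OF R'(1-3,5) z]] zX(2)
   by (simp add: pb_elem_eq pullback_simps)
 qed
 hence "prep f M ?W ?V (xs' @ ys') (th +[msec P U] et)" using R' by (simp add: pb_represents_def)
 thus "EX W V xs. x : W & W <= U & prep f M W V xs (th +[msec P U] et)" using r(1,2) r'(1) by (intro exI conjI) auto
qed

lemma pullback_smult: assumes th: "th : Sec P U" and a: "a : X.\<O> U" and U: "opn X U" shows "a .[msec P U] th : Sec P U"
 unfolding pullback_mem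
proof (intro conjI ballI)
 show "a .[msec P U] th : extensional U" by (simp add: pullback_simps)
 fix x assume x: "x : U"
 obtain W V xs where r: "x : W" "W <= U" "prep f M W V xs th" by (rule pullback_rep[OF th x])
 hence R': "opn X W" "opn Y V" "W <= pre f V" "set xs <= X.\<O> W \<times> Sec M V" by (simp_all add: pb_represents_def)
 let ?ys = "map (%(b, m). (rst X U W a *[sect X W] b, m)) xs"
 have ra: "rst X U W a : X.\<O> W" using U a R' r by simp
 have "(a .[msec P U] th) z = pb_elem f M W V ?ys z" if z: "z : W" for z
 proof -
  have zX: "z : pts X" "z : U" using X.opn_subset[OF R'(1)] z r(2) by blast+
  have ag: "rg X z U a :[SX z]" "rg X z W (rst X U W a) = rg X z U a" using U a zX R' r z by simp_all
  have "map (gmap W V z) ?ys = map (%(b, m). (rg X z U a *[SX z] b, m)) (map (gmap W V z) xs)"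
   using R'(1,4) z ra ag by (auto simp: X.rgerm_ops)
  hence "mset (map (gmap W V z) ?ys) = img (%(b, m). (rg X z U a *[SX z] b, m)) (mset (map (gmap W V z) xs))" by (simp only: mset_map)
  moreover have "th z = pb_elem f M W V xs z" using r(3) z by (simp add: pb_represents_def)
  ultimately show ?thesis
   using pb_stalk_ops(2)[OF zX(1) gmap_closed[OF R' z] ag(1)] zX(2) by (simp only: pb_elem_eq pullback_simps restrict_apply')
 qed
 hence "prep f M W V ?ys (a .[msec P U] th)"  using R' ra X.sect_closed(2)[OF R'(1)] unfolding pb_represents_def by auto
 thus "EX W V xs. x : W & W <= U & prep f M W V xs (a .[msec P U] th)" using r(1,2) by auto
qed

lemma pullback_zero: assumes U: "opn X U" shows "0[msec P U] : Sec P U"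
proof -
 have "prep f M U (pts Y) [] 0[msec P U]"
  using U X.opn_subset[OF U] by (auto simp: pb_represents_def pullback_simps pb_elem_eq pb_stalk_def tensor_module_def preimg_mem)
 thus ?thesis unfolding pullback_mem by (auto simp: pullback_simps)
qed

sublocale pb: premodule "source f" "pullback f M"
proof (intro premodule.intro X.ringed_axioms premodule_axioms.intro pullback_zero)
 show "presheaf_on (space_top X) (Sec P) (mrst P)"
 proof
  fix U s assume "opn X U" "s : Sec P U"
  thus "mrst P U U s = s" by (simp add: pullback_simps pullback_mem extensional_restrict)
 qed (simp_all add: pullback_simps pullback_restrict Int_absorb1)
qed (((rule pullback_add pullback_smult; assumption) | (auto simp: pullback_simps fun_eq_iff restrict_def; fail))+)

lemma pb_unit: assumes V: "opn Y V" "m : Sec M V" shows "pb_unit f M V m : Sec P (pre f V)"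
  and "prep f M (pre f V) V [(1[sect X (pre f V)], m)] (pb_unit f M V m)"
  and "x : pre f V ==> pb_unit f M V m x = TC x {#(1[SX x], mg Y M (pt f x) V m)#}"
proof -
 show r: "prep f M (pre f V) V [(1[sect X (pre f V)], m)] (pb_unit f M V m)"
  using V X.sect_closed(3)[of "pre f V"] by (simp add: pb_represents_def pb_unit_def)
 thus "pb_unit f M V m : Sec P (pre f V)" unfolding pullback_mem by (auto simp: pb_unit_def)
 show "x : pre f V ==> pb_unit f M V m x = TC x {#(1[SX x], mg Y M (pt f x) V m)#}"
  using V X.rgerm_ops(3)[of "pre f V" x] by (simp add: pb_unit_def pb_elem_eq)
qed

end

subsection \<open>The action of the pullback of a tangent sheaf\<close>

definition gact :: "('a, 'b) ringed_space => 'a => ('a, ('a, 'b) vfield) germ => ('a, 'b) germ => ('a, 'b) germ" where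
 "gact X y mu bb = (UN (V, D):mu. vact X V D y bb)"

context morph
begin

lemma gact_germ [simp]: assumes V: "opn X V" "y : V" "D : Der f V" and bb: "bb :[SX y]" shows "gact X y (mg X T y V D) bb = vact X V D y bb"
proof -
 have D: "D : Sec T V" using V by (simp add: tan_simps)
 have eq: "vact X V' D' y bb = vact X V D y bb" if "(V', D') : mg X T y V D" for V' D'
 proof -
  have "opn X V' & y : V' & D' : Sec T V' & (EX W. opn X W & y : W & W <= V & W <= V' & mrst T V W D = mrst T V' W D')"
   using that unfolding mgerm_def germ_mem .
  then obtain W where W: "opn X V'" "D' : Der f V'" "opn X W" "y : W" "W <= V" "W <= V'" "mrst T V W D = mrst T V' W D'"
   unfolding tan_simps(1) by auto
  show ?thesis using vfield_restrict(2)[OF V(3,1) W(3,5,4) bb] vfield_restrict(2)[OF W(2,1,3,6,4) bb] W(7) by simp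
 qed
 have "(V, D) : mg X T y V D" unfolding mgerm_def by (rule germ_self[OF tan.mod_presheaf V(1,2) D])
 thus ?thesis unfolding gact_def by (rule UN_const_eq) (use eq in "simp add: case_prod_beta")
qed

lemma vact_msum: assumes U: "opn X U" and g: "!!l. l :# L ==> g l : Der f U" shows "msum (msec T U) g L : Der f U"
  and "z : U ==> bb :[SX z] ==> vact X U (msum (msec T U) g L) z bb = msum (SX z) (%l. vact X U (g l) z bb) L"
proof -
 interpret module "sect X U" "msec T U" by (rule tangent_module[OF U])
 show *: "msum (msec T U) g L : Der f U" for L using M.msum_closed[of g L] by (simp add: tan_simps)
 assume z: "z : U" "bb :[SX z]"
 then interpret S: cring "SX z" using X.stalk_cring X.opn_subset[OF U] by blast
 show "vact X U (msum (msec T U) g L) z bb = msum (SX z) (%l. vact X U (g l) z bb) L" using g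
 proof (induction L)
  case empty
  thus ?case using vfield_zero(2)[OF U z] by simp
 next
  case (add l L)
  hence gl: "g l : Der f U" by simp
  hence "msum (msec T U) g (add_mset l L) = g l +[msec T U] msum (msec T U) g L" by (simp add: tan_simps(1))
  thus ?case using vfield_add(2)[OF gl * U z] add U z by simp
 qed
qed

lemma gact_der: assumes y: "y : pts X" and mu: "mu :[tan.SM y]" shows "der (SX y) (SX y) (%a. a) (gact X y mu)"
  and "gg :[SY y] ==> gact X y mu (smap f y gg) = 0[SX y]"
proof -
 obtain V D where V: "opn X V" "y : V" "V <= pts X" "D : Sec T V" "mu = mg X T y V D" by (rule tan.mgerm_cases[OF mu openin_topspace y])
 note D = V(4)[unfolded tan_simps(1)]
 show "der (SX y) (SX y) (%a. a) (gact X y mu)"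
  by (rule der_cong[OF vact_der[OF D V(1,2)] X.stalk_cring[OF y]]) (simp add: V(5) gact_germ[OF V(1,2) D])
 show "gact X y mu (smap f y gg) = 0[SX y]" if "gg :[SY y]"
  using vact_kills[OF D V(1,2) that] gact_germ[OF V(1,2) D] y that by (simp add: V(5))
qed

lemma gact_add: assumes y: "y : pts X" and mu: "mu :[tan.SM y]" "nu :[tan.SM y]" and bb: "bb :[SX y]"
 shows "gact X y (mu +[tan.SM y] nu) bb = gact X y mu bb +[SX y] gact X y nu bb"
proof -
 obtain V D E where V: "opn X V" "y : V" "D : Sec T V" "E : Sec T V" "mu = mg X T y V D" "nu = mg X T y V E"
  "mu +[tan.SM y] nu = mg X T y V (D +[msec T V] E)" by (rule tan.mgerm_cases2[OF mu y])
 note D = V(3,4)[unfolded tan_simps(1)]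
 show ?thesis unfolding V(7) unfolding V(5,6)
  using gact_germ[OF V(1,2) D(1) bb] gact_germ[OF V(1,2) D(2) bb] gact_germ[OF V(1,2) vfield_add(1)[OF D V(1)] bb]
   vfield_add(2)[OF D V(1,2) bb] by simp
qed

lemma gact_smult: assumes y: "y : pts X" and mu: "al :[SX y]" "nu :[tan.SM y]" and bb: "bb :[SX y]"
 shows "gact X y (al .[tan.SM y] nu) bb = al *[SX y] gact X y nu bb"
proof -
 obtain V a D where V: "opn X V" "y : V" "a : X.\<O> V" "D : Sec T V" "al = rg X y V a" "nu = mg X T y V D"
  "al .[tan.SM y] nu = mg X T y V (a .[msec T V] D)" by (rule tan.mgerm_cases_smult[OF mu y])
 note D = V(4)[unfolded tan_simps(1)]
 show ?thesis unfolding V(7) unfolding V(5,6) using gact_germ[OF V(1,2) D bb] gact_germ[OF V(1,2) vfield_smult(1)[OF D V(3,1)] bb]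
   vfield_smult(2)[OF D V(3,1,2) bb] by simp
qed

lemma gact_closed: "y : pts X ==> mu :[tan.SM y] ==> bb :[SX y] ==> gact X y mu bb :[SX y]" using der_closed[OF gact_der(1)] .

end

locale tangent_target = morph f for f :: "('a, 'b, 'c, 'd) rs_morphism" +
 fixes t :: "('c, 'd, 'p, 'q) rs_morphism" assumes smooth_target: "smooth_morph t" and source_target: "source t = target f"

sublocale tangent_target \<subseteq> K: smooth_morph t rewrites "source t = target f" by (rule smooth_target) (rule source_target)

sublocale tangent_target \<subseteq> pullback_mod f "tangent t" by (intro pullback_mod.intro morph_axioms K.tan.premodule_axioms)

context tangent_target
begin

abbreviation "TE x == teq (SY x) (SX x) (smap f x) (MY x)"

text \<open>The derivation along \<open>f\<close> represented by a tensor: if \<open>C\<close> is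
  the sum of tensors of \<open>a_i\<close> with \<open>xi_i\<close>, the value at \<open>b\<close>
  is the sum of the \<open>a_i\<close> times the pullbacks of \<open>xi_i b\<close>.\<close>

definition act where
 "act x C bb = base_change.contract (SX x) (%mu. smap f x (gact Y (pt f x) mu bb)) C"

lemma gact_Y_closed: "x : pts X ==> mu :[MY x] ==> bb :[SY x] ==> smap f x (gact Y (pt f x) mu bb) :[SX x]"
 by (intro stalk_map_closed K.gact_closed pt_closed)

lemma act_class: assumes x: "x : pts X" and xs: "tens x xs" and bb: "bb :[SY x]"
 shows "act x (TC x xs) bb = msum (SX x) (%(a, mu). a *[SX x] smap f x (gact Y (pt f x) mu bb)) xs" unfolding act_def
proof (rule base_change.contract_class[OF bc[OF x] xs gact_Y_closed[OF x _ bb]])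
 note y = pt_closed[OF x]
 note h = stalk_map_hom[OF x]
 show "smap f x (gact Y (pt f x) (m +[MY x] n) bb) =
   smap f x (gact Y (pt f x) m bb) +[SX x] smap f x (gact Y (pt f x) n bb)"
  if "m :[MY x]" "n :[MY x]" for m n using that K.gact_closed[OF y _ bb] by (simp add: K.gact_add[OF y that bb] ring_hom_add[OF h])
 show "smap f x (gact Y (pt f x) (r .[MY x] m) bb) = smap f x r *[SX x] smap f x (gact Y (pt f x) m bb)"
  if "r :[SY x]" "m :[MY x]" for r m using that K.gact_closed[OF y _ bb] by (simp add: K.gact_smult[OF y that bb] ring_hom_mult[OF h])
qed

lemma act_der: assumes x: "x : pts X" and C: "C :[pb_stalk f (tangent t) x]" shows "der (SY x) (SX x) (smap f x) (act x C)"
  and "ka :[K.SY (pt f x)] ==> act x C (smap t (pt f x) ka) = 0[SX x]"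
proof -
 note y = pt_closed[OF x]
 note S = Y.stalk_cring[OF y] X.stalk_cring[OF x]
 interpret S: cring "SX x" by (rule S)
 obtain xs where xs: "tens x xs" "C = TC x xs" by (rule pb_stalk_cases[OF C])
 have "der (SY x) (SX x) (smap f x)
  (%bb. msum (SX x) (%i. (%(a, mu) bb. a *[SX x] smap f x (gact Y (pt f x) mu bb)) i bb) xs)"
 proof (rule der_msum[OF S stalk_map_hom[OF x]])
  fix i assume "i :# xs"
  then obtain a mu where i: "i = (a, mu)" "a :[SX x]" "mu :[MY x]" using xs(1) by auto
  thus "der (SY x) (SX x) (smap f x) ((%(a, mu) bb. a *[SX x] smap f x (gact Y (pt f x) mu bb)) i)"
   using K.gact_der(1)[OF y] by (simp add: der_smult[OF S stalk_map_hom[OF x]] der_hom_comp[OF S stalk_map_hom[OF x]])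
 qed
 thus "der (SY x) (SX x) (smap f x) (act x C)" by (rule der_cong[OF _ S(1)]) (simp add: xs(2) act_class[OF x xs(1)] case_prod_unfold)
 show "act x C (smap t (pt f x) ka) = 0[SX x]" if ka: "ka :[K.SY (pt f x)]"
 proof -
  have "smap t (pt f x) ka :[SY x]" by (rule K.stalk_map_closed[OF y ka])
  thus ?thesis unfolding xs(2) act_class[OF x xs(1) \<open>stalk_map t (pt f x) ka \<in> carrier (SY x)\<close>]
   using xs(1) by (intro S.msum_zero)
    (auto simp: K.gact_der(2)[OF y _ ka] ring_hom_zero'[OF S stalk_map_hom[OF x]])
 qed
qed

lemma act_closed: "x : pts X ==> C :[pb_stalk f (tangent t) x] ==> bb :[SY x] ==> act x C bb :[SX x]" using der_closed[OF act_der(1)] .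

lemma act_ops: assumes x: "x : pts X" and C: "C :[pb_stalk f (tangent t) x]" and bb: "bb :[SY x]"
 shows "C' :[pb_stalk f (tangent t) x] ==> act x (C +[pb_stalk f (tangent t) x] C') bb = act x C bb +[SX x] act x C' bb"
  and "a :[SX x] ==> act x (a .[pb_stalk f (tangent t) x] C) bb = a *[SX x] act x C bb" and "act x 0[pb_stalk f (tangent t) x] bb = 0[SX x]"
proof -
 interpret S: cring "SX x" by (rule X.stalk_cring[OF x])
 let ?g = "%(a, mu). a *[SX x] smap f x (gact Y (pt f x) mu bb)"
 have g: "?g p :[SX x]" if "p :# xs" "tens x xs" for p xs
  using subsetD[OF that(2,1)] gact_Y_closed[OF x _ bb] by auto
 obtain xs where xs: "tens x xs" "C = TC x xs" by (rule pb_stalk_cases[OF C])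
 show "act x (C +[pb_stalk f (tangent t) x] C') bb = act x C bb +[SX x] act x C' bb" if C': "C' :[pb_stalk f (tangent t) x]"
 proof -
  obtain ys where ys: "tens x ys" "C' = TC x ys" by (rule pb_stalk_cases[OF C'])
  have xy: "tens x (xs + ys)" using xs(1) ys(1) by simp
  have "msum (SX x) ?g (xs + ys) = msum (SX x) ?g xs +[SX x] msum (SX x) ?g ys" by (rule S.msum_union) (rule g[OF _ xy])
  thus ?thesis unfolding xs(2) ys(2) pb_stalk_ops(1)[OF x xs(1) ys(1)]
    act_class[OF x xy bb] act_class[OF x xs(1) bb] act_class[OF x ys(1) bb] .
 qed
 show "act x (a .[pb_stalk f (tangent t) x] C) bb = a *[SX x] act x C bb" if a: "a :[SX x]"
 proof -
  let ?h = "%(b, m). (a *[SX x] b, m)"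
  have ys: "tens x (img ?h xs)" using xs(1) a by auto
  have "act x (TC x (img ?h xs)) bb = msum (SX x) (%p. ?g (?h p)) xs"
   unfolding act_class[OF x ys bb] using g[OF _ ys] by (intro S.msum_image) simp
  also have "... = msum (SX x) (%p. a *[SX x] ?g p) xs" using xs(1) a gact_Y_closed[OF x _ bb] by (intro S.msum_cong) (auto simp: S.m_assoc)
  also have "... = a *[SX x] msum (SX x) ?g xs" using g[OF _ xs(1)] a by (intro S.msum_ldistr[symmetric])
  finally show ?thesis unfolding xs(2) pb_stalk_ops(2)[OF x xs(1) a] by (simp add: act_class[OF x xs(1) bb])
 qed
 show "act x 0[pb_stalk f (tangent t) x] bb = 0[SX x]" using act_class[OF x _ bb, of "{#}"] by (simp add: pb_stalk_def tensor_module_def)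
qed

subsection \<open>The normal form with respect to a frame\<close>

context
 fixes x assumes x: "x : pts X"
begin

interpretation bc: base_change "SY x" "SX x" "smap f x" "MY x" by (rule bc[OF x])
interpretation S: cring "SX x" by (rule X.stalk_cring[OF x])

lemma TE_image: assumes "!!l. l :# L ==> TE x {#g l#} {#h l#}" shows "TE x (img g L) (img h L)" using assms
proof (induction L)
 case empty
 thus ?case by (simp add: tensor_eq.refl)
next
 case (add l L)
 thus ?case using bc.tensor_eq_union[of "{#g l#}" "{#h l#}" "img g L" "img h L"] by simp
qed

lemma TE_msum: assumes V: "opn Y V" "pt f x : V" and g: "!!l. l :# L ==> g l : Der t V" and a: "a :[SX x]"
 shows "TE x {#(a, mg Y (tangent t) (pt f x) V (msum (msec (tangent t) V) g L))#}
  (img (%l. (a, mg Y (tangent t) (pt f x) V (g l))) L)" using g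
proof (induction L)
 case empty
 interpret M: module "sect Y V" "msec (tangent t) V" by (rule K.tangent_module[OF V(1)])
 let ?z = "mg Y (tangent t) (pt f x) V 0[msec (tangent t) V]"
 have z: "?z :[MY x]" using V by simp
 \<comment> \<open>That the tensor of \<open>a\<close> with zero is trivial has to be derived from
   the generating rules: zero is the scalar 0 times itself, and moving this scalar to the left gives
   the tensor of 0 with zero.\<close>
 have "0[SY x] .[MY x] ?z = ?z"
  unfolding Y.rgerm_zero[OF V, symmetric] using K.tan.mgerm_smult[OF V, of "0[sect Y V]" "0[msec (tangent t) V]"] by simp
 moreover have "0[SY x] :[SY x]" unfolding Y.rgerm_zero[OF V, symmetric] using V by simp
 moreover have "a *[SX x] smap f x 0[SY x] = 0[SX x]"
  using a ring_hom_zero'[OF Y.stalk_cring[OF pt_closed[OF x]] X.stalk_cring[OF x] stalk_map_hom[OF x]] by simp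
 ultimately have A: "TE x {#(0[SX x], ?z)#} {#(a, ?z)#}"
  using tensor_eq.balanced[of a "SX x" "0[SY x]" "SY x" ?z "MY x" "smap f x"] a z by simp
 show ?case using tensor_eq.trans[OF tensor_eq.sym[OF A] tensor_eq.null[OF z]] by simp
next
 case (add l L)
 interpret M: module "sect Y V" "msec (tangent t) V" by (rule K.tangent_module[OF V(1)])
 have gl: "g l : Sec (tangent t) V" and gL: "msum (msec (tangent t) V) g L : Sec (tangent t) V"
  using add.prems K.vact_msum(1)[OF V(1), of L g] by (simp_all add: K.tan_simps(1))
 let ?p = "(a, mg Y (tangent t) (pt f x) V (g l))" and ?q = "(a, mg Y (tangent t) (pt f x) V (msum (msec (tangent t) V) g L))"
 let ?I = "img (%l. (a, mg Y (tangent t) (pt f x) V (g l))) L"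
 have A: "TE x {#(a, mg Y (tangent t) (pt f x) V (g l) +[MY x] mg Y (tangent t) (pt f x) V (msum (msec (tangent t) V) g L))#} {#?p, ?q#}"
  using V gl a by (intro tensor_eq.add_right) simp_all
 have "TE x ({#?p#} + {#?q#}) ({#?p#} + ?I)" using V gl a add by (intro bc.tensor_eq_union tensor_eq.refl) simp_all
 hence "TE x {#?p, ?q#} (add_mset ?p ?I)" by (simp add: add_mset_commute[of ?p ?q])
 from tensor_eq.trans[OF A this] show ?case using gl by (simp add: K.tan.mgerm_add[OF V gl gL])
qed

lemma TE_add: assumes "!!l. l :# L ==> g l :[SX x] & h l :[SX x] & m l :[MY x]"
 shows "TE x (img (%l. (g l, m l)) L + img (%l. (h l, m l)) L) (img (%l. (g l +[SX x] h l, m l)) L)" using assms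
proof (induction L)
 case empty
 thus ?case by (simp add: tensor_eq.refl)
next
 case (add l L)
 hence "TE x {#(g l, m l), (h l, m l)#} {#(g l +[SX x] h l, m l)#}" by (intro tensor_eq.sym[OF tensor_eq.add_left]) simp_all
 from bc.tensor_eq_union[OF this add.IH] add.prems show ?case by (simp add: add_mset_commute[of "(h l, m l)"])
qed

lemma TE_zero: assumes "!!l. l :# L ==> m l :[MY x]" shows "TE x {#} (img (%l. (0[SX x], m l)) L)" using assms
proof (induction L)
 case empty
 thus ?case by (simp add: tensor_eq.refl)
next
 case (add l L)
 thus ?case using bc.tensor_eq_union[OF tensor_eq.sym[OF tensor_eq.null[of "m l"]] add.IH] by simp
qed

context
 fixes U V n c F a N fr assumes chart: "K.chart U V n c F a N" and frame: "K.frame U n c a fr" and xU: "pt f x : U"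
begin

abbreviation "ix == ixs c n"
abbreviation "crd l == rg Y (pt f x) U (a l)"
abbreviation "frm l == mg Y (tangent t) (pt f x) U (fr l)"

lemma frame_facts: "opn Y U" "l :# ix ==> fr l : Der t U" "l :# ix ==> crd l :[SY x]"
 "l :# ix ==> frm l :[MY x]"
 using K.chartD(5)[OF chart] frame K.chart_coord[OF chart] xU by (simp_all add: K.frame_def[OF chart] K.tan_simps(1))

text \<open>On a neighbourhood the field is the combination of the frame with its values at the
  coordinates as coefficients, and these coefficients can be moved to the left factor of the
  tensor.\<close>

lemma TE_single: assumes mu: "mu :[MY x]" and b: "b :[SX x]"
 shows "TE x {#(b, mu)#} (img (%l. (b *[SX x] smap f x (gact Y (pt f x) mu (crd l)), frm l)) ix)"
proof -
 let ?T = "tangent t"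
 note o = K.chartD(5)[OF chart]
 obtain W D where W: "opn Y W" "pt f x : W" "W <= U" "D : Sec ?T W" "mu = mg Y ?T (pt f x) W D" by (rule K.tan.mgerm_cases[OF mu o xU])
 note D = W(4)[unfolded K.tan_simps(1)]
 let ?c = "%l. D W (rst Y U W (a l))" and ?e = "%l. mrst ?T U W (fr l)"
 have c: "?c l : Y.\<O> W" and e: "?e l : Der t W" and eM: "?e l : Sec ?T W" if "l :# ix" for l
  using that K.derivationsD(2)[OF D W(1) subset_refl] K.chart_coord[OF chart] W o
   K.vfield_restrict(1)[OF frame_facts(2) o W(1,3)] by (simp_all add: K.tan_simps(1))
 have ce: "?c l .[msec ?T W] ?e l : Der t W" if "l :# ix" for l by (rule K.vfield_smult(1)[OF e[OF that] c[OF that] W(1)])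
 have cg: "rg Y z W (?c l) = vact Y W D z (rg Y z U (a l))" if "l :# ix" "z : W" for l z
  using K.vact_germ[OF D W(1) o _ W(1) that(2) subset_refl W(3)] K.chart_coord[OF chart] that by simp
 have "D = msum (msec ?T W) (%l. ?c l .[msec ?T W] ?e l) ix"
 proof (rule K.derivations_eqI[OF D K.vact_msum(1)[OF W(1) ce] W(1)], assumption)
  fix z bb assume z: "z : W" and bb: "bb :[stk Y z]"
  have zY: "z : pts Y" "z : U" using Y.opn_subset[OF W(1)] z W(3) by blast+
  interpret Z: cring "stk Y z" by (rule Y.stalk_cring[OF zY(1)])
  have "vact Y W D z bb = msum (stk Y z) (%l. vact Y W D z (rg Y z U (a l)) *[stk Y z] vact Y U (fr l) z bb) ix"
   by (rule K.frame_expand[OF chart frame Y.local_stalk[OF zY(1)] id_ring_hom[unfolded id_def] K.vact_der[OF D W(1) z] zY(2)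
      K.vact_kills[OF D W(1) z] bb])
  also have "... = msum (stk Y z) (%l. vact Y W (?c l .[msec ?T W] ?e l) z bb) ix" by (rule Z.msum_cong)
    (simp add: K.vfield_smult(2)[OF e c W(1) z bb] K.vfield_restrict(2)[OF frame_facts(2) o W(1,3) z bb] cg[OF _ z])
  also have "... = vact Y W (msum (msec ?T W) (%l. ?c l .[msec ?T W] ?e l) ix) z bb" by (rule K.vact_msum(2)[OF W(1) ce z bb, symmetric])
  finally show "vact Y W D z bb = vact Y W (msum (msec ?T W) (%l. ?c l .[msec ?T W] ?e l) ix) z bb" .
 qed
 hence mu: "mu = mg Y ?T (pt f x) W (msum (msec ?T W) (%l. ?c l .[msec ?T W] ?e l) ix)" using W(5) by simp
 have "TE x {#(b, mu)#} (img (%l. (b, mg Y ?T (pt f x) W (?c l .[msec ?T W] ?e l))) ix)" unfolding mu by (rule TE_msum[OF W(1,2) ce b])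
 moreover have "TE x (img (%l. (b, mg Y ?T (pt f x) W (?c l .[msec ?T W] ?e l))) ix)
  (img (%l. (b *[SX x] smap f x (gact Y (pt f x) (mg Y ?T (pt f x) W D) (crd l)), frm l)) ix)"
 proof (rule TE_image)
  fix l assume l: "l :# ix"
  have "mg Y ?T (pt f x) W (?c l .[msec ?T W] ?e l) = rg Y (pt f x) W (?c l) .[MY x] frm l"
   using K.tan.mgerm_smult[OF W(1,2) c[OF l] eM[OF l]] K.tan.mgerm_mrst[OF o W(1,3,2)] frame_facts(2)[OF l] by (simp add: K.tan_simps(1))
  moreover have "rg Y (pt f x) W (?c l) = gact Y (pt f x) (mg Y ?T (pt f x) W D) (crd l)"
   using K.gact_germ[OF W(1,2) D frame_facts(3)[OF l]] cg[OF l W(2)] by simp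
  ultimately show "TE x {#(b, mg Y ?T (pt f x) W (?c l .[msec ?T W] ?e l))#}
    {#(b *[SX x] smap f x (gact Y (pt f x) (mg Y ?T (pt f x) W D) (crd l)), frm l)#}"
   using tensor_eq.sym[OF tensor_eq.balanced[OF b Y.rgerm_closed[OF W(1,2) c[OF l]] frame_facts(4)[OF l]]] by simp
 qed
 ultimately show ?thesis unfolding W(5)[symmetric] by rule
qed

lemma TE_normal: assumes "tens x xs"
 shows "TE x xs (img (%l. (msum (SX x) (%(b, mu). b *[SX x] smap f x (gact Y (pt f x) mu (crd l))) xs, frm l)) ix)" using assms
proof (induction xs)
 case empty
 thus ?case using TE_zero[of ix "%l. frm l"] frame_facts(4) by simp
next
 case (add p xs)
 obtain b mu where p: "p = (b, mu)" by (rule prod.exhaust[of p])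
 have b: "b :[SX x]" "mu :[MY x]" using add.prems p by auto
 let ?s = "%l. msum (SX x) (%(b, mu). b *[SX x] smap f x (gact Y (pt f x) mu (crd l))) xs"
 let ?r = "%l. b *[SX x] smap f x (gact Y (pt f x) mu (crd l))"
 have r: "?r l :[SX x]" if "l :# ix" for l using gact_Y_closed[OF x b(2) frame_facts(3)[OF that]] b(1) by simp
 have "TE x ({#(b, mu)#} + xs) (img (%l. (?r l, frm l)) ix + img (%l. (?s l, frm l)) ix)"
  using add by (intro bc.tensor_eq_union TE_single b) simp_all
 moreover have "TE x (img (%l. (?r l, frm l)) ix + img (%l. (?s l, frm l)) ix) (img (%l. (?r l +[SX x] ?s l, frm l)) ix)"
  by (rule TE_add) (use r frame_facts(4) in simp)
 ultimately have "TE x ({#(b, mu)#} + xs) (img (%l. (?r l +[SX x] ?s l, frm l)) ix)" by rule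
 moreover have "img (%l. (?r l +[SX x] ?s l, frm l)) ix = img (%l. (msum (SX x) (%(b, mu). b *[SX x] smap f x (gact Y (pt f x) mu (crd l))) (add_mset p xs), frm l)) ix"
  using r by (intro image_mset_cong) (simp add: p)
 ultimately show ?case by (simp add: p)
qed

lemma normal_form: assumes C: "C :[pb_stalk f (tangent t) x]" shows "C = TC x (img (%l. (act x C (crd l), frm l)) ix)"
proof -
 obtain xs where xs: "tens x xs" "C = TC x xs" by (rule pb_stalk_cases[OF C])
 have "C = TC x (img (%l. (msum (SX x) (%(b, mu). b *[SX x] smap f x (gact Y (pt f x) mu (crd l))) xs, frm l)) ix)"
  unfolding xs(2) by (rule bc.tensor_class_eqI[OF TE_normal[OF xs(1)]])
 also have "... = TC x (img (%l. (act x C (crd l), frm l)) ix)"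
  unfolding xs(2) by (intro arg_cong[where f = "TC x"] image_mset_cong) (simp add: act_class[OF x xs(1) frame_facts(3)])
 finally show ?thesis .
qed

end

text \<open>The coefficients of the normal form are the values of the action at the coordinates, so
  the action determines the tensor. Equations between sections of the pullback can therefore be
  tested on functions.\<close>

lemma act_inj: assumes C: "C :[pb_stalk f (tangent t) x]" "C' :[pb_stalk f (tangent t) x]"
  and eq: "!!bb. bb :[SY x] ==> act x C bb = act x C' bb" shows "C = C'"
proof -
 obtain U V n c F a N where chart: "K.chart U V n c F a N" and xU: "pt f x : U" by (rule K.chart_exists[OF pt_closed[OF x]])
 obtain fr where frame: "K.frame U n c a fr" by (rule K.frame_exists[OF chart])
 note nf = normal_form[OF chart frame xU]
 have "img (%l. (act x C (rg Y (pt f x) U (a l)), mg Y (tangent t) (pt f x) U (fr l))) (ixs c n) =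
   img (%l. (act x C' (rg Y (pt f x) U (a l)), mg Y (tangent t) (pt f x) U (fr l))) (ixs c n)"
  by (rule image_mset_cong) (simp add: eq frame_facts(3)[OF chart frame xU])
 thus ?thesis using nf[OF C(1)] nf[OF C(2)] by simp
qed

end

end

subsection \<open>Sections of the pullback of a tangent sheaf\<close>

context tangent_target
begin

abbreviation "TY == tangent t"
abbreviation "PT == pullback f (tangent t)"

lemma sec_pt: "opn X U ==> x : U ==> x : pts X" using X.opn_subset by blast

definition sact where "sact th x = act x (th x)"

lemma sec_closed [simp]:
 "opn X U ==> th : Sec PT U ==> x : U ==> bb :[SY x] ==> sact th x bb :[SX x]"
 unfolding sact_def by (rule act_closed[OF sec_pt pullback_value])

lemma sec_act: assumes U: "opn X U" and th: "th : Sec PT U" and x: "x : U" and bb: "bb :[SY x]"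
 shows "et : Sec PT U ==> sact (th +[msec PT U] et) x bb = sact th x bb +[SX x] sact et x bb"
  and "a : X.\<O> U ==> sact (a .[msec PT U] th) x bb = rg X x U a *[SX x] sact th x bb" and "sact (0[msec PT U]) x bb = 0[SX x]"
 unfolding sact_def using x act_ops[OF sec_pt[OF U x] pullback_value[OF th x] bb] pullback_value[OF _ x] U by (simp_all add: pullback_simps)

lemma sec_eqI: assumes "opn X U" "th : Sec PT U" "et : Sec PT U" and "!!x bb. x : U ==> bb :[SY x] ==> sact th x bb = sact et x bb"
 shows "th = et"
proof (rule pullback_eqI[OF assms(2,3)])
 show "th x = et x" if "x : U" for x
  by (rule act_inj[OF sec_pt[OF assms(1) that] pullback_value[OF assms(2) that] pullback_value[OF assms(3) that] assms(4)[unfolded sact_def, OF that]])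
qed

text \<open>The action is faithful, and on functions the laws are those of the stalk rings.\<close>

lemma pullback_module: assumes U: "opn X U" shows "module (sect X U) (msec PT U)"
proof -
 interpret O: cring "sect X U" by (rule X.sect_cring[OF U])
 note rs = cring.cring_simprules[OF X.stalk_cring[OF sec_pt[OF U]]]
 note z = sec_act(3)[OF U pb.mod_zero[OF U]] and cl = sec_closed[OF U]
 show ?thesis
 proof (intro moduleI abelian_groupI)
  fix th assume th: "th : Sec PT U"
  show "EX et:Sec PT U. et +[msec PT U] th = 0[msec PT U]"
  proof (intro bexI sec_eqI[OF U])
   fix x bb assume x: "x : U" "bb :[SY x]"
   interpret S: cring "SX x" by (rule X.stalk_cring[OF sec_pt[OF U x(1)]])
   interpret h: ring_hom_cring "sect X U" "SX x" "rg X x U" using U x X.rgerm_hom by (intro ring_hom_cringI O.cring_axioms S.cring_axioms)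
   show "sact (((-[sect X U] 1[sect X U]) .[msec PT U] th) +[msec PT U] th) x bb = sact (0[msec PT U]) x bb"
    using U th x by (simp add: sec_act[OF U] S.l_minus S.l_neg)
  qed (use U th in simp_all)
 qed (((rule sec_eqI[OF U]; simp add: sec_act[OF U] z cl U X.rgerm_ops X.sect_closed rs; fail)
  | (simp add: U O.cring_axioms; fail))+)
qed

lemma sec_msum: assumes U: "opn X U" and g: "!!l. l :# L ==> g l : Sec PT U" and x: "x : U" "bb :[SY x]"
 shows "sact (msum (msec PT U) g L) x bb = msum (SX x) (%l. sact (g l) x bb) L" using g
proof (induction L)
 interpret module "sect X U" "msec PT U" by (rule pullback_module[OF U])
 interpret S: cring "SX x" by (rule X.stalk_cring[OF sec_pt[OF U x(1)]])
 {
  case empty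
  show ?case using sec_act(3)[OF U pb.mod_zero[OF U] x] by simp
 next
  case (add l L)
  hence gl: "g l : Sec PT U" by simp
  thus ?case using add sec_act(1)[OF U gl x M.msum_closed[of g L]] U x by simp
 }
qed

lemma act_rep: assumes r: "prep f TY W V xs th" and x: "x : W" and bb: "bb :[SY x]"
 shows "sact th x bb = msum (SX x) (%(a, D). rg X x W a *[SX x] smap f x (vact Y V D (pt f x) bb)) (mset xs)"
proof -
 have o: "opn X W" "opn Y V" "W <= pre f V" "set xs <= X.\<O> W \<times> Sec TY V" "th x = pb_elem f TY W V xs x"
  using r x by (simp_all add: pb_represents_def)
 have xX: "x : pts X" and y: "pt f x : V" using x o(3) by (auto simp: preimg_mem)
 interpret S: cring "SX x" by (rule X.stalk_cring[OF xX])
 have p: "fst p : X.\<O> W" "snd p : Der t V" if "p :# mset xs" for p using subsetD[OF o(4), of p] that by (auto simp: K.tan_simps(1))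
 have "sact th x bb = msum (SX x) (%(a, mu). a *[SX x] smap f x (gact Y (pt f x) mu bb)) (img (gmap W V x) (mset xs))"
  unfolding sact_def o(5) pb_elem_eq using act_class[OF xX gmap_closed[OF o(1-4) x] bb] by simp
 also have "... = msum (SX x) (%p. (%(a, mu). a *[SX x] smap f x (gact Y (pt f x) mu bb)) (gmap W V x p)) (mset xs)"
  using p o y x xX bb by (intro S.msum_image) (simp add: case_prod_unfold)
 also have "... = msum (SX x) (%(a, D). rg X x W a *[SX x] smap f x (vact Y V D (pt f x) bb)) (mset xs)"
  using p o y bb by (intro S.msum_cong) (simp add: case_prod_unfold)
 finally show ?thesis .
qed

lemma act_unit: assumes V: "opn Y V" "D : Der t V" and x: "x : pre f V" and bb: "bb :[SY x]"
 shows "sact (pb_unit f TY V D) x bb = smap f x (vact Y V D (pt f x) bb)"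
proof -
 have D: "D : Sec TY V" using V by (simp add: K.tan_simps(1))
 have xX: "x : pts X" and y: "pt f x : V" using x by (auto simp: preimg_mem)
 interpret S: cring "SX x" by (rule X.stalk_cring[OF xX])
 show ?thesis using act_rep[OF pb_unit(2)[OF V(1) D] x bb] X.rgerm_ops(3)[OF opn_preimg[OF V(1)] x] V y xX bb by simp
qed

text \<open>Connects the \<open>foldr\<close> in the definition of \<open>differential\<close> with
  the action: its germs are the values of the tensor with representing list
  \<open>xs\<close>.\<close>

lemma foldr_germ: assumes W: "opn X W" "opn X W'" "W' <= W" and V: "opn Y V" "opn Y V'" "V' <= V" and sub: "W' <= pre f V'"
  and b: "b : Y.\<O> V'" and xs: "set xs <= X.\<O> W \<times> Der t V"
 defines "s == foldr (%(a, D) c. (rst X W W' a *[sect X W'] pull f V' W' (D V' b)) +[sect X W'] c) xs 0[sect X W']" shows "s : X.\<O> W'"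
  and "x : W' ==> rg X x W' s = msum (SX x) (%(a, D). rg X x W a *[SX x]
   smap f x (vact Y V D (pt f x) (rg Y (pt f x) V' b))) (mset xs)"
proof -
 have "s : X.\<O> W' & (ALL x:W'. rg X x W' s = msum (SX x) (%(a, D). rg X x W a *[SX x]
   smap f x (vact Y V D (pt f x) (rg Y (pt f x) V' b))) (mset xs))" unfolding s_def using xs
 proof (induction xs)
  case Nil
  show ?case
  proof (intro conjI ballI)
   fix x assume x: "x : W'"
   interpret S: cring "SX x" by (rule X.stalk_cring[OF sec_pt[OF W(2) x]])
   show "rg X x W' (foldr (%(a, D) c. (rst X W W' a *[sect X W'] pull f V' W' (D V' b)) +[sect X W'] c) [] 0[sect X W']) =
    msum (SX x) (%(a, D). rg X x W a *[SX x] smap f x (vact Y V D (pt f x) (rg Y (pt f x) V' b))) (mset [])"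
    using X.rgerm_zero[OF W(2) x] by simp
  qed (simp add: X.sect_closed[OF W(2)])
 next
  case (Cons p xs)
  obtain a D where p: "p = (a, D)" by (rule prod.exhaust[of p])
  let ?c = "foldr (%(a, D) c. (rst X W W' a *[sect X W'] pull f V' W' (D V' b)) +[sect X W'] c) xs 0[sect X W']"
  have a: "a : X.\<O> W" and D: "D : Der t V" using Cons.prems p by auto
  have IH: "?c : X.\<O> W'" "!!x. x : W' ==> rg X x W' ?c = msum (SX x) (%(a, D). rg X x W a *[SX x]
   smap f x (vact Y V D (pt f x) (rg Y (pt f x) V' b))) (mset xs)" using Cons by simp_all
  have d: "D V' b : Y.\<O> V'" by (rule K.derivationsD(2)[OF D V(2,3) b])
  have pc: "pull f V' W' (D V' b) : X.\<O> W'" "rst X W W' a : X.\<O> W'" using pull_closed[OF V(2) W(2) sub d] a W by simp_all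
  show ?case
  proof (intro conjI ballI)
   fix x assume x: "x : W'"
   have xX: "x : pts X" and y: "pt f x : V'" "pt f x : V" using x sub subsetD[OF V(3)] by (auto simp: preimg_mem)
   interpret S: cring "SX x" by (rule X.stalk_cring[OF xX])
   have v: "vact Y V D (pt f x) (rg Y (pt f x) V' b) = rg Y (pt f x) V' (D V' b)" by (rule K.vact_germ_same[OF D V(1,2) y(1) V(3) b])
   have cl: "rg X x W a :[SX x]" "rg Y (pt f x) V' (D V' b) :[SY x]" using a W x y V d by auto
   show "rg X x W' (foldr (%(a, D) c. (rst X W W' a *[sect X W'] pull f V' W' (D V' b)) +[sect X W'] c) (p # xs) 0[sect X W']) =
    msum (SX x) (%(a, D). rg X x W a *[SX x] smap f x (vact Y V D (pt f x) (rg Y (pt f x) V' b))) (mset (p # xs))"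
    using pc IH(1) x cl xX X.sect_closed(2)[OF W(2) pc(2,1)] a W
    by (simp add: p X.rgerm_ops[OF W(2) x] IH(2)[OF x] pull_germ[OF V(2) W(2) sub d x] v)
  qed (simp add: p pc IH(1) X.sect_closed[OF W(2)])
 qed
 thus "s : X.\<O> W'" "x : W' ==> rg X x W' s = msum (SX x) (%(a, D). rg X x W a *[SX x]
   smap f x (vact Y V D (pt f x) (rg Y (pt f x) V' b))) (mset xs)" by simp_all
qed

lemma act_section: assumes U: "opn X U" and th: "th : Sec PT U" and V: "opn Y V" "b : Y.\<O> V" obtains s where "s : X.\<O> (U Int pre f V)"
  "!!z. z : U Int pre f V ==> rg X z (U Int pre f V) s = sact th z (rg Y (pt f z) V b)"
proof (rule X.sect_glue[of "U Int pre f V" "%z. sact th z (rg Y (pt f z) V b)"])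
 fix x assume x: "x : U Int pre f V"
 obtain W0 V0 xs where r: "x : W0" "W0 <= U" "prep f TY W0 V0 xs th" by (rule pullback_rep[OF th, of x]) (use x in simp, rule)
 hence o: "opn X W0" "opn Y V0" "W0 <= pre f V0" "set xs <= X.\<O> W0 \<times> Der t V0" by (simp_all add: pb_represents_def K.tan_simps(1))
 let ?V = "V Int V0" and ?W = "W0 Int pre f V"
 have V': "opn Y ?V" "?V <= V0" "?V <= V" and W': "opn X ?W" "?W <= W0" and sub: "?W <= pre f ?V" using V o by (auto simp: preimg_mem)
 have b: "rst Y V ?V b : Y.\<O> ?V" using V V' by simp
 note s = foldr_germ[OF o(1) W' o(2) V'(1,2) sub b o(4)]
 let ?s = "foldr (%(a, D) c. (rst X W0 ?W a *[sect X ?W] pull f ?V ?W (D ?V (rst Y V ?V b))) +[sect X ?W] c) xs 0[sect X ?W]"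
 have "rg X z ?W ?s = sact th z (rg Y (pt f z) V b)" if z: "z : ?W" for z
 proof -
  have y: "pt f z : ?V" "pt f z : V" using z sub by (auto simp: preimg_mem)
  hence "rg Y (pt f z) ?V (rst Y V ?V b) = rg Y (pt f z) V b" using V V' by simp
  thus ?thesis using s(2)[OF z] act_rep[OF r(3), of z "rg Y (pt f z) V b"] z V y by simp
 qed
 thus "EX W s. opn X W & x : W & W <= U Int pre f V & s : X.\<O> W & (ALL z:W. rg X z W s = sact th z (rg Y (pt f z) V b))"
  using r(1,2) x W' s(1) by auto
qed (use U V in "auto")

text \<open>Near a point one takes the frame with sections of the values of \<open>de\<close> at the
  coordinates as coefficients, and \<open>frame_expand\<close> shows that this acts as prescribed.
  The tensors obtained from different charts coincide because the action is faithful.\<close>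

lemma section_exists: assumes U: "opn X U" and de: "!!x. x : U ==> der (SY x) (SX x) (smap f x) (de x)"
  and kills: "!!x ka. x : U ==> ka :[K.SY (pt f x)] ==> de x (smap t (pt f x) ka) = 0[SX x]"
  and loc: "!!V b. opn Y V ==> b : Y.\<O> V ==> EX s:X.\<O> (U Int pre f V).
   ALL z:U Int pre f V. rg X z (U Int pre f V) s = de z (rg Y (pt f z) V b)"
 obtains th where "th : Sec PT U" "!!x bb. x : U ==> bb :[SY x] ==> sact th x bb = de x bb"
proof -
 define P where "P x C \<longleftrightarrow> C :[pb_stalk f TY x] & (ALL bb:car (SY x). act x C bb = de x bb)" for x C
 define th where "th = (\<lambda>x\<in>U. SOME C. P x C)"
 have ex: "EX W V xs. x : W & W <= U & opn X W & opn Y V & W <= pre f V & set xs <= X.\<O> W \<times> Sec TY V &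
   (ALL z:W. P z (pb_elem f TY W V xs z))" if x: "x : U" for x
 proof -
  have xX: "x : pts X" by (rule sec_pt[OF U x])
  obtain C V n c F a N where chart: "K.chart C V n c F a N" and xC: "pt f x : C" by (rule K.chart_exists[OF pt_closed[OF xX]])
  note o = K.chartD(5)[OF chart]
  obtain fr where frame: "K.frame C n c a fr" by (rule K.frame_exists[OF chart])
  let ?W = "U Int pre f C"
  have W: "opn X ?W" "x : ?W" "?W <= U" "?W <= pre f C" using U o x xX xC by (auto simp: preimg_mem)
  have "EX s. s : X.\<O> ?W & (ALL z:?W. rg X z ?W s = de z (rg Y (pt f z) C (a l)))" if "c <= l" "l < n" for l
   using loc[OF o K.chart_coord[OF chart that(2)]] by blast
  then obtain s where s: "!!l. c <= l ==> l < n ==> s l : X.\<O> ?W & (ALL z:?W. rg X z ?W (s l) = de z (rg Y (pt f z) C (a l)))" by metis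
  let ?xs = "map (%l. (s l, fr l)) [c..<n]"
  have fr: "fr l : Der t C" if "c <= l" "l < n" for l using frame that by (simp add: K.frame_def[OF chart])
  have xs: "set ?xs <= X.\<O> ?W \<times> Sec TY C" using s fr by (auto simp: K.tan_simps(1))
  have "ALL z:?W. P z (pb_elem f TY ?W C ?xs z)" unfolding P_def
  proof (intro conjI ballI)
   fix z assume z: "z : ?W"
   show "pb_elem f TY ?W C ?xs z :[pb_stalk f TY z]" by (rule pb_elem_closed[OF W(1) o W(4) xs z])
   fix bb assume bb: "bb :[SY z]"
   have zX: "z : pts X" "z : U" and y: "pt f z : C" using z by (auto simp: preimg_mem)
   interpret S: cring "SX z" by (rule X.stalk_cring[OF zX(1)])
   have dc: "de z (rg Y (pt f z) C (a l)) :[SX z]" if "l < n" for l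
    by (rule der_closed[OF de[OF zX(2)]]) (use K.chart_coord[OF chart that] o y in simp)
   have "prep f TY ?W C ?xs (pb_elem f TY ?W C ?xs)" using W o xs by (simp add: pb_represents_def)
   from act_rep[OF this z bb]
   have "sact (pb_elem f TY ?W C ?xs) z bb = msum (SX z) (%(a, D). rg X z ?W a *[SX z] smap f z (vact Y C D (pt f z) bb))
     (img (%l. (s l, fr l)) (ixs c n))" by simp
   also have "... = msum (SX z)
    (%l. (%(a, D). rg X z ?W a *[SX z] smap f z (vact Y C D (pt f z) bb)) (s l, fr l)) (ixs c n)"
    by (rule S.msum_image) (use s z zX y o fr bb dc in simp)
   also have "... = msum (SX z) (%l. de z (rg Y (pt f z) C (a l)) *[SX z] smap f z (vact Y C (fr l) (pt f z) bb)) (ixs c n)"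
    by (rule S.msum_cong) (use s z in simp)
   also have "... = de z bb"
    by (rule K.frame_expand[OF chart frame X.local_stalk[OF zX(1)] stalk_map_hom[OF zX(1)] de[OF zX(2)] y kills[OF zX(2)] bb, symmetric])
   finally show "act z (pb_elem f TY ?W C ?xs z) bb = de z bb" unfolding sact_def .
  qed
  thus ?thesis using W o xs by blast
 qed
 have P: "P x (th x)" if x: "x : U" for x
 proof -
  have "EX C. P x C" using ex[OF x] by auto
  thus ?thesis using someI_ex[of "P x"] x by (simp add: th_def)
 qed
 have "th : Sec PT U" unfolding pullback_mem
 proof (intro conjI ballI)
  fix x assume x: "x : U"
  from ex[OF x] obtain W V xs where W: "x : W" "W <= U" "opn X W" "opn Y V" "W <= pre f V" "set xs <= X.\<O> W \<times> Sec TY V"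
   "ALL z:W. P z (pb_elem f TY W V xs z)" by auto
  have "th z = pb_elem f TY W V xs z" if z: "z : W" for z
   using act_inj[OF sec_pt[OF W(3) z], of "th z" "pb_elem f TY W V xs z"] P[OF subsetD[OF W(2) z]] W(7) z by (simp add: P_def)
  thus "EX W V xs. x : W & W <= U & prep f TY W V xs th"
   using W by (intro exI[of _ W] exI[of _ V] exI[of _ xs]) (simp add: pb_represents_def)
 qed (simp add: th_def)
 thus ?thesis by rule (use P in "simp add: P_def sact_def")
qed

end

section \<open>Differentials\<close>

text \<open>Here \<open>s\<close> is the structure morphism of the source and \<open>t\<close> that
  of the target, so \<open>s\<close> is the composite of \<open>f\<close> and \<open>t\<close>. The
  two agree only up to \<open>mor_eq\<close>, which is recorded on points and on stalks.\<close>

locale differential_setup = tangent_target f t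
 for f :: "('a, 'b, 'c, 'd) rs_morphism" and t :: "('c, 'd, 'p, 'q) rs_morphism" +
 fixes s :: "('a, 'b, 'p, 'q) rs_morphism"
 assumes morph_s: "morph s" and source_s: "source s = source f" and target_s: "target s = target t"
  and pt_s: "x : pts (source f) ==> pt s x = pt t (pt f x)" and map_s: "x : pts (source f) ==> ka : car (stk (target t) (pt t (pt f x))) ==>
   smap s x ka = smap f x (smap t (pt f x) ka)"

sublocale differential_setup \<subseteq> J: morph s rewrites "source s = source f" by (rule morph_s) (rule source_s)

context differential_setup
begin

lemma J_SY: "x : pts X ==> J.SY x = K.SY (pt f x)" by (simp add: pt_s target_s)

lemma der_vact:
 "opn X U ==> D : Der s U ==> x : U ==>
  der (SY x) (SX x) (smap f x) (%bb. vact X U D x (smap f x bb))"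
 by (rule der_comp_hom[OF Y.stalk_cring[OF pt_closed] X.stalk_cring stalk_map_hom J.vact_der]) (simp_all add: sec_pt)

lemma vact_kills_base: assumes "opn X U" "D : Der s U" "x : U" "ka :[K.SY (pt f x)]"
 shows "vact X U D x (smap f x (smap t (pt f x) ka)) = 0[SX x]"
 using J.vact_kills[OF assms(2,1,3)] assms J_SY[OF sec_pt[OF assms(1,3)]] map_s[OF sec_pt[OF assms(1,3)]] by simp

text \<open>Killing pulled back sections is the same as killing their germs. The relative fields
  thus become the kernel of the action on functions of the target, which is how the differential
  sees them.\<close>

lemma relative_derivations: assumes U: "opn X U" shows "D : Der f U \<longleftrightarrow> D : Der s U &
  (ALL x:U. ALL bb:car (SY x). vact X U D x (smap f x bb) = 0[SX x])"
proof
 assume D: "D : Der f U"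
 have "D : Der s U"
 proof (rule conjunct1[OF J.derivationsI[OF U derivationsD(1)[OF D] vact_der[OF D U]]])
  fix x ka assume x: "x : U" "ka :[J.SY x]"
  note xX = sec_pt[OF U x(1)]
  have ka: "ka :[K.SY (pt f x)]" using x(2) J_SY[OF xX] by simp
  show "vact X U D x (smap s x ka) = 0[SX x]"
   unfolding map_s[OF xX ka] by (rule vact_kills[OF D U x(1) K.stalk_map_closed[OF pt_closed[OF xX] ka]])
 qed (use vact_germ_same[OF D U] in simp_all)
 thus "D : Der s U & (ALL x:U. ALL bb:car (SY x). vact X U D x (smap f x bb) = 0[SX x])" using vact_kills[OF D U] by simp
next
 assume *: "D : Der s U & (ALL x:U. ALL bb:car (SY x). vact X U D x (smap f x bb) = 0[SX x])"
 hence D: "D : Der s U" by simp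
 show "D : Der f U" by (rule conjunct1[OF derivationsI[OF U J.derivationsD(1)[OF D] J.vact_der[OF D U]]])
   (use * J.vact_germ_same[OF D U] in simp_all)
qed

text \<open>Replaces the definite description by a formula for the action. A solution exists since a
  field composed with the pullback of functions is a derivation along \<open>f\<close>; it is unique
  since the defining equations fix its action.\<close>

lemma differential_spec: assumes U: "opn X U" and D: "D : Der s U" shows "diff f s t U D : Sec PT U"
  and "x : U ==> bb :[SY x] ==> sact (diff f s t U D) x bb = vact X U D x (smap f x bb)"
proof -
 define Q where "Q th \<longleftrightarrow> th : Sec PT U &
   (ALL W V xs. W <= U & prep f TY W V xs th -->
    (ALL W' V' b. opn X W' & opn Y V' & W' <= W & V' <= V & W' <= pre f V' & b : Y.\<O> V' -->
     D W' (pull f V' W' b) = foldr (%(a, xi) c. (rst X W W' a *[sect X W'] pull f V' W' (xi V' b))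
        +[sect X W'] c) xs 0[sect X W']))" for th
 have Dpull: "rg X z W (D W (pull f V W b)) = vact X U D z (smap f z (rg Y (pt f z) V b))"
  if "opn X W" "W <= U" "opn Y V" "W <= pre f V" "b : Y.\<O> V" "z : W" for W V b z
  using J.vact_germ_same[OF D U that(1,6,2) pull_closed[OF that(3,1,4,5)]] pull_germ[OF that(3,1,4,5,6)] by simp
 obtain th where th: "th : Sec PT U"
  "!!x bb. x : U ==> bb :[SY x] ==> sact th x bb = vact X U D x (smap f x bb)"
 proof (rule section_exists[OF U der_vact[OF U D]])
  show "vact X U D x (smap f x (smap t (pt f x) ka)) = 0[SX x]"
   if "x : U" "ka :[K.SY (pt f x)]" for x ka by (rule vact_kills_base[OF U D that])
  fix V b assume V: "opn Y V" "b : Y.\<O> V"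
  let ?W = "U Int pre f V"
  have W: "opn X ?W" "?W <= U" "?W <= pre f V" using U V by auto
  show "EX s:X.\<O> ?W. ALL z:?W. rg X z ?W s = vact X U D z (smap f z (rg Y (pt f z) V b))"
   by (intro bexI[of _ "D ?W (pull f V ?W b)"] ballI Dpull[OF W(1,2) V(1) W(3) V(2)]
     J.derivationsD(2)[OF D W(1,2) pull_closed[OF V(1) W(1,3) V(2)]])
 qed ((assumption | (rule that; assumption))+)
 have Q1: "Q th" unfolding Q_def
 proof (intro conjI th(1) allI impI; elim conjE)
  fix W V xs W' V' b
  assume r: "W <= U" "prep f TY W V xs th" and o: "opn X W'" "opn Y V'" "W' <= W" "V' <= V" "W' <= pre f V'" "b : Y.\<O> V'"
  have WV: "opn X W" "opn Y V" "set xs <= X.\<O> W \<times> Der t V" using r(2) by (simp_all add: pb_represents_def K.tan_simps(1))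
  note fg = foldr_germ[OF WV(1) o(1,3) WV(2) o(2,4,5,6) WV(3)]
  have WU: "W' <= U" using o(3) r(1) by blast
  show "D W' (pull f V' W' b) = foldr (%(a, xi) c. (rst X W W' a *[sect X W'] pull f V' W' (xi V' b)) +[sect X W'] c) xs 0[sect X W']"
  proof (rule X.sect_eqI[OF o(1) J.derivationsD(2)[OF D o(1) WU pull_closed[OF o(2,1,5,6)]] fg(1)])
   fix z assume z: "z : W'"
   have zU: "z : U" "z : W" and b: "rg Y (pt f z) V' b :[SY z]" using z WU o by (auto simp: preimg_mem)
   show "rg X z W' (D W' (pull f V' W' b)) =
     rg X z W' (foldr (%(a, xi) c. (rst X W W' a *[sect X W'] pull f V' W' (xi V' b)) +[sect X W'] c) xs 0[sect X W'])"
    unfolding fg(2)[OF z] act_rep[OF r(2) zU(2) b, symmetric] th(2)[OF zU(1) b] by (rule Dpull[OF o(1) WU o(2,5,6) z])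
  qed
 qed
 have uniq: "th' = th" if Q: "Q th'" for th'
 proof (rule sec_eqI[OF U _ th(1)])
  show th': "th' : Sec PT U" using Q by (simp add: Q_def)
  fix x bb assume x: "x : U" "bb :[SY x]"
  obtain W V xs where r: "x : W" "W <= U" "prep f TY W V xs th'" by (rule pullback_rep[OF th' x(1)])
  have WV: "opn X W" "opn Y V" "W <= pre f V" "set xs <= X.\<O> W \<times> Der t V"
   using r(3) by (simp_all add: pb_represents_def K.tan_simps(1))
  have y: "pt f x : V" using r(1) WV(3) by (auto simp: preimg_mem)
  obtain V' b where V': "opn Y V'" "pt f x : V'" "V' <= V" "b : Y.\<O> V'" "bb = rg Y (pt f x) V' b"
   by (rule Y.stalk_shrink_ring[OF x(2) WV(2) y])
  let ?W = "W Int pre f V'"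
  have W: "opn X ?W" "?W <= W" "?W <= pre f V'" "x : ?W" "?W <= U" using WV V' r by (auto simp: preimg_mem)
  have "D ?W (pull f V' ?W b) = foldr (%(a, xi) c. (rst X W ?W a *[sect X ?W] pull f V' ?W (xi V' b)) +[sect X ?W] c) xs 0[sect X ?W]"
   using Q[unfolded Q_def, THEN conjunct2, rule_format, OF conjI[OF r(2,3)], of ?W V' b] W V' by simp
  thus "sact th' x bb = sact th x bb"
   using foldr_germ(2)[OF WV(1) W(1,2) WV(2) V'(1,3) W(3) V'(4) WV(4) W(4)] Dpull[OF W(1,5) V'(1) W(3) V'(4) W(4)]
    act_rep[OF r(3,1) x(2)] th(2)[OF x] by (simp add: V'(5))
 qed
 have "(THE th. Q th) = th" by (rule the_equality[of Q, OF Q1 uniq])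
 moreover have "diff f s t U D = (THE th. Q th)" using U D unfolding differential_def Q_def by (simp add: J.tan_simps(1))
 ultimately have "diff f s t U D = th" by simp
 thus "diff f s t U D : Sec PT U" and "x : U ==> bb :[SY x] ==> sact (diff f s t U D) x bb = vact X U D x (smap f x bb)"
  using th by simp_all
qed

lemma differential_eqI: assumes "opn X U" "D : Der s U" "th : Sec PT U"
  and "!!x bb. x : U ==> bb :[SY x] ==> sact th x bb = vact X U D x (smap f x bb)" shows "diff f s t U D = th"
 using assms differential_spec[OF assms(1,2)] by (intro sec_eqI[OF assms(1) _ assms(3)]) simp_all

lemma differential_hom: "diff f s t : sheaf_hom X (tangent s) PT" unfolding sheaf_hom_def mem_Collect_eq linear_map_def J.tan_simps(1)
proof (intro conjI allI impI ballI; (elim conjE)?)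
 note spec = differential_spec
 show "diff f s t : (\<Pi>\<^sub>E U\<in>{U. opn X U}. Der s U \<rightarrow>\<^sub>E Sec PT U)"
 proof (rule PiE_I)
  fix U assume "U : {U. opn X U}"
  thus "diff f s t U : Der s U \<rightarrow>\<^sub>E Sec PT U"
   using spec(1)[of U] by (intro PiE_I) (simp_all add: differential_def J.tan_simps(1))
 qed (simp add: differential_def)
 fix U assume U: "opn X U"
 show "diff f s t U : Der s U \<rightarrow> Sec PT U" using spec(1)[OF U] by simp
 fix D assume D: "D : Der s U"
 note spD = spec[OF U D]
 show "diff f s t U (D +[msec (tangent s) U] E) = diff f s t U D +[msec PT U] diff f s t U E"
  if E: "E : Der s U" for E using U spD spec[OF U E] sec_pt[OF U]
  by (intro differential_eqI[OF U J.vfield_add(1)[OF D E U]]) (simp_all add: sec_act[OF U] J.vfield_add(2)[OF D E U])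
 show "diff f s t U (r .[msec (tangent s) U] D) = r .[msec PT U] diff f s t U D" if r: "r : X.\<O> U" for r using U spD r sec_pt[OF U]
  by (intro differential_eqI[OF U J.vfield_smult(1)[OF D r U]]) (simp_all add: sec_act[OF U] J.vfield_smult(2)[OF D r U])
 show "diff f s t V (mrst (tangent s) U V D) = mrst PT U V (diff f s t U D)" if V: "opn X V" "V <= U" for V
 proof (rule differential_eqI[OF V(1) J.vfield_restrict(1)[OF D U V]])
  show "mrst PT U V (diff f s t U D) : Sec PT V" using spD(1) U V by simp
  fix x bb assume x: "x : V" "bb :[SY x]"
  hence "sact (mrst PT U V (diff f s t U D)) x bb = sact (diff f s t U D) x bb" by (simp add: sact_def pullback_simps)
  thus "sact (mrst PT U V (diff f s t U D)) x bb = vact X V (mrst (tangent s) U V D) x (smap f x bb)"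
   using spD(2)[OF subsetD[OF V(2) x(1)] x(2)] J.vfield_restrict(2)[OF D U V x(1)] x sec_pt[OF V(1)] by simp
 qed
qed

text \<open>Local surjectivity of the differential of a smooth morphism. In a chart of
  \<open>f\<close> the field takes the prescribed values on functions of the target and the value
  zero at the relative coordinates.\<close>

lemma lift_exists: assumes smooth: "smooth_morph f" and U: "opn X U" and th: "th : Sec PT U" and x: "x : U"
 obtains W D where "opn X W" "x : W" "W <= U" "D : Der s W"
  "!!z bb. z : W ==> bb :[SY z] ==> vact X W D z (smap f z bb) = sact th z bb"
proof -
 interpret F: smooth_morph f by fact
 obtain C V n c F a N where chart: "F.chart C V n c F a N" and xC: "x : C" by (rule F.chart_exists[OF sec_pt[OF U x]])
 note C = F.chartD[OF chart]
 let ?W = "U Int C"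
 have W: "opn X ?W" "x : ?W" "?W <= U" "?W <= C" "?W <= pre f V" using U C x xC by auto
 have sd: "der (SY z) (SX z) (smap f z) (sact th z)" if "z : U" for z
  unfolding sact_def by (rule act_der(1)[OF sec_pt[OF U that] pullback_value[OF th that]])
 have ex: "EX r. r : X.\<O> ?W & (ALL z:?W. rg X z ?W r = sact th z (rg Y (pt f z) V b))" if b: "b : Y.\<O> V" for b
 proof -
  obtain r where r: "r : X.\<O> (U Int pre f V)"
   "!!z. z : U Int pre f V ==> rg X z (U Int pre f V) r = sact th z (rg Y (pt f z) V b)"
   by (rule act_section[OF U th C(6) b]) (rule; assumption)
  have o: "opn X (U Int pre f V)" "?W <= U Int pre f V" using U C by auto
  show ?thesis
  proof (intro exI[of _ "rst X (U Int pre f V) ?W r"] conjI ballI)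
   fix z assume z: "z : ?W"
   show "rg X z ?W (rst X (U Int pre f V) ?W r) = sact th z (rg Y (pt f z) V b)"
    using X.rgerm_rst[OF o(1) W(1) o(2) z r(1)] r(2)[OF subsetD[OF o(2) z]] by simp
  qed (rule X.rst_closed[OF o(1) W(1) o(2) r(1)])
 qed
 obtain d where d: "!!b. b : Y.\<O> V ==> d b : X.\<O> ?W"
  "!!b z. b : Y.\<O> V ==> z : ?W ==> rg X z ?W (d b) = sact th z (rg Y (pt f z) V b)" using ex by metis
 have zfacts: "z : pts X" "pt f z : V" "z : U" "z : C" if "z : ?W" for z using that W(5) by (auto simp: preimg_mem)
 note pc = pull_closed[OF C(6) W(1,5)]
 have der: "der (sect Y V) (sect X ?W) (pull f V ?W) d" unfolding der_def
 proof (intro conjI ballI Pi_I d(1), assumption)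
  fix a b assume ab: "a : Y.\<O> V" "b : Y.\<O> V"
  note yc = Y.sect_closed[OF C(6)] and xc = X.sect_closed[OF W(1)]
  show "d (a +[sect Y V] b) = d a +[sect X ?W] d b"
  proof (rule X.sect_eqI[OF W(1)])
   fix z assume z: "z : ?W"
   note zf = zfacts[OF z]
   show "rg X z ?W (d (a +[sect Y V] b)) = rg X z ?W (d a +[sect X ?W] d b)"
    using ab yc d zf derD(2)[OF sd[OF zf(3)], of "rg Y (pt f z) V a" "rg Y (pt f z) V b"] C(6)
    by (simp add: X.rgerm_ops[OF W(1) z] Y.rgerm_ops[OF C(6) zf(2)])
  qed (use ab yc xc d in simp_all)
  show "d (a *[sect Y V] b) = (pull f V ?W a *[sect X ?W] d b) +[sect X ?W] (pull f V ?W b *[sect X ?W] d a)"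
  proof (rule X.sect_eqI[OF W(1)])
   fix z assume z: "z : ?W"
   note zf = zfacts[OF z]
   show "rg X z ?W (d (a *[sect Y V] b)) =
     rg X z ?W ((pull f V ?W a *[sect X ?W] d b) +[sect X ?W] (pull f V ?W b *[sect X ?W] d a))"
    using ab yc xc pc d zf derD(3)[OF sd[OF zf(3)], of "rg Y (pt f z) V a" "rg Y (pt f z) V b"] C(6)
    by (simp add: X.rgerm_ops[OF W(1) z] Y.rgerm_ops[OF C(6) zf(2)] pull_germ[OF C(6) W(1,5) _ z])
  qed (use ab yc xc pc d in simp_all)
 qed
 obtain D0 where D0: "der (sect X C) (sect X ?W) (rst X C ?W) D0" "!!r. r : Y.\<O> V ==> D0 (pull f V C r) = d r"
  by (rule F.chart_extend[OF chart W(1,4) der, of "%_. 0[sect X ?W]"])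
   (((simp add: X.sect_closed[OF W(1)]; fail) | (rule that; assumption))+)
 \<comment> \<open>The chart fixes the derivation on functions of the affine open \<open>V\<close>;
   localisation carries the agreement to all germs of the target. In particular germs of the base
   are killed, as \<open>vfield_extend\<close> demands.\<close>
 have agree: "de (smap f z bb) = sact th z bb"
  if z: "z : ?W" and de: "der (SX z) (SX z) (%a. a) de" "!!a. a : X.\<O> C ==> de (rg X z C a) = rg X z ?W (D0 a)"
   and bb: "bb :[SY z]" for z de bb
 proof -
  note zf = zfacts[OF z]
  note S = X.stalk_cring[OF zf(1)] Y.stalk_cring[OF pt_closed[OF zf(1)]]
  show ?thesis
  proof (rule der_localizing_ext[OF S(2,1) Y.affine_localizing[OF C(2) zf(2)] stalk_map_hom[OF zf(1)]
     der_comp_hom[OF S(2,1) stalk_map_hom[OF zf(1)] de(1)] sd[OF zf(3)] _ bb])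
   fix b assume b: "b : Y.\<O> V"
   have "smap f z (rg Y (pt f z) V b) = rg X z C (pull f V C b)" by (rule pull_germ[OF C(6,5,3) b zf(4), symmetric])
   thus "de (smap f z (rg Y (pt f z) V b)) = sact th z (rg Y (pt f z) V b)"
    using de(2)[OF pull_closed[OF C(6,5,3) b]] D0(2)[OF b] d(2)[OF b z] by simp
  qed
 qed
 obtain D where D: "D : Der s ?W" "!!z a. z : ?W ==> a : X.\<O> C ==> vact X ?W D z (rg X z C a) = rg X z ?W (D0 a)"
 proof (rule J.vfield_extend[OF C(1) W(1,4) D0(1)])
  fix z de ka assume z: "z : ?W" and de: "der (SX z) (SX z) (%a. a) de"
   "!!a. a : X.\<O> C ==> de (rg X z C a) = rg X z ?W (D0 a)" and ka: "ka :[J.SY z]"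
  note zf = zfacts[OF z]
  have ka': "ka :[K.SY (pt f z)]" using ka J_SY[OF zf(1)] by simp
  have "de (smap f z (smap t (pt f z) ka)) = sact th z (smap t (pt f z) ka)"
   by (rule agree[OF z de K.stalk_map_closed[OF pt_closed[OF zf(1)] ka']])
  also have "... = 0[SX z]" unfolding sact_def by (rule act_der(2)[OF zf(1) pullback_value[OF th zf(3)] ka'])
  finally show "de (smap s z ka) = 0[SX z]" by (simp add: map_s[OF zf(1) ka'])
 qed ((assumption | (rule that; assumption))+)
 show ?thesis by (rule that[OF W(1-3) D(1)]) (rule agree[OF _ J.vact_der[OF D(1) W(1)] D(2)])
qed

end

section \<open>Splittings on stalks\<close>

lemma sheaf_homD: assumes "h : sheaf_hom X M N" "opn X U" shows "m : Sec M U ==> h U m : Sec N U"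
  and "m : Sec M U ==> m' : Sec M U ==> h U (m +[msec M U] m') = h U m +[msec N U] h U m'"
  and "a :[sect X U] ==> m : Sec M U ==> h U (a .[msec M U] m) = a .[msec N U] h U m"
  and "opn X V ==> V <= U ==> m : Sec M U ==> h V (mrst M U V m) = mrst N U V (h U m)"
proof -
 have l: "linear_map (sect X U) (msec M U) (msec N U) (h U)" using assms unfolding sheaf_hom_def by simp
 show "m : Sec M U ==> h U m : Sec N U" using l unfolding linear_map_def by auto
 show "m : Sec M U ==> m' : Sec M U ==> h U (m +[msec M U] m') = h U m +[msec N U] h U m'" using l unfolding linear_map_def by simp
 show "a :[sect X U] ==> m : Sec M U ==> h U (a .[msec M U] m) = a .[msec N U] h U m" using l unfolding linear_map_def by simp
 show "opn X V ==> V <= U ==> m : Sec M U ==> h V (mrst M U V m) = mrst N U V (h U m)" using assms unfolding sheaf_hom_def by simp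
qed

lemma sheaf_hom_ext: assumes "h : sheaf_hom X M N" "h' : sheaf_hom X M N'" "!!U m. opn X U ==> m : Sec M U ==> h U m = h' U m"
 shows "h = h'"
proof
 fix U
 have e: "h : (\<Pi>\<^sub>E U\<in>{U. opn X U}. Sec M U \<rightarrow>\<^sub>E Sec N U)" "h' : (\<Pi>\<^sub>E U\<in>{U. opn X U}. Sec M U \<rightarrow>\<^sub>E Sec N' U)"
  using assms(1,2) by (auto simp: sheaf_hom_def)
 show "h U = h' U"
 proof (cases "opn X U")
  case True
  hence "h U : Sec M U \<rightarrow>\<^sub>E Sec N U" "h' U : Sec M U \<rightarrow>\<^sub>E Sec N' U" using PiE_mem[OF e(1)] PiE_mem[OF e(2)] by auto
  thus ?thesis using assms(3)[OF True] by (intro extensionalityI[of _ "Sec M U"]) (auto simp: PiE_def)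
 next
  case False
  thus ?thesis using e by (auto simp: PiE_def extensional_def)
 qed
qed

lemma sheaf_homI: assumes "!!U. ~ opn X U ==> h U = undefined" "!!U m. opn X U ==> m ~: Sec M U ==> h U m = undefined"
  and "!!U m. opn X U ==> m : Sec M U ==> h U m : Sec N U"
  and "!!U m m'. opn X U ==> m : Sec M U ==> m' : Sec M U ==> h U (m +[msec M U] m') = h U m +[msec N U] h U m'"
  and "!!U a m. opn X U ==> a :[sect X U] ==> m : Sec M U ==> h U (a .[msec M U] m) = a .[msec N U] h U m"
  and "!!U V m. opn X U ==> opn X V ==> V <= U ==> m : Sec M U ==> h V (mrst M U V m) = mrst N U V (h U m)" shows "h : sheaf_hom X M N"
 unfolding sheaf_hom_def mem_Collect_eq linear_map_def
proof (intro conjI allI impI ballI; (elim conjE)?)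
 show "h : (\<Pi>\<^sub>E U\<in>{U. opn X U}. Sec M U \<rightarrow>\<^sub>E Sec N U)"
 proof (rule PiE_I)
  fix U assume "U : {U. opn X U}"
  thus "h U : Sec M U \<rightarrow>\<^sub>E Sec N U" using assms(2,3) by auto
 qed (simp add: assms(1))
qed (simp_all add: assms)

section \<open>Maps of stalks induced by homomorphisms and by the unit of the pullback\<close>

definition hmap where
 "hmap X N x h mu = (UN (V, m):mu. mg X N x V (h V m))"

context
 fixes X :: "('a, 'b) ringed_space" and M :: "('a, 'b, 'm) mod_sheaf" and N :: "('a, 'b, 'n) mod_sheaf" and h
 assumes M: "premodule X M" and N: "premodule X N" and h: "h : sheaf_hom X M N"
begin

interpretation M: premodule X M by (rule M)
interpretation N: premodule X N by (rule N)

lemma hmap_germ: assumes "opn X U" "x : U" "m : Sec M U" shows "hmap X N x h (mg X M x U m) = mg X N x U (h U m)"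
 unfolding hmap_def mgerm_def by (rule germ_op1[OF M.mod_presheaf N.mod_presheaf, where p = "%V. V" and op = h])
  (use assms sheaf_homD[OF h] in simp_all)

lemma hmap_hom: assumes x: "x : pts X" shows "mu :[M.SM x] ==> hmap X N x h mu :[N.SM x]" and "mu :[M.SM x] ==> nu :[M.SM x] ==>
   hmap X N x h (mu +[M.SM x] nu) = hmap X N x h mu +[N.SM x] hmap X N x h nu" and "al :[stk X x] ==> mu :[M.SM x] ==>
   hmap X N x h (al .[M.SM x] mu) = al .[N.SM x] hmap X N x h mu"
proof -
 show "hmap X N x h mu :[N.SM x]" if "mu :[M.SM x]"
  by (rule M.mgerm_cases[OF that openin_topspace x]) (simp add: hmap_germ sheaf_homD[OF h])
 show "hmap X N x h (mu +[M.SM x] nu) = hmap X N x h mu +[N.SM x] hmap X N x h nu"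
  if "mu :[M.SM x]" "nu :[M.SM x]" by (rule M.mgerm_cases2[OF that x]) (simp add: hmap_germ sheaf_homD[OF h] N.mgerm_add)
 show "hmap X N x h (al .[M.SM x] mu) = al .[N.SM x] hmap X N x h mu"
  if "al :[stk X x]" "mu :[M.SM x]" by (rule M.mgerm_cases_smult[OF that x]) (simp add: hmap_germ sheaf_homD[OF h] N.mgerm_smult)
qed

end

lemma pb_map_class: assumes "pullback_mod f M" "pullback_mod f N" and h: "h : sheaf_hom (target f) M N"
  and U: "opn (source f) U" "x : U" "th : Sec (pullback f M) U"
  and xs: "set_mset xs <= car (stk (source f) x) \<times> car (stalk_module (target f) M (pt f x))"
   "th x = pullback_mod.TC f M x xs"
 shows "pb_map f M N h U th x = pullback_mod.TC f N x (img (map_prod id (hmap (target f) N (pt f x) h)) xs)"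
proof -
 interpret M: pullback_mod f M by fact
 interpret N: pullback_mod f N by fact
 have x: "x : pts (source f)" using M.X.opn_subset[OF U(1)] U(2) by blast
 note hh = hmap_hom[OF M.N.premodule_axioms N.N.premodule_axioms h M.pt_closed[OF x]]
 have "pb_map f M N h U th x = tensor_map (M.SY x) (M.SX x) (smap f x) (N.MY x) (hmap (target f) N (pt f x) h) (M.TC x xs)"
  using U xs(2) unfolding pb_map_def hmap_def[abs_def] by simp
 also have "... = N.TC x (img (map_prod id (hmap (target f) N (pt f x) h)) xs)"
  by (rule base_change.tensor_map_class[OF M.bc[OF x] xs(1), where ro = "%r. r"]) (simp_all add: hh)
 finally show ?thesis .
qed

context tangent_target
begin

lemma unit_add: assumes V: "opn Y V" and D: "D : Sec TY V" and E: "E : Sec TY V"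
 shows "pb_unit f TY V (D +[msec TY V] E) = pb_unit f TY V D +[msec PT (pre f V)] pb_unit f TY V E"
proof (rule sec_eqI[OF opn_preimg[OF V]])
 note DE = D[unfolded K.tan_simps(1)] E[unfolded K.tan_simps(1)]
 note o = opn_preimg[OF V] and u = pb_unit(1)[OF V]
 show "pb_unit f TY V (D +[msec TY V] E) : Sec PT (pre f V)" using V D E by (intro u) simp
 fix x bb assume x: "x : pre f V" "bb :[SY x]"
 have xX: "x : pts X" and y: "pt f x : V" using x(1) by (auto simp: preimg_mem)
 show "sact (pb_unit f TY V (D +[msec TY V] E)) x bb = sact (pb_unit f TY V D +[msec PT (pre f V)] pb_unit f TY V E) x bb"
  using sec_act(1)[OF o u[OF D] x u[OF E]] act_unit[OF V DE(1) x] act_unit[OF V DE(2) x] act_unit[OF V K.vfield_add(1)[OF DE V] x]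
   K.vfield_add(2)[OF DE V y x(2)] ring_hom_add[OF stalk_map_hom[OF xX]] DE V y x(2) by simp
qed (use pb_unit(1)[OF V] V D E in simp)

lemma unit_smult: assumes V: "opn Y V" and a: "a : Y.\<O> V" and D: "D : Sec TY V"
 shows "pb_unit f TY V (a .[msec TY V] D) = sh f V a .[msec PT (pre f V)] pb_unit f TY V D"
proof (rule sec_eqI[OF opn_preimg[OF V]])
 note D' = D[unfolded K.tan_simps(1)]
 note o = opn_preimg[OF V] and u = pb_unit(1)[OF V]
 show "pb_unit f TY V (a .[msec TY V] D) : Sec PT (pre f V)" using V D a by (intro u) simp
 fix x bb assume x: "x : pre f V" "bb :[SY x]"
 have xX: "x : pts X" and y: "pt f x : V" using x(1) by (auto simp: preimg_mem)
 show "sact (pb_unit f TY V (a .[msec TY V] D)) x bb = sact (sh f V a .[msec PT (pre f V)] pb_unit f TY V D) x bb"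
  using sec_act(2)[OF o u[OF D] x sh_closed[OF V a]] act_unit[OF V D' x] act_unit[OF V K.vfield_smult(1)[OF D' a V] x]
   K.vfield_smult(2)[OF D' a V y x(2)] ring_hom_mult[OF stalk_map_hom[OF xX]] stalk_map_germ[OF V y a xX] D' a V y x(2) by simp
qed (use pb_unit(1)[OF V] V D a in simp)

lemma unit_restrict: assumes V: "opn Y V" "opn Y V'" "V' <= V" and D: "D : Sec TY V"
 shows "pb_unit f TY V' (mrst TY V V' D) = mrst PT (pre f V) (pre f V') (pb_unit f TY V D)"
proof (rule sec_eqI[OF opn_preimg[OF V(2)]])
 note D' = D[unfolded K.tan_simps(1)]
 show "pb_unit f TY V' (mrst TY V V' D) : Sec PT (pre f V')" using V D by (intro pb_unit(1)) simp_all
 fix x bb assume x: "x : pre f V'" "bb :[SY x]"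
 have x': "x : pre f V" and y: "pt f x : V'" using x(1) V(3) by (auto simp: preimg_mem)
 have "sact (mrst PT (pre f V) (pre f V') (pb_unit f TY V D)) x bb = sact (pb_unit f TY V D) x bb"
  using x(1) by (simp add: sact_def pullback_simps)
 thus "sact (pb_unit f TY V' (mrst TY V V' D)) x bb = sact (mrst PT (pre f V) (pre f V') (pb_unit f TY V D)) x bb"
  using act_unit[OF V(1) D' x' x(2)] act_unit[OF V(2) K.vfield_restrict(1)[OF D' V] x]
   K.vfield_restrict(2)[OF D' V y x(2)] by simp
qed (use pb_unit(1)[OF V(1) D] V preimg_mono[OF V(3)] in simp)

definition umap where
 "umap x mu = (UN (V, D):mu. mg X PT x (pre f V) (pb_unit f TY V D))"

lemma umap_germ: assumes V: "opn Y V" "pt f x : V" "D : Sec TY V" and x: "x : pts X"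
 shows "umap x (mg Y TY (pt f x) V D) = mg X PT x (pre f V) (pb_unit f TY V D)" unfolding umap_def mgerm_def
 by (rule germ_op1[OF K.tan.mod_presheaf pb.mod_presheaf, where p = "pre f" and op = "pb_unit f TY"])
  (use assms unit_restrict pb_unit(1) preimg_mono in "simp_all add: preimg_mem")

lemma umap_hom: assumes x: "x : pts X" shows "mu :[MY x] ==> umap x mu :[pb.SM x]"
  and "mu :[MY x] ==> nu :[MY x] ==> umap x (mu +[MY x] nu) = umap x mu +[pb.SM x] umap x nu"
  and "al :[SY x] ==> mu :[MY x] ==> umap x (al .[MY x] mu) = smap f x al .[pb.SM x] umap x mu"
proof -
 note y = pt_closed[OF x]
 have p: "x : pre f V" if "pt f x : V" for V using x that by (simp add: preimg_mem)
 show "umap x mu :[pb.SM x]" if "mu :[MY x]" by (rule K.tan.mgerm_cases[OF that openin_topspace y]) (simp add: umap_germ x pb_unit(1) p)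
 show "umap x (mu +[MY x] nu) = umap x mu +[pb.SM x] umap x nu" if "mu :[MY x]" "nu :[MY x]"
  by (rule K.tan.mgerm_cases2[OF that y]) (simp add: umap_germ x p unit_add pb.mgerm_add pb_unit(1))
 show "umap x (al .[MY x] mu) = smap f x al .[pb.SM x] umap x mu" if "al :[SY x]" "mu :[MY x]"
  by (rule K.tan.mgerm_cases_smult[OF that y]) (simp add: umap_germ x p unit_smult pb.mgerm_smult pb_unit(1) stalk_map_germ)
qed

end

section \<open>Commutators and linear combinations of derivations\<close>

lemma (in abelian_group) msum_minus: assumes "!!x. x :# M ==> g x :[G] & h x :[G]"
 shows "msum G (%x. g x -[G] h x) M = msum G g M -[G] msum G h M" using assms
proof (induction M)
 case empty
 show ?case by (simp add: minus_eq r_neg)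
next
 case (add x M)
 thus ?case by (simp add: minus_eq minus_add a_ac)
qed

lemma (in cring) msum_rdistr:
 "a :[R] ==> (!!x. x :# M ==> g x :[R]) ==> msum R g M *[R] a = msum R (%x. g x *[R] a) M"
 by (simp add: m_comm[of "msum R g M"] msum_ldistr) (rule msum_cong, simp add: m_comm)

lemma der_msum_arg: assumes "cring A" "cring B" "der A B ps d" "!!x. x :# M ==> g x :[A]" shows "d (msum A g M) = msum B (%x. d (g x)) M"
proof -
 interpret A: cring A by fact
 interpret B: cring B by fact
 show ?thesis by (rule msum_hom[of A B d, OF A.abelian_monoid_axioms B.abelian_monoid_axioms _ der_zero[OF assms(3,1,2)]])
   (use assms(3,4) in "auto simp: der_def")
qed

text \<open>If \<open>D\<close> and \<open>E\<close> are combinations of commuting derivations, then the second order terms of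
 their commutator cancel.\<close>

lemma combination_commutator: assumes A: "cring A" and B: "cring B" and ph: "ph : ring_hom B A"
  and D: "der A A (%a. a) D" and E: "der A A (%a. a) E" and e: "!!l. l :# L ==> der B B (%a. a) (e l)"
  and comm: "!!l m b. l :# L ==> m :# L ==> b :[B] ==> e l (e m b) = e m (e l b)" and u: "!!l. l :# L ==> u l :[A]"
  and De: "!!b. b :[B] ==> D (ph b) = msum A (%l. D (u l) *[A] ph (e l b)) L"
  and Ee: "!!b. b :[B] ==> E (ph b) = msum A (%l. E (u l) *[A] ph (e l b)) L" and b: "b :[B]"
 shows "D (E (ph b)) -[A] E (D (ph b)) = msum A (%l. (D (E (u l)) -[A] E (D (u l))) *[A] ph (e l b)) L"
proof -
 interpret A: cring A by (rule A)
 note ec = der_closed[OF e] and Dc = der_closed[OF D] and Ec = der_closed[OF E] and pc = ring_hom_closed[OF ph]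
 note cl = ec Dc Ec pc u b
 \<comment> \<open>The Leibniz rule splits the composite into a second order part and a combination
   of the \<open>e l\<close>. It is used for \<open>D\<close> after \<open>E\<close> and for
   \<open>E\<close> after \<open>D\<close>.\<close>
 have step: "F (G (ph b)) = msum A (%l. msum A (%m. G (u l) *[A] (F (u m) *[A] ph (e m (e l b)))) L) L +[A]
   msum A (%l. F (G (u l)) *[A] ph (e l b)) L"
  if F: "der A A (%a. a) F" "!!b. b :[B] ==> F (ph b) = msum A (%l. F (u l) *[A] ph (e l b)) L"
   and G: "der A A (%a. a) G" "!!b. b :[B] ==> G (ph b) = msum A (%l. G (u l) *[A] ph (e l b)) L" for F G
 proof -
  note FGc = der_closed[OF F(1)] der_closed[OF G(1)]
  have "F (G (ph b)) = msum A (%l. F (G (u l) *[A] ph (e l b))) L"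
   unfolding G(2)[OF b] by (rule der_msum_arg[OF A A F(1)]) (use cl FGc in simp)
  also have "... = msum A (%l. (G (u l) *[A] F (ph (e l b))) +[A] (F (G (u l)) *[A] ph (e l b))) L"
   by (rule A.msum_cong) (use cl FGc in "simp add: derD(3)[OF F(1)] A.m_comm")
  also have "... = msum A (%l. G (u l) *[A] F (ph (e l b))) L +[A] msum A (%l. F (G (u l)) *[A] ph (e l b)) L"
   by (rule A.msum_add) (use cl FGc in simp)
  also have "msum A (%l. G (u l) *[A] F (ph (e l b))) L =
    msum A (%l. msum A (%m. G (u l) *[A] (F (u m) *[A] ph (e m (e l b)))) L) L"
   by (rule A.msum_cong, subst F(2)) (use cl FGc in "simp_all add: A.msum_ldistr")
  finally show ?thesis .
 qed
 \<comment> \<open>The second order parts of the two composites become equal once the summations are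
   exchanged and the derivations \<open>e\<close> are commuted.\<close>
 let ?Z = "msum A (%l. msum A (%m. E (u l) *[A] (D (u m) *[A] ph (e m (e l b)))) L) L"
 have "msum A (%l. msum A (%m. D (u l) *[A] (E (u m) *[A] ph (e m (e l b)))) L) L =
   msum A (%m. msum A (%l. D (u l) *[A] (E (u m) *[A] ph (e m (e l b)))) L) L" by (rule A.msum_swap) (use cl in simp)
 also have "... = ?Z"
 proof (intro A.msum_cong)
  fix l m assume "l :# L" "m :# L"
  thus "D (u m) *[A] (E (u l) *[A] ph (e l (e m b))) = E (u l) *[A] (D (u m) *[A] ph (e m (e l b)))"
   using cl by (simp add: comm[of l m b] A.m_lcomm)
 qed
 finally have Z: "msum A (%l. msum A (%m. D (u l) *[A] (E (u m) *[A] ph (e m (e l b)))) L) L = ?Z" .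
 have cancel: "(z +[A] a) -[A] (z +[A] c) = a -[A] c" if "z :[A]" "a :[A]" "c :[A]" for z a c
 proof -
  have "(z +[A] a) -[A] (z +[A] c) = (z +[A] -[A] z) +[A] (a -[A] c)" using that by (simp add: A.minus_eq A.minus_add A.a_ac)
  thus ?thesis using that by (simp add: A.r_neg)
 qed
 have "D (E (ph b)) -[A] E (D (ph b)) =
   msum A (%l. D (E (u l)) *[A] ph (e l b)) L -[A] msum A (%l. E (D (u l)) *[A] ph (e l b)) L"
  using step[OF D De E Ee] step[OF E Ee D De] cancel[of ?Z] by (simp add: Z)
 also have "... = msum A (%l. (D (E (u l)) *[A] ph (e l b)) -[A] (E (D (u l)) *[A] ph (e l b))) L"
  by (rule A.msum_minus[symmetric]) (use cl in simp)
 also have "... = msum A (%l. (D (E (u l)) -[A] E (D (u l))) *[A] ph (e l b)) L"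
  by (rule A.msum_cong) (use cl in "simp add: A.minus_eq A.l_distr A.l_minus")
 finally show ?thesis .
qed

text \<open>To be a combination of the \<open>e l\<close> whose coefficients are the own values at
  the \<open>u l\<close> is a linear condition. It therefore passes from the derivations
  \<open>d s\<close> to their combinations over \<open>A\<close>, by an exchange of two
  sums.\<close>

lemma combination_linear: assumes A: "cring A" and B: "cring B" and ph: "ph : ring_hom B A"
  and c: "!!s. s :# M ==> c s :[A]" and d: "!!s x. s :# M ==> x :[B] ==> d s x :[B]"
  and e: "!!l. l :# L ==> e l :[B]" and u: "!!l. l :# L ==> u l :[B]" and de: "!!s. s :# M ==> d s b = msum B (%l. d s (u l) *[B] e l) L"
 shows "msum A (%s. c s *[A] ph (d s b)) M = msum A (%l. msum A (%s. c s *[A] ph (d s (u l))) M *[A] ph (e l)) L"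
proof -
 interpret A: cring A by (rule A)
 interpret B: cring B by (rule B)
 note cl = ring_hom_closed[OF ph] c d e u
 have hom: "ph (d s b) = msum A (%l. ph (d s (u l) *[B] e l)) L" if s: "s :# M" for s unfolding de[OF s]
  by (rule msum_hom[of B A ph, OF B.abelian_monoid_axioms A.abelian_monoid_axioms _ ring_hom_zero'[OF B A ph] ring_hom_add[OF ph]])
   (use cl s in auto)
 have "msum A (%s. c s *[A] ph (d s b)) M = msum A (%s. msum A (%l. c s *[A] ph (d s (u l)) *[A] ph (e l)) L) M"
  by (rule A.msum_cong) (simp add: hom A.msum_ldistr cl ring_hom_mult[OF ph] A.m_assoc cong: A.msum_cong)
 also have "... = msum A (%l. msum A (%s. c s *[A] ph (d s (u l)) *[A] ph (e l)) M) L" by (rule A.msum_swap) (simp add: cl)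
 also have "... = msum A (%l. msum A (%s. c s *[A] ph (d s (u l))) M *[A] ph (e l)) L" by (rule A.msum_cong) (simp add: A.msum_rdistr cl)
 finally show ?thesis .
qed

lemma pb_map_rep: assumes "pullback_mod f M" "pullback_mod f N" and h: "h : sheaf_hom (target f) M N"
  and U: "opn (source f) U" "th : Sec (pullback f M) U" and W: "W <= U" and r: "prep f M W V xs th"
 shows "prep f N W V (map (map_prod id (h V)) xs) (pb_map f M N h U th)"
proof -
 interpret M: pullback_mod f M by fact
 interpret N: pullback_mod f N by fact
 have o: "opn (source f) W" "opn (target f) V" "W <= pre f V" "set xs <= M.X.\<O> W \<times> Sec M V"
  "!!x. x : W ==> th x = pb_elem f M W V xs x" using r by (simp_all add: pb_represents_def)
 have c: "set (map (map_prod id (h V)) xs) <= M.X.\<O> W \<times> Sec N V" using o(4) sheaf_homD(1)[OF h o(2)] by auto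
 have "pb_map f M N h U th x = pb_elem f N W V (map (map_prod id (h V)) xs) x" if x: "x : W" for x
 proof -
  have y: "pt f x : V" using x o(3) by (auto simp: M.preimg_mem)
  have "map (map_prod id (hmap (target f) N (pt f x) h)) (map (%(a, m). (rg (source f) x W a, mg (target f) M (pt f x) V m)) xs) =
    map (%(a, m). (rg (source f) x W a, mg (target f) N (pt f x) V m)) (map (map_prod id (h V)) xs)"
   using o(4) y by (auto simp: hmap_germ[OF M.N.premodule_axioms N.N.premodule_axioms h o(2)])
  thus ?thesis using pb_map_class[OF assms(1-3) U(1) subsetD[OF W x] U(2) M.gmap_closed[OF o(1-4) x]] o(5)[OF x]
   by (simp only: M.pb_elem_eq N.pb_elem_eq mset_map[symmetric])
 qed
 thus ?thesis using o c by (simp add: pb_represents_def)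
qed

lemma pb_map_closed: assumes "pullback_mod f M" "pullback_mod f N" "h : sheaf_hom (target f) M N"
  and U: "opn (source f) U" "th : Sec (pullback f M) U" shows "pb_map f M N h U th : Sec (pullback f N) U"
proof -
 interpret M: pullback_mod f M by fact
 interpret N: pullback_mod f N by fact
 show ?thesis unfolding N.pullback_mem
 proof (intro conjI ballI)
  show "pb_map f M N h U th : extensional U" using U by (simp add: pb_map_def)
  fix x assume "x : U"
  then obtain W V xs where r: "x : W" "W <= U" "prep f M W V xs th" by (rule M.pullback_rep[OF U(2)])
  show "EX W V xs. x : W & W <= U & prep f N W V xs (pb_map f M N h U th)" using r(1,2) pb_map_rep[OF assms(1-3) U r(2,3)] by auto
 qed
qed

section \<open>Towers\<close>

locale leaf_tower =
 fixes q :: "('a, 'b, 'c, 'd) rs_morphism" and p :: "('c, 'd, 'e, 'f) rs_morphism"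
  and tX :: "('a, 'b, 'p, 'q) rs_morphism" and tY :: "('c, 'd, 'p, 'q) rs_morphism" and tS :: "('e, 'f, 'p, 'q) rs_morphism"
 assumes setups: "differential_setup q tY tX" "differential_setup p tS tY" "differential_setup (mor_comp p q) tS tX"
  and src: "source p = target q"

sublocale leaf_tower \<subseteq> Q: differential_setup q tY tX by (rule setups)

sublocale leaf_tower \<subseteq> P: differential_setup p tS tY rewrites "source p = target q" by ((rule setups src)+)

text \<open>The two steps of the tower and the composite must speak of the same spaces, stalks and
  preimages for their lemmas to be combined; the rewrites make these terms literally equal.\<close>

sublocale leaf_tower \<subseteq> R: differential_setup "mor_comp p q" tS tX
 rewrites "source (mor_comp p q) = source q" and "target (mor_comp p q) = target p"
  and "pt (mor_comp p q) = (%x. pt p (pt q x))" and "pre (mor_comp p q) = (%V. pre q (pre p V))"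
proof -
 have "pre (mor_comp p q) V = pre q (pre p V)" for V by (auto simp: preimg_def mor_comp_def src)
 thus "pre (mor_comp p q) = (%V. pre q (pre p V))" by blast
qed ((rule setups | (simp add: mor_comp_def comp_def; fail))+)

context leaf_tower
begin

abbreviation "X == source q"
abbreviation "Y == target q"
abbreviation "S == target p"
abbreviation "SX x == stk X x"
abbreviation "SY y == stk Y y"
abbreviation "SS s == stk S s"
abbreviation "r == mor_comp p q"
abbreviation "TX == tangent tX"
abbreviation "TY == tangent tY"
abbreviation "TS == tangent tS"
abbreviation "qTY == pullback q TY"
abbreviation "pTS == pullback p TS"
abbreviation "rTS == pullback r TS"
abbreviation "dq == diff q tX tY"
abbreviation "dp == diff p tY tS"
abbreviation "dr == diff r tX tS"
abbreviation "rMY x == stalk_module S TS (pt p (pt q x))"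
abbreviation (input) "qcd C a x l \<equiv> rgerm S (pt p (pt q x)) C (a l)"
abbreviation "rTC x == tcl (SS (pt p (pt q x))) (SX x) (smap r x) (rMY x)"
abbreviation "rgmap W V x == (%(a, m). (rg X x W a, mg S TS (pt p (pt q x)) V m))"

lemma comp_map:
 "x : pts X ==> ka : car (SS (pt p (pt q x))) ==> smap r x ka = smap q x (smap p (pt q x) ka)"
 using stalk_map_comp[of q p x ka] Q.morph_axioms P.morph_axioms src by simp

lemma q_pTS: "pullback_mod q pTS" by (intro pullback_mod.intro Q.morph_axioms P.pb.premodule_axioms)

lemma q_TY: "pullback_mod q TY" by (rule Q.pullback_mod_axioms)

lemma pb_comp_rep: assumes U: "opn X U" "th : Sec rTS U" and W: "W <= U" and rep: "prep r TS W V xs th"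
 shows "prep q pTS W (pre p V) (map (map_prod id (pb_unit p TS V)) xs) (pb_comp p q TS U th)"
proof -
 interpret N: pullback_mod q pTS by (rule q_pTS)
 have o: "opn X W" "opn S V" "W <= pre q (pre p V)" "set xs <= Q.X.\<O> W \<times> Sec TS V"
  "!!x. x : W ==> th x = pb_elem r TS W V xs x" using rep by (auto simp: pb_represents_def mor_comp_def preimg_def src)
 have c: "set (map (map_prod id (pb_unit p TS V)) xs) <= Q.X.\<O> W \<times> Sec pTS (pre p V)" using o(4) P.pb_unit(1)[OF o(2)] by auto
 have "pb_comp p q TS U th x = pb_elem q pTS W (pre p V) (map (map_prod id (pb_unit p TS V)) xs) x" if x: "x : W" for x
 proof -
  have xX: "x : pts X" and y: "pt q x : pts Y" "pt p (pt q x) : V" using x o(3) by (auto simp: Q.preimg_mem P.preimg_mem)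
  have xs: "set_mset (mset (map (rgmap W V x) xs)) <= car (SX x) \<times> car (rMY x)" using R.gmap_closed[OF o(1-4) x] .
  have "pb_comp p q TS U th x = tensor_map (SY (pt q x)) (SX x) (smap q x) (N.MY x) (P.umap (pt q x)) (rTC x (mset (map (rgmap W V x) xs)))"
   using U(2) W x o(5)[OF x] U(1) unfolding pb_comp_def P.umap_def[abs_def] R.pb_elem_eq by auto
  also have "... = N.TC x (img (map_prod id (P.umap (pt q x))) (mset (map (rgmap W V x) xs)))"
   by (rule base_change.tensor_map_class[OF R.bc[OF xX] xs, where ro = "smap p (pt q x)"])
    (use comp_map[OF xX] P.stalk_map_closed[OF y(1)] P.umap_hom[OF y(1)] in simp_all)
  also have "img (map_prod id (P.umap (pt q x))) (mset (map (rgmap W V x) xs)) =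
    mset (map (N.gmap W (pre p V) x) (map (map_prod id (pb_unit p TS V)) xs))"
  proof -
   have "map (map_prod id (P.umap (pt q x))) (map (rgmap W V x) xs) =
     map (N.gmap W (pre p V) x) (map (map_prod id (pb_unit p TS V)) xs)" using o(4) by (auto simp: P.umap_germ[OF o(2) y(2) _ y(1)])
   thus ?thesis by (simp only: mset_map[symmetric])
  qed
  finally show ?thesis unfolding N.pb_elem_eq .
 qed
 thus ?thesis using o c unfolding pb_represents_def by simp
qed

lemma pb_comp_closed: assumes U: "opn X U" "th : Sec rTS U" shows "pb_comp p q TS U th : Sec (pullback q pTS) U"
proof -
 interpret N: pullback_mod q pTS by (rule q_pTS)
 show ?thesis unfolding N.pullback_mem
 proof (intro conjI ballI)
  show "pb_comp p q TS U th : extensional U" using U by (simp add: pb_comp_def)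
  fix x assume "x : U"
  then obtain W V xs where r: "x : W" "W <= U" "prep r TS W V xs th" by (rule R.pullback_rep[OF U(2)])
  show "EX W V xs. x : W & W <= U & prep q pTS W V xs (pb_comp p q TS U th)" using r(1,2) pb_comp_rep[OF U r(2,3)] by auto
 qed
qed

end

section \<open>Horizontal lifts and the pullback of a splitting\<close>

locale tower_splitting = leaf_tower +
 fixes ta assumes tau: "tangent_splitting p tY tS ta"
begin

lemma tau_hom: "ta : sheaf_hom Y pTS TY" using tau by (simp add: tangent_splitting_def src)

lemma tau_section: "opn Y U ==> th : Sec pTS U ==> dp U (ta U th) = th" using tau by (simp add: tangent_splitting_def src)

lemma tau_closed: "opn Y U ==> th : Sec pTS U ==> ta U th : Der tY U" using sheaf_homD(1)[OF tau_hom] by (simp add: Q.K.tan_simps(1))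

lemma tau_act: assumes "opn Y U" "th : Sec pTS U" "y : U" "gg :[SS (pt p y)]" shows "vact Y U (ta U th) y (smap p y gg) = P.sact th y gg"
 using P.differential_spec(2)[OF assms(1) tau_closed[OF assms(1,2)] assms(3,4)] tau_section[OF assms(1,2)] by simp

definition lift where "lift V xi = ta (pre p V) (pb_unit p TS V xi)"

abbreviation (input) "lva V xi \<equiv> vact Y (preimg p V) (lift V xi)"

lemma unit_closed: "opn S V ==> xi : Der tS V ==> pb_unit p TS V xi : Sec pTS (pre p V)"
 by (rule P.pb_unit(1)) (simp_all add: P.K.tan_simps(1))

lemma lift_closed: "opn S V ==> xi : Der tS V ==> lift V xi : Der tY (pre p V)"
 unfolding lift_def by (rule tau_closed[OF P.opn_preimg unit_closed])

text \<open>The lift is \<open>p\<close>-related to \<open>xi\<close>, since \<open>dp\<close> maps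
  it to the unit section of \<open>xi\<close>.\<close>

lemma lift_act: assumes V: "opn S V" "xi : Der tS V" and y: "y : pre p V" and gg: "gg :[SS (pt p y)]"
 shows "lva V xi y (smap p y gg) = smap p y (vact S V xi (pt p y) gg)"
 unfolding lift_def tau_act[OF P.opn_preimg[OF V(1)] unit_closed[OF V] y gg] by (rule P.act_unit[OF V y gg])

text \<open>Near \<open>y\<close> the section is the combination of the unit sections of the frame,
  with sections of its values at the coordinates as coefficients. By linearity \<open>ta\<close>
  replaces the unit sections by the lifts. All questions about a splitting are in this way reduced
  to the lifts of a frame.\<close>

lemma tau_frame: assumes U: "opn Y U" and th: "th : Sec pTS U" and chart: "P.K.chart C V n c F a N" and frame: "P.K.frame C n c a fr"
  and y: "y : U" "pt p y : C" and bb: "bb :[SY y]"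
 shows "vact Y U (ta U th) y bb = msum (SY y) (%l. P.sact th y (rg S (pt p y) C (a l)) *[SY y]
  lva C (fr l) y bb) (ixs c n)"
proof -
 let ?W = "U Int pre p C" and ?L = "ixs c n"
 note oC = P.K.chartD(5)[OF chart]
 have yY: "y : pts Y" by (rule P.sec_pt[OF U y(1)])
 have W: "opn Y ?W" "y : ?W" "?W <= U" "?W <= pre p C" using U oC y yY by (auto simp: P.preimg_mem)
 note oP = P.opn_preimg[OF oC]
 have fr: "fr l : Der tS C" if "l :# ?L" for l using frame that by (simp add: P.K.frame_def[OF chart])
 have "EX r. r : Q.Y.\<O> ?W & (ALL z:?W. rg Y z ?W r = P.sact th z (rg S (pt p z) C (a l)))" if "l :# ?L" for l
  by (rule P.act_section[OF U th oC P.K.chart_coord[OF chart, of l]]) (use that in auto)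
 then obtain s where s: "!!l. l :# ?L ==> s l : Q.Y.\<O> ?W & (ALL z:?W. rg Y z ?W (s l) = P.sact th z (rg S (pt p z) C (a l)))" by metis
 let ?e = "%l. mrst pTS (pre p C) ?W (pb_unit p TS C (fr l))"
 have e: "?e l : Sec pTS ?W" if "l :# ?L" for l by (rule P.pb.mrst_closed[OF oP W(1,4) unit_closed[OF oC fr[OF that]]])
 interpret MP: module "sect Y ?W" "msec pTS ?W" by (rule P.pullback_module[OF W(1)])
 interpret MT: module "sect Y ?W" "msec TY ?W" by (rule Q.K.tangent_module[OF W(1)])
 interpret Sy: cring "SY y" by (rule Q.Y.stalk_cring[OF yY])
 have se: "s l .[msec pTS ?W] ?e l : Sec pTS ?W" if "l :# ?L" for l using s[OF that] e[OF that] by simp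
 have eq: "mrst pTS U ?W th = msum (msec pTS ?W) (%l. s l .[msec pTS ?W] ?e l) ?L"
 proof (rule P.sec_eqI[OF W(1) P.pb.mrst_closed[OF U W(1,3) th] MP.M.msum_closed])
  fix z gg assume z: "z : ?W" and gg: "gg :[SS (pt p z)]"
  have zf: "z : U" "z : pre p C" "pt p z : C" "z : pts Y" using z by (auto simp: P.preimg_mem)
  interpret Sz: cring "SY z" by (rule Q.Y.stalk_cring[OF zf(4)])
  have "P.sact (mrst pTS U ?W th) z gg = P.sact th z gg" using z by (simp add: P.sact_def P.pullback_simps)
  also have "... = msum (SY z) (%l. P.sact th z (rg S (pt p z) C (a l)) *[SY z] smap p z (vact S C (fr l) (pt p z) gg)) ?L"
   unfolding P.sact_def by (rule P.K.frame_expand[OF chart frame Q.Y.local_stalk[OF zf(4)] P.stalk_map_hom[OF zf(4)]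
      P.act_der(1)[OF zf(4) P.pullback_value[OF th zf(1)]] zf(3) P.act_der(2)[OF zf(4) P.pullback_value[OF th zf(1)]] gg])
  also have "... = msum (SY z) (%l. P.sact (s l .[msec pTS ?W] ?e l) z gg) ?L"
  proof (rule Sz.msum_cong)
   fix l assume l: "l :# ?L"
   have "P.sact (?e l) z gg = P.sact (pb_unit p TS C (fr l)) z gg" using z by (simp add: P.sact_def P.pullback_simps)
   hence "P.sact (?e l) z gg = smap p z (vact S C (fr l) (pt p z) gg)" using P.act_unit[OF oC fr[OF l] zf(2) gg] by simp
   thus "P.sact th z (rg S (pt p z) C (a l)) *[SY z] smap p z (vact S C (fr l) (pt p z) gg) =
     P.sact (s l .[msec pTS ?W] ?e l) z gg" using P.sec_act(2)[OF W(1) e[OF l] z gg, of "s l"] s[OF l] z by simp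
  qed
  also have "... = P.sact (msum (msec pTS ?W) (%l. s l .[msec pTS ?W] ?e l) ?L) z gg" by (rule P.sec_msum[OF W(1) se z gg, symmetric])
  finally show "P.sact (mrst pTS U ?W th) z gg = P.sact (msum (msec pTS ?W) (%l. s l .[msec pTS ?W] ?e l) ?L) z gg" .
 qed
 note h = sheaf_homD[OF tau_hom W(1)]
 have "ta ?W (0[sect Y ?W] .[msec pTS ?W] 0[msec pTS ?W]) = 0[sect Y ?W] .[msec TY ?W] ta ?W 0[msec pTS ?W]" by (rule h(3)) simp_all
 hence zero: "ta ?W 0[msec pTS ?W] = 0[msec TY ?W]" using h(1) by simp
 let ?d = "%l. s l .[msec TY ?W] mrst TY (pre p C) ?W (lift C (fr l))"
 have d: "mrst TY (pre p C) ?W (lift C (fr l)) : Der tY ?W" if "l :# ?L" for l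
  by (rule Q.K.vfield_restrict(1)[OF lift_closed[OF oC fr[OF that]] oP W(1,4)])
 have "mrst TY U ?W (ta U th) = ta ?W (mrst pTS U ?W th)" by (rule sheaf_homD(4)[OF tau_hom U W(1,3) th, symmetric])
 also have "... = msum (msec TY ?W) (%l. ta ?W (s l .[msec pTS ?W] ?e l)) ?L" unfolding eq
  by (rule msum_hom[of "msec pTS ?W" "msec TY ?W" "ta ?W", OF MP.M.abelian_monoid_axioms MT.M.abelian_monoid_axioms _ zero h(2) se])
   (use h(1) in auto)
 also have "... = msum (msec TY ?W) ?d ?L"
 proof (rule MT.M.msum_cong)
  fix l assume l: "l :# ?L"
  show "ta ?W (s l .[msec pTS ?W] ?e l) = ?d l"
   using h(3)[OF _ e[OF l], of "s l"] s[OF l] sheaf_homD(4)[OF tau_hom oP W(1,4) unit_closed[OF oC fr[OF l]]] by (simp add: lift_def)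
 qed
 finally have r: "mrst TY U ?W (ta U th) = msum (msec TY ?W) ?d ?L" .
 have sd: "?d l : Der tY ?W" if "l :# ?L" for l by (rule Q.K.vfield_smult(1)[OF d[OF that] conjunct1[OF s[OF that]] W(1)])
 have "vact Y U (ta U th) y bb = vact Y ?W (msum (msec TY ?W) ?d ?L) y bb"
  unfolding r[symmetric] by (rule Q.K.vfield_restrict(2)[OF tau_closed[OF U th] U W(1,3,2) bb, symmetric])
 also have "... = msum (SY y) (%l. vact Y ?W (?d l) y bb) ?L" by (rule Q.K.vact_msum(2)[OF W(1) sd W(2) bb])
 also have "... = msum (SY y) (%l. P.sact th y (rg S (pt p y) C (a l)) *[SY y] lva C (fr l) y bb) ?L"
 proof (rule Sy.msum_cong)
  fix l assume l: "l :# ?L"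
  show "vact Y ?W (?d l) y bb = P.sact th y (rg S (pt p y) C (a l)) *[SY y] lva C (fr l) y bb"
   using Q.K.vfield_smult(2)[OF d[OF l] conjunct1[OF s[OF l]] W(1,2) bb] s[OF l] W(2)
    Q.K.vfield_restrict(2)[OF lift_closed[OF oC fr[OF l]] oP W(1,4,2) bb] by simp
 qed
 finally show ?thesis .
qed

abbreviation "pbs == psplit q p tY tS ta"

lemma pbs_eq: "opn X U ==> th : Sec rTS U ==> pbs U th = pb_map q pTS TY ta U (pb_comp p q TS U th)" by (simp add: pullback_splitting_def)

lemma pbs_closed: "opn X U ==> th : Sec rTS U ==> pbs U th : Sec qTY U"
 unfolding pbs_eq by (rule pb_map_closed[OF q_pTS q_TY tau_hom _ pb_comp_closed])

lemma pbs_rep: assumes U: "opn X U" "th : Sec rTS U" and W: "W <= U" and rep: "prep r TS W V xs th"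
 shows "prep q TY W (pre p V) (map (map_prod id (lift V)) xs) (pbs U th)"
proof -
 have "map (map_prod id (ta (pre p V))) (map (map_prod id (pb_unit p TS V)) xs) = map (map_prod id (lift V)) xs"
  by (simp add: lift_def case_prod_unfold map_prod_def)
 thus ?thesis using pb_map_rep[OF q_pTS q_TY tau_hom U(1) pb_comp_closed[OF U] W pb_comp_rep[OF U W rep]] by (simp only: pbs_eq[OF U])
qed

text \<open>A tensor built from horizontal fields on \<open>Y\<close> is determined by its values at
  the coordinates of \<open>S\<close>. This applies both to the pullback of a splitting and to the
  pullback of its distribution.\<close>

lemma rep_frame: assumes rep: "prep q TY W V xs \<omega>" and im: "snd ` set xs <= ta V ` Sec pTS V"
  and chart: "P.K.chart C V' n c F a N" and frame: "P.K.frame C n c a fr" and x: "x : W" "pt p (pt q x) : C" and bb: "bb :[SY (pt q x)]"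
 shows "Q.sact \<omega> x bb = msum (SX x) (%l. Q.sact \<omega> x (smap p (pt q x) (qcd C a x l)) *[SX x]
  smap q x (lva C (fr l) (pt q x) bb)) (ixs c n)"
proof -
 let ?L = "ixs c n" and ?y = "pt q x"
 have o: "opn X W" "opn Y V" "W <= pre q V" "set xs <= Q.X.\<O> W \<times> Der tY V"
  using rep by (simp_all add: pb_represents_def Q.K.tan_simps(1))
 note oC = P.K.chartD(5)[OF chart]
 have xX: "x : pts X" and y: "?y : V" using x(1) o(3) by (auto simp: Q.preimg_mem)
 note yY = Q.pt_closed[OF xX]
 have yC: "?y : pre p C" using x(2) yY by (simp add: P.preimg_mem)
 have crd: "rg S (pt p ?y) C (a l) :[SS (pt p ?y)]" and fr: "fr l : Der tS C" if "l :# ?L" for l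
  using P.K.chart_coord[OF chart, of l] oC x(2) that frame by (simp_all add: P.K.frame_def[OF chart])
 have s: "fst s : Q.X.\<O> W" "snd s : Der tY V" "snd s : ta V ` Sec pTS V" if "s :# mset xs" for s
  using subsetD[OF o(4), of s] subsetD[OF im, of "snd s"] that by auto
 interpret Sx: cring "SX x" by (rule Q.X.stalk_cring[OF xX])
 interpret Sy: cring "SY ?y" by (rule Q.Y.stalk_cring[OF yY])
 have sf: "vact Y V (snd s) ?y bb = msum (SY ?y) (%l. vact Y V (snd s) ?y (smap p ?y (rg S (pt p ?y) C (a l))) *[SY ?y]
  lva C (fr l) ?y bb) ?L" if t: "s :# mset xs" for s
 proof -
  obtain th where th: "th : Sec pTS V" "snd s = ta V th" using s(3)[OF t] by auto
  show ?thesis unfolding th(2) tau_frame[OF o(2) th(1) chart frame y x(2) bb]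
   by (rule Sy.msum_cong) (simp add: tau_act[OF o(2) th(1) y crd])
 qed
 let ?u = "%l. smap p ?y (rg S (pt p ?y) C (a l))" and ?d = "%s. vact Y V (snd s) ?y"
 have "msum (SX x) (%s. rg X x W (fst s) *[SX x] smap q x (?d s bb)) (mset xs) =
  msum (SX x) (%l. msum (SX x) (%s. rg X x W (fst s) *[SX x] smap q x (?d s (?u l))) (mset xs) *[SX x]
   smap q x (lva C (fr l) ?y bb)) ?L"
  by (rule combination_linear[where d = ?d and u = ?u, OF Sx.cring_axioms Sy.cring_axioms Q.stalk_map_hom[OF xX] _ _ _ _ sf])
   (use s(1,2) o(1,2) x(1) y yY yC crd bb lift_closed[OF oC fr] P.opn_preimg[OF oC] in simp_all)
 also have "... = msum (SX x) (%l. Q.sact \<omega> x (?u l) *[SX x] smap q x (lva C (fr l) ?y bb)) ?L"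
  by (rule Sx.msum_cong) (simp add: Q.act_rep[OF rep x(1)] P.stalk_map_closed[OF yY crd] case_prod_unfold)
 finally show ?thesis by (simp add: Q.act_rep[OF rep x(1) bb] case_prod_unfold)
qed

text \<open>The entries of a representing list are replaced by their lifts, which act on functions
  of \<open>S\<close> as before.\<close>

lemma pbs_section: assumes U: "opn X U" and th: "th : Sec rTS U" and x: "x : U" and gg: "gg : car (SS (pt p (pt q x)))"
 shows "Q.sact (pbs U th) x (smap p (pt q x) gg) = R.sact th x gg"
proof -
 have xX: "x : pts X" by (rule Q.sec_pt[OF U x])
 interpret Sx: cring "SX x" by (rule Q.X.stalk_cring[OF xX])
 obtain W V xs where rep: "x : W" "W <= U" "prep r TS W V xs th" by (rule R.pullback_rep[OF th x])
 have o: "opn X W" "opn S V" "W <= pre q (pre p V)" "set xs <= Q.X.\<O> W \<times> Der tS V"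
  using rep(3) Q.X.opn_subset[of W] by (auto simp: pb_represents_def P.K.tan_simps(1) mor_comp_def Q.preimg_mem P.preimg_mem preimg_def src)
 have y: "pt q x : pre p V" "pt p (pt q x) : V" using rep(1) o(3) by (auto simp: Q.preimg_mem P.preimg_mem)
 have s: "fst s : Q.X.\<O> W" "snd s : Der tS V" if "s :# mset xs" for s using subsetD[OF o(4), of s] that by auto
 have "Q.sact (pbs U th) x (smap p (pt q x) gg) = msum (SX x) (%(a, D). rg X x W a *[SX x]
   smap q x (vact Y (pre p V) D (pt q x) (smap p (pt q x) gg))) (img (map_prod id (lift V)) (mset xs))"
  unfolding Q.act_rep[OF pbs_rep[OF U th rep(2,3)] rep(1) P.stalk_map_closed[OF Q.pt_closed[OF xX] gg]] mset_map ..
 also have "... = R.sact th x gg" unfolding R.act_rep[OF rep(3,1) gg] by (subst Sx.msum_image; (rule Sx.msum_cong)?)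
   (use s o(1,2) rep(1) y xX Q.pt_closed[OF xX] gg lift_closed P.stalk_map_closed in
    "simp_all add: case_prod_unfold lift_act comp_map P.opn_preimg")
 finally show ?thesis .
qed

lemma pbs_frame: assumes U: "opn X U" and th: "th : Sec rTS U" and chart: "P.K.chart C V n c F a N" and frame: "P.K.frame C n c a fr"
  and x: "x : U" "pt p (pt q x) : C" and bb: "bb :[SY (pt q x)]"
 shows "Q.sact (pbs U th) x bb = msum (SX x) (%l. R.sact th x (qcd C a x l) *[SX x]
  smap q x (lva C (fr l) (pt q x) bb)) (ixs c n)"
proof -
 interpret Sx: cring "SX x" by (rule Q.X.stalk_cring[OF Q.sec_pt[OF U x(1)]])
 obtain W V' xs where rep: "x : W" "W <= U" "prep r TS W V' xs th" by (rule R.pullback_rep[OF th x(1)])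
 have "snd ` set (map (map_prod id (lift V')) xs) <= ta (pre p V') ` Sec pTS (pre p V')"
  using rep(3) unit_closed[of V'] by (auto simp: pb_represents_def P.K.tan_simps(1) mor_comp_def lift_def)
 note f = rep_frame[OF pbs_rep[OF U th rep(2,3)] this chart frame rep(1) x(2) bb]
 show ?thesis unfolding f using P.K.chart_coord[OF chart] P.K.chartD(5)[OF chart] x(2)
  by (intro Sx.msum_cong) (simp add: pbs_section[OF U th x(1)])
qed

lemma base_chart: assumes "s : pts S" obtains C V n c F a N fr where "P.K.chart C V n c F a N" "P.K.frame C n c a fr" "s : C" "opn S C"
  "!!l. l :# ixs c n ==> fr l : Der tS C" "!!l. l :# ixs c n ==> rg S s C (a l) :[SS s]"
proof -
 obtain C V n c F a N where chart: "P.K.chart C V n c F a N" and s: "s : C" by (rule P.K.chart_exists[OF assms])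
 obtain fr where frame: "P.K.frame C n c a fr" by (rule P.K.frame_exists[OF chart])
 show ?thesis by (rule that[OF chart frame s P.K.chartD(5)[OF chart]])
   (use frame P.K.chart_coord[OF chart] P.K.chartD(5)[OF chart] s in "simp_all add: P.K.frame_def[OF chart]")
qed

text \<open>The right hand side of \<open>pbs_frame\<close> depends linearly on \<open>th\<close>,
  and the action is faithful; tensor classes need not be touched.\<close>

lemma pbs_hom: "pbs : sheaf_hom X rTS qTY"
proof (rule sheaf_homI)
 show "pbs U = undefined" if "~ opn X U" for U using that by (simp add: pullback_splitting_def)
 show "pbs U m = undefined" if "opn X U" "m ~: Sec rTS U" for U m using that by (simp add: pullback_splitting_def)
 show "opn X U ==> m : Sec rTS U ==> pbs U m : Sec qTY U" for U m by (rule pbs_closed)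
 fix U th assume U: "opn X U" and th: "th : Sec rTS U"
 note pt = Q.sec_pt[OF U] and cl = pbs_closed[OF U]
 have Lcl: "smap q x (lva C xi (pt q x) bb) :[SX x]"
  if "x : U" "opn S C" "pt p (pt q x) : C" "xi : Der tS C" "bb :[SY (pt q x)]" for C xi x bb
  using that pt[OF that(1)] lift_closed[OF that(2,4)] by (simp add: P.preimg_mem)
 have Rcl: "R.sact et x gg :[SX x]" if "x : U" "et : Sec rTS U" "gg : car (SS (pt p (pt q x)))" for et x gg
  by (rule R.sec_closed[OF U that(2,1,3)])
 show "pbs U (th +[msec rTS U] et) = pbs U th +[msec qTY U] pbs U et" if et: "et : Sec rTS U" for et
 proof (rule Q.sec_eqI[OF U cl])
  fix x bb assume x: "x : U" "bb :[SY (pt q x)]"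
  have sS: "pt p (pt q x) : pts S" using pt[OF x(1)] by simp
  interpret Sx: cring "SX x" by (rule Q.X.stalk_cring[OF pt[OF x(1)]])
  obtain C V n c F a N fr where ch: "P.K.chart C V n c F a N" "P.K.frame C n c a fr" "pt p (pt q x) : C" "opn S C"
   and fr: "!!l. l :# ixs c n ==> fr l : Der tS C"
    "!!l. l :# ixs c n ==> qcd C a x l : car (SS (pt p (pt q x)))" by (rule base_chart[OF sS]) (rule; assumption)
  note f = pbs_frame[OF U _ ch(1,2) x(1) ch(3) x(2)]
  note c = Lcl[OF x(1) ch(4,3) fr(1) x(2)] Rcl[OF x(1) _ fr(2)]
  have "Q.sact (pbs U (th +[msec rTS U] et)) x bb = Q.sact (pbs U th) x bb +[SX x] Q.sact (pbs U et) x bb"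
   unfolding f[OF th] f[OF et] f[OF R.pb.mod_add[OF U th et]] by (subst Sx.msum_add[symmetric], use c th et in simp, rule Sx.msum_cong)
    (use c th et fr(2) in "simp add: R.sec_act(1)[OF U th x(1) _ et] Sx.l_distr")
  thus "Q.sact (pbs U (th +[msec rTS U] et)) x bb = Q.sact (pbs U th +[msec qTY U] pbs U et) x bb"
   using Q.sec_act(1)[OF U cl[OF th] x cl[OF et]] by simp
 qed (use cl U th et in simp_all)
 show "pbs U (a .[msec rTS U] th) = a .[msec qTY U] pbs U th" if a': "a : Q.X.\<O> U" for a
 proof (rule Q.sec_eqI[OF U cl])
  fix x bb assume x: "x : U" "bb :[SY (pt q x)]"
  have sS: "pt p (pt q x) : pts S" using pt[OF x(1)] by simp
  interpret Sx: cring "SX x" by (rule Q.X.stalk_cring[OF pt[OF x(1)]])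
  obtain C V n c F b N fr where ch: "P.K.chart C V n c F b N" "P.K.frame C n c b fr" "pt p (pt q x) : C" "opn S C"
   and fr: "!!l. l :# ixs c n ==> fr l : Der tS C"
    "!!l. l :# ixs c n ==> rg S (pt p (pt q x)) C (b l) : car (SS (pt p (pt q x)))" by (rule base_chart[OF sS]) (rule; assumption)
  note f = pbs_frame[OF U _ ch(1,2) x(1) ch(3) x(2)]
  note c = Lcl[OF x(1) ch(4,3) fr(1) x(2)] Rcl[OF x(1) _ fr(2)]
  have ag: "rg X x U a :[SX x]" using a' U x by simp
  have "Q.sact (pbs U (a .[msec rTS U] th)) x bb = rg X x U a *[SX x] Q.sact (pbs U th) x bb"
   unfolding f[OF th] f[OF R.pb.mod_smult[OF U a' th]] by (subst Sx.msum_ldistr, rule ag, use c th in simp, rule Sx.msum_cong)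
    (use c th fr(2) ag in "simp add: R.sec_act(2)[OF U th x(1) _ a'] Sx.m_assoc")
  thus "Q.sact (pbs U (a .[msec rTS U] th)) x bb = Q.sact (a .[msec qTY U] pbs U th) x bb" using Q.sec_act(2)[OF U cl[OF th] x a'] by simp
 qed (use cl U th a' in simp_all)
 show "pbs V (mrst rTS U V th) = mrst qTY U V (pbs U th)" if V: "opn X V" "V <= U" for V
 proof (rule Q.sec_eqI[OF V(1) pbs_closed[OF V(1) R.pb.mrst_closed[OF U V th]] Q.pb.mrst_closed[OF U V cl[OF th]]])
  fix x bb assume x: "x : V" "bb :[SY (pt q x)]"
  have xU: "x : U" using x V by auto
  have sS: "pt p (pt q x) : pts S" using pt[OF xU] by simp
  obtain C V' n c F b N fr where ch: "P.K.chart C V' n c F b N" "P.K.frame C n c b fr" "pt p (pt q x) : C" by (rule base_chart[OF sS])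
  have "R.sact (mrst rTS U V th) x = R.sact th x" "Q.sact (mrst qTY U V (pbs U th)) x = Q.sact (pbs U th) x"
   using x(1) by (simp_all add: R.sact_def Q.sact_def R.pullback_simps Q.pullback_simps)
  thus "Q.sact (pbs V (mrst rTS U V th)) x bb = Q.sact (mrst qTY U V (pbs U th)) x bb"
   using pbs_frame[OF U th ch(1,2) xU ch(3) x(2)] pbs_frame[OF V(1) R.pb.mrst_closed[OF U V th] ch(1,2) x(1) ch(3) x(2)] by simp
 qed
qed

text \<open>On representing lists \<open>pbs\<close> lifts each entry and \<open>dp\<close> undoes
  this, which leaves the list that represents \<open>pb_comp\<close>.\<close>

lemma pbs_normal: "normal_splitting q p tY tS pbs" unfolding normal_splitting_def Let_def
proof (intro conjI allI impI ballI)
 show "pbs : sheaf_hom X rTS qTY" by (rule pbs_hom)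
 fix U th assume U: "opn X U" and th: "th : Sec rTS U"
 interpret N: pullback_mod q pTS by (rule q_pTS)
 have dp: "dp : sheaf_hom Y TY pTS" by (rule P.differential_hom)
 show "pb_map q TY pTS dp U (pbs U th) = pb_comp p q TS U th"
 proof (rule N.pullback_eqI[OF pb_map_closed[OF q_TY q_pTS dp U pbs_closed[OF U th]] pb_comp_closed[OF U th]])
  fix x assume "x : U"
  then obtain W V xs where rep: "x : W" "W <= U" "prep r TS W V xs th" by (rule R.pullback_rep[OF th])
  have o: "opn S V" "set xs <= Q.X.\<O> W \<times> Der tS V" using rep(3) by (simp_all add: pb_represents_def mor_comp_def P.K.tan_simps(1))
  have "map (map_prod id (dp (pre p V))) (map (map_prod id (lift V)) xs) = map (map_prod id (pb_unit p TS V)) xs"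
   using o(2) by (auto simp: lift_def tau_section[OF P.opn_preimg[OF o(1)] unit_closed[OF o(1)]])
  with pb_map_rep[OF q_TY q_pTS dp U pbs_closed[OF U th] rep(2) pbs_rep[OF U th rep(2,3)]]
  have "prep q pTS W (pre p V) (map (map_prod id (pb_unit p TS V)) xs) (pb_map q TY pTS dp U (pbs U th))" by (simp only:)
  with pb_comp_rep[OF U th rep(2,3)] rep(1) show "pb_map q TY pTS dp U (pbs U th) x = pb_comp p q TS U th x"
   by (simp add: pb_represents_def)
 qed
qed

end

subsection \<open>Flat local homomorphisms\<close>

text \<open>If \<open>ph a = 0\<close>, then \<open>1 \<otimes> a\<close> vanishes in \<open>A \<otimes> R\<close>, hence by flatness in \<open>A \<otimes> aR\<close>. For \<open>a \<noteq> 0\<close> the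
 annihilator of \<open>a\<close> consists of non-units, so that \<open>t \<otimes> ra \<mapsto> t ph(r)\<close> is well-defined modulo the
 maximal ideal of \<open>A\<close>; but it sends \<open>1 \<otimes> a\<close> to \<open>1\<close>.\<close>

lemma flat_local_kernel: assumes R: "cring R" and A: "is_local_ring A" and ph: "ph : ring_hom R A"
  and local: "!!r. r :[R] ==> ph r : Units A ==> r : Units R" and flat: "flat_ring_map R A ph" and a: "a :[R]" "ph a = 0[A]"
 shows "a = 0[R]"
proof (rule ccontr)
 assume nz: "a ~= 0[R]"
 have Ac: "cring A" using A by (simp add: is_local_ring_def)
 interpret R: cring R by (rule R)
 interpret A: cring A by (rule Ac)
 interpret h: ring_hom_cring R A ph by (intro ring_hom_cringI R Ac ph)
 obtain I where I: "maximalideal I A" "!!J. maximalideal J A ==> J = I" using A by (auto simp: is_local_ring_def)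
 interpret I: maximalideal I A by (rule I(1))
 interpret F: ring_hom_cring A "A Quot I" "(+>\<^bsub>A\<^esub>) I" by (rule I.rcos_ring_hom_cring[OF Ac])
 have nonunit: "t : I" if t: "t :[A]" "t ~: Units A" for t
 proof -
  have "1[A] ~: PIdl\<^bsub>A\<^esub> t" using t A.m_comm unfolding cgenideal_def by (auto simp: Units_def)
  then obtain P where "maximalideal P A" "PIdl\<^bsub>A\<^esub> t <= P" by (rule A.exists_maximalideal[OF A.cgenideal_ideal[OF t(1)]])
  thus ?thesis using I(2) A.cgenideal_self[OF t(1)] by blast
 qed
 have zero: "I +>\<^bsub>A\<^esub> t = 0[A Quot I]" if "t : I" for t using I.a_rcos_const[OF that] unfolding FactRing_def ring.simps .
 let ?c = "%t. I +>\<^bsub>A\<^esub> t"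
 \<comment> \<open>As \<open>a\<close> is nonzero, whatever annihilates it is not a unit, so by
   locality its image lies in the maximal ideal \<open>I\<close>. Hence \<open>ph r\<close> modulo
   \<open>I\<close> depends only on the product of \<open>r\<close> and \<open>a\<close>.\<close>
 have key: "?c (ph r) = ?c (ph r')" if r: "r :[R]" "r' :[R]" "r *[R] a = r' *[R] a" for r r'
 proof -
  let ?d = "r -[R] r'"
  have d: "?d :[R]" using r by simp
  have da: "?d *[R] a = 0[R]" using r a by (simp add: R.minus_eq R.l_distr R.l_minus R.r_neg)
  have "?d ~: Units R"
  proof
   assume u: "?d : Units R"
   hence "a = inv\<^bsub>R\<^esub> ?d *[R] (?d *[R] a)" using a d by (simp add: R.m_assoc[symmetric])
   thus False using nz u da by simp
  qed
  hence "ph ?d : I" using local[OF d] nonunit[of "ph ?d"] d by auto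
  hence "?c (ph r -[A] ph r') = 0[A Quot I]" using zero r by simp
  hence "?c (ph r) -[A Quot I] ?c (ph r') = 0[A Quot I]" using r by simp
  thus ?thesis using r by simp
 qed
 \<comment> \<open>The ring as a module over itself. This module and the ideal generated by
   \<open>a\<close> both consist of elements of the ring, which is the type of modules over which
   \<open>flat_ring_map\<close> quantifies.\<close>
 let ?N = "\<lparr>carrier = car R, mult = mult R, one = one R, zero = zero R, add = add R, smult = mult R\<rparr> :: ('a, 'a) module"
 have N: "module R ?N" by (intro moduleI R abelian_groupI) (auto simp: R.a_ac R.l_distr R.r_distr R.m_assoc)
 interpret N: module R ?N by (rule N)
 let ?H = "(%r. r *[R] a) ` car R"
 have neg: "-[?N] x = -[R] x" if "x :[R]" for x using N.M.minus_equality[of "-[R] x" x] that by (simp add: R.l_neg)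
 have "submodule ?H R ?N"
 proof (rule N.submoduleI)
  show "0[?N] : ?H" using a by (auto intro!: image_eqI[of _ _ "0[R]"])
  show "-[?N] x : ?H" if "x : ?H" for x
  proof -
   obtain r where r: "r :[R]" "x = r *[R] a" using \<open>x \<in> ?H\<close> by auto
   thus ?thesis using a neg[of x] by (intro image_eqI[of _ _ "-[R] r"]) (simp_all add: R.l_minus)
  qed
  show "x +[?N] y : ?H" if xy: "x : ?H" "y : ?H" for x y
  proof -
   obtain r r' where "r :[R]" "x = r *[R] a" "r' :[R]" "y = r' *[R] a" using xy by auto
   thus ?thesis using a by (intro image_eqI[of _ _ "r +[R] r'"]) (simp_all add: R.l_distr)
  qed
  show "s .[?N] x : ?H" if sx: "s :[R]" "x : ?H" for s x
  proof -
   obtain r where "r :[R]" "x = r *[R] a" using sx(2) by auto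
   thus ?thesis using a sx(1) by (intro image_eqI[of _ _ "s *[R] r"]) (simp_all add: R.m_assoc)
  qed
 qed (use a in auto)
 hence M: "module R (?N\<lparr>carrier := ?H\<rparr>)" (is "module R ?M") by (rule submodule.submodule_is_module[OF _ N])
 interpret M: module R ?M by (rule M)
 interpret bM: base_change R A ph ?M using M.M.a_closed M.smult_closed by (intro base_change.intro Ac) simp_all
 interpret bN: base_change R A ph ?N by (intro base_change.intro Ac) simp_all
 have aH: "a : ?H" using a by (intro image_eqI[of _ _ "1[R]"]) simp_all
 have lin: "linear_map R ?M ?N (%x. x)" using a by (auto simp: linear_map_def)
 have "inj_on (%x. x) (car ?M)" by simp
 hence inj: "inj_on (tensor_map R A ph ?N (%x. x)) (car (tmod R A ph ?M))" using flat M N lin unfolding flat_ring_map_def by blast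
 have mp: "img (map_prod id (%x. x)) xs = xs" for xs :: "('b \<times> 'a) multiset" by (simp add: map_prod_def)
 have tm: "tensor_map R A ph ?N (%x. x) (tcl R A ph ?M xs) = tcl R A ph ?N xs"
  if "set_mset xs <= car A \<times> ?H" for xs using bM.tensor_map_class[of xs ph "%r. r" R "%x. x" ?N] that a by (auto simp: mp)
 have "teq R A ph ?N {#(1[A] *[A] ph a, 1[R])#} {#(1[A], a .[?N] 1[R])#}" by rule (use a in simp_all)
 hence e1: "teq R A ph ?N {#(0[A], 1[R])#} {#(1[A], a)#}" using a by simp
 have "teq R A ph ?N {#(0[A], 1[R])#} {#}" by rule simp
 hence "tcl R A ph ?N {#(1[A], a)#} = tcl R A ph ?N {#}" by (intro bN.tensor_class_eqI tensor_eq.trans[OF tensor_eq.sym[OF e1]])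
 moreover have xs: "set_mset {#(1[A], a)#} <= car A \<times> ?H" "set_mset {#} <= car A \<times> ?H" using aH by simp_all
 ultimately have "tensor_map R A ph ?N (%x. x) (tcl R A ph ?M {#(1[A], a)#}) =
   tensor_map R A ph ?N (%x. x) (tcl R A ph ?M {#})" by (simp only: tm)
 moreover have "tcl R A ph ?M xs :[tmod R A ph ?M]" if "set_mset xs <= car A \<times> ?H" for xs
  unfolding bM.tensor_module_carrier by rule (use that in simp)
 ultimately have "tcl R A ph ?M {#(1[A], a)#} = tcl R A ph ?M {#}" using inj_onD[OF inj] xs by blast
 hence eq: "teq R A ph ?M {#(1[A], a)#} {#}" using bM.tensor_class_self[of "{#}"] by (intro bM.tensor_class_mem) simp
 \<comment> \<open>Division by \<open>a\<close> inside its ideal. By \<open>key\<close> the residue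
   class of \<open>ph (ro m)\<close> does not depend on the quotient chosen, which makes
   \<open>?g\<close> below balanced and biadditive.\<close>
 define ro where "ro m = (SOME r. r :[R] & m = r *[R] a)" for m
 have ro: "ro m :[R]" "ro m *[R] a = m" if "m : ?H" for m
 proof -
  have "EX r. r :[R] & m = r *[R] a" using that by auto
  from someI_ex[OF this] show "ro m :[R]" "ro m *[R] a = m" unfolding ro_def by simp_all
 qed
 have k: "?c (ph (ro m)) = ?c (ph r)" if "m : ?H" "r :[R]" "r *[R] a = m" for m r
  using key[OF ro(1)[OF that(1)] that(2)] ro(2)[OF that(1)] that(3) by simp
 let ?g = "%(t, m). ?c t *[A Quot I] ?c (ph (ro m))"
 have "msum (A Quot I) ?g {#(1[A], a)#} = msum (A Quot I) ?g {#}"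
 proof (rule tensor_eq_msum[OF F.S.abelian_monoid_axioms eq, THEN conjunct2, THEN conjunct2])
  fix t m n assume "t :[A]" "m :[?M]" "n :[?M]"
  hence tmn: "t :[A]" "m : ?H" "n : ?H" by simp_all
  have "m +[?M] n : ?H" using M.M.a_closed[of m n] tmn by simp
  moreover have "(ro m +[R] ro n) *[R] a = m +[?M] n" using ro tmn a by (simp add: R.l_distr)
  ultimately have "?c (ph (ro (m +[?M] n))) = ?c (ph (ro m +[R] ro n))" using ro(1) tmn by (intro k) simp_all
  thus "?g (t, m +[?M] n) = ?g (t, m) +[A Quot I] ?g (t, n)" using ro(1) tmn by (simp add: F.S.r_distr)
 next
  fix t s m assume "t :[A]" "s :[R]" "m :[?M]"
  hence tsm: "t :[A]" "s :[R]" "m : ?H" by simp_all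
  have "s .[?M] m : ?H" using M.smult_closed[of s m] tsm by simp
  moreover have "(s *[R] ro m) *[R] a = s .[?M] m" using ro[OF tsm(3)] tsm a by (simp add: R.m_assoc)
  ultimately have "?c (ph (ro (s .[?M] m))) = ?c (ph (s *[R] ro m))" using ro(1) tsm by (intro k) simp_all
  thus "?g (t *[A] ph s, m) = ?g (t, s .[?M] m)" using ro(1) tsm by (simp add: F.S.m_assoc)
 qed (use ro(1) M.M.a_closed M.smult_closed in "simp_all add: F.S.l_distr")
 moreover have "?c (ph (ro a)) = ?c (ph 1[R])" using a aH by (intro k) simp_all
 ultimately have "?c 1[A] = 0[A Quot I]" by simp
 hence "I +>\<^bsub>A\<^esub> 1[A] = I" unfolding FactRing_def ring.simps .
 hence "1[A] : I" using I.a_rcos_self[OF A.one_closed] by simp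
 thus False using I.one_imp_carrier I.I_notcarr by simp
qed

locale leaf_setting = leaf_tower + assumes smooth_q: "smooth_morph q" and smooth_p: "smooth_morph p" and flat_q: "faithfully_flat q"
begin

abbreviation (input) "psp \<equiv> pullback_splitting q p tY tS"
abbreviation (input) "tsplit E t \<equiv> is_transverse_splitting q p tX tY tS E (psp t)"
abbreviation (input) "basic \<equiv> leaf_space_basic_unfolding q p tX tY tS"
abbreviation (input) "flat_sp \<equiv> flat_splitting p tY tS"

lemma q_surj: assumes "y : pts Y" obtains x where "x : pts X" "pt q x = y"
proof -
 have "pt q ` pts X = pts Y" using flat_q unfolding faithfully_flat_def by rule
 hence "y : pt q ` pts X" using assms by simp
 thus ?thesis by rule (rule, simp_all)
qed

lemma q_inj: assumes x: "x : pts X" and "bb :[SY (pt q x)]" "bb' :[SY (pt q x)]" "smap q x bb = smap q x bb'" shows "bb = bb'"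
proof -
 note R = Q.Y.stalk_cring[OF Q.pt_closed[OF x]] and A = Q.X.stalk_cring[OF x]
 interpret R: cring "SY (pt q x)" by (rule R)
 interpret h: ring_hom_cring "SY (pt q x)" "SX x" "smap q x" by (intro ring_hom_cringI R A Q.stalk_map_hom[OF x])
 have flat: "flat_ring_map (SY (pt q x)) (SX x) (smap q x)" using flat_q x unfolding faithfully_flat_def by auto
 have "bb -[SY (pt q x)] bb' = 0[SY (pt q x)]"
  by (rule flat_local_kernel[OF R Q.X.local_stalk[OF x] Q.stalk_map_hom[OF x] Q.stalk_map_local[OF x] flat])
   (use assms in "simp_all")
 thus ?thesis using assms by simp
qed

end

locale leaf_splitting = leaf_setting + tower_splitting
begin

lemma pbs_unit: assumes V: "opn S V" "xi : Der tS V" and x: "x : pre q (pre p V)" and bb: "bb :[SY (pt q x)]"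
 shows "Q.sact (pbs (pre q (pre p V)) (pb_unit r TS V xi)) x bb = smap q x (lva V xi (pt q x) bb)"
proof -
 let ?U = "pre q (pre p V)"
 have xi: "xi : Sec TS V" using V by (simp add: P.K.tan_simps(1))
 have U: "opn X ?U" using V by simp
 have xX: "x : pts X" and y: "pt q x : pre p V" using x by (auto simp: Q.preimg_mem)
 interpret Sx: cring "SX x" by (rule Q.X.stalk_cring[OF xX])
 have "prep q TY ?U (pre p V) [(1[sect X ?U], lift V xi)] (pbs ?U (pb_unit r TS V xi))"
  using pbs_rep[OF U R.pb_unit(1)[OF V(1) xi] subset_refl R.pb_unit(2)[OF V(1) xi]] by simp
 from Q.act_rep[OF this x bb] show ?thesis using Q.X.rgerm_ops(3)[OF U x] xX y bb lift_closed[OF V] P.opn_preimg[OF V(1)] by simp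
qed

subsection \<open>Horizontal vector fields\<close>

definition hor where "hor U D \<longleftrightarrow> D : Der tX U & dq U D = pbs U (dr U D)"

lemma hor_act: assumes "opn X U" "D : Der tX U" "x : U"
 shows "gg : car (SS (pt p (pt q x))) ==> R.sact (dr U D) x gg = vact X U D x (smap r x gg)"
  and "bb :[SY (pt q x)] ==> Q.sact (dq U D) x bb = vact X U D x (smap q x bb)"
 using R.differential_spec(2)[OF assms(1,2,3)] Q.differential_spec(2)[OF assms(1,2,3)] by simp_all

lemma hor_frame: assumes U: "opn X U" and h: "hor U D" and chart: "P.K.chart C V n c F a N" and frame: "P.K.frame C n c a fr"
  and x: "x : U" "pt p (pt q x) : C" and bb: "bb :[SY (pt q x)]"
 shows "vact X U D x (smap q x bb) = msum (SX x) (%l. vact X U D x (smap r x (qcd C a x l)) *[SX x]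
  smap q x (lva C (fr l) (pt q x) bb)) (ixs c n)"
proof -
 interpret Sx: cring "SX x" by (rule Q.X.stalk_cring[OF Q.sec_pt[OF U x(1)]])
 have D: "D : Der tX U" "dq U D = pbs U (dr U D)" using h by (simp_all add: hor_def)
 have "vact X U D x (smap q x bb) = Q.sact (pbs U (dr U D)) x bb" using hor_act(2)[OF U D(1) x(1) bb] D(2) by simp
 also have "... = msum (SX x) (%l. R.sact (dr U D) x (qcd C a x l) *[SX x]
  smap q x (lva C (fr l) (pt q x) bb)) (ixs c n)"
  by (rule pbs_frame[OF U R.differential_spec(1)[OF U D(1)] chart frame x bb])
 also have "... = msum (SX x) (%l. vact X U D x (smap r x (qcd C a x l)) *[SX x]
  smap q x (lva C (fr l) (pt q x) bb)) (ixs c n)"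
  by (rule Sx.msum_cong) (use P.K.chart_coord[OF chart] P.K.chartD(5)[OF chart] x(2) in "simp add: hor_act(1)[OF U D(1) x(1)]")
 finally show ?thesis .
qed

lemma horI: assumes U: "opn X U" and D: "D : Der tX U"
  and eq: "!!x C V n c F a N fr bb. x : U ==> P.K.chart C V n c F a N ==> P.K.frame C n c a fr ==> pt p (pt q x) : C ==>
   bb :[SY (pt q x)] ==> vact X U D x (smap q x bb) =
    msum (SX x) (%l. vact X U D x (smap r x (qcd C a x l)) *[SX x]
     smap q x (lva C (fr l) (pt q x) bb)) (ixs c n)" shows "hor U D" unfolding hor_def
proof (intro conjI D Q.differential_eqI[OF U D pbs_closed[OF U R.differential_spec(1)[OF U D]]])
 fix x bb assume x: "x : U" and bb: "bb :[SY (pt q x)]"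
 have xX: "x : pts X" by (rule Q.sec_pt[OF U x])
 interpret Sx: cring "SX x" by (rule Q.X.stalk_cring[OF xX])
 obtain C V n c F a N fr where ch: "P.K.chart C V n c F a N" "P.K.frame C n c a fr" "pt p (pt q x) : C" "opn S C"
  and crd: "!!l. l :# ixs c n ==> qcd C a x l : car (SS (pt p (pt q x)))"
  by (rule base_chart[OF P.pt_closed[OF Q.pt_closed[OF xX]]]) (rule; assumption)
 show "Q.sact (pbs U (dr U D)) x bb = vact X U D x (smap q x bb)"
  unfolding pbs_frame[OF U R.differential_spec(1)[OF U D] ch(1,2) x ch(3) bb] eq[OF x ch(1-3) bb]
  by (rule Sx.msum_cong) (simp add: hor_act(1)[OF U D x crd])
qed

lemma hor_closed: assumes U: "opn X U" shows "hor U 0[msec TX U]" and "hor U D ==> hor U E ==> hor U (D +[msec TX U] E)"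
  and "a : Q.X.\<O> U ==> hor U D ==> hor U (a .[msec TX U] D)" and "opn X V ==> V <= U ==> hor U D ==> hor V (mrst TX U V D)"
proof -
 note Q = sheaf_homD[OF Q.differential_hom U, unfolded Q.J.tan_simps(1)]
  and R = sheaf_homD[OF R.differential_hom U, unfolded Q.J.tan_simps(1)] and B = sheaf_homD[OF pbs_hom U]
 show add: "hor U D ==> hor U E ==> hor U (D +[msec TX U] E)" for D E
  using Q(2) R(1,2) B(2) Q.J.vfield_add(1)[OF _ _ U] by (simp add: hor_def)
 show smult: "a : Q.X.\<O> U ==> hor U D ==> hor U (a .[msec TX U] D)" for a D
  using Q(3) R(1,3) B(3) Q.J.vfield_smult(1)[OF _ _ U] by (simp add: hor_def)
 show "opn X V ==> V <= U ==> hor U D ==> hor V (mrst TX U V D)"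
  using Q(4) R(1,4) B(4) Q.J.vfield_restrict(1)[OF _ U] by (simp add: hor_def)
 show "hor U 0[msec TX U]"
 proof (rule horI[OF U Q.J.vfield_zero(1)[OF U]])
  fix x C V n c F a N fr bb
  assume x: "x : U" and ch: "P.K.chart C V n c F a N" "P.K.frame C n c a fr" "pt p (pt q x) : C" and bb: "bb :[SY (pt q x)]"
  have xX: "x : pts X" by (rule Q.sec_pt[OF U x])
  have y: "pt q x : pre p C" using Q.pt_closed[OF xX] ch(3) by (simp add: P.preimg_mem)
  interpret Sx: cring "SX x" by (rule Q.X.stalk_cring[OF xX])
  note oC = P.K.chartD(5)[OF ch(1)]
  have "msum (SX x) (%l. vact X U 0[msec TX U] x (smap r x (qcd C a x l)) *[SX x]
     smap q x (lva C (fr l) (pt q x) bb)) (ixs c n) = 0[SX x]"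
   using ch(2) y bb lift_closed[OF oC, of "fr _"] P.K.chart_coord[OF ch(1)] oC ch(3) xX
   by (intro Sx.msum_zero) (simp add: Q.J.vfield_zero(2)[OF U x] P.K.frame_def[OF ch(1)])
  thus "vact X U 0[msec TX U] x (smap q x bb) = msum (SX x) (%l. vact X U 0[msec TX U] x (smap r x (qcd C a x l)) *[SX x]
     smap q x (lva C (fr l) (pt q x) bb)) (ixs c n)"
   using Q.J.vfield_zero(2)[OF U x Q.stalk_map_closed[OF xX bb]] by simp
 qed
qed

lemma hor_local: assumes U: "opn X U" and D: "D : Der tX U" and loc: "!!x. x : U ==> EX W. opn X W & x : W & W <= U & hor W (mrst TX U W D)"
 shows "hor U D" unfolding hor_def
proof (intro conjI D Q.sec_eqI[OF U Q.differential_spec(1)[OF U D] pbs_closed[OF U R.differential_spec(1)[OF U D]]])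
 fix x bb assume x: "x : U" and bb: "bb :[SY (pt q x)]"
 obtain W where W: "opn X W" "x : W" "W <= U" "hor W (mrst TX U W D)" using loc[OF x] by auto
 have D': "D : Sec TX U" using D by (simp add: Q.J.tan_simps(1))
 note Q = sheaf_homD(4)[OF Q.differential_hom U W(1,3) D'] and R = sheaf_homD(1,4)[OF R.differential_hom U] 
 have "mrst qTY U W (dq U D) = mrst qTY U W (pbs U (dr U D))"
  using W(4) Q R(2)[OF W(1,3) D'] sheaf_homD(4)[OF pbs_hom U W(1,3) R(1)[OF D']] by (simp add: hor_def)
 hence "restrict (dq U D) W x = restrict (pbs U (dr U D)) W x" by (simp add: Q.pullback_simps)
 thus "Q.sact (dq U D) x bb = Q.sact (pbs U (dr U D)) x bb" using W(2) by (simp add: Q.sact_def)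
qed

text \<open>The coefficients of a horizontal field are its values at the coordinates of
  \<open>S\<close>. If \<open>dr\<close> kills the field they vanish, and then the field kills all
  functions of \<open>Y\<close>. This will be exactness of the unfolding at its middle term.\<close>

lemma vertical: assumes U: "opn X U" shows "D : Der q U \<longleftrightarrow> hor U D & dr U D = 0[msec rTS U]"
proof
 assume D: "D : Der q U"
 hence D': "D : Der tX U" and k: "!!x bb. x : U ==> bb :[SY (pt q x)] ==> vact X U D x (smap q x bb) = 0[SX x]"
  using Q.relative_derivations[OF U] by simp_all
 have kr: "vact X U D x (smap r x gg) = 0[SX x]" if "x : U" "gg : car (SS (pt p (pt q x)))" for x gg
  using k[OF that(1) P.stalk_map_closed[OF Q.pt_closed[OF Q.sec_pt[OF U that(1)]] that(2)]] comp_map[OF Q.sec_pt[OF U that(1)] that(2)] by simp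
 have "dr U D = 0[msec rTS U]"
  by (rule R.differential_eqI[OF U D' R.pb.mod_zero[OF U]]) (simp add: R.sec_act(3)[OF U R.pb.mod_zero[OF U]] kr)
 moreover have "hor U D"
 proof (rule horI[OF U D'])
  fix x C V n c F a N fr bb
  assume x: "x : U" and ch: "P.K.chart C V n c F a N" "P.K.frame C n c a fr" "pt p (pt q x) : C" and bb: "bb :[SY (pt q x)]"
  have xX: "x : pts X" by (rule Q.sec_pt[OF U x])
  have y: "pt q x : pre p C" using Q.pt_closed[OF xX] ch(3) by (simp add: P.preimg_mem)
  interpret Sx: cring "SX x" by (rule Q.X.stalk_cring[OF xX])
  note oC = P.K.chartD(5)[OF ch(1)]
  have "msum (SX x) (%l. vact X U D x (smap r x (qcd C a x l)) *[SX x]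
     smap q x (lva C (fr l) (pt q x) bb)) (ixs c n) = 0[SX x]"
   using ch(2) y bb lift_closed[OF oC, of "fr _"] P.K.chart_coord[OF ch(1)] oC ch(3) xX
   by (intro Sx.msum_zero) (simp add: kr[OF x] P.K.frame_def[OF ch(1)])
  thus "vact X U D x (smap q x bb) = msum (SX x) (%l. vact X U D x (smap r x (qcd C a x l)) *[SX x]
     smap q x (lva C (fr l) (pt q x) bb)) (ixs c n)" using k[OF x bb] by simp
 qed
 ultimately show "hor U D & dr U D = 0[msec rTS U]" by simp
next
 assume h: "hor U D & dr U D = 0[msec rTS U]"
 hence D: "D : Der tX U" "dq U D = pbs U (dr U D)" "dr U D = 0[msec rTS U]" by (simp_all add: hor_def)
 have kr: "vact X U D x (smap r x gg) = 0[SX x]" if "x : U" "gg : car (SS (pt p (pt q x)))" for x gg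
  using hor_act(1)[OF U D(1) that] R.sec_act(3)[OF U R.pb.mod_zero[OF U] that] D(3) by simp
 show "D : Der q U" unfolding Q.relative_derivations[OF U]
 proof (intro conjI D(1) ballI)
  fix x bb assume x: "x : U" and bb: "bb :[SY (pt q x)]"
  have xX: "x : pts X" by (rule Q.sec_pt[OF U x])
  interpret Sx: cring "SX x" by (rule Q.X.stalk_cring[OF xX])
  obtain C V n c F a N fr where ch: "P.K.chart C V n c F a N" "P.K.frame C n c a fr" "pt p (pt q x) : C" "opn S C"
   and fr: "!!l. l :# ixs c n ==> fr l : Der tS C"
    "!!l. l :# ixs c n ==> qcd C a x l : car (SS (pt p (pt q x)))"
   by (rule base_chart[OF P.pt_closed[OF Q.pt_closed[OF xX]]]) (rule; assumption)
  have y: "pt q x : pre p C" using Q.pt_closed[OF xX] ch(3) by (simp add: P.preimg_mem)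
  show "vact X U D x (smap q x bb) = 0[SX x]" unfolding hor_frame[OF U conjunct1[OF h] ch(1,2) x ch(3) bb]
   using y bb xX lift_closed[OF ch(4) fr(1)] ch(4) by (intro Sx.msum_zero) (simp add: kr[OF x fr(2)])
 qed
qed

text \<open>Smoothness of \<open>q\<close> lifts the section \<open>pbs U th\<close> along
  \<open>dq\<close>. By \<open>pbs_section\<close> the lift has image \<open>th\<close> under
  \<open>dr\<close>, and then it is horizontal by construction.\<close>

lemma hor_lift: assumes U: "opn X U" and th: "th : Sec rTS U" and x: "x : U"
 obtains W D where "opn X W" "x : W" "W <= U" "hor W D" "dr W D = mrst rTS U W th"
proof -
 obtain W D where W: "opn X W" "x : W" "W <= U" and D: "D : Der tX W"
  "!!z bb. z : W ==> bb :[SY (pt q z)] ==> vact X W D z (smap q z bb) = Q.sact (pbs U th) z bb"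
  by (rule Q.lift_exists[OF smooth_q U pbs_closed[OF U th] x]) (rule; assumption)
 have thW: "mrst rTS U W th : Sec rTS W" by (rule R.pb.mrst_closed[OF U W(1,3) th])
 have dr: "dr W D = mrst rTS U W th"
 proof (rule R.differential_eqI[OF W(1) D(1) thW])
  fix z gg assume z: "z : W" and gg: "gg : car (SS (pt p (pt q z)))"
  have zX: "z : pts X" by (rule Q.sec_pt[OF W(1) z])
  have "R.sact (mrst rTS U W th) z gg = R.sact th z gg" using z by (simp add: R.sact_def R.pullback_simps)
  also have "... = Q.sact (pbs U th) z (smap p (pt q z) gg)" by (rule pbs_section[OF U th subsetD[OF W(3) z] gg, symmetric])
  also have "... = vact X W D z (smap r z gg)" using D(2)[OF z P.stalk_map_closed[OF Q.pt_closed[OF zX] gg]] comp_map[OF zX gg] by simp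
  finally show "R.sact (mrst rTS U W th) z gg = vact X W D z (smap r z gg)" .
 qed
 have "dq W D = pbs W (dr W D)" unfolding dr
 proof (rule Q.differential_eqI[OF W(1) D(1) pbs_closed[OF W(1) thW]])
  fix z bb assume z: "z : W" and bb: "bb :[SY (pt q z)]"
  have "Q.sact (pbs W (mrst rTS U W th)) z bb = Q.sact (pbs U th) z bb"
   unfolding sheaf_homD(4)[OF pbs_hom U W(1,3) th] using z by (simp add: Q.sact_def Q.pullback_simps)
  thus "Q.sact (pbs W (mrst rTS U W th)) z bb = vact X W D z (smap q z bb)" using D(2)[OF z bb] by simp
 qed
 thus ?thesis using that[OF W _ dr] D(1) by (simp add: hor_def)
qed

end

subsection \<open>Unfoldings and horizontal vector fields\<close>

lemma linear_map_diff: assumes M: "module R M" and N: "module R N" and h: "linear_map R M N h" shows "h 0[M] = 0[N]"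
  and "m :[M] ==> m' :[M] ==> h (m -[M] m') = h m -[N] h m'"
proof -
 interpret M: module R M by (rule M)
 interpret N: module R N by (rule N)
 have c: "m :[M] ==> h m :[N]" and a: "m :[M] ==> m' :[M] ==> h (m +[M] m') = h m +[N] h m'"
  and s: "r :[R] ==> m :[M] ==> h (r .[M] m) = r .[N] h m" for m m' r using h by (auto simp: linear_map_def)
 show "h 0[M] = 0[N]" using s[of "0[R]" "0[M]"] c[of "0[M]"] by simp
 assume m: "m :[M]" "m' :[M]"
 have "(-[R] 1[R]) .[M] m' = -[M] m'" "(-[R] 1[R]) .[N] h m' = -[N] h m'"
  using M.smult_l_minus[of "1[R]" m'] N.smult_l_minus[of "1[R]" "h m'"] m c by simp_all
 thus "h (m -[M] m') = h m -[N] h m'" using s[of "-[R] 1[R]" m'] a[of m "-[M] m'"] m by (simp add: M.M.minus_eq N.M.minus_eq)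
qed

lemma sheaf_hom_linear: "h : sheaf_hom X M N ==> opn X U ==> linear_map (sect X U) (msec M U) (msec N U) (h U)"
 unfolding sheaf_hom_def by simp

text \<open>Local solutions of \<open>h m = D\<close> glue, since injectivity makes them agree on
  overlaps. The target enters through the separation property \<open>sep\<close>, so that sections
  of a pullback can take its place.\<close>

lemma injective_sheaf_surj: assumes F: "sheaf_on T F r" and U: "openin T U" and D: "D : G U"
  and h: "!!V W m. openin T V ==> openin T W ==> W <= V ==> m : F V ==> h W (r V W m) = s V W (h V m)"
  and hG: "!!V m. openin T V ==> m : F V ==> h V m : G V"
  and ss: "!!V W. openin T V ==> openin T W ==> W <= V ==> V <= U ==> s V W (s U V D) = s U W D"
  and inj: "!!V. openin T V ==> inj_on (h V) (F V)"
  and sep: "!!D'. D' : G U ==> (!!x. x : U ==> EX W. openin T W & x : W & W <= U & s U W D' = s U W D) ==> D' = D"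
  and loc: "!!x. x : U ==> EX W m. openin T W & x : W & W <= U & m : F W & h W m = s U W D" obtains m where "m : F U" "h U m = D"
proof -
 define P where "P W m \<longleftrightarrow> openin T W & W <= U & m : F W & h W m = s U W D" for W m
 define \<U> where "\<U> = {W. EX m. P W m}"
 define e where "e W = (SOME m. P W m)" for W
 have e: "openin T W" "W <= U" "e W : F W" "h W (e W) = s U W D" if "W : \<U>" for W
 proof -
  have "P W (e W)" using that unfolding \<U>_def e_def mem_Collect_eq by rule
  thus "openin T W" "W <= U" "e W : F W" "h W (e W) = s U W D" by (simp_all add: P_def)
 qed
 have cover: "\<Union>\<U> = U"
 proof
  show "U <= \<Union>\<U>"
  proof
   fix x assume "x : U"
   from loc[OF this] obtain W m where "x : W" "P W m" unfolding P_def by blast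
   thus "x : \<Union>\<U>" unfolding \<U>_def by blast
  qed
 qed (use e(2) in auto)
 note P = sheaf_on_presheaf[OF F]
 have ex: "EX! t. t : F (\<Union>\<U>) & (ALL W:\<U>. r (\<Union>\<U>) W t = e W)"
 proof (rule sheaf_on_ex1[OF F])
  fix V W assume V: "V : \<U>" and W: "W : \<U>"
  have o: "openin T (V Int W)" using e(1)[OF V] e(1)[OF W] by auto
  show "r V (V Int W) (e V) = r W (V Int W) (e W)"
  proof (rule inj_onD[OF inj[OF o]])
   show "h (V Int W) (r V (V Int W) (e V)) = h (V Int W) (r W (V Int W) (e W))"
    using h[OF e(1)[OF V] o _ e(3)[OF V]] h[OF e(1)[OF W] o _ e(3)[OF W]] e(4)[OF V] e(4)[OF W]
     ss[OF e(1)[OF V] o _ e(2)[OF V]] ss[OF e(1)[OF W] o _ e(2)[OF W]] by simp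
  qed (use presheaf_onD(1)[OF P e(1)[OF V] o _ e(3)[OF V]] presheaf_onD(1)[OF P e(1)[OF W] o _ e(3)[OF W]] in simp_all)
 qed ((rule e; assumption)+)
 obtain t where t': "t : F (\<Union>\<U>) & (ALL W:\<U>. r (\<Union>\<U>) W t = e W)" by (rule exE[OF ex1_implies_ex[OF ex]])
 have t: "t : F U" "!!W. W : \<U> ==> r U W t = e W" using t' unfolding cover by simp_all
 have "h U t = D"
 proof (rule sep[OF hG[OF U t(1)]])
  fix x assume "x : U"
  then obtain W where W: "W : \<U>" "x : W" using cover by blast
  have "s U W (h U t) = s U W D" using h[OF U e(1,2)[OF W(1)] t(1)] t(2)[OF W(1)] e(4)[OF W(1)] by simp
  thus "EX W. openin T W & x : W & W <= U & s U W (h U t) = s U W D" using W e(1,2)[OF W(1)] by blast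
 qed
 thus ?thesis using that t(1) by blast
qed

lemma (in morph) tangent_sep: assumes U: "opn X U" and D: "D : Der f U" "D' : Der f U"
  and loc: "!!x. x : U ==> EX W. opn X W & x : W & W <= U & mrst T U W D' = mrst T U W D" shows "D' = D"
proof (rule derivations_eqI[OF D(2,1) U])
 fix x bb assume x: "x : U" "bb :[SX x]"
 obtain W where W: "opn X W" "x : W" "W <= U" "mrst T U W D' = mrst T U W D" using loc[OF x(1)] by auto
 show "vact X U D' x bb = vact X U D x bb"
  using vfield_restrict(2)[OF D(1) U W(1,3,2) x(2)] vfield_restrict(2)[OF D(2) U W(1,3,2) x(2)] W(4) by simp
qed

text \<open>A splitting is determined by the lifts of a frame. After pullback to \<open>X\<close>
  these are values of the pulled back splitting, and nothing is lost there by \<open>q_surj\<close>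
  and \<open>q_inj\<close>.\<close>

lemma (in leaf_setting) splitting_unique: assumes "leaf_splitting q p tX tY tS ta" "leaf_splitting q p tX tY tS ta'"
  and eq: "!!U th. opn X U ==> th : Sec rTS U ==> psp ta U th = psp ta' U th" shows "ta = ta'"
proof -
 interpret A: leaf_splitting q p tX tY tS ta by fact
 interpret B: leaf_splitting q p tX tY tS ta' by fact
 show ?thesis
 proof (rule sheaf_hom_ext[OF A.tau_hom B.tau_hom])
  fix U th assume U: "opn Y U" and th: "th : Sec pTS U"
  show "ta U th = ta' U th"
  proof (rule Q.K.derivations_eqI[OF A.tau_closed[OF U th] B.tau_closed[OF U th] U])
   fix y bb assume y: "y : U" and bb: "bb :[SY y]"
   have yY: "y : pts Y" by (rule P.sec_pt[OF U y])
   interpret Sy: cring "SY y" by (rule Q.Y.stalk_cring[OF yY])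
   obtain x where x: "x : pts X" "pt q x = y" by (rule q_surj[OF yY])
   obtain C V n c F a N fr where ch: "P.K.chart C V n c F a N" "P.K.frame C n c a fr" "pt p y : C" "opn S C"
    and fr: "!!l. l :# ixs c n ==> fr l : Der tS C" by (rule A.base_chart[OF P.pt_closed[OF yY]]) (rule; assumption)
   have yC: "y : pre p C" "x : pre q (pre p C)" using yY x ch(3) by (simp_all add: P.preimg_mem Q.preimg_mem)
   have "vact Y (pre p C) (A.lift C (fr l)) y bb = vact Y (pre p C) (B.lift C (fr l)) y bb" if l: "l :# ixs c n" for l
   proof (rule q_inj[OF x(1)])
    have u: "pb_unit r TS C (fr l) : Sec rTS (pre q (pre p C))" using R.pb_unit(1)[OF ch(4)] fr[OF l] by (simp add: P.K.tan_simps(1))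
    note lc = A.lift_closed[OF ch(4) fr[OF l]] B.lift_closed[OF ch(4) fr[OF l]] and oC = P.opn_preimg[OF ch(4)]
    show "vact Y (pre p C) (A.lift C (fr l)) y bb :[SY (pt q x)]" "vact Y (pre p C) (B.lift C (fr l)) y bb :[SY (pt q x)]"
     using lc oC yC(1) bb x(2) by simp_all
    show "smap q x (vact Y (pre p C) (A.lift C (fr l)) y bb) = smap q x (vact Y (pre p C) (B.lift C (fr l)) y bb)"
     using A.pbs_unit[OF ch(4) fr[OF l] yC(2), of bb] B.pbs_unit[OF ch(4) fr[OF l] yC(2), of bb]
      eq[OF Q.opn_preimg[OF oC] u] x(2) bb by simp
   qed
   thus "vact Y U (ta U th) y bb = vact Y U (ta' U th) y bb"
    unfolding A.tau_frame[OF U th ch(1,2) y ch(3) bb] B.tau_frame[OF U th ch(1,2) y ch(3) bb] by (intro Sy.msum_cong) simp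
  qed
 qed
qed

section \<open>Unfoldings as sheaves of horizontal fields\<close>

locale transverse_unfolding = leaf_splitting +
 fixes E :: "('a, 'b, 'e, 'f, 'u) unf" assumes strict: "strict_unfolding r tX tS (folia q) E" and transverse: "trsplit q p tX tY tS E pbs"
begin

lemma source_r: "source r = X" by (simp add: mor_comp_def)

lemma leaf_sects: "Sec (folia q) U = Der q U" "msec (folia q) = msec (tangent q)" "mrst (folia q) = mrst (tangent q)"
 "bracket (folia q) = comm X" by (simp_all add: leaf_foliation_def Q.tan_simps(1))

lemmas strictD = strict[unfolded strict_unfolding_def Let_def source_r]

lemma E_lie: "is_lie_algebroid tX E" using strictD by simp

lemma E_mod: "is_mod_sheaf X E" and anchor_hom: "anchor E : sheaf_hom X E TX"
 using E_lie[unfolded is_lie_algebroid_def Let_def Q.source_s] by simp_all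

lemma incl_hom: "incl E : sheaf_hom X (folia q) E" using strictD by simp

lemma proj_hom: "proj E : sheaf_hom X E rTS" using strictD by simp

lemma anchor_incl: "opn X U ==> g : Der q U ==> anchor E U (incl E U g) = g"
 using strictD by (elim conjE) (simp add: leaf_foliation_def Q.tan_simps(1))

lemma proj_kernel: "opn X U ==> {u : Sec E U. proj E U u = 0[msec rTS U]} = incl E U ` Der q U"
 using strictD by (elim conjE) (simp add: leaf_sects Q.tan_simps(1))

lemma proj_surj: "opn X U ==> th : Sec rTS U ==> x : U ==>
  EX W. opn X W & x : W & W <= U & (EX u:Sec E W. proj E W u = mrst rTS U W th)" using strictD by simp

lemma proj_anchor: "opn X U ==> u : Sec E U ==> dr U (anchor E U u) = proj E U u" using strictD by simp

lemma anchor_closed: "opn X U ==> u : Sec E U ==> anchor E U u : Der tX U"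
 using sheaf_homD(1)[OF anchor_hom] by (simp add: Q.J.tan_simps(1))

lemma anchor_bracket: assumes "opn X U" "u : Sec E U" "v : Sec E U"
 shows "bracket E U u v : Sec E U" and "anchor E U (bracket E U u v) = comm X U (anchor E U u) (anchor E U v)"
 using E_lie[unfolded is_lie_algebroid_def Let_def Q.source_s] assms by simp_all

lemma E_module: "opn X U ==> module (sect X U) (msec E U)" and E_sheaf: "sheaf_on (space_top X) (Sec E) (mrst E)"
 using E_mod by (simp_all add: is_mod_sheaf_def)

lemma anchor_hor: "opn X U ==> u : Sec E U ==> hor U (anchor E U u)"
 using transverse anchor_closed proj_anchor unfolding hor_def is_transverse_splitting_def by simp

text \<open>If the anchor of a section vanishes, so does its projection, which is \<open>dr\<close>
  of the anchor. The section then comes from the foliation, where the anchor is the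
  inclusion.\<close>

lemma anchor_inj: assumes U: "opn X U" shows "inj_on (anchor E U) (Sec E U)"
proof (rule inj_onI)
 fix u v assume uv: "u : Sec E U" "v : Sec E U" "anchor E U u = anchor E U v"
 interpret E: module "sect X U" "msec E U" by (rule E_module[OF U])
 interpret T: module "sect X U" "msec TX U" by (rule Q.J.tangent_module[OF U])
 have L: "module (sect X U) (msec (folia q) U)" unfolding leaf_sects by (rule Q.tangent_module[OF U])
 let ?w = "u -[msec E U] v"
 have w: "?w : Sec E U" using uv by simp
 have "anchor E U u : Sec TX U" using sheaf_homD(1)[OF anchor_hom U uv(1)] .
 hence a: "anchor E U ?w = 0[msec TX U]"
  using linear_map_diff(2)[OF E_module[OF U] Q.J.tangent_module[OF U] sheaf_hom_linear[OF anchor_hom U] uv(1,2)] uv(3)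
  by (simp add: T.M.minus_eq T.M.r_neg)
 have "proj E U ?w = 0[msec rTS U]"
  using proj_anchor[OF U w] linear_map_diff(1)[OF Q.J.tangent_module[OF U] R.pullback_module[OF U] sheaf_hom_linear[OF R.differential_hom U]]
  by (simp add: a)
 then obtain g where g: "g : Der q U" "?w = incl E U g" using proj_kernel[OF U] w by blast
 have "g = 0[msec TX U]" using anchor_incl[OF U g(1)] a g(2) by simp
 hence "g = 0[msec (folia q) U]" by (simp add: leaf_sects Q.tan_simps(2) Q.J.tan_simps(2))
 hence w0: "?w = 0[msec E U]" using g(2) linear_map_diff(1)[OF L E_module[OF U] sheaf_hom_linear[OF incl_hom U]] by simp
 have "u = ?w +[msec E U] v" using uv(1,2) by (simp add: E.M.minus_eq E.M.a_assoc E.M.l_neg)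
 thus "u = v" unfolding w0 using uv(2) by simp
qed

text \<open>For a horizontal \<open>D\<close> there is locally a section \<open>u\<close> whose
  projection is \<open>dr\<close> of \<open>D\<close>. The difference of \<open>D\<close> and the
  anchor of \<open>u\<close> is vertical by \<open>vertical\<close>, hence the anchor of an included
  section. Injectivity of the anchor glues the local preimages.\<close>

lemma anchor_image: assumes U: "opn X U" shows "anchor E U ` Sec E U = {D. hor U D}"
proof
 show "anchor E U ` Sec E U <= {D. hor U D}" using anchor_hor[OF U] by auto
 show "{D. hor U D} <= anchor E U ` Sec E U"
 proof
  fix D assume "D : {D. hor U D}"
  hence D: "hor U D" "D : Der tX U" by (simp_all add: hor_def)
  have "EX m. m : Sec E U & anchor E U m = D"
  proof (rule injective_sheaf_surj[OF E_sheaf U, where G = "Der tX" and h = "anchor E" and s = "mrst TX" and D = D])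
   show "D : Der tX U" by (rule D)
   show "anchor E W (mrst E V W m) = mrst TX V W (anchor E V m)" if "opn X V" "opn X W" "W <= V" "m : Sec E V" for V W m
    by (rule sheaf_homD(4)[OF anchor_hom that])
   show "anchor E V m : Der tX V" if "opn X V" "m : Sec E V" for V m by (rule anchor_closed[OF that])
   show "mrst TX V W (mrst TX U V D) = mrst TX U W D" if "opn X V" "opn X W" "W <= V" "V <= U" for V W
    using U that D(2) by (simp add: Q.J.tan_simps(1))
   show "inj_on (anchor E V) (Sec E V)" if "opn X V" for V by (rule anchor_inj[OF that])
   show "D' = D" if "D' : Der tX U" "!!x. x : U ==> EX W. opn X W & x : W & W <= U & mrst TX U W D' = mrst TX U W D" for D'
    by (rule Q.J.tangent_sep[OF U D(2) that])
   show "EX W m. opn X W & x : W & W <= U & m : Sec E W & anchor E W m = mrst TX U W D" if x: "x : U" for x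
   proof -
    obtain W u where W: "opn X W" "x : W" "W <= U" and u: "u : Sec E W" "proj E W u = mrst rTS U W (dr U D)"
     using proj_surj[OF U R.differential_spec(1)[OF U D(2)] x] by auto
    interpret E: module "sect X W" "msec E W" by (rule E_module[OF W(1)])
    interpret T: module "sect X W" "msec TX W" by (rule Q.J.tangent_module[OF W(1)])
    interpret PB: module "sect X W" "msec rTS W" by (rule R.pullback_module[OF W(1)])
    have DM: "D : Sec TX U" using D(2) by (simp add: Q.J.tan_simps(1))
    let ?D = "mrst TX U W D" and ?u = "anchor E W u"
    have c: "?D : Sec TX W" "?u : Sec TX W" using Q.J.tan.mrst_closed[OF U W(1,3) DM] sheaf_homD(1)[OF anchor_hom W(1) u(1)] .
    let ?g = "?D -[msec TX W] ?u"
    have h: "hor W ?D" "hor W ?u" using hor_closed(4)[OF U W(1,3) D(1)] anchor_hor[OF W(1) u(1)] .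
    have "(-[sect X W] 1[sect X W]) .[msec TX W] ?u = -[msec TX W] ?u" using T.smult_l_minus[of "1[sect X W]" ?u] c by simp
    hence "hor W (-[msec TX W] ?u)" using hor_closed(3)[OF W(1) _ h(2), of "-[sect X W] 1[sect X W]"] by simp
    hence hg: "hor W ?g" unfolding T.M.minus_eq by (rule hor_closed(2)[OF W(1) h(1)])
    have dD: "dr W ?D = mrst rTS U W (dr U D)" by (rule sheaf_homD(4)[OF R.differential_hom U W(1,3) DM])
    have "dr W ?g = dr W ?D -[msec rTS W] dr W ?u"
     by (rule linear_map_diff(2)[OF Q.J.tangent_module[OF W(1)] R.pullback_module[OF W(1)] sheaf_hom_linear[OF R.differential_hom W(1)] c])
    also have "... = 0[msec rTS W]"
     using proj_anchor[OF W(1) u(1)] u(2) dD sheaf_homD(1)[OF R.differential_hom W(1) c(1)] by (simp add: PB.M.minus_eq PB.M.r_neg)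
    finally have g: "?g : Der q W" using vertical[OF W(1)] hg by simp
    have ig: "incl E W ?g : Sec E W" using sheaf_homD(1)[OF incl_hom W(1)] g by (simp add: leaf_sects Q.tan_simps(1))
    have "anchor E W (u +[msec E W] incl E W ?g) = ?u +[msec TX W] ?g"
     using sheaf_homD(2)[OF anchor_hom W(1) u(1) ig] anchor_incl[OF W(1) g] by simp
    also have "... = ?D" using c T.M.a_lcomm[of ?u ?D "-[msec TX W] ?u"] by (simp add: T.M.minus_eq T.M.r_neg)
    finally show ?thesis using W u ig by (intro exI[of _ W] exI[of _ "u +[msec E W] incl E W ?g"]) simp
   qed
  qed blast
  thus "D : anchor E U ` Sec E U" by blast
 qed
qed

text \<open>The two horizontal fields are anchors of sections \<open>?u\<close> and
  \<open>?v\<close> of \<open>E\<close>, so their commutator is the anchor of a bracket and again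
  horizontal. It lies above the commutator of \<open>xi\<close> and \<open>et\<close>, and is
  therefore related to the lift of this commutator as well as to the commutator of the
  lifts.\<close>

lemma lift_commutator: assumes V: "opn S V" and xi: "xi : Der tS V" and et: "et : Der tS V"
 shows "lift V (comm S V xi et) = comm Y (pre p V) (lift V xi) (lift V et)"
proof (rule Q.K.derivations_eqI)
 note oV = P.opn_preimg[OF V] and cm = P.K.vfield_commutator[OF xi et V]
 note lc = lift_closed[OF V xi] lift_closed[OF V et] lift_closed[OF V cm(1)]
 note lcm = Q.K.vfield_commutator[OF lc(1,2) oV]
 show "lift V (comm S V xi et) : Der tY (pre p V)" "comm Y (pre p V) (lift V xi) (lift V et) : Der tY (pre p V)"
  "opn Y (pre p V)" by ((rule lc lcm oV)+)
 fix y bb assume y: "y : pre p V" and bb: "bb :[SY y]"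
 have yY: "y : pts Y" using P.sec_pt[OF oV y] .
 obtain x where x: "x : pts X" "pt q x = y" by (rule q_surj[OF yY])
 let ?U = "pre q (pre p V)"
 have U: "opn X ?U" "x : ?U" using oV x y by (simp_all add: Q.preimg_mem)
 let ?th = "%ze. pb_unit r TS V ze"
 have th: "?th ze : Sec rTS ?U" if "ze : Der tS V" for ze using R.pb_unit(1)[OF V] that by (simp add: P.K.tan_simps(1))
 obtain W1 u1 where W1: "opn X W1" "x : W1" "W1 <= ?U" and u1: "u1 : Sec E W1" "proj E W1 u1 = mrst rTS ?U W1 (?th xi)"
  using proj_surj[OF U(1) th[OF xi] U(2)] by auto
 obtain W2 u2 where W2: "opn X W2" "x : W2" "W2 <= ?U" and u2: "u2 : Sec E W2" "proj E W2 u2 = mrst rTS ?U W2 (?th et)"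
  using proj_surj[OF U(1) th[OF et] U(2)] by auto
 let ?W = "W1 Int W2"
 have W: "opn X ?W" "x : ?W" "?W <= ?U" using W1 W2 by auto
 have proj: "proj E ?W (mrst E W' ?W u) = mrst rTS ?U ?W (?th ze)" and mem: "mrst E W' ?W u : Sec E ?W"
  if "opn X W'" "?W <= W'" "W' <= ?U" "u : Sec E W'" "proj E W' u = mrst rTS ?U W' (?th ze)" "ze : Der tS V" for W' u ze
  using sheaf_homD(4)[OF proj_hom that(1) W(1) that(2,4)] that(5) R.pb.mrst_mrst[OF U(1) that(1) W(1) that(2,3) th[OF that(6)]]
   presheaf_onD(1)[OF sheaf_on_presheaf[OF E_sheaf] that(1) W(1) that(2,4)] by simp_all
 let ?u = "mrst E W1 ?W u1" and ?v = "mrst E W2 ?W u2"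
 have u: "?u : Sec E ?W" "proj E ?W ?u = mrst rTS ?U ?W (?th xi)" and v: "?v : Sec E ?W" "proj E ?W ?v = mrst rTS ?U ?W (?th et)"
  using mem[OF W1(1) Int_lower1 W1(3) u1 xi] proj[OF W1(1) Int_lower1 W1(3) u1 xi]
   mem[OF W2(1) Int_lower2 W2(3) u2 et] proj[OF W2(1) Int_lower2 W2(3) u2 et] .
 have actr: "R.sact (mrst rTS ?U ?W (?th ze)) z gg = smap r z (vact S V ze (pt p (pt q z)) gg)"
  if "z : ?W" "ze : Der tS V" "gg : car (SS (pt p (pt q z)))" for z ze gg
 proof -
  have "R.sact (mrst rTS ?U ?W (?th ze)) z gg = R.sact (?th ze) z gg" using that(1) by (simp add: R.sact_def R.pullback_simps)
  thus ?thesis using R.act_unit[OF V that(2) subsetD[OF W(3) that(1)] that(3)] by simp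
 qed
 have actq: "Q.sact (pbs ?W (mrst rTS ?U ?W (?th ze))) z bb = smap q z (lva V ze (pt q z) bb)"
  if "z : ?W" "ze : Der tS V" "bb :[SY (pt q z)]" for z ze bb
 proof -
  have "Q.sact (pbs ?W (mrst rTS ?U ?W (?th ze))) z bb = Q.sact (pbs ?U (?th ze)) z bb"
   unfolding sheaf_homD(4)[OF pbs_hom U(1) W(1,3) th[OF that(2)]] using that(1) by (simp add: Q.sact_def Q.pullback_simps)
  thus ?thesis using pbs_unit[OF V that(2) subsetD[OF W(3) that(1)] that(3)] by simp
 qed
 \<comment> \<open>A horizontal field above \<open>ze\<close> is related to \<open>ze\<close> on
   functions of \<open>S\<close> and to the lift of \<open>ze\<close> on functions of
   \<open>Y\<close>.\<close>
 have key: "vact X ?W D z (smap r z gg) = smap r z (vact S V ze (pt p (pt q z)) gg)"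
  "vact X ?W D z (smap q z bb) = smap q z (lva V ze (pt q z) bb)"
  if "hor ?W D" "dr ?W D = mrst rTS ?U ?W (?th ze)" "ze : Der tS V" "z : ?W" "gg : car (SS (pt p (pt q z)))" "bb :[SY (pt q z)]" for D z ze gg bb
  using hor_act[OF W(1) _ that(4), of D] that actr[OF that(4,3,5)] actq[OF that(4,3,6)] by (simp_all add: hor_def)
 let ?D = "anchor E ?W ?u" and ?E = "anchor E ?W ?v"
 have D: "hor ?W ?D" "dr ?W ?D = mrst rTS ?U ?W (?th xi)" and E: "hor ?W ?E" "dr ?W ?E = mrst rTS ?U ?W (?th et)"
  using anchor_hor[OF W(1)] proj_anchor[OF W(1)] u v by simp_all
 have Dd: "?D : Der tX ?W" "?E : Der tX ?W" using D E by (simp_all add: hor_def)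
 let ?B = "comm X ?W ?D ?E"
 note B = Q.J.vfield_commutator[OF Dd W(1)]
 have hB: "hor ?W ?B" using anchor_hor[OF W(1) anchor_bracket(1)[OF W(1) u(1) v(1)]] anchor_bracket(2)[OF W(1) u(1) v(1)] by simp
 have dB: "dr ?W ?B = mrst rTS ?U ?W (?th (comm S V xi et))"
 proof (rule R.differential_eqI[OF W(1) B(1)])
  show "mrst rTS ?U ?W (?th (comm S V xi et)) : Sec rTS ?W" by (rule R.pb.mrst_closed[OF U(1) W(1,3) th[OF cm(1)]])
  fix z gg assume z: "z : ?W" and gg: "gg : car (SS (pt p (pt q z)))"
  have zX: "z : pts X" by (rule Q.sec_pt[OF W(1) z])
  have s: "pt p (pt q z) : V" using z W(3) by (auto simp: Q.preimg_mem P.preimg_mem)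
  interpret Sz: cring "SX z" by (rule Q.X.stalk_cring[OF zX])
  have sS: "pt p (pt q z) : pts S" using P.Y.opn_subset[OF V] s by blast
  interpret Ss: cring "SS (pt p (pt q z))" by (rule P.Y.stalk_cring[OF sS])
  interpret hh: ring_hom_cring "SS (pt p (pt q z))" "SX z" "smap r z"
   by (intro ring_hom_cringI Ss.cring_axioms Sz.cring_axioms R.stalk_map_hom[OF zX])
  note vgg = P.K.vact_closed[OF xi V s gg] P.K.vact_closed[OF et V s gg]
  \<comment> \<open>\<open>key\<close> states both relations at once; where only the first is
    wanted, the germ 1 fills the place of the other argument.\<close>
  have b0: "1[SY (pt q z)] :[SY (pt q z)]" using Q.Y.stalk_cring[OF Q.pt_closed[OF zX]] by (simp add: cring.cring_simprules)
  show "R.sact (mrst rTS ?U ?W (?th (comm S V xi et))) z gg = vact X ?W ?B z (smap r z gg)"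
   unfolding actr[OF z cm(1) gg] cm(2)[OF s gg] B(2)[OF z R.stalk_map_closed[OF zX gg]]
    key(1)[OF D xi z gg b0] key(1)[OF E et z gg b0] key(1)[OF D xi z vgg(2) b0] key(1)[OF E et z vgg(1) b0]
   using P.K.vact_closed[OF xi V s vgg(2)] P.K.vact_closed[OF et V s vgg(1)] by simp
 qed
 have bbx: "bb :[SY (pt q x)]" using bb x by simp
 have yV: "pt q x : pre p V" using x y by simp
 interpret Sx: cring "SX x" by (rule Q.X.stalk_cring[OF x(1)])
 interpret Sy: cring "SY (pt q x)" by (rule Q.Y.stalk_cring[OF Q.pt_closed[OF x(1)]])
 interpret hq: ring_hom_cring "SY (pt q x)" "SX x" "smap q x"
  by (intro ring_hom_cringI Sy.cring_axioms Sx.cring_axioms Q.stalk_map_hom[OF x(1)])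
 have g0: "1[SS (pt p (pt q x))] : car (SS (pt p (pt q x)))"
  using P.Y.stalk_cring[OF P.pt_closed[OF Q.pt_closed[OF x(1)]]] by (simp add: cring.cring_simprules)
 note lbb = Q.K.vact_closed[OF lc(1) oV yV bbx] Q.K.vact_closed[OF lc(2) oV yV bbx]
 note llbb = Q.K.vact_closed[OF lc(1) oV yV lbb(2)] Q.K.vact_closed[OF lc(2) oV yV lbb(1)]
 have "vact Y (pre p V) (lift V (comm S V xi et)) (pt q x) bb = vact Y (pre p V) (comm Y (pre p V) (lift V xi) (lift V et)) (pt q x) bb"
 proof (rule q_inj[OF x(1) Q.K.vact_closed[OF lc(3) oV yV bbx] Q.K.vact_closed[OF lcm(1) oV yV bbx]])
  have "smap q x (vact Y (pre p V) (lift V (comm S V xi et)) (pt q x) bb) = vact X ?W ?B x (smap q x bb)"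
   by (rule key(2)[OF hB dB cm(1) W(2) g0 bbx, symmetric])
  also have "... = smap q x (vact Y (pre p V) (comm Y (pre p V) (lift V xi) (lift V et)) (pt q x) bb)"
   unfolding B(2)[OF W(2) Q.stalk_map_closed[OF x(1) bbx]] lcm(2)[OF yV bbx]
    key(2)[OF D xi W(2) g0 bbx] key(2)[OF E et W(2) g0 bbx] key(2)[OF D xi W(2) g0 lbb(2)] key(2)[OF E et W(2) g0 lbb(1)] using llbb by simp
  finally show "smap q x (vact Y (pre p V) (lift V (comm S V xi et)) (pt q x) bb) =
    smap q x (vact Y (pre p V) (comm Y (pre p V) (lift V xi) (lift V et)) (pt q x) bb)" .
 qed
 thus "vact Y (pre p V) (lift V (comm S V xi et)) y bb = vact Y (pre p V) (comm Y (pre p V) (lift V xi) (lift V et)) y bb"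
  by (simp add: x(2))
qed

end

abbreviation (in leaf_setting) (input) "tunf \<equiv> transverse_unfolding q p tX tY tS"

text \<open>The splitting can be read off from the pairs of projection and anchor. With
  \<open>E' = E\<close> this gives uniqueness of the splitting of an unfolding, with two unfoldings
  it excludes isomorphisms between different splittings.\<close>

lemma (in leaf_setting) transverse_unique:
 fixes E :: "('a, 'b, 'e, 'f, 'u) unf" and E' :: "('a, 'b, 'e, 'f, 'v) unf"
 assumes "tunf ta E" "tunf ta' E'"
  and match: "!!U u. opn X U ==> u : Sec E U ==> EX u':Sec E' U. proj E' U u' = proj E U u & anchor E' U u' = anchor E U u" shows "ta = ta'"
proof -
 interpret A: transverse_unfolding q p tX tY tS ta E by fact
 interpret B: transverse_unfolding q p tX tY tS ta' E' by fact
 show ?thesis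
 proof (rule splitting_unique[OF A.leaf_splitting_axioms B.leaf_splitting_axioms])
  fix U th assume U: "opn X U" and th: "th : Sec rTS U"
  show "A.pbs U th = B.pbs U th"
  proof (rule Q.pullback_eqI[OF A.pbs_closed[OF U th] B.pbs_closed[OF U th]])
   fix x assume x: "x : U"
   obtain W u where W: "opn X W" "x : W" "W <= U" and u: "u : Sec E W" "proj E W u = mrst rTS U W th" using A.proj_surj[OF U th x] by auto
   obtain u' where u': "u' : Sec E' W" "proj E' W u' = proj E W u" "anchor E' W u' = anchor E W u" using match[OF W(1) u(1)] by auto
   have "A.pbs W (mrst rTS U W th) = B.pbs W (mrst rTS U W th)"
    using A.anchor_hor[OF W(1) u(1)] B.anchor_hor[OF W(1) u'(1)] A.proj_anchor[OF W(1) u(1)] u u' by (simp add: A.hor_def B.hor_def)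
   hence "restrict (A.pbs U th) W = restrict (B.pbs U th) W"
    using sheaf_homD(4)[OF A.pbs_hom U W(1,3) th] sheaf_homD(4)[OF B.pbs_hom U W(1,3) th] by (simp add: Q.pullback_simps)
   thus "A.pbs U th x = B.pbs U th x" using W(2) by (metis restrict_apply')
  qed
 qed
qed

text \<open>Both anchors are injective with the horizontal fields as image, and an isomorphism
  preserves anchors. So it can only be one anchor followed by the inverse of the other. This map
  respects inclusion, projection and bracket, because all of them are determined by the
  anchor.\<close>

lemma (in leaf_splitting) unfolding_isos_unique:
 fixes E :: "('a, 'b, 'e, 'f, 'u) unf" and E' :: "('a, 'b, 'e, 'f, 'v) unf"
 assumes "tunf ta E" "tunf ta E'"
 shows "EX! ph. ph : unfolding_isos X (folia q) E E'"
proof -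
 interpret A: transverse_unfolding q p tX tY tS ta E by fact
 interpret B: transverse_unfolding q p tX tY tS ta E' by fact
 define ph where "ph = (\<lambda>U\<in>{U. opn X U}. \<lambda>u\<in>Sec E U. inv_into (Sec E' U) (anchor E' U) (anchor E U u))"
 have img: "anchor E U ` Sec E U = anchor E' U ` Sec E' U" if "opn X U" for U using A.anchor_image[OF that] B.anchor_image[OF that] by simp
 have ph: "ph U u : Sec E' U" "anchor E' U (ph U u) = anchor E U u" if U: "opn X U" and u: "u : Sec E U" for U u
 proof -
  have "anchor E U u : anchor E' U ` Sec E' U" using img[OF U] u by blast
  thus "ph U u : Sec E' U" "anchor E' U (ph U u) = anchor E U u" using U u by (simp_all add: ph_def inv_into_into f_inv_into_f)
 qed
 have uniq: "v = ph U u" if "opn X U" "u : Sec E U" "v : Sec E' U" "anchor E' U v = anchor E U u" for U u v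
  using inj_onD[OF B.anchor_inj[OF that(1)], of v "ph U u"] ph[OF that(1,2)] that(3,4) by simp
 note ha = sheaf_homD[OF A.anchor_hom] and hb = sheaf_homD[OF B.anchor_hom]
 have hom: "ph : sheaf_hom X E E'"
 proof (rule sheaf_homI)
  fix U assume U: "opn X U"
  interpret EA: module "sect X U" "msec E U" by (rule A.E_module[OF U])
  interpret EB: module "sect X U" "msec E' U" by (rule B.E_module[OF U])
  fix u assume u: "u : Sec E U"
  note fu = ph[OF U u]
  show "ph U u : Sec E' U" by (rule fu)
  show "ph U (u +[msec E U] v) = ph U u +[msec E' U] ph U v" if v: "v : Sec E U" for v
   by (rule uniq[OF U, symmetric]) (use u v fu ph[OF U v] ha(2)[OF U u v] hb(2)[OF U fu(1) ph(1)[OF U v]] in simp_all)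
  show "ph U (a .[msec E U] u) = a .[msec E' U] ph U u" if a: "a :[sect X U]" for a
   by (rule uniq[OF U, symmetric]) (use u a fu ha(3)[OF U a u] hb(3)[OF U a fu(1)] in simp_all)
  show "ph V (mrst E U V u) = mrst E' U V (ph U u)" if V: "opn X V" "V <= U" for V by (rule uniq[OF V(1), symmetric])
    (use presheaf_onD(1)[OF sheaf_on_presheaf[OF A.E_sheaf] U V u] presheaf_onD(1)[OF sheaf_on_presheaf[OF B.E_sheaf] U V fu(1)]
     ha(4)[OF U V u] hb(4)[OF U V fu(1)] fu in simp_all)
 qed (simp_all add: ph_def)
 have "ph : unfolding_isos X (folia q) E E'" unfolding unfolding_isos_def mem_Collect_eq
 proof (intro conjI hom allI impI ballI)
  fix U assume U: "opn X U"
  show "bij_betw (ph U) (Sec E U) (Sec E' U)" unfolding bij_betw_def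
  proof (intro conjI inj_onI)
   show "u = v" if "u : Sec E U" "v : Sec E U" "ph U u = ph U v" for u v
    using inj_onD[OF A.anchor_inj[OF U], of u v] ph(2)[OF U that(1)] ph(2)[OF U that(2)] that by simp
   show "ph U ` Sec E U = Sec E' U"
   proof
    show "ph U ` Sec E U <= Sec E' U" using ph(1)[OF U] by blast
    show "Sec E' U <= ph U ` Sec E U"
    proof
     fix v assume v: "v : Sec E' U"
     then obtain u where u: "u : Sec E U" "anchor E U u = anchor E' U v" using img[OF U] by (metis (no_types) imageE imageI)
     thus "v : ph U ` Sec E U" using uniq[OF U u(1) v] by simp
    qed
   qed
  qed
  show "ph U (incl E U g) = incl E' U g" if "g : Sec (folia q) U" for g
  proof (rule uniq[OF U, symmetric])
   have g: "g : Der q U" using that by (simp add: A.leaf_sects Q.tan_simps(1))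
   show "incl E U g : Sec E U" "incl E' U g : Sec E' U" by ((rule sheaf_homD(1)[OF A.incl_hom U that] sheaf_homD(1)[OF B.incl_hom U that])+)
   show "anchor E' U (incl E' U g) = anchor E U (incl E U g)" using A.anchor_incl[OF U g] B.anchor_incl[OF U g] by simp
  qed
  fix u assume u: "u : Sec E U"
  note fu = ph[OF U u]
  show "anchor E' U (ph U u) = anchor E U u" by (rule fu)
  show "proj E' U (ph U u) = proj E U u" using B.proj_anchor[OF U fu(1)] A.proj_anchor[OF U u] fu(2) by simp
  show "ph U (bracket E U u v) = bracket E' U (ph U u) (ph U v)" if v: "v : Sec E U" for v by (rule uniq[OF U, symmetric])
    (use A.anchor_bracket[OF U u v] B.anchor_bracket[OF U fu(1) ph(1)[OF U v]] fu(2) ph(2)[OF U v] in simp_all)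
 qed
 moreover have "ps = ph" if ps: "ps : unfolding_isos X (folia q) E E'" for ps
 proof -
  have h: "ps : sheaf_hom X E E'" and a: "!!U u. opn X U ==> u : Sec E U ==> anchor E' U (ps U u) = anchor E U u"
   using ps unfolding unfolding_isos_def by simp_all
  show ?thesis by (rule sheaf_hom_ext[OF h hom]) (rule uniq[OF _ _ sheaf_homD(1)[OF h] a])
 qed
 ultimately show ?thesis by rule
qed

context leaf_splitting
begin

text \<open>The pulled back connection asks for local lists with entries in the distribution. By
  \<open>rep_frame\<close> such a list forces the expansion by which \<open>horI\<close> recognises
  horizontal fields, and conversely \<open>pbs_rep\<close> supplies a list.\<close>

lemma pullback_connection_hor: assumes U: "opn X U" shows "pconn q tX tY (HD p tS ta) U = {D. hor U D}"
proof (intro equalityI subsetI)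
 fix D assume "D : pconn q tX tY (HD p tS ta) U"
 hence D: "D : Der tX U" and loc: "ALL x:U. EX W V xs. x : W & W <= U & prep q TY W V xs (dq U D) &
   snd ` set xs <= HD p tS ta V" by (simp_all add: pullback_connection_def Q.J.tan_simps(1))
 have "hor U D"
 proof (rule horI[OF U D])
  fix x C V n c F a N fr bb
  assume x: "x : U" and ch: "P.K.chart C V n c F a N" "P.K.frame C n c a fr" "pt p (pt q x) : C" and bb: "bb :[SY (pt q x)]"
  obtain W V' xs where rep: "x : W" "prep q TY W V' xs (dq U D)" "snd ` set xs <= HD p tS ta V'" using bspec[OF loc x] by auto
  hence im: "snd ` set xs <= ta V' ` Sec pTS V'" by (simp add: horizontal_distribution_def src pb_represents_def)
  have xX: "x : pts X" by (rule Q.sec_pt[OF U x])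
  interpret Sx: cring "SX x" by (rule Q.X.stalk_cring[OF xX])
  have c: "qcd C a x l : car (SS (pt p (pt q x)))" if "l :# ixs c n" for l
   using P.K.chart_coord[OF ch(1), of l] P.K.chartD(5)[OF ch(1)] ch(3) that by simp
  show "vact X U D x (smap q x bb) = msum (SX x) (%l. vact X U D x (smap r x (qcd C a x l)) *[SX x]
    smap q x (lva C (fr l) (pt q x) bb)) (ixs c n)"
   unfolding hor_act(2)[OF U D x bb, symmetric] rep_frame[OF rep(2) im ch(1,2) rep(1) ch(3) bb]
   by (rule Sx.msum_cong) (simp add: hor_act(2)[OF U D x] P.stalk_map_closed[OF Q.pt_closed[OF xX]] c comp_map[OF xX])
 qed
 thus "D : {D. hor U D}" by simp
next
 fix D assume "D : {D. hor U D}"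
 hence D: "D : Der tX U" "dq U D = pbs U (dr U D)" by (simp_all add: hor_def)
 note th = R.differential_spec(1)[OF U D(1)]
 show "D : pconn q tX tY (HD p tS ta) U" unfolding pullback_connection_def mem_Collect_eq Q.J.tan_simps(1)
 proof (intro conjI D(1) ballI)
  fix x assume "x : U"
  then obtain W V xs where rep: "x : W" "W <= U" "prep r TS W V xs (dr U D)" by (rule R.pullback_rep[OF th])
  have o: "opn S V" "set xs <= Q.X.\<O> W \<times> Der tS V" using rep(3) by (simp_all add: pb_represents_def mor_comp_def P.K.tan_simps(1))
  have "snd ` set (map (map_prod id (lift V)) xs) <= HD p tS ta (pre p V)"
   using o unit_closed[OF o(1)] by (auto simp: horizontal_distribution_def src lift_def)
  thus "EX W V xs. x : W & W <= U & prep q TY W V xs (dq U D) & snd ` set xs <= HD p tS ta V"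
   using rep(1,2) pbs_rep[OF U th rep(2,3)] unfolding D(2) by blast
 qed
qed

end

section \<open>The unfolding of a flat splitting\<close>

locale flat_leaf_splitting = leaf_splitting + assumes flat: "!!V xi et. opn S V ==> xi : Der tS V ==> et : Der tS V ==>
  lift V (comm S V xi et) = comm Y (pre p V) (lift V xi) (lift V et)"
begin

lemma lift_zero: assumes V: "opn S V" and y: "y : pre p V" and bb: "bb :[SY y]"
 shows "vact Y (pre p V) (lift V 0[msec TS V]) y bb = 0[SY y]"
proof -
 note oV = P.opn_preimg[OF V] and z = P.K.vfield_zero(1)[OF V]
 have yY: "y : pts Y" and s: "pt p y : V" using y by (auto simp: P.preimg_mem)
 interpret Sy: cring "SY y" by (rule Q.Y.stalk_cring[OF yY])
 obtain C V' n c F a N fr where ch: "P.K.chart C V' n c F a N" "P.K.frame C n c a fr" "pt p y : C" "opn S C"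
  and fr: "!!l. l :# ixs c n ==> fr l : Der tS C"
    "!!l. l :# ixs c n ==> rg S (pt p y) C (a l) :[SS (pt p y)]" by (rule base_chart[OF P.pt_closed[OF yY]]) (rule; assumption)
 have yC: "y : pre p C" using ch(3) yY by (simp add: P.preimg_mem)
 have "P.sact (pb_unit p TS V 0[msec TS V]) y gg = 0[SY y]" if "gg :[SS (pt p y)]" for gg
  using P.act_unit[OF V z y that] P.K.vfield_zero(2)[OF V s that]
   ring_hom_zero'[OF P.Y.stalk_cring[OF P.pt_closed[OF yY]] Q.Y.stalk_cring[OF yY] P.stalk_map_hom[OF yY]] by simp
 thus ?thesis unfolding tau_frame[OF oV unit_closed[OF V z] ch(1,2) y ch(3) bb, folded lift_def]
  using fr(2) Q.K.vact_closed[OF lift_closed[OF ch(4) fr(1)] P.opn_preimg[OF ch(4)] yC bb] by (intro Sy.msum_zero) simp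
qed

text \<open>Partial derivatives of coordinates are 0 or 1, so the commutator of two frame fields
  kills the coordinates as well as the base, and vanishes by \<open>chart_der_eqI\<close>. Flatness
  carries this over to the lifts.\<close>

lemma frame_commute: assumes chart: "P.K.chart C V n c F a N" and frame: "P.K.frame C n c a fr" and l: "l :# ixs c n" and m: "m :# ixs c n"
  and y: "y : pre p C" and bb: "bb :[SY y]" shows "lva C (fr l) y (lva C (fr m) y bb) =
  lva C (fr m) y (lva C (fr l) y bb)"
proof -
 note oC = P.K.chartD(5)[OF chart]
 have fr: "fr k : Der tS C"
  "!!j z. c <= j ==> j < n ==> z : C ==> vact S C (fr k) z (rg S z C (a j)) = (if j = k then 1[SS z] else 0[SS z])"
  if "k :# ixs c n" for k using frame that by (simp_all add: P.K.frame_def[OF chart])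
 note D = fr[OF l] and E = fr[OF m]
 note B = P.K.vfield_commutator[OF D(1) E(1) oC]
 have "comm S C (fr l) (fr m) = 0[msec TS C]"
 proof (rule P.K.derivations_eqI[OF B(1) P.K.vfield_zero(1)[OF oC] oC])
  fix z gg assume z: "z : C" and gg: "gg :[SS z]"
  have zS: "z : pts S" using P.Y.opn_subset[OF oC] z by blast
  interpret Sz: cring "SS z" by (rule P.Y.stalk_cring[OF zS])
  note dz = der_zero[OF P.K.vact_der[OF D(1) oC z] Sz.cring_axioms Sz.cring_axioms]
   der_zero[OF P.K.vact_der[OF E(1) oC z] Sz.cring_axioms Sz.cring_axioms]
   der_one[OF P.K.vact_der[OF D(1) oC z] Sz.cring_axioms Sz.cring_axioms id_ring_hom[unfolded id_def]]
   der_one[OF P.K.vact_der[OF E(1) oC z] Sz.cring_axioms Sz.cring_axioms id_ring_hom[unfolded id_def]]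
  have cc: "rg S z C (a j) :[SS z]" if "j < n" for j using P.K.chart_coord[OF chart that] oC z by simp
  have "vact S C (comm S C (fr l) (fr m)) z gg = vact S C 0[msec TS C] z gg"
   by (rule P.K.chart_der_eqI[OF chart z P.Y.local_stalk[OF zS] id_ring_hom[unfolded id_def]
      P.K.vact_der[OF B(1) oC z] P.K.vact_der[OF P.K.vfield_zero(1)[OF oC] oC z] _ _ gg])
    (use P.K.vact_kills[OF B(1) oC z] P.K.vact_kills[OF P.K.vfield_zero(1)[OF oC] oC z]
     B(2)[OF z] D(2) E(2) z cc dz P.K.vfield_zero(2)[OF oC z] in "simp_all")
  thus "vact S C (comm S C (fr l) (fr m)) z gg = vact S C 0[msec TS C] z gg" .
 qed
 hence z: "comm Y (pre p C) (lift C (fr l)) (lift C (fr m)) = lift C 0[msec TS C]" using flat[OF oC D(1) E(1)] by simp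
 have yY: "y : pts Y" using y by (simp add: P.preimg_mem)
 interpret Sy: cring "SY y" by (rule Q.Y.stalk_cring[OF yY])
 note oP = P.opn_preimg[OF oC] and lc = lift_closed[OF oC D(1)] lift_closed[OF oC E(1)]
 have z0: "lva C (fr l) y (lva C (fr m) y bb) -[SY y]
  lva C (fr m) y (lva C (fr l) y bb) = 0[SY y]"
  using Q.K.vfield_commutator(2)[OF lc oP y bb] lift_zero[OF oC y bb] by (simp add: z)
 note c = Q.K.vact_closed[OF lc(1) oP y] Q.K.vact_closed[OF lc(2) oP y]
 from z0 show ?thesis unfolding Sy.r_right_minus_eq[OF c(1)[OF c(2)[OF bb]] c(2)[OF c(1)[OF bb]]] .
qed

lemma hor_commutator: assumes U: "opn X U" and D: "hor U D" and E: "hor U E" shows "hor U (comm X U D E)"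
proof -
 have D': "D : Der tX U" and E': "E : Der tX U" using D E by (simp_all add: hor_def)
 note B = Q.J.vfield_commutator[OF D' E' U]
 show ?thesis
 proof (rule horI[OF U B(1)])
  fix x C V n c F a N fr bb
  assume x: "x : U" and ch: "P.K.chart C V n c F a N" "P.K.frame C n c a fr" "pt p (pt q x) : C" and bb: "bb :[SY (pt q x)]"
  have xX: "x : pts X" by (rule Q.sec_pt[OF U x])
  have yY: "pt q x : pts Y" by (rule Q.pt_closed[OF xX])
  have y: "pt q x : pre p C" using yY ch(3) by (simp add: P.preimg_mem)
  note S = Q.X.stalk_cring[OF xX] Q.Y.stalk_cring[OF yY]
  interpret Sx: cring "SX x" by (rule S)
  note oC = P.K.chartD(5)[OF ch(1)]
  let ?L = "ixs c n" and ?e = "%l. lva C (fr l) (pt q x)"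
  let ?u = "%l. smap r x (qcd C a x l)"
  have fr: "fr l : Der tS C" if "l :# ?L" for l using ch(2) that by (simp add: P.K.frame_def[OF ch(1)])
  have u: "?u l :[SX x]" if "l :# ?L" for l using P.K.chart_coord[OF ch(1), of l] oC ch(3) that R.stalk_map_closed[OF xX] by simp
  have "vact X U D x (vact X U E x (smap q x bb)) -[SX x] vact X U E x (vact X U D x (smap q x bb)) =
    msum (SX x) (%l. (vact X U D x (vact X U E x (?u l)) -[SX x] vact X U E x (vact X U D x (?u l))) *[SX x] smap q x (?e l bb)) ?L"
  proof (rule combination_commutator[OF S Q.stalk_map_hom[OF xX] Q.J.vact_der[OF D' U x] Q.J.vact_der[OF E' U x]])
   show "der (SY (pt q x)) (SY (pt q x)) (%a. a) (?e l)" if "l :# ?L" for l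
    by (rule Q.K.vact_der[OF lift_closed[OF oC fr[OF that]] P.opn_preimg[OF oC] y])
   show "?e l (?e m b) = ?e m (?e l b)" if "l :# ?L" "m :# ?L" "b :[SY (pt q x)]" for l m b
    by (rule frame_commute[OF ch(1,2) that(1,2) y that(3)])
   show "?u l :[SX x]" if "l :# ?L" for l by (rule u[OF that])
   show "vact X U D x (smap q x b) = msum (SX x) (%l. vact X U D x (?u l) *[SX x] smap q x (?e l b)) ?L"
    "vact X U E x (smap q x b) = msum (SX x) (%l. vact X U E x (?u l) *[SX x] smap q x (?e l b)) ?L"
    if "b :[SY (pt q x)]" for b using hor_frame[OF U D ch(1,2) x ch(3) that] hor_frame[OF U E ch(1,2) x ch(3) that] .
  qed (rule bb)
  also have "... = msum (SX x) (%l. vact X U (comm X U D E) x (?u l) *[SX x] smap q x (?e l bb)) ?L"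
   by (rule Sx.msum_cong) (simp add: B(2)[OF x u])
  finally show "vact X U (comm X U D E) x (smap q x bb) =
    msum (SX x) (%l. vact X U (comm X U D E) x (?u l) *[SX x] smap q x (?e l bb)) ?L" unfolding B(2)[OF x Q.stalk_map_closed[OF xX bb]] .
 qed
qed

text \<open>The restrictions make the maps undefined outside opens and sections, as
  \<open>sheaf_hom\<close> demands. With \<open>dr\<close> as projection, the condition on the
  induced anchor holds by construction.\<close>

definition hor_unf :: "('a, 'b, 'e, 'f, ('a, 'b) vfield) unf" where
 "hor_unf = \<lparr>msec = (%U. (msec TX U)\<lparr>carrier := {D. hor U D}\<rparr>), mrst = mrst TX, bracket = comm X,
  anchor = (\<lambda>U\<in>{U. opn X U}. \<lambda>D\<in>{D. hor U D}. D), incl = (\<lambda>U\<in>{U. opn X U}. \<lambda>D\<in>Der q U. D),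
  proj = (\<lambda>U\<in>{U. opn X U}. \<lambda>D\<in>{D. hor U D}. dr U D)\<rparr>"

lemma hor_unf_simps [simp]:
 "Sec hor_unf U = {D. hor U D}" "zero (msec hor_unf U) = zero (msec TX U)"
 "add (msec hor_unf U) = add (msec TX U)" "smult (msec hor_unf U) = smult (msec TX U)"
 "mrst hor_unf = mrst TX" "bracket hor_unf = comm X"
 "opn X U ==> hor U D ==> anchor hor_unf U D = D"
 "opn X U ==> D : Der q U ==> incl hor_unf U D = D"
 "opn X U ==> hor U D ==> proj hor_unf U D = dr U D" by (simp_all add: hor_unf_def)

lemma horizontal_submodule: assumes U: "opn X U" shows "submodule {D. hor U D} (sect X U) (msec TX U)"
proof -
 interpret T: module "sect X U" "msec TX U" by (rule Q.J.tangent_module[OF U])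
 show ?thesis
 proof (rule T.submoduleI)
  show "{D. hor U D} <= Sec TX U" by (auto simp: hor_def Q.J.tan_simps(1))
  fix D assume "D : {D. hor U D}"
  hence D: "hor U D" "D : Sec TX U" by (simp_all add: hor_def Q.J.tan_simps(1))
  have "(-[sect X U] 1[sect X U]) .[msec TX U] D = -[msec TX U] D" using T.smult_l_minus[of "1[sect X U]" D] D by simp
  thus "-[msec TX U] D : {D. hor U D}" using hor_closed(3)[OF U _ D(1), of "-[sect X U] 1[sect X U]"] by simp
 qed (use hor_closed(1-3)[OF U] in simp_all)
qed

lemma horizontal_sheaf: "sheaf_on (space_top X) (%U. {D. hor U D}) (mrst TX)"
proof (rule subsheaf_on[OF Q.J.tangent_sheaf])
 show "{D. hor U D} <= Sec TX U" if "opn X U" for U by (auto simp: hor_def Q.J.tan_simps(1))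
 show "mrst TX U V D : {D. hor V D}" if "opn X U" "opn X V" "V <= U" "D : {D. hor U D}" for U V D
  using hor_closed(4)[OF that(1-3)] that(4) by simp
 show "D : {D. hor U D}" if "opn X U" "D : Sec TX U"
  "!!x. x : U ==> EX W. opn X W & x : W & W <= U & mrst TX U W D : {D. hor W D}" for U D
  using hor_local[OF that(1), of D] that(2,3) by (simp add: Q.J.tan_simps(1))
qed

lemma horizontal_lie: "is_lie_algebroid tX hor_unf"
proof (rule Q.J.sub_lie_algebroid)
 show "is_mod_sheaf X hor_unf"
  by (rule submodule_sheaf[OF Q.J.tangent_mod_sheaf horizontal_submodule horizontal_sheaf]) (simp_all add: hor_unf_def)
 show "Sec hor_unf U <= Der tX U" if "opn X U" for U by (auto simp: hor_def)
 show "anchor hor_unf = (\<lambda>U\<in>{U. opn X U}. \<lambda>D\<in>Sec hor_unf U. D)" by (simp add: hor_unf_def)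
 show "comm X U D E : Sec hor_unf U" if "opn X U" "D : Sec hor_unf U" "E : Sec hor_unf U" for U D E
  using hor_commutator[OF that(1)] that(2,3) by simp
qed simp_all

lemma leaf_lie: "is_lie_algebroid r (folia q)"
proof (rule R.sub_lie_algebroid)
 show "is_mod_sheaf X (folia q)" using Q.tangent_mod_sheaf by (simp add: is_mod_sheaf_def leaf_foliation_def)
 show "Sec (folia q) U <= Der r U" if U: "opn X U" for U
 proof
  fix D assume "D : Sec (folia q) U"
  hence D: "D : Der q U" by (simp add: leaf_foliation_def Q.tan_simps(1))
  hence "D : Der tX U" "!!x bb. x : U ==> bb :[SY (pt q x)] ==> vact X U D x (smap q x bb) = 0[SX x]"
   using Q.relative_derivations[OF U] by simp_all
  thus "D : Der r U" unfolding R.relative_derivations[OF U]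
   using comp_map[OF Q.sec_pt[OF U]] P.stalk_map_closed[OF Q.pt_closed[OF Q.sec_pt[OF U]]] by simp
 qed
 show "zero (msec (folia q) U) = zero (msec (tangent r) U) & add (msec (folia q) U) = add (msec (tangent r) U) &
  smult (msec (folia q) U) = smult (msec (tangent r) U)" if "opn X U" for U
  by (simp add: leaf_foliation_def tangent_def Let_def mor_comp_def)
 show "mrst (folia q) = mrst (tangent r)" by (simp add: leaf_foliation_def tangent_def Let_def mor_comp_def)
 show "anchor (folia q) = (\<lambda>U\<in>{U. opn X U}. \<lambda>D\<in>Sec (folia q) U. D)" by (simp add: leaf_foliation_def)
 show "comm X U D E : Sec (folia q) U" if "opn X U" "D : Sec (folia q) U" "E : Sec (folia q) U" for U D E
  using Q.vfield_commutator(1)[of D U E] that by (simp add: leaf_foliation_def Q.tan_simps(1))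
qed (simp add: leaf_foliation_def)

text \<open>If \<open>dr\<close> of \<open>u\<close> is locally the unit section of
  \<open>xi\<close>, then \<open>u\<close> is \<open>q\<close>-related to the lift of
  \<open>xi\<close> and maps pulled back functions to pulled back functions. As \<open>g\<close>
  kills these, both terms of the commutator vanish on them.\<close>

lemma base_direction_ideal: assumes U: "opn X U" and u: "hor U u" and b: "base_direction r tS U (dr U u)" and g: "g : Der q U"
 shows "comm X U u g : Der q U"
proof -
 have u': "u : Der tX U" "dq U u = pbs U (dr U u)" using u by (simp_all add: hor_def)
 have g': "g : Der tX U" "!!x bb. x : U ==> bb :[SY (pt q x)] ==> vact X U g x (smap q x bb) = 0[SX x]"
  using g Q.relative_derivations[OF U] by simp_all
 note B = Q.J.vfield_commutator[OF u'(1) g'(1) U]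
 show ?thesis unfolding Q.relative_derivations[OF U]
 proof (intro conjI B(1) ballI)
  fix x bb assume x: "x : U" and bb: "bb :[SY (pt q x)]"
  have xX: "x : pts X" by (rule Q.sec_pt[OF U x])
  interpret Sx: cring "SX x" by (rule Q.X.stalk_cring[OF xX])
  obtain W V xi where rep: "x : W" "W <= U" "prep r TS W V [(1[sect X W], xi)] (dr U u)"
   using b x unfolding base_direction_def by (auto simp: mor_comp_def)
  have o: "opn X W" "opn S V" "W <= pre q (pre p V)" "xi : Der tS V"
   using rep(3) by (auto simp: pb_represents_def P.K.tan_simps(1) mor_comp_def preimg_def src)
  have y: "pt q x : pre p V" using rep(1) o(3) by (auto simp: Q.preimg_mem)
  have "prep q TY W (pre p V) [(1[sect X W], lift V xi)] (dq U u)"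
   using pbs_rep[OF U R.differential_spec(1)[OF U u'(1)] rep(2,3)] u'(2) by simp
  note vl = Q.K.vact_closed[OF lift_closed[OF o(2,4)] P.opn_preimg[OF o(2)] y bb]
  have "vact X U u x (smap q x bb) = smap q x (lva V xi (pt q x) bb)"
   using hor_act(2)[OF U u'(1) x bb] Q.act_rep[OF \<open>pb_represents q TY W (preimg p V) [(1[sect X W], lift V xi)] (dq U u)\<close> rep(1) bb]
    Q.X.rgerm_ops(3)[OF o(1) rep(1)] Q.stalk_map_closed[OF xX vl] by simp
  thus "vact X U (comm X U u g) x (smap q x bb) = 0[SX x]" using B(2)[OF x Q.stalk_map_closed[OF xX bb]] g'(2)[OF x bb] g'(2)[OF x vl]
    der_zero[OF Q.J.vact_der[OF u'(1) U x] Sx.cring_axioms Sx.cring_axioms] by simp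
 qed
qed

lemma horizontal_strict: "strict_unfolding r tX tS (folia q) hor_unf"
proof -
 have src_r: "source r = X" by (simp add: mor_comp_def)
 \<comment> \<open>The tangent sheaves of \<open>q\<close> and of \<open>tX\<close> have the same
   operations and restrictions; they differ in their carriers only.\<close>
 have L: "Sec (folia q) U = Der q U" "add (msec (folia q) U) = add (msec TX U)"
  "smult (msec (folia q) U) = smult (msec TX U)" "mrst (folia q) = mrst TX" "bracket (folia q) = comm X"
  "opn X U ==> D : Der q U ==> anchor (folia q) U D = D" for U D
  by (simp_all add: leaf_foliation_def) (simp_all add: tangent_def Let_def Q.source_s)
 have q_hor: "hor U D" "dr U D = 0[msec rTS U]" if "opn X U" "D : Der q U" for U D using vertical[OF that(1)] that(2) by simp_all
 have qc: "D +[msec TX U] E : Der q U" "a : Q.X.\<O> U ==> a .[msec TX U] D : Der q U"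
  if "opn X U" "D : Der q U" "E : Der q U" for U D E a
  using Q.vfield_add(1)[OF that(2,3,1)] Q.vfield_smult(1)[OF that(2) _ that(1)] Q.tan_simps(3,4) Q.J.tan_simps(3,4) by simp_all
 have qr: "mrst TX U V D : Der q V" if "opn X U" "opn X V" "V <= U" "D : Der q U" for U V D
  using Q.vfield_restrict(1)[OF that(4,1,2,3)] by (simp add: Q.tan_simps(5) Q.J.tan_simps(5))
 have D: "D : Der tX U" if "hor U D" for U D using that by (simp add: hor_def)
 note R = sheaf_homD[OF R.differential_hom, unfolded Q.J.tan_simps(1)]
 show ?thesis unfolding strict_unfolding_def Let_def src_r
 proof (intro conjI allI impI ballI leaf_lie horizontal_lie)
  show "incl hor_unf : sheaf_hom X (folia q) hor_unf"
   by (rule sheaf_homI) (use q_hor qc qr in \<open>simp_all add: L\<close>, simp_all add: hor_unf_def)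
  show "proj hor_unf : sheaf_hom X hor_unf rTS" by (rule sheaf_homI) (use R hor_closed D in simp_all, simp_all add: hor_unf_def)
  fix U assume U: "opn X U"
  show "inj_on (incl hor_unf U) (Sec (folia q) U)" using U by (simp add: inj_on_def L)
  show "anchor hor_unf U (incl hor_unf U g) = anchor (folia q) U g" if "g : Sec (folia q) U" for g using that U q_hor by (simp add: L)
  show "incl hor_unf U (bracket (folia q) U g h) =
    bracket hor_unf U (incl hor_unf U g) (incl hor_unf U h)"
   if "g : Sec (folia q) U" "h : Sec (folia q) U" for g h using that U Q.vfield_commutator(1)[of g U h] by (simp add: L)
  show "{u : Sec hor_unf U. proj hor_unf U u = 0[msec rTS U]} =
    incl hor_unf U ` Sec (folia q) U"
  proof -
   have "incl hor_unf U ` Sec (folia q) U = Der q U" using U by (simp add: L)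
   moreover have "{u : Sec hor_unf U. proj hor_unf U u = 0[msec rTS U]} = Der q U"
   proof (intro equalityI subsetI)
    fix u assume "u : {u : Sec hor_unf U. proj hor_unf U u = 0[msec rTS U]}"
    hence "hor U u" "proj hor_unf U u = 0[msec rTS U]" by simp_all
    thus "u : Der q U" using vertical[OF U] hor_unf_simps(9)[OF U] by simp
   next
    fix u assume u: "u : Der q U"
    show "u : {u : Sec hor_unf U. proj hor_unf U u = 0[msec rTS U]}" using q_hor[OF U u] U by simp
   qed
   ultimately show ?thesis by simp
  qed
  show "EX W. opn X W & x : W & W <= U & (EX u:Sec hor_unf W. proj hor_unf W u = mrst rTS U W th)"
   if th: "th : Sec rTS U" "x : U" for th x
  proof -
   obtain W D where "opn X W" "x : W" "W <= U" "hor W D" "dr W D = mrst rTS U W th" by (rule hor_lift[OF U th])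
   thus ?thesis by (intro exI[of _ W] conjI bexI[of _ D]) simp_all
  qed
  show "dr U (anchor hor_unf U u) = proj hor_unf U u" if "u : Sec hor_unf U" for u using that U by simp
  show "bracket hor_unf U u (incl hor_unf U g) : incl hor_unf U ` Sec (folia q) U"
   if "u : Sec hor_unf U" "base_direction r tS U (proj hor_unf U u)" "g : Sec (folia q) U" for u g
  proof -
   have "comm X U u g : Der q U" using base_direction_ideal[OF U, of u g] that U by (simp add: L)
   thus ?thesis using that(3) U by (intro image_eqI[of _ _ "comm X U u g"]) (simp_all add: L)
  qed
 qed
qed

lemma horizontal_transverse: "trsplit q p tX tY tS hor_unf pbs" unfolding is_transverse_splitting_def using pbs_hom by (simp add: hor_def)

end

lemma (in differential_setup) differential_kernel: assumes U: "opn X U"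
 shows "D : Der f U \<longleftrightarrow> D : Der s U & diff f s t U D = 0[msec PT U]"
proof -
 interpret PB: module "sect X U" "msec PT U" by (rule pullback_module[OF U])
 show ?thesis
 proof
  assume "D : Der f U"
  hence D: "D : Der s U" "!!x bb. x : U ==> bb :[SY x] ==> vact X U D x (smap f x bb) = 0[SX x]"
   using relative_derivations[OF U] by simp_all
  have "diff f s t U D = 0[msec PT U]"
   by (rule differential_eqI[OF U D(1) PB.M.zero_closed]) (simp add: sec_act(3)[OF U PB.M.zero_closed] D(2))
  thus "D : Der s U & diff f s t U D = 0[msec PT U]" using D(1) by simp
 next
  assume D: "D : Der s U & diff f s t U D = 0[msec PT U]"
  have "vact X U D x (smap f x bb) = 0[SX x]" if "x : U" "bb :[SY x]" for x bb
   using differential_spec(2)[OF U _ that, of D] sec_act(3)[OF U PB.M.zero_closed that] D by simp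
  thus "D : Der f U" unfolding relative_derivations[OF U] using D by simp
 qed
qed

subsection \<open>Ehresmann connections\<close>

context tower_splitting
begin

text \<open>The image of a section of \<open>dp\<close> is the set of fixed points of the idempotent
  \<open>ta\<close> after \<open>dp\<close>. Written as an equation, membership is visibly linear
  and local.\<close>

lemma distribution_iff: assumes U: "opn Y U" shows "D : HD p tS ta U \<longleftrightarrow> D : Der tY U & ta U (dp U D) = D"
proof
 assume "D : HD p tS ta U"
 then obtain th where th: "th : Sec pTS U" "D = ta U th" using U by (auto simp: horizontal_distribution_def src)
 thus "D : Der tY U & ta U (dp U D) = D" using tau_closed[OF U] tau_section[OF U] by simp
next
 assume D: "D : Der tY U & ta U (dp U D) = D"
 show "D : HD p tS ta U" using U D P.differential_spec(1)[OF U, of D] by (simp add: horizontal_distribution_def src image_iff) metis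
qed

text \<open>The idempotent \<open>ta\<close> after \<open>dp\<close> splits a field into a part in
  the distribution and a rest that \<open>dp\<close> kills, which is therefore vertical.\<close>

lemma distribution_ehresmann: "ehresmann_connection p tY (HD p tS ta)" unfolding ehresmann_connection_def Let_def src
proof (intro conjI allI impI ballI)
 let ?H = "HD p tS ta"
 note d = sheaf_homD[OF P.differential_hom] and t = sheaf_homD[OF tau_hom]
 have HM: "D : Sec TY U" if "opn Y U" "D : ?H U" for U D using that by (simp add: distribution_iff Q.K.tan_simps(1))
 show "?H U = {}" if "~ opn Y U" for U using that by (simp add: horizontal_distribution_def src)
 show "submodule (?H U) (sect Y U) (msec TY U)" if U: "opn Y U" for U
 proof -
  interpret T: module "sect Y U" "msec TY U" by (rule Q.K.tangent_module[OF U])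
  have smult: "a .[msec TY U] ta U (dp U D) = ta U (dp U (a .[msec TY U] D))" if "a :[sect Y U]" "D : Sec TY U" for a D
   using that d(1,3)[OF U] t(3)[OF U] by simp
  have scl: "a .[msec TY U] D : ?H U" if "a :[sect Y U]" "D : ?H U" for a D
  proof -
   have D: "D : Sec TY U" "ta U (dp U D) = D" using HM[OF U that(2)] that(2) distribution_iff[OF U] by simp_all
   show ?thesis unfolding distribution_iff[OF U] using smult[OF that(1) D(1)] D T.smult_closed[OF that(1) D(1)]
    by (simp add: Q.K.tan_simps(1))
  qed
  show ?thesis
  proof (rule T.submoduleI)
   show "?H U <= Sec TY U" using HM[OF U] by blast
   have z: "0[msec TY U] : Sec TY U" by simp
   have "ta U (dp U 0[msec TY U]) = 0[msec TY U]"
    by (simp only: linear_map_diff(1)[OF Q.K.tangent_module[OF U] P.pullback_module[OF U] sheaf_hom_linear[OF P.differential_hom U]]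
      linear_map_diff(1)[OF P.pullback_module[OF U] Q.K.tangent_module[OF U] sheaf_hom_linear[OF tau_hom U]])
   thus "0[msec TY U] : ?H U" unfolding distribution_iff[OF U] using z by (simp add: Q.K.tan_simps(1))
   show "D +[msec TY U] E : ?H U" if "D : ?H U" "E : ?H U" for D E
   proof -
    have D: "D : Sec TY U" "ta U (dp U D) = D" "E : Sec TY U" "ta U (dp U E) = E" using HM[OF U] that distribution_iff[OF U] by simp_all
    show ?thesis unfolding distribution_iff[OF U] using D d(1,2)[OF U] t(2)[OF U] T.M.a_closed[OF D(1,3)] by (simp add: Q.K.tan_simps(1))
   qed
   show "-[msec TY U] D : ?H U" if D: "D : ?H U" for D
    using scl[OF _ D, of "-[sect Y U] 1[sect Y U]"] T.smult_l_minus[of "1[sect Y U]" D] HM[OF U D] by simp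
  qed (use scl in blast)
 qed
 show "sheaf_on (space_top Y) ?H (mrst TY)"
 proof (rule subsheaf_on[OF Q.K.tangent_sheaf])
  show "?H U <= Sec TY U" if "opn Y U" for U using HM[OF that] by blast
  show "mrst TY U V D : ?H V" if "opn Y U" "opn Y V" "V <= U" "D : ?H U" for U V D
  proof -
   have D: "D : Sec TY U" "ta U (dp U D) = D" using HM[OF that(1,4)] that(4) distribution_iff[OF that(1)] by simp_all
   show ?thesis unfolding distribution_iff[OF that(2)]
    using d(4)[OF that(1-3) D(1)] t(4)[OF that(1-3) d(1)[OF that(1) D(1)]] D(2) Q.K.tan.mrst_closed[OF that(1-3) D(1)]
    by (simp add: Q.K.tan_simps(1))
  qed
  show "D : ?H U" if U: "opn Y U" and D: "D : Sec TY U"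
   and loc: "!!x. x : U ==> EX W. opn Y W & x : W & W <= U & mrst TY U W D : ?H W" for U D
  proof -
   have D': "D : Der tY U" using D by (simp add: Q.K.tan_simps(1))
   have "ta U (dp U D) = D"
   proof (rule Q.K.tangent_sep[OF U D' tau_closed[OF U d(1)[OF U D]]])
    fix x assume "x : U"
    then obtain W where W: "opn Y W" "x : W" "W <= U" "mrst TY U W D : ?H W" using loc by blast
    have "mrst TY U W (ta U (dp U D)) = mrst TY U W D"
     using W(4) d(4)[OF U W(1,3) D] t(4)[OF U W(1,3) d(1)[OF U D]] distribution_iff[OF W(1)] by simp
    thus "EX W. opn Y W & x : W & W <= U & mrst TY U W (ta U (dp U D)) = mrst TY U W D" using W by blast
   qed
   thus ?thesis using D' distribution_iff[OF U] by simp
  qed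
 qed
 show "EX! (v, h). v : Sec (tangent p) U & h : ?H U & D = v +[msec TY U] h" if U: "opn Y U" and D: "D : Sec TY U" for U D
 proof -
  interpret T: module "sect Y U" "msec TY U" by (rule Q.K.tangent_module[OF U])
  interpret PB: module "sect Y U" "msec pTS U" by (rule P.pullback_module[OF U])
  let ?h = "ta U (dp U D)" and ?v = "D -[msec TY U] ta U (dp U D)"
  have dD: "dp U D : Sec pTS U" by (rule d(1)[OF U D])
  have h: "?h : Sec TY U" by (rule t(1)[OF U dD])
  have v: "?v : Sec TY U" using D h by simp
  have "dp U ?v = dp U D -[msec pTS U] dp U ?h"
   by (rule linear_map_diff(2)[OF Q.K.tangent_module[OF U] P.pullback_module[OF U] sheaf_hom_linear[OF P.differential_hom U] D h])
  also have "... = 0[msec pTS U]" using tau_section[OF U dD] dD by (simp add: PB.M.minus_eq PB.M.r_neg)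
  finally have vert: "?v : Sec (tangent p) U" using v P.differential_kernel[OF U, of ?v] by (simp add: P.tan_simps(1) Q.K.tan_simps(1))
  have dec: "D = ?v +[msec TY U] ?h" using D h by (simp add: T.M.minus_eq T.M.a_assoc T.M.l_neg)
  have hH: "?h : ?H U" using h tau_section[OF U dD] distribution_iff[OF U, of ?h] by (simp add: Q.K.tan_simps(1))
  show ?thesis
  proof (rule ex1I[of _ "(?v, ?h)"])
   show "case (?v, ?h) of (v, h) => v : Sec (tangent p) U & h : ?H U & D = v +[msec TY U] h" using vert hH dec by simp
   fix z assume z: "case z of (v, h) => v : Sec (tangent p) U & h : ?H U & D = v +[msec TY U] h"
   obtain v' h' where zz: "z = (v', h')" by (cases z)
   have z': "v' : Der p U" "h' : ?H U" "D = v' +[msec TY U] h'" using z zz by (simp_all add: P.tan_simps(1))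
   have c: "v' : Sec TY U" "h' : Sec TY U" "dp U v' = 0[msec pTS U]" "ta U (dp U h') = h'"
    using z'(1,2) P.differential_kernel[OF U] distribution_iff[OF U] by (simp_all add: Q.K.tan_simps(1))
   have "dp U D = dp U h'" using d(2)[OF U c(1,2)] z'(3) c(3) d(1)[OF U c(2)] by simp
   hence "h' = ?h" using c(4) by simp
   moreover have "v' = D -[msec TY U] h'" using z'(3) c(1,2) by (simp add: T.M.minus_eq T.M.a_assoc T.M.r_neg)
   ultimately show "z = (?v, ?h)" by (simp add: zz)
  qed
 qed
qed

end

context flat_leaf_splitting
begin

text \<open>The same cancellation as in \<open>hor_commutator\<close>, now on \<open>Y\<close> with
  the identity as \<open>ph\<close>: a field in the distribution is the combination of the lifted
  frame with its values at the coordinates of \<open>S\<close>.\<close>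

lemma distribution_integrable: "integrable_connection p tY (HD p tS ta)" unfolding integrable_connection_def src
proof (intro conjI allI impI ballI distribution_ehresmann)
 fix U D E assume U: "opn Y U" and "D : HD p tS ta U" "E : HD p tS ta U"
 hence D: "D : Der tY U" "ta U (dp U D) = D" and E: "E : Der tY U" "ta U (dp U E) = E" using distribution_iff[OF U] by simp_all
 note B = Q.K.vfield_commutator[OF D(1) E(1) U]
 let ?B = "comm Y U D E"
 note dB = P.differential_spec(1)[OF U B(1)]
 have "ta U (dp U ?B) = ?B"
 proof (rule Q.K.derivations_eqI[OF tau_closed[OF U dB] B(1) U])
  fix y bb assume y: "y : U" and bb: "bb :[SY y]"
  have yY: "y : pts Y" by (rule P.sec_pt[OF U y])
  interpret Sy: cring "SY y" by (rule Q.Y.stalk_cring[OF yY])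
  obtain C V n c F a N fr where ch: "P.K.chart C V n c F a N" "P.K.frame C n c a fr" "pt p y : C" "opn S C"
   and fr: "!!l. l :# ixs c n ==> fr l : Der tS C"
    "!!l. l :# ixs c n ==> rg S (pt p y) C (a l) :[SS (pt p y)]" by (rule base_chart[OF P.pt_closed[OF yY]]) (rule; assumption)
  have yC: "y : pre p C" using yY ch(3) by (simp add: P.preimg_mem)
  let ?L = "ixs c n" and ?e = "%l. lva C (fr l) y"
  let ?u = "%l. smap p y (rg S (pt p y) C (a l))"
  have u: "?u l :[SY y]" if "l :# ?L" for l by (rule P.stalk_map_closed[OF yY fr(2)[OF that]])
  have exp: "vact Y U (ta U (dp U G)) y b = msum (SY y) (%l. vact Y U G y (?u l) *[SY y] ?e l b) ?L"
   if "G : Der tY U" "b :[SY y]" for G b unfolding tau_frame[OF U P.differential_spec(1)[OF U that(1)] ch(1,2) y ch(3) that(2)]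
   by (rule Sy.msum_cong) (simp add: P.differential_spec(2)[OF U that(1) y fr(2)])
  have "vact Y U D y (vact Y U E y bb) -[SY y] vact Y U E y (vact Y U D y bb) =
    msum (SY y) (%l. (vact Y U D y (vact Y U E y (?u l)) -[SY y] vact Y U E y (vact Y U D y (?u l))) *[SY y] ?e l bb) ?L"
  proof (rule combination_commutator[where ph = "%a. a" and L = "?L" and e = "?e" and u = "?u",
     OF Sy.cring_axioms Sy.cring_axioms id_ring_hom[unfolded id_def] Q.K.vact_der[OF D(1) U y] Q.K.vact_der[OF E(1) U y]])
   show "der (SY y) (SY y) (%a. a) (?e l)" if "l :# ?L" for l
    by (rule Q.K.vact_der[OF lift_closed[OF ch(4) fr(1)[OF that]] P.opn_preimg[OF ch(4)] yC])
   show "?e l (?e m b) = ?e m (?e l b)" if "l :# ?L" "m :# ?L" "b :[SY y]" for l m b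
    by (rule frame_commute[OF ch(1,2) that(1,2) yC that(3)])
   show "?u l :[SY y]" if "l :# ?L" for l by (rule u[OF that])
   show "vact Y U D y b = msum (SY y) (%l. vact Y U D y (?u l) *[SY y] ?e l b) ?L"
    "vact Y U E y b = msum (SY y) (%l. vact Y U E y (?u l) *[SY y] ?e l b) ?L"
    if "b :[SY y]" for b using exp[OF D(1) that] exp[OF E(1) that] D(2) E(2) by simp_all
  qed (rule bb)
  also have "... = msum (SY y) (%l. vact Y U ?B y (?u l) *[SY y] ?e l bb) ?L" by (rule Sy.msum_cong) (simp add: B(2)[OF y u])
  also have "... = vact Y U (ta U (dp U ?B)) y bb" by (rule exp[OF B(1) bb, symmetric])
  finally have "vact Y U D y (vact Y U E y bb) -[SY y] vact Y U E y (vact Y U D y bb) = vact Y U (ta U (dp U ?B)) y bb" .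
  thus "vact Y U (ta U (dp U ?B)) y bb = vact Y U ?B y bb" by (simp only: B(2)[OF y bb])
 qed
 thus "?B : HD p tS ta U" using B(1) distribution_iff[OF U] by simp
qed

end

lemma (in leaf_tower) distribution_inj: assumes "tower_splitting q p tX tY tS ta" "tower_splitting q p tX tY tS ta'"
  and eq: "HD p tS ta = HD p tS ta'" shows "ta = ta'"
proof -
 interpret A: tower_splitting q p tX tY tS ta by fact
 interpret B: tower_splitting q p tX tY tS ta' by fact
 show ?thesis
 proof (rule sheaf_hom_ext[OF A.tau_hom B.tau_hom])
  fix U th assume U: "opn Y U" and th: "th : Sec pTS U"
  have "ta U th : HD p tS ta U" using A.distribution_iff[OF U] A.tau_closed[OF U th] A.tau_section[OF U th] by simp
  thus "ta U th = ta' U th" unfolding eq using B.distribution_iff[OF U] A.tau_section[OF U th] by simp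
 qed
qed

section \<open>The splitting defined by a connection\<close>

locale leaf_connection = leaf_setting +
 fixes H assumes connection: "ehresmann_connection p tY H"
begin

lemma connection_facts:
 "~ opn Y U ==> H U = {}" "opn Y U ==> submodule (H U) (sect Y U) (msec TY U)" "sheaf_on (space_top Y) H (mrst TY)"
 "opn Y U ==> D : Der tY U ==> EX! (v, h). v : Der p U & h : H U & D = v +[msec TY U] h"
 using connection unfolding ehresmann_connection_def Let_def src P.tan_simps(1) Q.K.tan_simps(1) by simp_all

lemma connection_der: "opn Y U ==> h : H U ==> h : Der tY U"
 using module.submoduleE(1)[OF Q.K.tangent_module connection_facts(2)] by (auto simp: Q.K.tan_simps(1))

text \<open>Two fields in \<open>H\<close> with the same image differ by a vertical field. This
  gives the first field a second decomposition besides the one with vertical part zero, so that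
  uniqueness applies.\<close>

lemma dp_inj: assumes U: "opn Y U" shows "inj_on (dp U) (H U)"
proof (rule inj_onI)
 fix h h' assume h: "h : H U" and h': "h' : H U" and eq: "dp U h = dp U h'"
 interpret T: module "sect Y U" "msec TY U" by (rule Q.K.tangent_module[OF U])
 interpret PB: module "sect Y U" "msec pTS U" by (rule P.pullback_module[OF U])
 have c: "h : Sec TY U" "h' : Sec TY U" using connection_der[OF U] h h' by (simp_all add: Q.K.tan_simps(1))
 note lin = Q.K.tangent_module[OF U] P.pullback_module[OF U] sheaf_hom_linear[OF P.differential_hom U]
 let ?v = "h -[msec TY U] h'"
 have v: "?v : Sec TY U" "0[msec TY U] : Sec TY U" using c by simp_all
 have "dp U ?v = 0[msec pTS U]"
  using linear_map_diff(2)[OF lin c] eq sheaf_homD(1)[OF P.differential_hom U c(2)] by (simp add: PB.M.minus_eq PB.M.r_neg)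
 hence vert: "?v : Der p U" "0[msec TY U] : Der p U"
  using v P.differential_kernel[OF U] linear_map_diff(1)[OF lin] by (simp_all add: Q.K.tan_simps(1))
 have dec: "h = ?v +[msec TY U] h'" "h = 0[msec TY U] +[msec TY U] h" using c by (simp_all add: T.M.minus_eq T.M.a_assoc T.M.l_neg)
 obtain z where z: "!!z'. case z' of (v, k) => v : Der p U & k : H U & h = v +[msec TY U] k ==> z' = z"
  using connection_facts(4)[OF U connection_der[OF U h]] by blast
 have z1: "(?v, h') = z" by (rule z) (use vert dec h' in simp)
 have z2: "(0[msec TY U], h) = z" by (rule z) (use vert dec h in simp)
 show "h = h'" using arg_cong[OF HOL.trans[OF z2 z1[symmetric]], of snd] by simp
qed

text \<open>Smoothness of \<open>p\<close> gives local lifts of \<open>th\<close>, and the component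
  of such a lift in \<open>H\<close> has the same image. Injectivity of \<open>dp\<close> on
  \<open>H\<close> glues these components.\<close>

lemma dp_surj: assumes U: "opn Y U" and th: "th : Sec pTS U" obtains h where "h : H U" "dp U h = th"
proof (rule injective_sheaf_surj[OF connection_facts(3) U, where G = "Sec pTS" and h = dp and s = "mrst pTS" and D = th])
 have HM: "h : Sec TY V" if "opn Y V" "h : H V" for V h using connection_der[OF that] by (simp add: Q.K.tan_simps(1))
 show "dp W (mrst TY V W m) = mrst pTS V W (dp V m)" if "opn Y V" "opn Y W" "W <= V" "m : H V" for V W m
  by (rule sheaf_homD(4)[OF P.differential_hom that(1-3) HM[OF that(1,4)]])
 show "dp V m : Sec pTS V" if "opn Y V" "m : H V" for V m by (rule sheaf_homD(1)[OF P.differential_hom that(1) HM[OF that]])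
 show "mrst pTS V W (mrst pTS U V th) = mrst pTS U W th" if "opn Y V" "opn Y W" "W <= V" "V <= U" for V W
  by (rule P.pb.mrst_mrst[OF U that(1,2) that(3,4) th])
 show "th' = th" if th': "th' : Sec pTS U" and loc: "!!x. x : U ==> EX W. opn Y W & x : W & W <= U & mrst pTS U W th' = mrst pTS U W th" for th'
 proof (rule P.sec_eqI[OF U th' th])
  fix y bb assume y: "y : U" "bb :[SS (pt p y)]"
  obtain W where W: "y : W" "mrst pTS U W th' = mrst pTS U W th" using loc[OF y(1)] by blast
  from arg_cong[OF W(2), of "%f. f y"] have "th' y = th y" using W(1) by (simp add: P.pullback_simps)
  thus "P.sact th' y bb = P.sact th y bb" by (simp add: P.sact_def)
 qed
 show "EX W m. opn Y W & x : W & W <= U & m : H W & dp W m = mrst pTS U W th" if x: "x : U" for x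
 proof -
  obtain W D where W: "opn Y W" "x : W" "W <= U" and D: "D : Der tY W"
   "!!z bb. z : W ==> bb :[SS (pt p z)] ==> vact Y W D z (smap p z bb) = P.sact th z bb"
   by (rule P.lift_exists[OF smooth_p U th x]) (rule; assumption)
  have dD: "dp W D = mrst pTS U W th"
  proof (rule P.differential_eqI[OF W(1) D(1) P.pb.mrst_closed[OF U W(1,3) th]])
   fix z bb assume z: "z : W" and bb: "bb :[SS (pt p z)]"
   have "P.sact (mrst pTS U W th) z bb = P.sact th z bb" using z by (simp add: P.sact_def P.pullback_simps)
   thus "P.sact (mrst pTS U W th) z bb = vact Y W D z (smap p z bb)" using D(2)[OF z bb] by simp
  qed
  interpret PB: module "sect Y W" "msec pTS W" by (rule P.pullback_module[OF W(1)])
  obtain v h where vh: "v : Der p W" "h : H W" "D = v +[msec TY W] h" using connection_facts(4)[OF W(1) D(1)] by auto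
  have v: "v : Sec TY W" "dp W v = 0[msec pTS W]" using P.differential_kernel[OF W(1)] vh(1) by (simp_all add: Q.K.tan_simps(1))
  have "dp W h = dp W D" using sheaf_homD(1,2)[OF P.differential_hom W(1)] v HM[OF W(1) vh(2)] vh(3) by simp
  thus ?thesis using W vh(2) dD by auto
 qed
qed (use dp_inj th in auto)

definition split where
 "split = (\<lambda>U\<in>{U. opn Y U}. \<lambda>th\<in>Sec pTS U. THE h. h : H U & dp U h = th)"

lemma split_eqI: assumes U: "opn Y U" and h: "h : H U" "dp U h = th" shows "split U th = h"
proof -
 have "th : Sec pTS U" using P.differential_spec(1)[OF U connection_der[OF U h(1)]] h(2) by simp
 hence "split U th = (THE h. h : H U & dp U h = th)" using U by (simp add: split_def)
 also have "... = h" by rule (use h inj_onD[OF dp_inj[OF U]] in auto)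
 finally show ?thesis .
qed

lemma split_spec: assumes U: "opn Y U" and th: "th : Sec pTS U" shows "split U th : H U" "dp U (split U th) = th"
proof -
 obtain h where "h : H U" "dp U h = th" by (rule dp_surj[OF U th])
 thus "split U th : H U" "dp U (split U th) = th" using split_eqI[OF U] by simp_all
qed

lemma split_tangent: "tangent_splitting p tY tS split" unfolding tangent_splitting_def src
proof (intro conjI allI impI ballI)
 note d = sheaf_homD[OF P.differential_hom]
 have HM: "h : Sec TY V" if "opn Y V" "h : H V" for V h using connection_der[OF that] by (simp add: Q.K.tan_simps(1))
 show "dp U (split U th) = th" if "opn Y U" "th : Sec pTS U" for U th by (rule split_spec(2)[OF that])
 show "split : sheaf_hom Y pTS TY"
 proof (rule sheaf_homI)
  show "split U = undefined" if "~ opn Y U" for U using that by (simp add: split_def)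
  show "split U m = undefined" if "opn Y U" "m ~: Sec pTS U" for U m using that by (simp add: split_def)
  fix U m assume U: "opn Y U" and m: "m : Sec pTS U"
  note s = split_spec[OF U m] and sM = HM[OF U split_spec(1)[OF U m]]
  show "split U m : Sec TY U" by (rule sM)
  show "split U (m +[msec pTS U] m') = split U m +[msec TY U] split U m'" if m': "m' : Sec pTS U" for m'
   using d(2)[OF U sM HM[OF U split_spec(1)[OF U m']]] s(2) split_spec(2)[OF U m']
   by (intro split_eqI[OF U module.submoduleE(5)[OF Q.K.tangent_module[OF U] connection_facts(2)[OF U] s(1) split_spec(1)[OF U m']]]) simp
  show "split U (a .[msec pTS U] m) = a .[msec TY U] split U m" if a: "a :[sect Y U]" for a
   using d(3)[OF U a sM] s(2) by (intro split_eqI[OF U module.submoduleE(4)[OF Q.K.tangent_module[OF U] connection_facts(2)[OF U] a s(1)]]) simp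
  show "split V (mrst pTS U V m) = mrst TY U V (split U m)" if V: "opn Y V" "V <= U" for V using d(4)[OF U V sM] s(2)
   by (intro split_eqI[OF V(1) presheaf_onD(1)[OF sheaf_on_presheaf[OF connection_facts(3)] U V s(1)]]) simp
 qed
qed

lemma split_distribution: "HD p tS split = H"
proof
 fix U show "HD p tS split U = H U"
 proof (cases "opn Y U")
  case True
  have "h : split U ` Sec pTS U" if "h : H U" for h
   using split_eqI[OF True that HOL.refl] P.differential_spec(1)[OF True connection_der[OF True that]] by (metis image_eqI)
  thus ?thesis using True split_spec(1)[OF True] by (auto simp: horizontal_distribution_def src)
 qed (simp add: horizontal_distribution_def src connection_facts(1))
qed

text \<open>By integrability the commutator of the two lifts belongs to \<open>H\<close>, and since
  the lifts are related to \<open>xi\<close> and \<open>et\<close> it lies above their commutator.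
  The splitting picks the unique such field.\<close>

lemma split_flat: assumes integrable: "!!U D E. opn Y U ==> D : H U ==> E : H U ==> comm Y U D E : H U"
  and V: "opn S V" and xi: "xi : Der tS V" and et: "et : Der tS V" shows "split (pre p V) (pb_unit p TS V (comm S V xi et)) =
  comm Y (pre p V) (split (pre p V) (pb_unit p TS V xi)) (split (pre p V) (pb_unit p TS V et))"
proof -
 interpret tower_splitting q p tX tY tS split by unfold_locales (rule split_tangent)
 note oV = P.opn_preimg[OF V] and cm = P.K.vfield_commutator[OF xi et V]
 note lc = lift_closed[OF V xi] lift_closed[OF V et]
 note B = Q.K.vfield_commutator[OF lc oV]
 have "comm Y (pre p V) (lift V xi) (lift V et) : H (pre p V)"
  unfolding lift_def by (rule integrable[OF oV split_spec(1)[OF oV unit_closed[OF V xi]] split_spec(1)[OF oV unit_closed[OF V et]]])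
 moreover have "dp (pre p V) (comm Y (pre p V) (lift V xi) (lift V et)) = pb_unit p TS V (comm S V xi et)"
 proof (rule P.differential_eqI[OF oV B(1) unit_closed[OF V cm(1)]])
  fix y gg assume y: "y : pre p V" and gg: "gg :[SS (pt p y)]"
  have yY: "y : pts Y" by (rule P.sec_pt[OF oV y])
  have s: "pt p y : V" using y by (simp add: P.preimg_mem)
  have sS: "pt p y : pts S" by (rule P.pt_closed[OF yY])
  interpret Sy: cring "SY y" by (rule Q.Y.stalk_cring[OF yY])
  interpret Ss: cring "SS (pt p y)" by (rule P.Y.stalk_cring[OF sS])
  interpret hh: ring_hom_cring "SS (pt p y)" "SY y" "smap p y"
   by (intro ring_hom_cringI Ss.cring_axioms Sy.cring_axioms P.stalk_map_hom[OF yY])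
  note vgg = P.K.vact_closed[OF xi V s gg] P.K.vact_closed[OF et V s gg]
  show "P.sact (pb_unit p TS V (comm S V xi et)) y gg =
    vact Y (pre p V) (comm Y (pre p V) (lift V xi) (lift V et)) y (smap p y gg)"
   unfolding P.act_unit[OF V cm(1) y gg] cm(2)[OF s gg] B(2)[OF y P.stalk_map_closed[OF yY gg]]
    lift_act[OF V xi y gg] lift_act[OF V et y gg] lift_act[OF V xi y vgg(2)] lift_act[OF V et y vgg(1)]
   using P.K.vact_closed[OF xi V s vgg(2)] P.K.vact_closed[OF et V s vgg(1)] by simp
 qed
 ultimately show ?thesis unfolding lift_def by (rule split_eqI[OF oV])
qed

end

section \<open>Assembly of the equivalence\<close>

lemma differential_setupI: assumes f: "morph f" and s: "morph s" and t: "smooth_morphism t"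
  and st: "source t = target f" "source s = source f" and eq: "mor_eq s (mor_comp t f)" shows "differential_setup f t s"
proof -
 have t': "smooth_morph t" using t by (simp add: smooth_morph_def smooth_morph_axioms_def morph_def smooth_morphism_def)
 hence mt: "morph t" by (simp add: smooth_morph_def)
 have tgt: "target s = target t" using eq by (simp add: mor_eq_def mor_comp_def)
 have pts: "pt s x = pt t (pt f x)" if "x : pts (source f)" for x using eq that by (simp add: mor_eq_def mor_comp_def)
 have map: "smap s x ka = smap f x (smap t (pt f x) ka)"
  if "x : pts (source f)" "ka : car (stk (target t) (pt t (pt f x)))" for x ka
  using stalk_map_eq[OF eq s, of x ka] stalk_map_comp[OF f mt st(1)[symmetric] that] that st(2) pts[OF that(1)] by (simp add: tgt)
 show ?thesis
  by (intro differential_setup.intro differential_setup_axioms.intro tangent_target.intro tangent_target_axioms.intro f s t' st tgt pts map)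
qed

lemma leaf_settingI:
 fixes q :: "('a, 'b, 'c, 'd) rs_morphism" and p :: "('c, 'd, 'e, 'f) rs_morphism"
 assumes t: "smooth_morphism tX" "smooth_morphism tY" "smooth_morphism tS"
  and st: "source q = source tX" "target q = source tY" "source p = source tY" "target p = source tS"
  and eq: "mor_eq tX (mor_comp tY q)" "mor_eq tY (mor_comp tS p)"
  and sm: "smooth_morphism q" "smooth_morphism p" "smooth_morphism (mor_comp p q)" and flat: "faithfully_flat q"
 shows "leaf_setting q p tX tY tS"
proof -
 have m: "morph f" if "smooth_morphism f" for f :: "('r, 's, 't, 'u) rs_morphism" using that by (simp add: morph_def smooth_morphism_def)
 have smm: "smooth_morph f" if "smooth_morphism f" for f :: "('r, 's, 't, 'u) rs_morphism"
  using that by (simp add: smooth_morph_def smooth_morph_axioms_def m)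
 have src: "source p = target q" by (simp add: st)
 \<comment> \<open>Compatibility of the composite with the structure morphisms follows from that of
   the two steps. The comorphisms agree because the preimage under \<open>tY\<close> is the preimage
   under \<open>p\<close> of that under \<open>tS\<close>.\<close>
 have eq3: "mor_eq tX (mor_comp tS (mor_comp p q))" unfolding mor_eq_def
 proof (intro conjI allI impI ballI)
  show "source tX = source (mor_comp tS (mor_comp p q))" "target tX = target (mor_comp tS (mor_comp p q))"
   using eq by (simp_all add: mor_eq_def mor_comp_def)
  show "pt tX x = pt (mor_comp tS (mor_comp p q)) x" if x: "x : pts (source tX)" for x
  proof -
   have "pt q x : pts (source tY)" using morph.pt_closed[OF m[OF sm(1)], of x] x st by simp
   thus ?thesis using eq x by (simp add: mor_eq_def mor_comp_def)
  qed
  show "sh tX V b = sh (mor_comp tS (mor_comp p q)) V b" if V: "opn (target tX) V" and b: "b :[sect (target tX) V]" for V b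
  proof -
   have tg: "target tX = target tY" using eq by (simp add: mor_eq_def mor_comp_def)
   have "pre tY V = pre p (pre tS V)"
   proof -
    have "pt p y : pts (source tS) & pt tY y = pt tS (pt p y)" if "y : pts (source tY)" for y
     using morph.pt_closed[OF m[OF sm(2)], of y] eq(2) that by (simp add: mor_eq_def mor_comp_def st)
    thus ?thesis unfolding preimg_def st by auto
   qed
   thus ?thesis using eq V b by (simp add: mor_eq_def mor_comp_def)
  qed
 qed
 have setups: "differential_setup q tY tX" "differential_setup p tS tY" "differential_setup (mor_comp p q) tS tX"
  by ((rule differential_setupI[OF m[OF sm(1)] m[OF t(1)] t(2) st(2)[symmetric] st(1)[symmetric] eq(1)]
    differential_setupI[OF m[OF sm(2)] m[OF t(2)] t(3) st(4)[symmetric] st(3)[symmetric] eq(2)]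
    differential_setupI[OF m[OF sm(3)] m[OF t(1)] t(3) _ _ eq3]; simp add: mor_comp_def st)+)
 show ?thesis
  by (rule leaf_setting.intro[OF leaf_tower.intro[OF setups src] leaf_setting_axioms.intro[OF smm[OF sm(1)] smm[OF sm(2)] flat]])
qed

context leaf_setting
begin

lemma leaf_splitting_iff: "leaf_splitting q p tX tY tS ta \<longleftrightarrow> tangent_splitting p tY tS ta"
 using leaf_setting_axioms leaf_tower_axioms by (auto simp: leaf_splitting_def tower_splitting_def tower_splitting_axioms_def)

lemma flat_iff: "flat_sp ta \<longleftrightarrow> flat_leaf_splitting q p tX tY tS ta"
proof (cases "tangent_splitting p tY tS ta")
 case True
 then interpret leaf_splitting q p tX tY tS ta by (simp add: leaf_splitting_iff)
 show ?thesis using leaf_splitting_axioms True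
  by (auto simp: flat_splitting_def flat_leaf_splitting_def flat_leaf_splitting_axioms_def lift_def src P.K.tan_simps(1))
next
 case False
 thus ?thesis by (simp add: flat_splitting_def flat_leaf_splitting_def leaf_splitting_iff)
qed

lemma transverse_iff:
 "tunf ta E \<longleftrightarrow> tangent_splitting p tY tS ta & strict_unfolding r tX tS (folia q) E &
  tsplit E ta" by (simp add: transverse_unfolding_def transverse_unfolding_axioms_def leaf_splitting_iff)

lemma basic_iff: "basic E \<longleftrightarrow> (EX ta. tunf ta E)"
proof
 show "EX ta. tunf ta E" if "basic E"
  using that unfolding leaf_space_basic_unfolding_def leaf_basic_splitting_def transverse_iff by blast
 assume "EX ta. tunf ta E"
 then obtain ta where ta: "tunf ta E" ..
 then interpret leaf_splitting q p tX tY tS ta by (simp add: transverse_unfolding_def)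
 show "basic E"
  using ta pbs_normal unfolding leaf_space_basic_unfolding_def leaf_basic_splitting_def transverse_iff by blast
qed

lemma basic_splitting:
 fixes E :: "('a, 'b, 'e, 'f, 'u) unf" assumes E: "basic E"
 shows "EX! ta. flat_sp ta & tsplit E ta"
proof -
 obtain ta where ta: "tunf ta E" using E unfolding basic_iff by auto
 interpret transverse_unfolding q p tX tY tS ta E by fact
 have flat: "flat_sp ta" unfolding flat_iff by unfold_locales (rule lift_commutator)
 show ?thesis
 proof (rule ex1I[of _ ta])
  show "flat_sp ta & tsplit E ta" using flat transverse by simp
  fix ta' assume "flat_sp ta' & tsplit E ta'"
  hence ta': "tunf ta' E" using strict by (simp add: transverse_iff flat_splitting_def)
  show "ta' = ta" by (rule transverse_unique[OF ta' ta]) blast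
 qed
qed

lemma splitting_unfolding: assumes "flat_sp ta"
 shows "EX E :: ('a, 'b, 'e, 'f, ('a, 'b) vfield) unf. basic E &
  tsplit E ta"
proof -
 interpret flat_leaf_splitting q p tX tY tS ta using assms by (simp add: flat_iff)
 have "tunf ta hor_unf" using tau horizontal_strict horizontal_transverse by (simp add: transverse_iff)
 thus ?thesis using horizontal_transverse basic_iff by blast
qed

lemma unfolding_isos_splitting:
 fixes E :: "('a, 'b, 'e, 'f, 'u) unf" and E' :: "('a, 'b, 'e, 'f, 'v) unf" assumes "basic E & basic E' &
    flat_sp ta & flat_sp ta' &
    tsplit E ta &
    tsplit E' ta'" shows "(ta = ta' --> (EX! ph. ph : unfolding_isos X (folia q) E E')) &
  (ta ~= ta' --> unfolding_isos X (folia q) E E' = {})"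
proof -
 have T: "tunf ta E" "tunf ta' E'"
  using assms by (simp_all add: transverse_iff flat_splitting_def leaf_space_basic_unfolding_def)
 interpret leaf_splitting q p tX tY tS ta using T(1) by (simp add: transverse_unfolding_def)
 show ?thesis
 proof (intro conjI impI)
  show "EX! ph. ph : unfolding_isos X (folia q) E E'" if "ta = ta'" by (rule unfolding_isos_unique[OF T(1)]) (simp add: T(2) that)
  assume ne: "ta ~= ta'"
  show "unfolding_isos X (folia q) E E' = {}"
  proof (rule equals0I)
   fix ph assume "ph : unfolding_isos X (folia q) E E'"
   hence ph: "ph U u : Sec E' U" "anchor E' U (ph U u) = anchor E U u" "proj E' U (ph U u) = proj E U u"
    if "opn X U" "u : Sec E U" for U u using that sheaf_homD(1)[of ph X E E' U u] by (simp_all add: unfolding_isos_def)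
   have "ta = ta'" by (rule transverse_unique[OF T]) (use ph in blast)
   thus False using ne by simp
  qed
 qed
qed

lemma distribution_bij:
 "bij_betw (HD p tS) {ta. flat_sp ta} {H. integrable_connection p tY H}"
proof (rule bij_betw_imageI)
 show "inj_on (HD p tS) {ta. flat_sp ta}"
 proof (rule inj_onI)
  fix ta ta' assume "ta : {ta. flat_sp ta}" "ta' : {ta. flat_sp ta}" and eq: "HD p tS ta = HD p tS ta'"
  hence "tower_splitting q p tX tY tS ta" "tower_splitting q p tX tY tS ta'"
   by (simp_all add: flat_splitting_def leaf_splitting_iff[symmetric] leaf_splitting_def)
  thus "ta = ta'" using eq by (rule distribution_inj)
 qed
 show "HD p tS ` {ta. flat_sp ta} = {H. integrable_connection p tY H}"
 proof (intro equalityI subsetI)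
  fix H assume "H : HD p tS ` {ta. flat_sp ta}"
  then obtain ta where ta: "flat_leaf_splitting q p tX tY tS ta" "H = HD p tS ta" by (auto simp: flat_iff)
  show "H : {H. integrable_connection p tY H}" using flat_leaf_splitting.distribution_integrable[OF ta(1)] by (simp add: ta(2))
 next
  fix H assume "H : {H. integrable_connection p tY H}"
  hence H: "ehresmann_connection p tY H" "!!U D E. opn Y U ==> D : H U ==> E : H U ==> comm Y U D E : H U"
   by (simp_all add: integrable_connection_def src)
  interpret leaf_connection q p tX tY tS H by unfold_locales (rule H(1))
  have "flat_sp split"
   unfolding flat_splitting_def Let_def src P.K.tan_simps(1) using split_tangent split_flat[OF H(2)] by blast
  thus "H : HD p tS ` {ta. flat_sp ta}" using split_distribution by (intro image_eqI[of _ _ split]) simp_all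
 qed
qed

text \<open>By \<open>pullback_connection_hor\<close> the right hand side says that the anchors are
  exactly the fields horizontal for \<open>ta\<close>. Since the projection is \<open>dr\<close> of
  the anchor, horizontality of the anchors is the defining equation of a transverse
  splitting.\<close>

lemma transverse_connection:
 fixes E :: "('a, 'b, 'e, 'f, 'u) unf" assumes E: "basic E" and ta: "flat_sp ta"
 shows "tsplit E ta \<longleftrightarrow>
  (ALL U. opn X U --> anchor E U ` Sec E U = pconn q tX tY (HD p tS ta) U)"
proof
 interpret L: leaf_splitting q p tX tY tS ta using ta by (simp add: leaf_splitting_iff flat_splitting_def)
 show "ALL U. opn X U --> anchor E U ` Sec E U = pconn q tX tY (HD p tS ta) U"
  if "tsplit E ta"
 proof -
  have "tunf ta E"
   using that E ta by (simp add: transverse_iff flat_splitting_def leaf_space_basic_unfolding_def)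
  thus ?thesis using transverse_unfolding.anchor_image[of q p tX tY tS ta E] L.pullback_connection_hor by simp
 qed
 assume im: "ALL U. opn X U --> anchor E U ` Sec E U = pconn q tX tY (HD p tS ta) U"
 obtain ta' where ta': "tunf ta' E" using E unfolding basic_iff by auto
 have "psp ta U (proj E U u) = dq U (anchor E U u)" if U: "opn X U" and u: "u : Sec E U" for U u
 proof -
  have "anchor E U u : {D. L.hor U D}" using im U u L.pullback_connection_hor[OF U] by blast
  thus ?thesis using transverse_unfolding.proj_anchor[OF ta' U u] by (simp add: L.hor_def)
 qed
 thus "tsplit E ta" using L.pbs_hom by (simp add: is_transverse_splitting_def)
qed

end

theorem theorem16p3:
  fixes k :: "'k ring"
    and q :: "('a, 'b, 'c, 'd) rs_morphism"
    and p :: "('c, 'd, 'e, 'f) rs_morphism"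
    and tX :: "('a, 'b, 'k set, 'k set \<Rightarrow> ('k \<times> 'k) set) rs_morphism"
    and tY :: "('c, 'd, 'k set, 'k set \<Rightarrow> ('k \<times> 'k) set) rs_morphism"
    and tS :: "('e, 'f, 'k set, 'k set \<Rightarrow> ('k \<times> 'k) set) rs_morphism"
  assumes "field k"
    and "\<forall>n::nat. n > 0 \<longrightarrow> [n] \<cdot>\<^bsub>k\<^esub> \<one>\<^bsub>k\<^esub> \<noteq> \<zero>\<^bsub>k\<^esub>"
    and "smooth_morphism tX" and "target tX = Spec k"
    and "smooth_morphism tY" and "target tY = Spec k"
    and "smooth_morphism tS" and "target tS = Spec k"
    and "source q = source tX" and "target q = source tY"
    and "source p = source tY" and "target p = source tS"
    and "mor_eq tX (mor_comp tY q)" and "mor_eq tY (mor_comp tS p)"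
    and "smooth_morphism q" and "smooth_morphism p" and "smooth_morphism (mor_comp p q)"
    and "faithfully_flat q"
  shows
    \<comment> \<open>Every leaf-space-basic unfolding determines a flat splitting.\<close>
    "(\<forall>E :: ('a, 'b, 'e, 'f, ('a, 'b) vfield, 'g) unfolding_data.
        leaf_space_basic_unfolding q p tX tY tS E \<longrightarrow>
        (\<exists>!\<tau>. flat_splitting p tY tS \<tau> \<and>
              is_transverse_splitting q p tX tY tS E (pullback_splitting q p tY tS \<tau>))) \<and>
    \<comment> \<open>Every flat splitting arises in this way.\<close>
     (\<forall>\<tau>. flat_splitting p tY tS \<tau> \<longrightarrow>
        (\<exists>E :: ('a, 'b, 'e, 'f, ('a, 'b) vfield, ('a, 'b) vfield) unfolding_data.
              leaf_space_basic_unfolding q p tX tY tS E \<and>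
              is_transverse_splitting q p tX tY tS E (pullback_splitting q p tY tS \<tau>))) \<and>
    \<comment> \<open>Unfoldings with the same splitting are uniquely isomorphic, all others are not isomorphic.\<close>
     (\<forall>(E :: ('a, 'b, 'e, 'f, ('a, 'b) vfield, 'g) unfolding_data)
       (E' :: ('a, 'b, 'e, 'f, ('a, 'b) vfield, 'h) unfolding_data) \<tau> \<tau>'.
        leaf_space_basic_unfolding q p tX tY tS E \<and> leaf_space_basic_unfolding q p tX tY tS E' \<and>
        flat_splitting p tY tS \<tau> \<and> flat_splitting p tY tS \<tau>' \<and>
        is_transverse_splitting q p tX tY tS E (pullback_splitting q p tY tS \<tau>) \<and>
        is_transverse_splitting q p tX tY tS E' (pullback_splitting q p tY tS \<tau>') \<longrightarrow>
        (\<tau> = \<tau>' \<longrightarrow> (\<exists>!\<phi>. \<phi> \<in> unfolding_isos (source q) (leaf_foliation q) E E')) \<and>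
        (\<tau> \<noteq> \<tau>' \<longrightarrow> unfolding_isos (source q) (leaf_foliation q) E E' = {})) \<and>
    \<comment> \<open>Flat splittings are integrable Ehresmann connections, and the unfolding
        is the pullback of the connection to \<open>X\<close>.\<close>
     bij_betw (horizontal_distribution p tS)
        {\<tau>. flat_splitting p tY tS \<tau>} {H. integrable_connection p tY H} \<and>
     (\<forall>(E :: ('a, 'b, 'e, 'f, ('a, 'b) vfield, 'g) unfolding_data) \<tau>.
        leaf_space_basic_unfolding q p tX tY tS E \<and> flat_splitting p tY tS \<tau> \<longrightarrow>
        (is_transverse_splitting q p tX tY tS E (pullback_splitting q p tY tS \<tau>) \<longleftrightarrow>
         (\<forall>U. opn (source q) U \<longrightarrow>
            anchor E U ` msects E U =
              pullback_connection q tX tY (horizontal_distribution p tS \<tau>) U)))"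
proof -
 interpret leaf_setting q p tX tY tS by (rule leaf_settingI) fact+
 show ?thesis by (rule, (intro allI impI basic_splitting; assumption), rule, (intro allI impI splitting_unfolding; assumption), rule,
    (intro allI impI unfolding_isos_splitting; assumption), rule conjI[OF distribution_bij],
    (intro allI impI, elim conjE, rule transverse_connection; assumption))
qed

end
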